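(* Let $\Theta=(\Gamma,(x_{k,i}))$ be a patch framework with $\Gamma$ connected, let $\widetilde S\in\mathbb{O}(d)^m/_\sim$ be a critical point of $\widetilde F$, and let $S\in\pi^{-1}(\widetilde S)$. Then the following are equivalent. (1) $\widetilde S$ is a non-degenerate local minimum of $\widetilde F$. (2) $\widetilde g(\mathrm{Hess}\,\widetilde F(\widetilde S)[\widetilde Z],\widetilde Z)>0$ for all $\widetilde Z\in T_{\widetilde S}\mathbb{O}(d)^m/_\sim$ with $\widetilde Z\neq 0$. (3) $\mathrm{Tr}(\Omega^T L(S)\Omega)>0$ for all $\Omega=[\Omega_i]_1^m$ with $\Omega_i\in\mathrm{Skew}(d)$, $\sum_{i=1}^m\Omega_i=0$ and not all $\Omega_i$ equal to zero. (4) $\mathrm{Tr}(\Omega^T L(S)\Omega)>0$ for all $\Omega=[\Omega_i]_1^m$ with $\Omega_i\in\mathrm{Skew}(d)$ and not all $\Omega_i$ equal to each other. (5) $\omega^T\mathbb{L}(S)\omega>0$ for all $\omega=[\omega_{r,s}]_{1\le r<s\le d}$, $\omega_{r,s}\in\mathbb{R}^m$, such that not all $\omega_{r,s}$ are constant vectors. (6) $\mathbb{L}(S)$ is positive semi-definite and of rank $(m-1)d(d-1)/2$. (7) $\lambda_{d(d-1)/2+1}(\mathbb{L}(S))>0$.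
   Context: Notation. $\mathbb{O}(d)$ is the group of orthogonal $d\times d$ matrices, $\mathrm{Skew}(d)$ the space of skew-symmetric $d\times d$ matrices. $[A_i]_1^m$ is the vertical stack of matrices $A_1,\dots,A_m$; $[A]_i$ is the $i$th $d$-row block of $A$; $M_{ij}$ is the $(i,j)$ block of size $d\times d$ of an $md\times md$ matrix $M$. $\lambda_i(A)$ is the $i$th smallest eigenvalue of a symmetric matrix $A$; $A^\dagger$ is the Moore–Penrose pseudoinverse. Patch framework. $\Gamma$ is a bipartite graph on $n+m$ vertices; vertex $k\in\{1,\dots,n\}$ represents the $k$th point and vertex $n+i$, $i\in\{1,\dots,m\}$, the $i$th view; edges join points to views, and $(k,i)\in E(\Gamma)$ means that point $k$ is in view $i$, with local coordinates $x_{k,i}\in\mathbb{R}^d$. The tuple $\Theta=(\Gamma,(x_{k,i}))$ is a patch framework. Put $e_{ki}=e_k-e_{n+i}\in\mathbb{R}^{n+m}$ (standard basis vectors), $\varepsilon_i$ the $i$th standard basis vector of $\mathbb{R}^m$, $\mathcal{L}_\Gamma=\sum_{(k,i)\in E(\Gamma)}e_{ki}e_{ki}^T$, $B=\sum_{(k,i)\in E(\Gamma)}(\varepsilon_i\otimes I_d)x_{k,i}e_{ki}^T\in\mathbb{R}^{md\times(n+m)}$, $D=\sum_{(k,i)\in E(\Gamma)}(\varepsilon_i\otimes I_d)x_{k,i}x_{k,i}^T(\varepsilon_i\otimes I_d)^T$, and $C=D-B\mathcal{L}_\Gamma^\dagger B^T\in\mathbb{R}^{md\times md}$ (the patch-stress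 matrix, which is positive semi-definite). Elements of $\mathbb{O}(d)^m$ are written $S=[S_i]_1^m\in\mathbb{R}^{md\times d}$, and $F(S)=\mathrm{Tr}(CSS^T)$. Quotient. $S\sim SQ$ for $Q\in\mathbb{O}(d)$. The quotient $\mathbb{O}(d)^m/_\sim$ is identified with $\mathbb{O}(d)^{m-1}$ via $\pi(S)=[S_{i+1}S_1^T]_{i=1}^{m-1}$. Define $\widetilde F(\widetilde S)=\mathrm{Tr}\left(C\begin{bmatrix}I_d\\ \widetilde S\end{bmatrix}\begin{bmatrix}I_d\\ \widetilde S\end{bmatrix}^T\right)$, so $F=\widetilde F\circ\pi$. On $\mathbb{O}(d)^m$ use $g(Z,W)=\mathrm{Tr}(Z^TW)$; $T_S\mathbb{O}(d)^m=\{[S_i\Omega_i]_1^m:\Omega_i\in\mathrm{Skew}(d)\}$. The horizontal space at $S$ is $\mathcal{H}_S=\{[S_i\Omega_i]_1^m:\Omega_i\in\mathrm{Skew}(d),\sum_i\Omega_i=0\}$; the horizontal lift at $S\in\pi^{-1}(\widetilde S)$ of $\widetilde Z\in T_{\widetilde S}\mathbb{O}(d)^m/_\sim$ is the unique $Z\in\mathcal{H}_S$ with $D\pi(S)[Z]=\widetilde Z$. The Riemannian metric on the quotient is $\widetilde g(\widetilde Z,\widetilde W)=g(Z,W)$ for horizontal lifts $Z,W$ (independent of the choice of $S\in\pi^{-1}(\widetilde S)$). Riemannian gradient, Hessian and critical points of $\widetilde F$ are with respect to $\widetilde g$. A non-degenerate local minimum is a local minimizer at which the Hessian is non-singular. Matrices.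 $C(S)=\mathrm{blockdiag}(S_1,\dots,S_m)^T\,C\,\mathrm{blockdiag}(S_1,\dots,S_m)$; $\widehat C(S)$ is the block-diagonal matrix with $i$th diagonal block $\sum_{j=1}^mC(S)_{ij}$; $L(S)=C(S)-\widehat C(S)$. $P$ is the $md\times md$ permutation matrix such that row $(p-1)m+i$ of $PX$ is row $(i-1)d+p$ of $X$ ($1\le p\le d$, $1\le i\le m$), and $\mathcal{L}(S)=PL(S)P^T$. $\overline P$ is the block matrix with $m\times m$ blocks, block-rows indexed by pairs $(r,s)$, $1\le r<s\le d$ (column-major order), block-columns indexed by $(p,q)\in\{1,\dots,d\}^2$ (column-major order), whose $((r,s),(p,q))$ block is $0$ if $p=q$, $\delta_{pr}\delta_{qs}I_m$ if $p<q$, and $-\delta_{ps}\delta_{qr}I_m$ if $p>q$. Finally $\mathbb{L}(S)=\overline P(I_d\otimes\mathcal{L}(S))\overline P^T$, of size $md(d-1)/2$. A constant vector is a multiple of the all-ones vector. *)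

theory Defs
  imports
    "Jordan_Normal_Form.Char_Poly"
    "Jordan_Normal_Form.DL_Rank"
    "Graph_Theory.Digraph_Component"
    "HOL-Library.Extended_Real"
begin

text \<open>
  Points, views, blocks, coordinates and matrix entries are all counted from 0. A tuple
  \<open>[S\<^sub>1, \<dots>, S\<^sub>m]\<close> of \<open>d \<times> d\<close> matrices is the stacked \<open>md \<times> d\<close> matrix.
\<close>

section \<open>Matrices\<close>

definition mat_sum :: "nat \<Rightarrow> nat \<Rightarrow> ('a \<Rightarrow> real mat) \<Rightarrow> 'a set \<Rightarrow> real mat" where
  "mat_sum nr nc f I = mat nr nc (\<lambda>ij. \<Sum>a\<in>I. f a $$ ij)"

definition mat_tr :: "real mat \<Rightarrow> real" where
  "mat_tr A = (\<Sum>i<dim_row A. A $$ (i, i))"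

definition frob_inner :: "real mat \<Rightarrow> real mat \<Rightarrow> real" where
  "frob_inner A B = mat_tr (A\<^sup>T * B)"

definition frob_norm :: "real mat \<Rightarrow> real" where
  "frob_norm A = sqrt (frob_inner A A)"

definition kron :: "real mat \<Rightarrow> real mat \<Rightarrow> real mat" where
  "kron A B = mat (dim_row A * dim_row B) (dim_col A * dim_col B)
     (\<lambda>(i, j). A $$ (i div dim_row B, j div dim_col B) * B $$ (i mod dim_row B, j mod dim_col B))"

definition column_mat :: "real vec \<Rightarrow> real mat" where
  "column_mat v = mat_of_cols (dim_vec v) [v]"

definition row_block :: "nat \<Rightarrow> real mat \<Rightarrow> nat \<Rightarrow> real mat" where
  "row_block d A i = mat d (dim_col A) (\<lambda>(a, b). A $$ (i * d + a, b))"

definition mat_block :: "nat \<Rightarrow> real mat \<Rightarrow> nat \<Rightarrow> nat \<Rightarrow> real mat" where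
  "mat_block d M i j = mat d d (\<lambda>(a, b). M $$ (i * d + a, j * d + b))"

definition vstack :: "nat \<Rightarrow> nat \<Rightarrow> (nat \<Rightarrow> real mat) \<Rightarrow> real mat" where
  "vstack d k A = mat (k * d) d (\<lambda>(r, c). A (r div d) $$ (r mod d, c))"

definition pseudoinverse :: "real mat \<Rightarrow> real mat" where
  "pseudoinverse A = (THE X. X \<in> carrier_mat (dim_col A) (dim_row A) \<and>
     A * X * A = A \<and> X * A * X = X \<and> (A * X)\<^sup>T = A * X \<and> (X * A)\<^sup>T = X * A)"

definition quad_form :: "real mat \<Rightarrow> real vec \<Rightarrow> real" where
  "quad_form A v = scalar_prod v (A *\<^sub>v v)"

definition pos_semidef :: "real mat \<Rightarrow> bool" where
  "pos_semidef A \<longleftrightarrow> square_mat A \<and> A\<^sup>T = A \<and> (\<forall>v\<in>carrier_vec (dim_row A). 0 \<le> quad_form A v)"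

definition mat_rank :: "real mat \<Rightarrow> nat" where
  "mat_rank A = vec_space.rank (dim_row A) A"

text \<open>
  Eigenvalues are counted with multiplicity, and \<open>i\<close> starts at 1 as in the notation \<open>\<lambda>\<^sub>i(A)\<close>.
  An index larger than the size of the matrix gives \<open>\<infinity>\<close>, the value of the empty minimum in
  the Courant--Fischer formula.
\<close>
definition eigenvalues_asc :: "real mat \<Rightarrow> real list" where
  "eigenvalues_asc A = sorted_list_of_multiset (proots (char_poly A))"

definition eigval_asc :: "nat \<Rightarrow> real mat \<Rightarrow> ereal" where
  "eigval_asc i A = (if 1 \<le> i \<and> i \<le> length (eigenvalues_asc A)
     then ereal (eigenvalues_asc A ! (i - 1)) else \<infinity>)"

definition constant_vec :: "real vec \<Rightarrow> bool" where
  "constant_vec v \<longleftrightarrow> (\<exists>c. v = c \<cdot>\<^sub>v vec (dim_vec v) (\<lambda>_. 1))"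

definition orth_mats :: "nat \<Rightarrow> real mat set" where
  "orth_mats d = {Q \<in> carrier_mat d d. Q\<^sup>T * Q = 1\<^sub>m d}"

definition skew_mats :: "nat \<Rightarrow> real mat set" where
  "skew_mats d = {A \<in> carrier_mat d d. A\<^sup>T = - A}"


section \<open>Patch frameworks\<close>

text \<open>
  The pair \<open>(k, i) \<in> E\<close> stands for the edge joining vertex \<open>k\<close> (a point) to vertex \<open>n + i\<close> (a view).
\<close>
definition patch_framework :: "nat \<Rightarrow> nat \<Rightarrow> nat \<Rightarrow> (nat \<times> nat) set \<Rightarrow> (nat \<Rightarrow> nat \<Rightarrow> real vec) \<Rightarrow> bool" where
  "patch_framework d n m E x \<longleftrightarrow>
     E \<subseteq> {..<n} \<times> {..<m} \<and> (\<forall>(k, i)\<in>E. x k i \<in> carrier_vec d)"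

definition patch_graph :: "nat \<Rightarrow> nat \<Rightarrow> (nat \<times> nat) set \<Rightarrow> nat pair_pre_digraph" where
  "patch_graph n m E = \<lparr>pverts = {..<n + m}, parcs = {(k, n + i) | k i. (k, i) \<in> E}\<rparr>"

text \<open>Connectedness in the library is that of the underlying undirected graph.\<close>
definition patch_connected :: "nat \<Rightarrow> nat \<Rightarrow> (nat \<times> nat) set \<Rightarrow> bool" where
  "patch_connected n m E \<longleftrightarrow> Digraph_Component.connected (with_proj (patch_graph n m E))"

definition edge_vec :: "nat \<Rightarrow> nat \<Rightarrow> nat \<Rightarrow> nat \<Rightarrow> real mat" where
  "edge_vec n m k i = column_mat (unit_vec (n + m) k - unit_vec (n + m) (n + i))"

definition patch_laplacian :: "nat \<Rightarrow> nat \<Rightarrow> (nat \<times> nat) set \<Rightarrow> real mat" where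
  "patch_laplacian n m E =
     mat_sum (n + m) (n + m) (\<lambda>(k, i). edge_vec n m k i * (edge_vec n m k i)\<^sup>T) E"

text \<open>The \<open>md \<times> d\<close> matrix \<open>\<epsilon>\<^sub>i \<otimes> I\<^sub>d\<close>.\<close>
definition view_inj :: "nat \<Rightarrow> nat \<Rightarrow> nat \<Rightarrow> real mat" where
  "view_inj d m i = kron (column_mat (unit_vec m i)) (1\<^sub>m d)"

definition patch_B :: "nat \<Rightarrow> nat \<Rightarrow> nat \<Rightarrow> (nat \<times> nat) set \<Rightarrow> (nat \<Rightarrow> nat \<Rightarrow> real vec) \<Rightarrow> real mat" where
  "patch_B d n m E x = mat_sum (m * d) (n + m)
     (\<lambda>(k, i). view_inj d m i * column_mat (x k i) * (edge_vec n m k i)\<^sup>T) E"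

definition patch_D :: "nat \<Rightarrow> nat \<Rightarrow> (nat \<times> nat) set \<Rightarrow> (nat \<Rightarrow> nat \<Rightarrow> real vec) \<Rightarrow> real mat" where
  "patch_D d m E x = mat_sum (m * d) (m * d)
     (\<lambda>(k, i). view_inj d m i * column_mat (x k i) * (column_mat (x k i))\<^sup>T * (view_inj d m i)\<^sup>T) E"

definition patch_stress :: "nat \<Rightarrow> nat \<Rightarrow> nat \<Rightarrow> (nat \<times> nat) set \<Rightarrow> (nat \<Rightarrow> nat \<Rightarrow> real vec) \<Rightarrow> real mat" where
  "patch_stress d n m E x =
     patch_D d m E x - patch_B d n m E x * pseudoinverse (patch_laplacian n m E) * (patch_B d n m E x)\<^sup>T"


section \<open>The matrices built from the patch-stress matrix\<close>

definition block_diag :: "nat \<Rightarrow> (nat \<Rightarrow> real mat) \<Rightarrow> real mat" where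
  "block_diag m A = diag_block_mat (map A [0..<m])"

definition C_at :: "nat \<Rightarrow> nat \<Rightarrow> real mat \<Rightarrow> real mat \<Rightarrow> real mat" where
  "C_at d m C S = (block_diag m (row_block d S))\<^sup>T * C * block_diag m (row_block d S)"

definition C_hat_at :: "nat \<Rightarrow> nat \<Rightarrow> real mat \<Rightarrow> real mat \<Rightarrow> real mat" where
  "C_hat_at d m C S = block_diag m (\<lambda>i. mat_sum d d (\<lambda>j. mat_block d (C_at d m C S) i j) {..<m})"

definition L_at :: "nat \<Rightarrow> nat \<Rightarrow> real mat \<Rightarrow> real mat \<Rightarrow> real mat" where
  "L_at d m C S = C_at d m C S - C_hat_at d m C S"

text \<open>Row \<open>p * m + i\<close> of \<open>P * X\<close> is row \<open>i * d + p\<close> of \<open>X\<close>, for \<open>p < d\<close> and \<open>i < m\<close>.\<close>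
definition perm_P :: "nat \<Rightarrow> nat \<Rightarrow> real mat" where
  "perm_P d m = mat (m * d) (m * d) (\<lambda>(a, b). if b = (a mod m) * d + a div m then 1 else 0)"

definition calL_at :: "nat \<Rightarrow> nat \<Rightarrow> real mat \<Rightarrow> real mat \<Rightarrow> real mat" where
  "calL_at d m C S = perm_P d m * L_at d m C S * (perm_P d m)\<^sup>T"

text \<open>The pairs \<open>(r, s)\<close> with \<open>r < s < d\<close> in column-major order: \<open>(0,1), (0,2), (1,2), (0,3), \<dots>\<close>.\<close>
definition upper_pairs :: "nat \<Rightarrow> (nat \<times> nat) list" where
  "upper_pairs d = concat (map (\<lambda>s. map (\<lambda>r. (r, s)) [0..<s]) [0..<d])"

definition Pbar_block :: "nat \<Rightarrow> nat \<times> nat \<Rightarrow> nat \<times> nat \<Rightarrow> real mat" where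
  "Pbar_block m = (\<lambda>(r, s) (p, q).
     if p = q then 0\<^sub>m m m
     else if p < q then (if p = r \<and> q = s then 1\<^sub>m m else 0\<^sub>m m m)
     else (if p = s \<and> q = r then - 1\<^sub>m m else 0\<^sub>m m m))"

text \<open>In column-major order, block column \<open>c\<close> has index \<open>(p, q) = (c mod d, c div d)\<close>.\<close>
definition Pbar :: "nat \<Rightarrow> nat \<Rightarrow> real mat" where
  "Pbar d m = mat (length (upper_pairs d) * m) (d * d * m) (\<lambda>(a, b).
     Pbar_block m (upper_pairs d ! (a div m)) (b div m mod d, b div m div d) $$ (a mod m, b mod m))"

definition LL_at :: "nat \<Rightarrow> nat \<Rightarrow> real mat \<Rightarrow> real mat \<Rightarrow> real mat" where
  "LL_at d m C S = Pbar d m * kron (1\<^sub>m d) (calL_at d m C S) * (Pbar d m)\<^sup>T"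

text \<open>The vector \<open>[\<omega>\<^sub>r\<^sub>,\<^sub>s]\<close> with blocks of length \<open>m\<close> in the same order as the block rows of \<open>Pbar\<close>.\<close>
definition stack_pairs :: "nat \<Rightarrow> nat \<Rightarrow> (nat \<times> nat \<Rightarrow> real vec) \<Rightarrow> real vec" where
  "stack_pairs d m w = vec (length (upper_pairs d) * m) (\<lambda>a. w (upper_pairs d ! (a div m)) $ (a mod m))"


section \<open>Riemannian geometry of embedded matrix manifolds\<close>

text \<open>
  A real function on the space of \<open>nr \<times> nc\<close> matrices has Frechet gradient \<open>G\<close> at \<open>A\<close> (with respect to
  the Frobenius inner product); \<open>diff_times k\<close> means \<open>k\<close> times Frechet differentiable.
\<close>
definition has_frechet_grad :: "nat \<Rightarrow> nat \<Rightarrow> (real mat \<Rightarrow> real) \<Rightarrow> real mat \<Rightarrow> real mat \<Rightarrow> bool" where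
  "has_frechet_grad nr nc f A G \<longleftrightarrow> G \<in> carrier_mat nr nc \<and>
     (\<forall>e>0. \<exists>\<delta>>0. \<forall>H\<in>carrier_mat nr nc. frob_norm H < \<delta> \<longrightarrow>
        \<bar>f (A + H) - f A - frob_inner G H\<bar> \<le> e * frob_norm H)"

primrec diff_times :: "nat \<Rightarrow> nat \<Rightarrow> nat \<Rightarrow> (real mat \<Rightarrow> real) \<Rightarrow> bool" where
  "diff_times nr nc 0 f \<longleftrightarrow> True"
| "diff_times nr nc (Suc k) f \<longleftrightarrow> (\<exists>G.
     (\<forall>A\<in>carrier_mat nr nc. has_frechet_grad nr nc f A (G A)) \<and>
     (\<forall>i<nr. \<forall>j<nc. diff_times nr nc k (\<lambda>A. G A $$ (i, j))))"

text \<open>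
  Smooth functions on a closed embedded submanifold are exactly the restrictions of smooth functions
  on the ambient space.
\<close>
definition smooth_on :: "nat \<Rightarrow> nat \<Rightarrow> real mat set \<Rightarrow> (real mat \<Rightarrow> real) \<Rightarrow> bool" where
  "smooth_on nr nc M f \<longleftrightarrow> (\<exists>F. (\<forall>k. diff_times nr nc k F) \<and> (\<forall>p\<in>M. f p = F p))"

definition curve_through :: "real mat set \<Rightarrow> real mat \<Rightarrow> real mat \<Rightarrow> (real \<Rightarrow> real mat) \<Rightarrow> bool" where
  "curve_through M p Z c \<longleftrightarrow> (\<forall>t. c t \<in> M) \<and> c 0 = p \<and>
     (\<forall>i<dim_row Z. \<forall>j<dim_col Z. ((\<lambda>t. c t $$ (i, j)) has_real_derivative Z $$ (i, j)) (at 0))"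

text \<open>The differential along \<open>M\<close> at \<open>p\<close> in the direction \<open>Z\<close>, of scalar and of matrix-valued maps.\<close>
definition diff_along :: "real mat set \<Rightarrow> (real mat \<Rightarrow> real) \<Rightarrow> real mat \<Rightarrow> real mat \<Rightarrow> real" where
  "diff_along M f p Z =
     (THE r. \<forall>c. curve_through M p Z c \<longrightarrow> ((\<lambda>t. f (c t)) has_real_derivative r) (at 0))"

definition mat_diff_along :: "real mat set \<Rightarrow> (real mat \<Rightarrow> real mat) \<Rightarrow> real mat \<Rightarrow> real mat \<Rightarrow> real mat" where
  "mat_diff_along M h p Z =
     mat (dim_row (h p)) (dim_col (h p)) (\<lambda>ij. diff_along M (\<lambda>q. h q $$ ij) p Z)"

text \<open>
  A submanifold \<open>mpts\<close> of the space of \<open>mrows \<times> mcols\<close> matrices with its tangent spaces and a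
  metric, which need not be the one induced from the ambient space.
\<close>
record riem_manifold =
  mrows :: nat
  mcols :: nat
  mpts :: "real mat set"
  mtangent :: "real mat \<Rightarrow> real mat set"
  mmetric :: "real mat \<Rightarrow> real mat \<Rightarrow> real mat \<Rightarrow> real"

definition smooth_functions :: "riem_manifold \<Rightarrow> (real mat \<Rightarrow> real) set" where
  "smooth_functions R = {f. smooth_on (mrows R) (mcols R) (mpts R) f}"

definition vector_fields :: "riem_manifold \<Rightarrow> (real mat \<Rightarrow> real mat) set" where
  "vector_fields R = {X. (\<forall>p\<in>mpts R. X p \<in> mtangent R p) \<and>
     (\<forall>i<mrows R. \<forall>j<mcols R. (\<lambda>p. X p $$ (i, j)) \<in> smooth_functions R)}"

definition lie_bracket :: "riem_manifold \<Rightarrow> (real mat \<Rightarrow> real mat) \<Rightarrow> (real mat \<Rightarrow> real mat) \<Rightarrow> real mat \<Rightarrow> real mat" where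
  "lie_bracket R X Y p = mat_diff_along (mpts R) Y p (X p) - mat_diff_along (mpts R) X p (Y p)"

definition levi_civita ::
  "riem_manifold \<Rightarrow> ((real mat \<Rightarrow> real mat) \<Rightarrow> (real mat \<Rightarrow> real mat) \<Rightarrow> real mat \<Rightarrow> real mat) \<Rightarrow> bool" where
  "levi_civita R nabla \<longleftrightarrow>
     (\<forall>X\<in>vector_fields R. \<forall>Y\<in>vector_fields R. nabla X Y \<in> vector_fields R) \<and>
     (\<forall>X\<in>vector_fields R. \<forall>X'\<in>vector_fields R. \<forall>Y\<in>vector_fields R.
        \<forall>f\<in>smooth_functions R. \<forall>h\<in>smooth_functions R. \<forall>p\<in>mpts R.
        nabla (\<lambda>q. f q \<cdot>\<^sub>m X q + h q \<cdot>\<^sub>m X' q) Y p = f p \<cdot>\<^sub>m nabla X Y p + h p \<cdot>\<^sub>m nabla X' Y p) \<and>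
     (\<forall>X\<in>vector_fields R. \<forall>Y\<in>vector_fields R. \<forall>Y'\<in>vector_fields R. \<forall>a b. \<forall>p\<in>mpts R.
        nabla X (\<lambda>q. a \<cdot>\<^sub>m Y q + b \<cdot>\<^sub>m Y' q) p = a \<cdot>\<^sub>m nabla X Y p + b \<cdot>\<^sub>m nabla X Y' p) \<and>
     (\<forall>X\<in>vector_fields R. \<forall>Y\<in>vector_fields R. \<forall>f\<in>smooth_functions R. \<forall>p\<in>mpts R.
        nabla X (\<lambda>q. f q \<cdot>\<^sub>m Y q) p
          = diff_along (mpts R) f p (X p) \<cdot>\<^sub>m Y p + f p \<cdot>\<^sub>m nabla X Y p) \<and>
     (\<forall>X\<in>vector_fields R. \<forall>Y\<in>vector_fields R. \<forall>p\<in>mpts R.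
        nabla X Y p - nabla Y X p = lie_bracket R X Y p) \<and>
     (\<forall>X\<in>vector_fields R. \<forall>Y\<in>vector_fields R. \<forall>V\<in>vector_fields R. \<forall>p\<in>mpts R.
        diff_along (mpts R) (\<lambda>q. mmetric R q (Y q) (V q)) p (X p)
          = mmetric R p (nabla X Y p) (V p) + mmetric R p (Y p) (nabla X V p))"

definition riem_grad :: "riem_manifold \<Rightarrow> (real mat \<Rightarrow> real) \<Rightarrow> real mat \<Rightarrow> real mat" where
  "riem_grad R f p = (THE G. G \<in> mtangent R p \<and>
     (\<forall>Z\<in>mtangent R p. mmetric R p G Z = diff_along (mpts R) f p Z))"

text \<open>
  \<open>\<nabla>\<^sub>Z grad f\<close> at \<open>p\<close>. On smooth vector fields the Levi-Civita connection is unique at the points of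
  the manifold, and its value at \<open>p\<close> depends on the first field only through its value at \<open>p\<close>, so neither
  choice matters.
\<close>
definition riem_hess :: "riem_manifold \<Rightarrow> (real mat \<Rightarrow> real) \<Rightarrow> real mat \<Rightarrow> real mat \<Rightarrow> real mat" where
  "riem_hess R f p Z =
     (let nabla = (SOME nabla. levi_civita R nabla);
          X = (SOME X. X \<in> vector_fields R \<and> X p = Z)
      in nabla X (riem_grad R f) p)"

definition critical_point :: "riem_manifold \<Rightarrow> (real mat \<Rightarrow> real) \<Rightarrow> real mat \<Rightarrow> bool" where
  "critical_point R f p \<longleftrightarrow> p \<in> mpts R \<and> riem_grad R f p = 0\<^sub>m (mrows R) (mcols R)"

definition local_minimizer :: "riem_manifold \<Rightarrow> (real mat \<Rightarrow> real) \<Rightarrow> real mat \<Rightarrow> bool" where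
  "local_minimizer R f p \<longleftrightarrow> p \<in> mpts R \<and>
     (\<exists>e>0. \<forall>q\<in>mpts R. frob_norm (q - p) < e \<longrightarrow> f p \<le> f q)"

definition nondegenerate_local_min :: "riem_manifold \<Rightarrow> (real mat \<Rightarrow> real) \<Rightarrow> real mat \<Rightarrow> bool" where
  "nondegenerate_local_min R f p \<longleftrightarrow> local_minimizer R f p \<and>
     (\<forall>Z\<in>mtangent R p. riem_hess R f p Z = 0\<^sub>m (mrows R) (mcols R) \<longrightarrow> Z = 0\<^sub>m (mrows R) (mcols R))"


section \<open>The quotient of a power of the orthogonal group\<close>

definition orth_power :: "nat \<Rightarrow> nat \<Rightarrow> real mat set" where
  "orth_power d k = {S \<in> carrier_mat (k * d) d. \<forall>i<k. row_block d S i \<in> orth_mats d}"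

definition orth_tangent :: "nat \<Rightarrow> nat \<Rightarrow> real mat \<Rightarrow> real mat set" where
  "orth_tangent d k S =
     {vstack d k (\<lambda>i. row_block d S i * \<Omega> i) | \<Omega>. \<forall>i<k. \<Omega> i \<in> skew_mats d}"

definition horizontal_space :: "nat \<Rightarrow> nat \<Rightarrow> real mat \<Rightarrow> real mat set" where
  "horizontal_space d m S =
     {vstack d m (\<lambda>i. row_block d S i * \<Omega> i) | \<Omega>.
        (\<forall>i<m. \<Omega> i \<in> skew_mats d) \<and> mat_sum d d \<Omega> {..<m} = 0\<^sub>m d d}"

definition quot_proj :: "nat \<Rightarrow> nat \<Rightarrow> real mat \<Rightarrow> real mat" where
  "quot_proj d m S = vstack d (m - 1) (\<lambda>i. row_block d S (Suc i) * (row_block d S 0)\<^sup>T)"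

definition horizontal_lift :: "nat \<Rightarrow> nat \<Rightarrow> real mat \<Rightarrow> real mat \<Rightarrow> real mat" where
  "horizontal_lift d m S Zt = (THE Z. Z \<in> horizontal_space d m S \<and>
     mat_diff_along (orth_power d m) (quot_proj d m) S Z = Zt)"

text \<open>The value does not depend on the chosen point \<open>S\<close> of the fibre.\<close>
definition quot_metric :: "nat \<Rightarrow> nat \<Rightarrow> real mat \<Rightarrow> real mat \<Rightarrow> real mat \<Rightarrow> real" where
  "quot_metric d m St Zt Wt =
     (let S = (SOME S. S \<in> orth_power d m \<and> quot_proj d m S = St)
      in frob_inner (horizontal_lift d m S Zt) (horizontal_lift d m S Wt))"

definition orth_quotient :: "nat \<Rightarrow> nat \<Rightarrow> riem_manifold" where
  "orth_quotient d m = \<lparr>mrows = (m - 1) * d, mcols = d, mpts = orth_power d (m - 1),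
     mtangent = orth_tangent d (m - 1), mmetric = quot_metric d m\<rparr>"

definition quot_objective :: "nat \<Rightarrow> real mat \<Rightarrow> real mat \<Rightarrow> real" where
  "quot_objective d C St = mat_tr (C * (1\<^sub>m d @\<^sub>r St) * (1\<^sub>m d @\<^sub>r St)\<^sup>T)"


definition all_equivalent :: "bool list \<Rightarrow> bool" where
  "all_equivalent Ps \<longleftrightarrow> (\<forall>P\<in>set Ps. \<forall>Q\<in>set Ps. P \<longleftrightarrow> Q)"

end

theory Submission
  imports Defs "HOL-Library.Landau_Symbols" "HOL-Analysis.L2_Norm"
begin

text \<open>
  In the left-invariant frame of the quotient a tangent vector is a family
  \<open>\<Xi>\<^sub>1, \<dots>, \<Xi>\<^sub>m\<^sub>-\<^sub>1\<close> of skew matrices, with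
  \<open>\<Sum>\<^sub>i \<langle>\<Xi>\<^sub>i, \<Xi>'\<^sub>i\<rangle> - \<langle>\<Sum>\<^sub>i \<Xi>\<^sub>i, \<Sum>\<^sub>i \<Xi>'\<^sub>i\<rangle> / m\<close> as metric, for which the
  Koszul formula gives the Levi-Civita connection explicitly. At a critical point metric compatibility
  alone yields \<open>g(Hess Z, W) = 2 tr(\<Omega>\<^sub>W\<^sup>T L \<Omega>\<^sub>Z)\<close>, where \<open>L\<close> is taken at \<open>[I; St]\<close> and the
  families are extended by \<open>0\<close>. Criticality also makes \<open>L\<close> symmetric, and \<open>L\<close> annihilates constant
  families, so (2)--(4) all say that \<open>L\<close> is positive on skew families modulo constants. The
  entries above the diagonal turn this into (5), and the spectral theorem, applied to a matrix
  whose kernel contains an explicit space of dimension \<open>d(d-1)/2\<close>, turns (5) into (6) and (7).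

  For (1), the second-order expansion is exact: \<open>F(q) - F(p) = tr(Y\<^sup>T L Y)\<close> with
  \<open>Y\<^sub>i = p\<^sub>i\<^sup>T q\<^sub>i - I\<close>. The symmetric part of \<open>Y\<^sub>i\<close> is \<open>- Y\<^sub>i Y\<^sub>i\<^sup>T / 2\<close>, so near \<open>p\<close> coercivity on the skew
  part decides. Conversely, at a local minimum \<open>L\<close> is positive semi-definite on skew families, whence
  a null vector lies in the kernel of the Hessian.
\<close>

section \<open>Symmetric matrices\<close>

text \<open>The Hessian is defined through a connection picked by \<open>SOME\<close>, so the
  Levi-Civita axioms hold for it only once some connection is known to satisfy them; the explicit
  Koszul formula supplies that witness. Criticality is tested in the tangent directions of the
  quotient, which move the views after the first: it makes their blocks of the diagonal correction
  symmetric. The block of the first view is symmetric because all blocks add up to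
  \<open>S\<^sup>T C S\<close>. The number \<open>d(d-1)/2\<close> is the dimension of the skew
  matrices, that is, of the constant families on which the form vanishes; extending families by
  \<open>0\<close>, centring them, or asking that they are not all equal are three ways to divide by
  these constants. The Riemannian computations live at the point \<open>[I; St]\<close> of the
  fibre, whereas the matrices in the statement are taken at an arbitrary \<open>S\<close>. Since
  \<open>S = [I; St] S\<^sub>1\<close>, passing between the two conjugates every member of a family
  by one orthogonal matrix, which preserves skewness, constancy and the value of the form.\<close>

lemma real_symmetric_eigenvector:
  fixes A :: "real mat"
  assumes A: "A \<in> carrier_mat n n" and sym: "A\<^sup>T = A" and n: "0 < n"
  obtains v e where "v \<in> carrier_vec n" "v \<noteq> 0\<^sub>v n" "A *\<^sub>v v = e \<cdot>\<^sub>v v"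
proof -
  note thesisI = that
  define B where "B = map_mat complex_of_real A"
  have B: "B \<in> carrier_mat n n" using A by (simp add: B_def)
  have "degree (char_poly B) = n" using degree_monic_char_poly[OF B] by simp
  hence "\<not> constant (poly (char_poly B))" using n by (simp add: constant_degree)
  then obtain z where "poly (char_poly B) z = 0" using fundamental_theorem_of_algebra by blast
  hence "eigenvalue B z" using eigenvalue_root_char_poly[OF B] by simp
  then obtain v where v: "v \<in> carrier_vec n" "v \<noteq> 0\<^sub>v n" "B *\<^sub>v v = z \<cdot>\<^sub>v v"
    using B unfolding eigenvalue_def eigenvector_def by auto
  define x where "x = (\<lambda>i. Re (v $ i))"
  define y where "y = (\<lambda>i. Im (v $ i))"
  have e: "(\<Sum>j<n. of_real (A $$ (i,j)) * v $ j) = z * v $ i" if "i < n" for i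
  proof -
    have "(B *\<^sub>v v) $ i = (\<Sum>j<n. of_real (A $$ (i,j)) * v $ j)"
      using A v(1) that by (simp add: B_def scalar_prod_def atLeast0LessThan)
    thus ?thesis using v(1) that by (simp add: v(3))
  qed
  have ex: "(\<Sum>j<n. A $$ (i,j) * x j) = Re z * x i - Im z * y i" if "i < n" for i
    using arg_cong[OF e[OF that], of Re] by (simp add: x_def y_def)
  have ey: "(\<Sum>j<n. A $$ (i,j) * y j) = Re z * y i + Im z * x i" if "i < n" for i
    using arg_cong[OF e[OF that], of Im] by (simp add: x_def y_def)
  have symA: "A $$ (i,j) = A $$ (j,i)" if "i < n" "j < n" for i j
    using arg_cong[OF sym, of "\<lambda>M. M $$ (i,j)"] A that by simp
  \<comment> \<open>Symmetry makes this double sum invariant under exchanging \<open>x\<close> and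
    \<open>y\<close>. Inserting \<open>A x\<close> and \<open>A y\<close> leaves \<open>Im z\<close>
    times the squared length of the eigenvector, so the eigenvalue is real, and \<open>x\<close> and
    \<open>y\<close> are each zero or a real eigenvector.\<close>
  have "(\<Sum>i<n. x i * (\<Sum>j<n. A $$ (i,j) * y j)) = (\<Sum>i<n. \<Sum>j<n. A $$ (i,j) * x i * y j)"
    by (simp add: sum_distrib_left mult_ac)
  also have "\<dots> = (\<Sum>i<n. \<Sum>j<n. A $$ (j,i) * x j * y i)"
    by (rule sum.swap)
  also have "\<dots> = (\<Sum>i<n. y i * (\<Sum>j<n. A $$ (i,j) * x j))"
    by (auto simp: sum_distrib_left mult_ac symA intro!: sum.cong)
  finally have "(\<Sum>i<n. x i * (Re z * y i + Im z * x i)) = (\<Sum>i<n. y i * (Re z * x i - Im z * y i))"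
    by (simp add: ex ey)
  hence "(\<Sum>i<n. x i * (Re z * y i + Im z * x i) - y i * (Re z * x i - Im z * y i)) = 0"
    by (simp add: sum_subtractf)
  also have "(\<Sum>i<n. x i * (Re z * y i + Im z * x i) - y i * (Re z * x i - Im z * y i))
      = Im z * (\<Sum>i<n. x i ^ 2 + y i ^ 2)"
    by (simp add: sum_distrib_left algebra_simps power2_eq_square)
  finally have *: "Im z = 0 \<or> (\<Sum>i<n. x i ^ 2 + y i ^ 2) = 0" by simp
  obtain i0 where i0: "i0 < n" "v $ i0 \<noteq> 0"
    using v by (metis carrier_vecD eq_vecI index_zero_vec(1) index_zero_vec(2))
  have "x i0 ^ 2 + y i0 ^ 2 \<noteq> 0"
    using i0 by (auto simp: x_def y_def complex_eq_iff sum_power2_eq_zero_iff)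
  hence "(\<Sum>i<n. x i ^ 2 + y i ^ 2) \<noteq> 0"
    using i0(1) by (subst sum_nonneg_eq_0_iff) (auto)
  with * have im: "Im z = 0" by simp
  have gen: thesis if f: "\<And>i. i < n \<Longrightarrow> (\<Sum>j<n. A $$ (i,j) * f j) = Re z * f i" "f i0 \<noteq> 0" for f
  proof (rule thesisI[of "vec n f" "Re z"])
    show "vec n f \<noteq> 0\<^sub>v n" using f(2) i0(1) by (metis index_vec index_zero_vec(1))
    show "A *\<^sub>v vec n f = Re z \<cdot>\<^sub>v vec n f"
      using A f(1) by (intro eq_vecI) (auto simp: scalar_prod_def atLeast0LessThan)
  qed simp
  show thesis
  proof (cases "x i0 = 0")
    case True
    hence "y i0 \<noteq> 0" using i0 by (auto simp: x_def y_def complex_eq_iff)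
    thus ?thesis using gen[of y] ey im by simp
  next
    case False
    thus ?thesis using gen[of x] ex im by simp
  qed
qed

lemma orth_matsD:
  assumes "Q \<in> orth_mats d"
  shows "Q \<in> carrier_mat d d" "Q\<^sup>T * Q = 1\<^sub>m d" "Q * Q\<^sup>T = 1\<^sub>m d"
  using assms mat_mult_left_right_inverse[of "Q\<^sup>T" d Q] by (auto simp: orth_mats_def)

lemma orth_mats_mult:
  assumes P: "P \<in> orth_mats d" and Q: "Q \<in> orth_mats d"
  shows "P * Q \<in> orth_mats d"
proof -
  note p = orth_matsD[OF P] note q = orth_matsD[OF Q]
  have "(P * Q)\<^sup>T * (P * Q) = Q\<^sup>T * (P\<^sup>T * P) * Q"
    using p(1) q(1) by (simp add: transpose_mult[OF p(1) q(1)] assoc_mult_mat[of _ d d _ d _ d])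
  also have "\<dots> = 1\<^sub>m d" using p q by simp
  finally show ?thesis using p q by (simp add: orth_mats_def)
qed

lemma orth_mats_transpose:
  assumes "Q \<in> orth_mats d" shows "Q\<^sup>T \<in> orth_mats d"
  using orth_matsD[OF assms] by (simp add: orth_mats_def)

lemma orth_mats_one: "1\<^sub>m d \<in> orth_mats d"
  by (simp add: orth_mats_def)

text \<open>The witness is a Householder reflection.\<close>
lemma orth_mat_first_col:
  assumes v: "v \<in> carrier_vec n" and n: "0 < n" and unit: "v \<bullet> v = 1"
  obtains W where "W \<in> orth_mats n" "col W 0 = v"
proof -
  \<comment> \<open>\<open>u\<close> is \<open>v - e\<^sub>0\<close>, of squared length
    \<open>s\<close>; the reflection in the hyperplane orthogonal to \<open>u\<close> sends
    \<open>e\<^sub>0\<close> to \<open>v\<close>. If \<open>s = 0\<close> then \<open>v\<close>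
    already equals \<open>e\<^sub>0\<close> and the identity serves.\<close>
  define u where "u = (\<lambda>i. v $ i - (if i = 0 then 1 else 0))"
  define s where "s = (\<Sum>i<n. u i * u i)"
  define W where "W = mat n n (\<lambda>(i,j). (if i = j then 1 else 0) - 2 / s * (u i * u j))"
  have vv: "(\<Sum>i<n. v $ i * v $ i) = 1"
    using unit v by (simp add: scalar_prod_def atLeast0LessThan)
  have s2: "s = 2 - 2 * v $ 0"
  proof -
    have "s = (\<Sum>i<n. v $ i * v $ i + (if i = 0 then 1 - 2 * v $ i else 0))"
      unfolding s_def u_def by (intro sum.cong) (auto simp: algebra_simps)
    thus ?thesis using n by (simp add: sum.distrib vv)
  qed
  show thesis
  proof (cases "s = 0")
    case True
    hence "u i = 0" if "i < n" for i
      using that unfolding s_def by (subst (asm) sum_nonneg_eq_0_iff) auto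
    hence "col (1\<^sub>m n) 0 = v" using v n by (intro eq_vecI) (auto simp: u_def)
    thus ?thesis using that[of "1\<^sub>m n"] orth_mats_one by blast
  next
    case False
    have "W\<^sup>T * W = 1\<^sub>m n"
    proof (rule eq_matI)
      fix i j assume "i < dim_row (1\<^sub>m n :: real mat)" "j < dim_col (1\<^sub>m n :: real mat)"
      hence ij: "i < n" "j < n" by auto
      have "(W\<^sup>T * W) $$ (i,j) = (\<Sum>k<n. ((if k = i then 1 else 0) - 2 / s * (u k * u i)) * ((if k = j then 1 else 0) - 2 / s * (u k * u j)))"
        using ij by (simp add: W_def scalar_prod_def atLeast0LessThan)
      also have "\<dots> = (\<Sum>k<n. (if k = i then (if i = j then 1 else 0) - 2 / s * (u i * u j) else 0)
          - (if k = j then 2 / s * (u i * u j) else 0) + 4 / s^2 * (u i * u j) * (u k * u k))"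
        by (intro sum.cong) (auto simp: algebra_simps power2_eq_square)
      also have "\<dots> = (if i = j then 1 else 0) - 4 / s * (u i * u j) + 4 / s^2 * (u i * u j) * s"
        using ij unfolding s_def by (simp add: sum.distrib sum_subtractf sum_distrib_left)
      also have "\<dots> = (if i = j then 1 else 0)" using False by (simp add: power2_eq_square)
      finally show "(W\<^sup>T * W) $$ (i,j) = 1\<^sub>m n $$ (i,j)" using ij by simp
    qed (auto simp: W_def)
    moreover have "col W 0 = v"
    proof (rule eq_vecI)
      fix i assume "i < dim_vec v"
      hence i: "i < n" using v by simp
      have "2 / s * u 0 = -1" using False s2 by (simp add: u_def field_simps)
      hence "2 / s * (u i * u 0) = - u i" by (metis mult.left_commute mult_minus1_right)
      thus "col W 0 $ i = v $ i" using i n by (simp add: W_def u_def)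
    qed (use v in \<open>auto simp: W_def\<close>)
    ultimately show ?thesis using that[of W] by (simp add: orth_mats_def W_def)
  qed
qed

text \<open>Deflation: a unit eigenvector is completed to an orthogonal \<open>W\<close>. The first
  column of \<open>W\<^sup>T A W\<close> is then a multiple of \<open>e\<^sub>0\<close>, by symmetry
  so is the first row, and the remaining block is symmetric of size one less.\<close>

lemma real_spectral_theorem:
  fixes A :: "real mat"
  assumes "A \<in> carrier_mat n n" and "A\<^sup>T = A"
  shows "\<exists>U e. U \<in> orth_mats n \<and> A = U * mat_diag n e * U\<^sup>T"
  using assms
proof (induction n arbitrary: A)
  case 0
  have "A = 1\<^sub>m 0 * mat_diag 0 (\<lambda>_. 0) * (1\<^sub>m 0)\<^sup>T" using 0 by (intro eq_matI) auto
  thus ?case using orth_mats_one by blast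
next
  case (Suc n)
  obtain w l where w: "w \<in> carrier_vec (Suc n)" "w \<noteq> 0\<^sub>v (Suc n)" "A *\<^sub>v w = l \<cdot>\<^sub>v w"
    using real_symmetric_eigenvector[OF Suc.prems] by auto
  have ww: "0 < w \<bullet> w" using conjugate_square_greater_0_vec[OF w(1)] w(2) by simp
  define v where "v = (1 / sqrt (w \<bullet> w)) \<cdot>\<^sub>v w"
  have v: "v \<in> carrier_vec (Suc n)" "v \<bullet> v = 1" "A *\<^sub>v v = l \<cdot>\<^sub>v v"
    using w ww Suc.prems by (auto simp: v_def mult_mat_vec smult_smult_assoc mult.commute)
  obtain W where W: "W \<in> orth_mats (Suc n)" "col W 0 = v"
    using orth_mat_first_col[OF v(1) _ v(2)] by auto
  note w' = orth_matsD[OF W(1)]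
  define B where "B = W\<^sup>T * A * W"
  have B: "B \<in> carrier_mat (Suc n) (Suc n)" using w' Suc.prems by (simp add: B_def)
  have Bsym: "B\<^sup>T = B"
    using w'(1) Suc.prems
    by (simp add: B_def transpose_mult[of _ "Suc n" "Suc n" _ "Suc n"] assoc_mult_mat[of _ "Suc n" "Suc n" _ "Suc n" _ "Suc n"])
  have B0: "B $$ (i,0) = (if i = 0 then l else 0)" if "i < Suc n" for i
  proof -
    have "col B 0 = W\<^sup>T *\<^sub>v (A *\<^sub>v v)"
    proof -
      have AW: "A * W \<in> carrier_mat (Suc n) (Suc n)" using w'(1) Suc.prems by simp
      have "B = W\<^sup>T * (A * W)"
        unfolding B_def by (rule assoc_mult_mat[of _ "Suc n" "Suc n" _ "Suc n" _ "Suc n"]) (use w'(1) Suc.prems in auto)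
      hence "col B 0 = W\<^sup>T *\<^sub>v col (A * W) 0"
        using col_mult2[OF _ AW, of "W\<^sup>T" "Suc n" 0] w'(1) by simp
      also have "col (A * W) 0 = A *\<^sub>v col W 0"
        by (rule col_mult2[of _ "Suc n" "Suc n" _ "Suc n"]) (use w'(1) Suc.prems in auto)
      finally show ?thesis unfolding W(2) .
    qed
    also have "\<dots> = l \<cdot>\<^sub>v (W\<^sup>T *\<^sub>v col W 0)" using v w'(1) W(2) by (simp add: mult_mat_vec)
    also have "W\<^sup>T *\<^sub>v col W 0 = col (W\<^sup>T * W) 0"
      by (rule col_mult2[symmetric, of _ "Suc n" "Suc n" _ "Suc n"]) (use w'(1) in auto)
    finally have "col B 0 = l \<cdot>\<^sub>v col (1\<^sub>m (Suc n)) 0" using w' by simp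
    hence "col B 0 $ i = (l \<cdot>\<^sub>v col (1\<^sub>m (Suc n)) 0) $ i" by simp
    thus ?thesis using that B by simp
  qed
  have B0': "B $$ (0,i) = (if i = 0 then l else 0)" if "i < Suc n" for i
    using B0[OF that] arg_cong[OF Bsym, of "\<lambda>M. M $$ (0,i)"] B that by simp
  define B' where "B' = mat n n (\<lambda>(i,j). B $$ (Suc i, Suc j))"
  have "B'\<^sup>T = B'"
  proof (rule eq_matI)
    fix i j assume "i < dim_row B'" "j < dim_col B'"
    thus "B'\<^sup>T $$ (i,j) = B' $$ (i,j)"
      using arg_cong[OF Bsym, of "\<lambda>M. M $$ (Suc i, Suc j)"] B by (simp add: B'_def)
  qed (auto simp: B'_def)
  moreover have B': "B' \<in> carrier_mat n n" by (simp add: B'_def)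
  ultimately obtain U e where U: "U \<in> orth_mats n" "B' = U * mat_diag n e * U\<^sup>T"
    using Suc.IH by blast
  note u' = orth_matsD[OF U(1)]
  define X where "X = four_block_mat (1\<^sub>m 1) (0\<^sub>m 1 n) (0\<^sub>m n 1) U"
  define D where "D = four_block_mat (mat 1 1 (\<lambda>_. l)) (0\<^sub>m 1 n) (0\<^sub>m n 1) (mat_diag n e)"
  have BB: "B = four_block_mat (mat 1 1 (\<lambda>_. l)) (0\<^sub>m 1 n) (0\<^sub>m n 1) B'"
    using B B0 B0' by (intro eq_matI) (auto simp: B'_def)
  have DD: "D = mat_diag (Suc n) (\<lambda>i. case i of 0 \<Rightarrow> l | Suc j \<Rightarrow> e j)"
    by (intro eq_matI) (auto simp: D_def mat_diag_def split: nat.splits)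
  have XT: "X\<^sup>T = four_block_mat (1\<^sub>m 1) (0\<^sub>m 1 n) (0\<^sub>m n 1) (U\<^sup>T)"
    using u'(1) by (auto simp: X_def transpose_four_block_mat[of _ 1 1 _ n _ n])
  have Xc: "X \<in> carrier_mat (Suc n) (Suc n)" using u'(1) by (auto simp: X_def)
  have md: "mat_diag n e \<in> carrier_mat n n" by simp
  have "X\<^sup>T * X = four_block_mat (1\<^sub>m 1) (0\<^sub>m 1 n) (0\<^sub>m n 1) (1\<^sub>m n)"
    unfolding XT unfolding X_def using u'
    by (subst mult_four_block_mat[of _ 1 1 _ n _ n _ _ 1 _ n]) auto
  also have "\<dots> = 1\<^sub>m (Suc n)" by (intro eq_matI) auto
  finally have Xo: "X \<in> orth_mats (Suc n)" using Xc by (simp add: orth_mats_def)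
  have XD: "X * D = four_block_mat (mat 1 1 (\<lambda>_. l)) (0\<^sub>m 1 n) (0\<^sub>m n 1) (U * mat_diag n e)"
    unfolding X_def D_def using u' md left_mult_zero_mat[OF md, of 1]
    by (subst mult_four_block_mat[of _ 1 1 _ n _ n _ _ 1 _ n]) (auto)
  have "X * D * X\<^sup>T = four_block_mat (mat 1 1 (\<lambda>_. l)) (0\<^sub>m 1 n) (0\<^sub>m n 1) (U * mat_diag n e * U\<^sup>T)"
    unfolding XD XT using u' md mult_carrier_mat[OF u'(1) md]
      right_mult_zero_mat[OF mult_carrier_mat[OF u'(1) md], of 1]
      mult_carrier_mat[OF mult_carrier_mat[OF u'(1) md] transpose_carrier_mat[THEN iffD2, OF u'(1)]]
    by (subst mult_four_block_mat[of _ 1 1 _ n _ n _ _ 1 _ n]) (auto)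
  hence XB: "X * D * X\<^sup>T = B" using U(2) BB by simp
  have Dc: "D \<in> carrier_mat (Suc n) (Suc n)" by (simp add: DD)
  have "A = (W * W\<^sup>T) * A * (W * W\<^sup>T)" using w' Suc.prems(1) by simp
  also have "\<dots> = W * B * W\<^sup>T"
    unfolding B_def using w'(1) Suc.prems(1)
    by (simp add: assoc_mult_mat[of _ "Suc n" "Suc n" _ "Suc n" _ "Suc n"])
  also have "\<dots> = W * (X * D * X\<^sup>T) * W\<^sup>T" using XB by simp
  also have "\<dots> = (W * X) * D * (X\<^sup>T * W\<^sup>T)"
    using w'(1) Xc Dc by (simp add: assoc_mult_mat[of _ "Suc n" "Suc n" _ "Suc n" _ "Suc n"])
  also have "X\<^sup>T * W\<^sup>T = (W * X)\<^sup>T"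
    using transpose_mult[OF w'(1) Xc] by simp
  finally show ?case using orth_mats_mult[OF W(1) Xo] DD by blast
qed

section \<open>Rank, spectrum and kernel of an orthogonally diagonalised matrix\<close>

lemma mult_mat_vec_index:
  assumes "A \<in> carrier_mat n m" "v \<in> carrier_vec m" "i < n"
  shows "(A *\<^sub>v v) $ i = (\<Sum>j<m. A $$ (i,j) * v $ j)"
  using assms by (auto simp: scalar_prod_def atLeast0LessThan)

lemma mult_mat_zero_vec:
  fixes A :: "real mat"
  assumes "A \<in> carrier_mat n m" shows "A *\<^sub>v 0\<^sub>v m = 0\<^sub>v n"
  using assms by (intro eq_vecI) auto

text \<open>Padding \<open>M\<close> with zero rows gives a square matrix with a zero row, hence of
  determinant zero, and each of its null vectors is one of \<open>M\<close>.\<close>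

lemma wide_mat_kernel:
  fixes M :: "real mat"
  assumes M: "M \<in> carrier_mat r N" and "r < N"
  obtains v where "v \<in> carrier_vec N" "v \<noteq> 0\<^sub>v N" "M *\<^sub>v v = 0\<^sub>v r"
proof -
  define M' where "M' = mat N N (\<lambda>(i,j). if i < r then M $$ (i,j) else 0)"
  have M': "M' \<in> carrier_mat N N" by (simp add: M'_def)
  have "M'\<^sup>T *\<^sub>v unit_vec N r = 0\<^sub>v N"
    using \<open>r < N\<close> by (intro eq_vecI) (auto simp: M'_def)
  moreover have "unit_vec N r \<noteq> (0\<^sub>v N :: real vec)" using \<open>r < N\<close> by simp
  ultimately have "det (M'\<^sup>T) = 0"
    using M' det_0_iff_vec_prod_zero[of "M'\<^sup>T" N] unit_vec_carrier[of N r]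
    by (metis transpose_carrier_mat)
  hence "det M' = 0" using det_transpose[OF M'] by simp
  then obtain v where v: "v \<in> carrier_vec N" "v \<noteq> 0\<^sub>v N" "M' *\<^sub>v v = 0\<^sub>v N"
    using M' det_0_iff_vec_prod_zero by blast
  have "M *\<^sub>v v = 0\<^sub>v r"
  proof (rule eq_vecI)
    fix i assume "i < dim_vec (0\<^sub>v r)"
    hence i: "i < r" by simp
    have "(M *\<^sub>v v) $ i = (M' *\<^sub>v v) $ i"
      using i \<open>r < N\<close> M v(1) by (simp add: M'_def scalar_prod_def)
    thus "(M *\<^sub>v v) $ i = 0\<^sub>v r $ i" using v(3) i \<open>r < N\<close> by simp
  qed (use M in simp)
  thus ?thesis using that v by blast
qed

text \<open>In the coordinates \<open>U\<^sup>T *\<^sub>v v\<close> the matrix acts entrywise as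
  multiplication by \<open>e\<close>; definiteness, rank and spectrum are all read off
  there.\<close>

locale orth_diag =
  fixes n :: nat and A U :: "real mat" and e :: "nat \<Rightarrow> real"
  assumes U: "U \<in> orth_mats n" and A_eq: "A = U * mat_diag n e * U\<^sup>T"
begin

lemmas U_carrier [simp, intro] = orth_matsD(1)[OF U]
lemmas U_orth = orth_matsD(2,3)[OF U]

lemma A_carrier [simp, intro]: "A \<in> carrier_mat n n"
  unfolding A_eq using U_carrier by (metis mat_diag_dim mult_carrier_mat transpose_carrier_mat)

lemma UT_carrier [simp, intro]: "U\<^sup>T \<in> carrier_mat n n"
  using U_carrier by simp

lemmas dims [simp] = carrier_matD[OF U_carrier] carrier_matD[OF A_carrier]

lemma mult_vec_carrier [simp, intro]: "U *\<^sub>v v \<in> carrier_vec n"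
  "U\<^sup>T *\<^sub>v v \<in> carrier_vec n" "A *\<^sub>v v \<in> carrier_vec n"
  by (auto intro!: carrier_vecI)

lemma A_sym: "A\<^sup>T = A"
proof -
  have c: "U * mat_diag n e \<in> carrier_mat n n" using U_carrier mat_diag_dim mult_carrier_mat by blast
  have "(mat_diag n e)\<^sup>T = mat_diag n e" by (intro eq_matI) (auto simp: mat_diag_def)
  thus ?thesis unfolding A_eq using transpose_mult[OF c UT_carrier] transpose_mult[OF U_carrier mat_diag_dim[of n e]]
      assoc_mult_mat[OF U_carrier mat_diag_dim[of n e] UT_carrier] by simp
qed

lemma UT_A: "U\<^sup>T * A = mat_diag n e * U\<^sup>T"
proof -
  have "U\<^sup>T * A = (U\<^sup>T * U) * (mat_diag n e * U\<^sup>T)"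
    unfolding A_eq using U_carrier mat_diag_dim[of n e] assoc_mult_mat[OF UT_carrier U_carrier, of "mat_diag n e * U\<^sup>T" n]
    by (metis UT_carrier assoc_mult_mat mult_carrier_mat)
  thus ?thesis using U_orth mat_diag_dim[of n e] by (metis left_mult_one_mat mult_carrier_mat transpose_carrier_mat U_carrier)
qed

lemma UT_A_vec:
  assumes v: "v \<in> carrier_vec n" and i: "i < n"
  shows "(U\<^sup>T *\<^sub>v (A *\<^sub>v v)) $ i = e i * (U\<^sup>T *\<^sub>v v) $ i"
proof -
  have "U\<^sup>T *\<^sub>v (A *\<^sub>v v) = (U\<^sup>T * A) *\<^sub>v v"
    using v by (simp add: assoc_mult_mat_vec[of _ n n _ n])
  also have "\<dots> = mat_diag n e *\<^sub>v (U\<^sup>T *\<^sub>v v)"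
    unfolding UT_A using v mat_diag_dim[of n e] by (intro assoc_mult_mat_vec[of _ n n _ n]) auto
  finally have *: "U\<^sup>T *\<^sub>v (A *\<^sub>v v) = mat_diag n e *\<^sub>v (U\<^sup>T *\<^sub>v v)" .
  have "(mat_diag n e *\<^sub>v (U\<^sup>T *\<^sub>v v)) $ i = (\<Sum>j<n. (if i = j then e j else 0) * (U\<^sup>T *\<^sub>v v) $ j)"
    using i mult_vec_carrier(2)[of v] by (simp add: mat_diag_def scalar_prod_def atLeast0LessThan del: index_mult_mat_vec) (simp add: scalar_prod_def atLeast0LessThan mult_mat_vec_def)
  also have "\<dots> = (\<Sum>j<n. if i = j then e j * (U\<^sup>T *\<^sub>v v) $ j else 0)"
    by (intro sum.cong) auto
  also have "\<dots> = e i * (U\<^sup>T *\<^sub>v v) $ i" using i by simp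
  finally show ?thesis using * by simp
qed

lemma U_UT_vec: "v \<in> carrier_vec n \<Longrightarrow> U *\<^sub>v (U\<^sup>T *\<^sub>v v) = v"
  using U_orth(2) assoc_mult_mat_vec[of U n n "U\<^sup>T" n v] by auto

lemma UT_U_vec: "v \<in> carrier_vec n \<Longrightarrow> U\<^sup>T *\<^sub>v (U *\<^sub>v v) = v"
  using U_orth(1) assoc_mult_mat_vec[of "U\<^sup>T" n n "U" n v] by auto

lemma UT_scalar_prod:
  assumes v: "v \<in> carrier_vec n" and w: "w \<in> carrier_vec n"
  shows "v \<bullet> w = (\<Sum>i<n. (U\<^sup>T *\<^sub>v v) $ i * (U\<^sup>T *\<^sub>v w) $ i)"
proof -
  have "v \<bullet> w = (U *\<^sub>v (U\<^sup>T *\<^sub>v v)) \<bullet> w" using U_UT_vec[OF v] by simp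
  also have "\<dots> = (U\<^sup>T *\<^sub>v v) \<bullet> (U\<^sup>T *\<^sub>v w)"
    using transpose_vec_mult_scalar[OF UT_carrier w mult_vec_carrier(2)] by simp
  finally show ?thesis using w by (simp add: scalar_prod_def atLeast0LessThan)
qed

lemma quad_form_eq:
  assumes v: "v \<in> carrier_vec n"
  shows "quad_form A v = (\<Sum>i<n. e i * (U\<^sup>T *\<^sub>v v) $ i ^ 2)"
proof -
  have "quad_form A v = (\<Sum>i<n. (U\<^sup>T *\<^sub>v v) $ i * (U\<^sup>T *\<^sub>v (A *\<^sub>v v)) $ i)"
    unfolding quad_form_def using v by (intro UT_scalar_prod) auto
  also have "\<dots> = (\<Sum>i<n. e i * (U\<^sup>T *\<^sub>v v) $ i ^ 2)"
    by (intro sum.cong refl) (simp only: UT_A_vec[OF v] lessThan_iff power2_eq_square mult_ac)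
  finally show ?thesis .
qed

lemma col_U: "i < n \<Longrightarrow> U\<^sup>T *\<^sub>v col U i = unit_vec n i"
  using U_orth(1) by (metis U_carrier col_mult2 col_one transpose_carrier_mat)

lemma quad_form_col: "i < n \<Longrightarrow> quad_form A (col U i) = e i"
proof -
  assume i: "i < n"
  have "quad_form A (col U i) = (\<Sum>j<n. if j = i then e i else 0)"
    using i by (subst quad_form_eq, simp add: carrier_vecI, intro sum.cong refl) (simp only: col_U, simp)
  thus ?thesis using i by simp
qed

lemma pos_semidef_iff: "pos_semidef A \<longleftrightarrow> (\<forall>i<n. 0 \<le> e i)"
proof
  assume "pos_semidef A"
  hence "0 \<le> quad_form A (col U i)" if "i < n" for i
    using that unfolding pos_semidef_def by (auto intro!: carrier_vecI)
  thus "\<forall>i<n. 0 \<le> e i" using quad_form_col by simp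
next
  assume *: "\<forall>i<n. 0 \<le> e i"
  have "0 \<le> quad_form A v" if "v \<in> carrier_vec n" for v
    unfolding quad_form_eq[OF that] using * by (intro sum_nonneg mult_nonneg_nonneg) auto
  thus "pos_semidef A" unfolding pos_semidef_def using A_sym A_carrier by auto
qed

lemma eigenvalues_asc_eq: "eigenvalues_asc A = sort (map e [0..<n])"
proof -
  have "similar_mat_wit A (mat_diag n e) U (U\<^sup>T)"
    unfolding similar_mat_wit_def Let_def using A_carrier U_orth A_eq by auto
  hence "similar_mat A (mat_diag n e)" unfolding similar_mat_def by blast
  hence "char_poly A = char_poly (mat_diag n e)" by (rule char_poly_similar)
  also have "\<dots> = (\<Prod>a\<leftarrow>diag_mat (mat_diag n e). [:- a, 1:])"
    by (rule char_poly_upper_triangular[of _ n]) (auto simp: mat_diag_def upper_triangular_def)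
  also have "diag_mat (mat_diag n e) = map e [0..<n]"
    by (auto simp: diag_mat_def mat_diag_def)
  finally have "char_poly A = (\<Prod>a\<leftarrow>map e [0..<n]. [:- a, 1:])" .
  moreover have "proots (\<Prod>a\<leftarrow>xs. [:- a, 1:]) = mset xs" for xs :: "real list"
  proof (induction xs)
    case (Cons a xs)
    have "(\<Prod>a\<leftarrow>xs. [:- a, 1:]) \<noteq> 0" by (auto simp: prod_list_zero_iff)
    thus ?case using Cons.IH by (simp add: proots_mult del: mult_pCons_left)
  qed simp
  ultimately have "proots (char_poly A) = mset (map e [0..<n])" by metis
  thus ?thesis unfolding eigenvalues_asc_def by (simp only: sorted_list_of_multiset_mset)
qed

text \<open>\<open>B\<close> collects the columns of \<open>U\<close> with non-zero eigenvalue. They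
  are linearly independent, and they span the column space of \<open>A\<close> because in the
  eigenbasis the range of \<open>A\<close> consists of the vectors supported where \<open>e\<close>
  does not vanish.\<close>

lemma rank_eq: "mat_rank A = card {i. i < n \<and> e i \<noteq> 0}"
proof -
  interpret vec_space "TYPE(real)" n .
  define r where "r = card {i. i < n \<and> e i \<noteq> 0}"
  obtain p where p: "bij_betw p {..<r} {i. i < n \<and> e i \<noteq> 0}"
    using ex_bij_betw_nat_finite[of "{i. i < n \<and> e i \<noteq> 0}"] unfolding r_def atLeast0LessThan by auto
  have pn: "p j < n" "e (p j) \<noteq> 0" if "j < r" for j using bij_betwE[OF p] that by auto
  define B where "B = mat n r (\<lambda>(a,j). U $$ (a, p j))"
  have B: "B \<in> carrier_mat n r" by (simp add: B_def)
  have colB: "col B j = col U (p j)" if "j < r" for j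
    using that pn[OF that] U_carrier by (intro eq_vecI) (auto simp: B_def)
  have UB: "(U\<^sup>T *\<^sub>v (B *\<^sub>v x)) $ i = (\<Sum>j<r. if i = p j then x $ j else 0)"
    if x: "x \<in> carrier_vec r" and i: "i < n" for x i
  proof -
    have "U\<^sup>T *\<^sub>v (B *\<^sub>v x) = (U\<^sup>T * B) *\<^sub>v x"
      using x B by (simp add: assoc_mult_mat_vec[of _ n n _ r])
    moreover have "(U\<^sup>T * B) $$ (i,j) = (if i = p j then 1 else 0)" if j: "j < r" for j
    proof -
      have "(U\<^sup>T * B) $$ (i,j) = col (U\<^sup>T * B) j $ i" using B i j U_carrier by auto
      also have "col (U\<^sup>T * B) j = U\<^sup>T *\<^sub>v col U (p j)"
        using col_mult2[of "U\<^sup>T" n n B r j] B j colB[OF j] by simp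
      also have "\<dots> $ i = (if i = p j then 1 else 0)" using col_U[OF pn(1)[OF j]] i pn(1)[OF j] by auto
      finally show ?thesis .
    qed
    ultimately have "(U\<^sup>T *\<^sub>v (B *\<^sub>v x)) $ i = (\<Sum>j<r. (if i = p j then 1 else 0) * x $ j)"
      using mult_mat_vec_index[OF mult_carrier_mat[OF UT_carrier B] x i] by (simp cong: sum.cong_simp)
    also have "\<dots> = (\<Sum>j<r. if i = p j then x $ j else 0)" by (intro sum.cong) auto
    finally show ?thesis .
  qed
  have UBp: "(U\<^sup>T *\<^sub>v (B *\<^sub>v x)) $ p j = x $ j" if x: "x \<in> carrier_vec r" and j: "j < r" for x j
  proof -
    have "(U\<^sup>T *\<^sub>v (B *\<^sub>v x)) $ p j = (\<Sum>j'<r. if p j = p j' then x $ j' else 0)"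
      using UB[OF x pn(1)[OF j]] by simp
    also have "\<dots> = (\<Sum>j'<r. if j = j' then x $ j' else 0)"
      using p j by (intro sum.cong refl) (auto dest: bij_betw_imp_inj_on inj_onD)
    finally show ?thesis using j by simp
  qed
  have inj: "x = 0\<^sub>v r" if "x \<in> carrier_vec r" "B *\<^sub>v x = 0\<^sub>v n" for x
  proof (rule eq_vecI)
    fix j assume "j < dim_vec (0\<^sub>v r :: real vec)"
    hence j: "j < r" by simp
    have "x $ j = (U\<^sup>T *\<^sub>v 0\<^sub>v n) $ p j" using UBp[OF that(1) j] that(2) by simp
    also have "\<dots> = 0" using pn(1)[OF j] U_carrier by simp
    finally show "x $ j = 0\<^sub>v r $ j" using j by simp
  qed (use that in simp)
  have dist: "distinct (cols B)"
    unfolding distinct_conv_nth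
  proof (intro allI impI)
    fix i j assume "i < length (cols B)" "j < length (cols B)" and ij: "i \<noteq> j"
    hence i: "i < r" and j: "j < r" using B by auto
    have "p i \<noteq> p j" using p i j ij by (auto dest: bij_betw_imp_inj_on inj_onD)
    hence "U\<^sup>T *\<^sub>v col U (p i) \<noteq> U\<^sup>T *\<^sub>v col U (p j)"
      using col_U[OF pn(1)[OF i]] col_U[OF pn(1)[OF j]] pn(1)[OF i] pn(1)[OF j] by (metis index_unit_vec(1) zero_neq_one)
    thus "cols B ! i \<noteq> cols B ! j" using i j B colB by (metis carrier_matD(2) cols_nth)
  qed
  have "lin_indpt (set (cols B))"
    using lin_depE[OF B _ dist] inj by metis
  hence rB: "rank B = r" using lin_indpt_full_rank[OF B dist] by simp
  have "(\<exists>x\<in>carrier_vec n. A *\<^sub>v x = y) \<longleftrightarrow> (\<exists>x\<in>carrier_vec r. B *\<^sub>v x = y)" for y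
    proof
      assume "\<exists>x\<in>carrier_vec n. A *\<^sub>v x = y"
      then obtain x where x: "x \<in> carrier_vec n" "A *\<^sub>v x = y" using A_carrier by auto
      define z where "z = vec r (\<lambda>j. (U\<^sup>T *\<^sub>v y) $ p j)"
      have z: "z \<in> carrier_vec r" by (simp add: z_def)
      have y: "y \<in> carrier_vec n" using x A_carrier by auto
      have "U\<^sup>T *\<^sub>v (B *\<^sub>v z) = U\<^sup>T *\<^sub>v y"
      proof (rule eq_vecI)
        fix i assume "i < dim_vec (U\<^sup>T *\<^sub>v y)"
        hence i: "i < n" using U_carrier by auto
        show "(U\<^sup>T *\<^sub>v (B *\<^sub>v z)) $ i = (U\<^sup>T *\<^sub>v y) $ i"
        proof (cases "e i = 0")
          case True
          have "(U\<^sup>T *\<^sub>v (B *\<^sub>v z)) $ i = 0"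
            unfolding UB[OF z i] using True pn by (intro sum.neutral) auto
          moreover have "(U\<^sup>T *\<^sub>v y) $ i = 0" using UT_A_vec[OF x(1) i] x(2) True by simp
          ultimately show ?thesis by simp
        next
          case False
          then obtain j where j: "j < r" "p j = i"
            using i p unfolding bij_betw_def by (metis (mono_tags, lifting) imageE lessThan_iff mem_Collect_eq)
          show ?thesis using UBp[OF z j(1)] j by (simp add: z_def)
        qed
      qed simp
      hence "U *\<^sub>v (U\<^sup>T *\<^sub>v (B *\<^sub>v z)) = U *\<^sub>v (U\<^sup>T *\<^sub>v y)" by simp
      hence "B *\<^sub>v z = y" using U_UT_vec[of y] U_UT_vec[of "B *\<^sub>v z"] y B z by simp
      thus "\<exists>x\<in>carrier_vec r. B *\<^sub>v x = y" using z B by auto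
    next
      assume "\<exists>x\<in>carrier_vec r. B *\<^sub>v x = y"
      then obtain x where x: "x \<in> carrier_vec r" "B *\<^sub>v x = y" using B by auto
      have y: "y \<in> carrier_vec n" using x B by auto
      \<comment> \<open>Where \<open>e i = 0\<close> the quotient is \<open>0\<close> by the
        convention for division; the coordinate of \<open>y\<close> vanishes there as well, since
        \<open>y\<close> is in the range of \<open>B\<close>.\<close>
      define z where "z = U *\<^sub>v vec n (\<lambda>i. (U\<^sup>T *\<^sub>v y) $ i / e i)"
      have z: "z \<in> carrier_vec n" unfolding z_def using U_carrier by auto
      have Az: "A *\<^sub>v z \<in> carrier_vec n" using z A_carrier by auto
      have "U\<^sup>T *\<^sub>v (A *\<^sub>v z) = U\<^sup>T *\<^sub>v y"
      proof (rule eq_vecI)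
        fix i assume "i < dim_vec (U\<^sup>T *\<^sub>v y)"
        hence i: "i < n" using U_carrier by auto
        have "(U\<^sup>T *\<^sub>v (A *\<^sub>v z)) $ i = e i * ((U\<^sup>T *\<^sub>v y) $ i / e i)"
          using UT_A_vec[OF z i] UT_U_vec[of "vec n (\<lambda>i. (U\<^sup>T *\<^sub>v y) $ i / e i)"] i unfolding z_def by simp
        also have "\<dots> = (U\<^sup>T *\<^sub>v y) $ i"
        proof (cases "e i = 0")
          case True
          have "(U\<^sup>T *\<^sub>v (B *\<^sub>v x)) $ i = 0"
            unfolding UB[OF x(1) i] using True pn by (intro sum.neutral) auto
          thus ?thesis using True x by simp
        qed simp
        finally show "(U\<^sup>T *\<^sub>v (A *\<^sub>v z)) $ i = (U\<^sup>T *\<^sub>v y) $ i" .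
      qed simp
      hence "U *\<^sub>v (U\<^sup>T *\<^sub>v (A *\<^sub>v z)) = U *\<^sub>v (U\<^sup>T *\<^sub>v y)" by simp
      hence "A *\<^sub>v z = y" using U_UT_vec[OF y] U_UT_vec[OF Az] by simp
      thus "\<exists>x\<in>carrier_vec n. A *\<^sub>v x = y" using z A_carrier by auto
    qed
  hence "col_space A = col_space B"
    unfolding col_space_eq[OF A_carrier] col_space_eq[OF B] using B by auto
  hence "rank A = rank B" unfolding rank_def col_space_def by simp
  thus ?thesis using rB r_def A_carrier unfolding mat_rank_def by auto
qed

end

text \<open>In a sorted list the entries below or equal to zero form an initial segment, so entry
  \<open>N\<close> is positive exactly if that segment has length at most \<open>N\<close>. An index
  past the end counts as positive, in agreement with the value \<infinity> of
  \<open>eigval_asc\<close>.\<close>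

lemma sorted_nth_pos_iff:
  fixes xs :: "real list"
  assumes "sorted xs"
  shows "(N < length xs \<longrightarrow> 0 < xs ! N) \<longleftrightarrow> length (filter (\<lambda>x. x \<le> 0) xs) \<le> N"
  using assms
proof (induction xs arbitrary: N)
  case (Cons a xs)
  show ?case
  proof (cases "a \<le> 0")
    case True
    thus ?thesis using Cons by (cases N) auto
  next
    case False
    hence "filter (\<lambda>x. x \<le> 0) (a # xs) = []" using Cons.prems by (force simp: filter_empty_conv)
    moreover have "0 < (a # xs) ! N" if "N < length (a # xs)"
      using False Cons.prems that nth_mem[OF that] by force
    ultimately show ?thesis by simp
  qed
qed simp

lemma (in orth_diag) eigval_asc_pos_iff:
  "0 < eigval_asc (N + 1) A \<longleftrightarrow> card {i. i < n \<and> e i \<le> 0} \<le> N"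
proof -
  define es where "es = eigenvalues_asc A"
  have es: "es = sort (map e [0..<n])" by (simp add: es_def eigenvalues_asc_eq)
  have "0 < eigval_asc (N + 1) A \<longleftrightarrow> (N < length es \<longrightarrow> 0 < es ! N)"
    unfolding eigval_asc_def es_def[symmetric] by auto
  also have "\<dots> \<longleftrightarrow> length (filter (\<lambda>x. x \<le> 0) es) \<le> N"
    by (rule sorted_nth_pos_iff) (simp add: es)
  also have "length (filter (\<lambda>x. x \<le> 0) es) = size (filter_mset (\<lambda>x. x \<le> 0) (mset es))"
    by (metis mset_filter size_mset)
  also have "mset es = mset (map e [0..<n])" by (simp add: es)
  also have "size (filter_mset (\<lambda>x. x \<le> 0) (mset (map e [0..<n]))) = length (filter (\<lambda>x. x \<le> 0) (map e [0..<n]))"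
    by (metis mset_filter size_mset)
  also have "\<dots> = length (filter (\<lambda>i. e i \<le> 0) [0..<n])" by (simp add: filter_map o_def)
  also have "\<dots> = card {i. i < n \<and> e i \<le> 0}"
    by (subst distinct_card[symmetric]) (auto intro: arg_cong[where f=card])
  finally show ?thesis .
qed

text \<open>With fewer than \<open>N\<close> zero eigenvalues some non-zero \<open>u\<close> would
  make \<open>V u\<close> orthogonal to all null eigenvectors, while \<open>A (V u) = 0\<close>
  kills the other coordinates; then \<open>V u = 0\<close>, against injectivity.\<close>

lemma (in orth_diag) kernel_dim_le:
  assumes V: "V \<in> carrier_mat n N"
    and inj: "\<And>u. u \<in> carrier_vec N \<Longrightarrow> V *\<^sub>v u = 0\<^sub>v n \<Longrightarrow> u = 0\<^sub>v N"
    and ker: "\<And>u. u \<in> carrier_vec N \<Longrightarrow> A *\<^sub>v (V *\<^sub>v u) = 0\<^sub>v n"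
  shows "N \<le> card {i. i < n \<and> e i = 0}"
proof (rule ccontr)
  define z where "z = card {i. i < n \<and> e i = 0}"
  assume "\<not> ?thesis"
  hence z: "z < N" by (simp add: z_def)
  obtain p where p: "bij_betw p {..<z} {i. i < n \<and> e i = 0}"
    using ex_bij_betw_nat_finite[of "{i. i < n \<and> e i = 0}"] unfolding z_def atLeast0LessThan by auto
  have pn: "p j < n" if "j < z" for j using bij_betwE[OF p] that by auto
  define M where "M = mat z N (\<lambda>(i,j). (U\<^sup>T * V) $$ (p i, j))"
  have "M \<in> carrier_mat z N" by (simp add: M_def)
  then obtain u where u: "u \<in> carrier_vec N" "u \<noteq> 0\<^sub>v N" "M *\<^sub>v u = 0\<^sub>v z"
    using wide_mat_kernel z by blast
  have Vu: "V *\<^sub>v u \<in> carrier_vec n" using V u by auto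
  have "U\<^sup>T *\<^sub>v (V *\<^sub>v u) = 0\<^sub>v n"
  proof (rule eq_vecI)
    fix i assume "i < dim_vec (0\<^sub>v n :: real vec)"
    hence i: "i < n" by simp
    show "(U\<^sup>T *\<^sub>v (V *\<^sub>v u)) $ i = 0\<^sub>v n $ i"
    proof (cases "e i = 0")
      case True
      then obtain j where j: "j < z" "p j = i"
        using i p unfolding bij_betw_def by (metis (mono_tags, lifting) imageE lessThan_iff mem_Collect_eq)
      have "(U\<^sup>T *\<^sub>v (V *\<^sub>v u)) $ i = ((U\<^sup>T * V) *\<^sub>v u) $ i"
        using V u by (simp add: assoc_mult_mat_vec[of _ n n _ N])
      also have "\<dots> = (M *\<^sub>v u) $ j"
        using j i u(1) V by (auto simp: M_def scalar_prod_def intro!: sum.cong)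
      finally show ?thesis using u(3) j i by simp
    next
      case False
      have "e i * (U\<^sup>T *\<^sub>v (V *\<^sub>v u)) $ i = 0"
        using UT_A_vec[OF Vu i] ker[OF u(1)] i U_carrier by simp
      thus ?thesis using False i by simp
    qed
  qed (use U_carrier in auto)
  hence "V *\<^sub>v u = 0\<^sub>v n" using U_UT_vec[OF Vu] mult_mat_zero_vec[OF U_carrier] by simp
  thus False using inj u by blast
qed

text \<open>Null eigenvectors have quadratic form zero, so each is \<open>V w\<close> for some
  \<open>w\<close> of length \<open>N\<close>. More than \<open>N\<close> of them would have
  linearly dependent \<open>w\<close>, which the orthonormality of the columns of \<open>U\<close>
  excludes.\<close>

lemma (in orth_diag) kernel_dim_ge:
  assumes V: "V \<in> carrier_mat n N"
    and ran: "\<And>v. v \<in> carrier_vec n \<Longrightarrow> quad_form A v = 0 \<Longrightarrow> \<exists>u\<in>carrier_vec N. v = V *\<^sub>v u"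
  shows "card {i. i < n \<and> e i = 0} \<le> N"
proof (rule ccontr)
  define z where "z = card {i. i < n \<and> e i = 0}"
  assume "\<not> ?thesis"
  hence z: "N < z" by (simp add: z_def)
  obtain p where p: "bij_betw p {..<z} {i. i < n \<and> e i = 0}"
    using ex_bij_betw_nat_finite[of "{i. i < n \<and> e i = 0}"] unfolding z_def atLeast0LessThan by auto
  have pn: "p j < n" "e (p j) = 0" if "j < z" for j using bij_betwE[OF p] that by auto
  have "\<exists>u\<in>carrier_vec N. col U (p j) = V *\<^sub>v u" if "j < z" for j
    using pn[OF that] quad_form_col[of "p j"] by (intro ran) auto
  then obtain w where w: "\<And>j. j < z \<Longrightarrow> w j \<in> carrier_vec N" "\<And>j. j < z \<Longrightarrow> col U (p j) = V *\<^sub>v w j"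
    by metis
  define M where "M = mat N z (\<lambda>(i,j). w j $ i)"
  have M: "M \<in> carrier_mat N z" by (simp add: M_def)
  then obtain c where c: "c \<in> carrier_vec z" "c \<noteq> 0\<^sub>v z" "M *\<^sub>v c = 0\<^sub>v N"
    using wide_mat_kernel z by blast
  have UTV: "U\<^sup>T * V \<in> carrier_mat n N" using V UT_carrier mult_carrier_mat by blast
  have *: "(U\<^sup>T * V * M) $$ (i,j) = (if i = p j then 1 else 0)" if "i < n" "j < z" for i j
  proof -
    have "col M j = w j" using w(1)[of j] that by (intro eq_vecI) (auto simp: M_def)
    hence "col (U\<^sup>T * V * M) j = U\<^sup>T *\<^sub>v col U (p j)"
      using col_mult2[OF UTV M that(2)] w(2)[of j] w(1)[of j] that V
      by (simp add: assoc_mult_mat_vec[of _ n n _ N])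
    hence "col (U\<^sup>T * V * M) j = unit_vec n (p j)" using col_U pn that by simp
    hence "col (U\<^sup>T * V * M) j $ i = unit_vec n (p j) $ i" by simp
    thus ?thesis using that pn(1)[of j] M U_carrier by auto
  qed
  have zero: "(U\<^sup>T * V * M) *\<^sub>v c = 0\<^sub>v n"
    using c assoc_mult_mat_vec[OF UTV M c(1)] mult_mat_zero_vec[OF UTV] by simp
  have "c = 0\<^sub>v z"
  proof (rule eq_vecI)
    fix j assume "j < dim_vec (0\<^sub>v z :: real vec)"
    hence j: "j < z" by simp
    have "((U\<^sup>T * V * M) *\<^sub>v c) $ (p j) = (\<Sum>j'<z. (U\<^sup>T * V * M) $$ (p j, j') * c $ j')"
      using c(1) M U_carrier pn(1)[OF j] by (auto simp: scalar_prod_def atLeast0LessThan intro!: sum.cong)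
    also have "\<dots> = (\<Sum>j'<z. if j = j' then c $ j' else 0)"
      using * pn(1)[OF j] p j by (intro sum.cong refl) (auto dest: bij_betw_imp_inj_on inj_onD)
    also have "\<dots> = c $ j" using j by simp
    finally show "c $ j = 0\<^sub>v z $ j" using zero pn(1)[OF j] j by simp
  qed (use c in auto)
  thus False using c by blast
qed

text \<open>\<open>V\<close> parametrises a known \<open>N\<close>-dimensional part of the kernel,
  so the eigenvalue zero has multiplicity \<open>z\<close> at least \<open>N\<close>. Each of the
  three conditions then amounts to: there is no negative eigenvalue, and
  \<open>z = N\<close>.\<close>

theorem psd_with_kernel_iff:
  fixes A :: "real mat"
  assumes A: "A \<in> carrier_mat n n" and sym: "A\<^sup>T = A"
    and V: "V \<in> carrier_mat n N"
    and inj: "\<And>u. u \<in> carrier_vec N \<Longrightarrow> V *\<^sub>v u = 0\<^sub>v n \<Longrightarrow> u = 0\<^sub>v N"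
    and ker: "\<And>u. u \<in> carrier_vec N \<Longrightarrow> A *\<^sub>v (V *\<^sub>v u) = 0\<^sub>v n"
  shows "(\<forall>v\<in>carrier_vec n. (\<forall>u\<in>carrier_vec N. v \<noteq> V *\<^sub>v u) \<longrightarrow> 0 < quad_form A v)
      \<longleftrightarrow> pos_semidef A \<and> mat_rank A = n - N" (is "?P \<longleftrightarrow> ?Q")
    and "pos_semidef A \<and> mat_rank A = n - N \<longleftrightarrow> 0 < eigval_asc (N + 1) A"
proof -
  obtain U e where "U \<in> orth_mats n" "A = U * mat_diag n e * U\<^sup>T"
    using real_spectral_theorem[OF A sym] by auto
  then interpret orth_diag n A U e by unfold_locales
  define z where "z = card {i. i < n \<and> e i = 0}"
  have Nz: "N \<le> z" unfolding z_def by (rule kernel_dim_le[OF V inj ker])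
  have split: "card {i. i < n \<and> (P i \<or> Q i)} = card {i. i < n \<and> P i} + card {i. i < n \<and> Q i}"
    if "\<And>i. \<not> (P i \<and> Q i)" for P Q
    using that by (subst card_Un_disjoint[symmetric]) (auto intro: arg_cong[where f=card])
  have "n = z + card {i. i < n \<and> e i \<noteq> 0}"
    unfolding z_def using split[of "\<lambda>i. e i = 0" "\<lambda>i. e i \<noteq> 0"] by simp
  hence rk: "mat_rank A = n - z" "z \<le> n" by (auto simp: rank_eq)
  have c0: "card {i. i < n \<and> e i \<le> 0} = z + card {i. i < n \<and> e i < 0}"
    unfolding z_def using split[of "\<lambda>i. e i = 0" "\<lambda>i. e i < 0"] by (simp add: le_less disj_commute)
  have psd: "pos_semidef A \<longleftrightarrow> card {i. i < n \<and> e i < 0} = 0"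
    unfolding pos_semidef_iff by (auto simp: not_le)
  show "pos_semidef A \<and> mat_rank A = n - N \<longleftrightarrow> 0 < eigval_asc (N + 1) A"
    unfolding eigval_asc_pos_iff c0 psd rk(1) using Nz rk(2) by linarith
  have q0: "quad_form A (V *\<^sub>v u) = 0" if "u \<in> carrier_vec N" for u
    using mult_mat_vec_carrier[OF V that] unfolding quad_form_def ker[OF that] by simp
  show "?P \<longleftrightarrow> ?Q"
  proof
    assume P: ?P
    have "0 \<le> quad_form A v" if "v \<in> carrier_vec n" for v
      using P q0 that by (metis less_imp_le order_refl)
    hence "pos_semidef A" using A sym unfolding pos_semidef_def by auto
    moreover have "z \<le> N" unfolding z_def
      by (rule kernel_dim_ge[OF V]) (use P in force)
    ultimately show ?Q using Nz rk by simp
  next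
    assume Q: ?Q
    hence zN: "z = N" using rk Nz by auto
    have e: "0 \<le> e i" if "i < n" for i using Q that pos_semidef_iff by simp
    show ?P
    proof (intro ballI impI, rule ccontr)
      fix v assume v: "v \<in> carrier_vec n" and nr: "\<forall>u\<in>carrier_vec N. v \<noteq> V *\<^sub>v u"
        and "\<not> 0 < quad_form A v"
      hence "(\<Sum>i<n. e i * (U\<^sup>T *\<^sub>v v) $ i ^ 2) = 0"
        using quad_form_eq[OF v] e by (metis (no_types, lifting) lessThan_iff less_eq_real_def mult_nonneg_nonneg sum_nonneg zero_le_power2)
      hence "e i * (U\<^sup>T *\<^sub>v v) $ i ^ 2 = 0" if "i < n" for i
        using that e by (subst (asm) sum_nonneg_eq_0_iff) auto
      hence z: "e i * (U\<^sup>T *\<^sub>v v) $ i = 0" if "i < n" for i using that by force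
      have "U\<^sup>T *\<^sub>v (A *\<^sub>v v) = 0\<^sub>v n"
        using z UT_A_vec[OF v] U_carrier by (intro eq_vecI) auto
      hence Av: "A *\<^sub>v v = 0\<^sub>v n"
        using U_UT_vec[OF mult_vec_carrier(3), of v] mult_mat_zero_vec[OF U_carrier] by simp
      \<comment> \<open>For a semi-definite matrix \<open>v\<close> with form zero is a null vector.
        Adjoining it to \<open>V\<close> as a further column would make the kernel have dimension
        \<open>N + 1\<close>, whereas \<open>z = N\<close>.\<close>
      define W where "W = mat n (Suc N) (\<lambda>(i,j). if j < N then V $$ (i,j) else v $ i)"
      have W: "W \<in> carrier_mat n (Suc N)" by (simp add: W_def)
      have Wu: "W *\<^sub>v u = V *\<^sub>v vec N (\<lambda>j. u $ j) + (u $ N) \<cdot>\<^sub>v v" if "u \<in> carrier_vec (Suc N)" for u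
        using that V v by (intro eq_vecI) (auto simp: W_def scalar_prod_def atLeast0LessThan mult.commute)
      have "Suc N \<le> z" unfolding z_def
      proof (rule kernel_dim_le[OF W])
        fix u :: "real vec" assume u: "u \<in> carrier_vec (Suc N)"
        have Vu: "V *\<^sub>v vec N (\<lambda>j. u $ j) \<in> carrier_vec n" using V by auto
        show "A *\<^sub>v (W *\<^sub>v u) = 0\<^sub>v n"
          unfolding Wu[OF u] using Vu v A ker[of "vec N (\<lambda>j. u $ j)"] Av
          by (auto simp: mult_add_distrib_mat_vec[OF A] mult_mat_vec[OF A])
        assume 0: "W *\<^sub>v u = 0\<^sub>v n"
        have uN: "u $ N = 0"
        proof (rule ccontr)
          assume "u $ N \<noteq> 0"
          have "v = V *\<^sub>v ((- 1 / u $ N) \<cdot>\<^sub>v vec N (\<lambda>j. u $ j))"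
          proof (rule eq_vecI)
            fix i assume "i < dim_vec (V *\<^sub>v ((- 1 / u $ N) \<cdot>\<^sub>v vec N (\<lambda>j. u $ j)))"
            hence i: "i < n" using V by simp
            have "(V *\<^sub>v vec N (\<lambda>j. u $ j) + (u $ N) \<cdot>\<^sub>v v) $ i = 0\<^sub>v n $ i"
              using 0 Wu[OF u] by simp
            hence "(V *\<^sub>v vec N (\<lambda>j. u $ j)) $ i + u $ N * v $ i = 0"
              using i v V by simp
            thus "v $ i = (V *\<^sub>v ((- 1 / u $ N) \<cdot>\<^sub>v vec N (\<lambda>j. u $ j))) $ i"
              using i V \<open>u $ N \<noteq> 0\<close> by (simp add: mult_mat_vec[OF V] field_simps)
          qed (use v V in auto)
          thus False using nr by (metis smult_carrier_vec vec_carrier)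
        qed
        hence "u $ N \<cdot>\<^sub>v v = 0\<^sub>v n" using v by (intro eq_vecI) auto
        hence "V *\<^sub>v vec N (\<lambda>j. u $ j) = 0\<^sub>v n"
          using 0 Wu[OF u] Vu by simp
        hence *: "vec N (\<lambda>j. u $ j) = 0\<^sub>v N" using inj by (metis vec_carrier)
        show "u = 0\<^sub>v (Suc N)"
        proof (rule eq_vecI)
          fix j assume "j < dim_vec (0\<^sub>v (Suc N) :: real vec)"
          hence "j < N \<or> j = N" by auto
          thus "u $ j = 0\<^sub>v (Suc N) $ j"
            using uN arg_cong[OF *, of "\<lambda>x. x $ j"] by auto
        qed (use u in auto)
      qed
      thus False using zN by simp
    qed
  qed
qed

lemma pos_def_lower_bound:
  fixes A :: "real mat"
  assumes A: "A \<in> carrier_mat n n" and sym: "A\<^sup>T = A"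
    and pd: "\<And>v. v \<in> carrier_vec n \<Longrightarrow> v \<noteq> 0\<^sub>v n \<Longrightarrow> 0 < quad_form A v"
  obtains c where "0 < c" "\<And>v. v \<in> carrier_vec n \<Longrightarrow> c * (v \<bullet> v) \<le> quad_form A v"
proof -
  obtain U e where "U \<in> orth_mats n" "A = U * mat_diag n e * U\<^sup>T"
    using real_spectral_theorem[OF A sym] by auto
  then interpret orth_diag n A U e by unfold_locales
  have e: "0 < e i" if "i < n" for i
  proof -
    have "col U i \<noteq> 0\<^sub>v n"
    proof
      assume "col U i = 0\<^sub>v n"
      hence "unit_vec n i = U\<^sup>T *\<^sub>v (0\<^sub>v n :: real vec)" using col_U[OF that] by simp
      hence "unit_vec n i $ i = (U\<^sup>T *\<^sub>v (0\<^sub>v n :: real vec)) $ i" by simp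
      thus False using that U_carrier by auto
    qed
    thus ?thesis using pd[of "col U i"] quad_form_col[OF that] that by auto
  qed
  \<comment> \<open>The smallest eigenvalue, capped at \<open>1\<close>; the extra element keeps the
    set non-empty when \<open>n = 0\<close>.\<close>
  define c where "c = Min (insert 1 (e ` {..<n}))"
  have "0 < c" unfolding c_def using e by (subst Min_gr_iff) auto
  moreover have "c * (v \<bullet> v) \<le> quad_form A v" if v: "v \<in> carrier_vec n" for v
  proof -
    have "c * (v \<bullet> v) = (\<Sum>i<n. c * (U\<^sup>T *\<^sub>v v) $ i ^ 2)"
      by (simp add: UT_scalar_prod[OF v v] sum_distrib_left power2_eq_square)
    also have "\<dots> \<le> (\<Sum>i<n. e i * (U\<^sup>T *\<^sub>v v) $ i ^ 2)"
      by (intro sum_mono mult_right_mono) (auto simp: c_def)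
    finally show ?thesis using quad_form_eq[OF v] by simp
  qed
  ultimately show ?thesis using that by blast
qed

section \<open>The pseudoinverse and the symmetry of the patch-stress matrix\<close>

lemma orth_diag_mult:
  assumes U: "U \<in> orth_mats n"
  shows "(U * mat_diag n f * U\<^sup>T) * (U * mat_diag n g * U\<^sup>T) = U * mat_diag n (\<lambda>i. f i * g i) * U\<^sup>T"
proof -
  note u = orth_matsD[OF U]
  have "(U * mat_diag n f * U\<^sup>T) * (U * mat_diag n g * U\<^sup>T)
      = U * (mat_diag n f * (U\<^sup>T * U) * mat_diag n g) * U\<^sup>T"
    using u(1)
    by (simp add: assoc_mult_mat[of _ n n _ n _ n] mult_carrier_mat[of _ n n _ n] del: mat_diag_diag)
  thus ?thesis using u by (simp add: right_mult_one_mat[OF mat_diag_dim])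
qed

text \<open>Penrose's argument: the symmetric idempotents \<open>A * X\<close> and
  \<open>A * Y\<close> absorb each other and hence agree, likewise \<open>X * A\<close> and
  \<open>Y * A\<close>; then \<open>X = X A X = Y A X = Y A Y = Y\<close>.\<close>

lemma pseudoinverse_unique:
  fixes A :: "real mat"
  assumes A: "A \<in> carrier_mat n n"
    and X: "X \<in> carrier_mat n n" "A * X * A = A" "X * A * X = X" "(A * X)\<^sup>T = A * X" "(X * A)\<^sup>T = X * A"
    and Y: "Y \<in> carrier_mat n n" "A * Y * A = A" "Y * A * Y = Y" "(A * Y)\<^sup>T = A * Y" "(Y * A)\<^sup>T = Y * A"
  shows "X = Y"
proof -
  note assoc = assoc_mult_mat[of _ n n _ n _ n]
  note tr = transpose_mult[of _ n n _ n]
  have AX: "A * X = A * Y"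
  proof -
    have "A * X = (A * Y * A) * X" using Y by simp
    also have "\<dots> = (A * Y) * (A * X)" using A X(1) Y(1) by (simp add: assoc)
    also have "\<dots> = (A * Y)\<^sup>T * (A * X)\<^sup>T" using X Y by simp
    also have "\<dots> = ((A * X) * (A * Y))\<^sup>T" using A X(1) Y(1) tr[of "A * X" "A * Y"] by simp
    also have "(A * X) * (A * Y) = (A * X * A) * Y" using A X(1) Y(1) by (simp add: assoc)
    also have "\<dots> = A * Y" using X by simp
    finally show ?thesis using Y by simp
  qed
  have XA: "X * A = Y * A"
  proof -
    have "X * A = X * (A * Y * A)" using Y by simp
    also have "\<dots> = (X * A) * (Y * A)" using A X(1) Y(1) by (simp add: assoc)
    also have "\<dots> = (X * A)\<^sup>T * (Y * A)\<^sup>T" using X Y by simp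
    also have "\<dots> = ((Y * A) * (X * A))\<^sup>T" using A X(1) Y(1) tr[of "Y * A" "X * A"] by simp
    also have "(Y * A) * (X * A) = Y * (A * X * A)" using A X(1) Y(1) by (simp add: assoc)
    also have "\<dots> = Y * A" using X by simp
    finally show ?thesis using Y by simp
  qed
  have "X = X * A * X" using X by simp
  also have "\<dots> = Y * (A * X)" using XA A X(1) Y(1) by (simp add: assoc)
  also have "\<dots> = Y * A * Y" using AX A X(1) Y(1) by (simp add: assoc)
  finally show ?thesis using Y by simp
qed

lemma pseudoinverse_symmetric:
  fixes A :: "real mat"
  assumes A: "A \<in> carrier_mat n n" and sym: "A\<^sup>T = A"
  shows "pseudoinverse A \<in> carrier_mat n n" "(pseudoinverse A)\<^sup>T = pseudoinverse A"
proof -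
  obtain U e where U: "U \<in> orth_mats n" and Ae: "A = U * mat_diag n e * U\<^sup>T"
    using real_spectral_theorem[OF A sym] by auto
  define K where "K = (\<lambda>f. U * mat_diag n f * U\<^sup>T)"
  have KK: "K f * K g = K (\<lambda>i. f i * g i)" for f g
    unfolding K_def by (rule orth_diag_mult[OF U])
  have K: "K f \<in> carrier_mat n n" "(K f)\<^sup>T = K f" for f
  proof -
    interpret orth_diag n "K f" U f by unfold_locales (use U in \<open>auto simp: K_def\<close>)
    show "K f \<in> carrier_mat n n" "(K f)\<^sup>T = K f" using A_carrier A_sym by auto
  qed
  have AK: "A = K e" using Ae K_def by simp
  \<comment> \<open>Since \<open>inverse 0 = 0\<close>, zero eigenvalues stay zero, as the Penrose
    equations require.\<close>
  define X where "X = K (\<lambda>i. inverse (e i))"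
  have X: "X \<in> carrier_mat n n" "A * X * A = A" "X * A * X = X" "(A * X)\<^sup>T = A * X" "(X * A)\<^sup>T = X * A"
  proof -
    have 1: "(\<lambda>i. e i * inverse (e i) * e i) = e" "(\<lambda>i. inverse (e i) * e i * inverse (e i)) = (\<lambda>i. inverse (e i))"
      by (auto simp: fun_eq_iff field_simps)
    show "X \<in> carrier_mat n n" "(A * X)\<^sup>T = A * X" "(X * A)\<^sup>T = X * A"
      using K by (auto simp: X_def AK KK)
    show "A * X * A = A" "X * A * X = X"
      unfolding X_def AK KK using 1 by simp_all
  qed
  have "pseudoinverse A = X"
    unfolding pseudoinverse_def
  proof (rule the_equality)
    show "X \<in> carrier_mat (dim_col A) (dim_row A) \<and>
     A * X * A = A \<and> X * A * X = X \<and> (A * X)\<^sup>T = A * X \<and> (X * A)\<^sup>T = X * A" using X A by simp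
  next
    fix Y assume "Y \<in> carrier_mat (dim_col A) (dim_row A) \<and>
     A * Y * A = A \<and> Y * A * Y = Y \<and> (A * Y)\<^sup>T = A * Y \<and> (Y * A)\<^sup>T = Y * A"
    thus "Y = X" using pseudoinverse_unique[OF A _ _ _ _ _ X, of Y] A by auto
  qed
  thus "pseudoinverse A \<in> carrier_mat n n" "(pseudoinverse A)\<^sup>T = pseudoinverse A"
    using X(1) K by (auto simp: X_def)
qed

lemma mat_sum_carrier [simp]: "mat_sum nr nc f I \<in> carrier_mat nr nc"
  by (simp add: mat_sum_def)

lemma mat_sum_index [simp]: "i < nr \<Longrightarrow> j < nc \<Longrightarrow> mat_sum nr nc f I $$ (i,j) = (\<Sum>a\<in>I. f a $$ (i,j))"
  by (simp add: mat_sum_def)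

lemma mat_sum_symmetric:
  assumes "\<And>a i j. a \<in> I \<Longrightarrow> i < n \<Longrightarrow> j < n \<Longrightarrow> f a $$ (i,j) = f a $$ (j,i)"
  shows "(mat_sum n n f I)\<^sup>T = mat_sum n n f I"
  by (rule eq_matI) (auto simp: mat_sum_def intro!: sum.cong assms)

lemma mult_transpose_self_symmetric:
  fixes v :: "real mat"
  assumes "v \<in> carrier_mat n m" "i < n" "j < n"
  shows "(v * v\<^sup>T) $$ (i,j) = (v * v\<^sup>T) $$ (j,i)"
  using assms by (auto simp: scalar_prod_def mult.commute)

text \<open>\<open>D\<close> and the Laplacian are sums of matrices of the form
  \<open>v v\<^sup>T\<close>, and a symmetric matrix has a symmetric pseudoinverse.\<close>

lemma patch_stress_symmetric:
  assumes "patch_framework d n m E x"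
  shows "patch_stress d n m E x \<in> carrier_mat (m * d) (m * d)"
    "(patch_stress d n m E x)\<^sup>T = patch_stress d n m E x"
proof -
  define L where "L = patch_laplacian n m E"
  define B where "B = patch_B d n m E x"
  define D where "D = patch_D d m E x"
  have L: "L \<in> carrier_mat (n + m) (n + m)" by (simp add: L_def patch_laplacian_def)
  have e: "edge_vec n m k i \<in> carrier_mat (n + m) 1" for k i
    by (simp add: edge_vec_def column_mat_def mat_of_cols_def)
  have Ls: "L\<^sup>T = L"
    unfolding L_def patch_laplacian_def
    by (rule mat_sum_symmetric) (auto simp del: index_mult_mat intro: mult_transpose_self_symmetric[OF e])
  have B: "B \<in> carrier_mat (m * d) (n + m)" by (simp add: B_def patch_B_def)
  have D: "D \<in> carrier_mat (m * d) (m * d)" by (simp add: D_def patch_D_def)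
  have Ds: "D\<^sup>T = D"
    unfolding D_def patch_D_def
  proof (rule mat_sum_symmetric, clarify, goal_cases)
    case (1 k i a b)
    define v where "v = view_inj d m i * column_mat (x k i)"
    have x: "x k i \<in> carrier_vec d" using assms 1 by (auto simp: patch_framework_def)
    have c: "column_mat (x k i) \<in> carrier_mat d 1" using x by (simp add: column_mat_def mat_of_cols_def)
    have w: "view_inj d m i \<in> carrier_mat (m * d) d"
      by (simp add: view_inj_def kron_def column_mat_def mat_of_cols_def)
    have v: "v \<in> carrier_mat (m * d) 1" unfolding v_def using w c by auto
    have "view_inj d m i * column_mat (x k i) * (column_mat (x k i))\<^sup>T * (view_inj d m i)\<^sup>T
        = v * v\<^sup>T"
      unfolding v_def using transpose_mult[OF w c] assoc_mult_mat[OF mult_carrier_mat[OF w c], of "(column_mat (x k i))\<^sup>T" d "(view_inj d m i)\<^sup>T" "m * d"] w c by simp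
    thus ?case using mult_transpose_self_symmetric[OF v] 1 by simp
  qed
  note P = pseudoinverse_symmetric[OF L Ls]
  have c: "B * pseudoinverse L \<in> carrier_mat (m * d) (n + m)" using B P by auto
  have BPB: "B * pseudoinverse L * B\<^sup>T \<in> carrier_mat (m * d) (m * d)" using c B by auto
  have "(B * pseudoinverse L * B\<^sup>T)\<^sup>T = B * pseudoinverse L * B\<^sup>T"
    using transpose_mult[OF c, of "B\<^sup>T" "m * d"] transpose_mult[OF B P(1)] B P
    by (simp add: assoc_mult_mat[OF B P(1)])
  hence "(D - B * pseudoinverse L * B\<^sup>T)\<^sup>T = D - B * pseudoinverse L * B\<^sup>T"
    using transpose_minus[OF D BPB] Ds by simp
  thus "patch_stress d n m E x \<in> carrier_mat (m * d) (m * d)"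
    "(patch_stress d n m E x)\<^sup>T = patch_stress d n m E x"
    using minus_carrier_mat[OF BPB, of D] unfolding patch_stress_def L_def B_def D_def by auto
qed

section \<open>Smooth functions and curves\<close>

lemma frob_inner_eq:
  assumes "G \<in> carrier_mat nr nc" "H \<in> carrier_mat nr nc"
  shows "frob_inner G H = (\<Sum>ij\<in>{..<nr} \<times> {..<nc}. G $$ ij * H $$ ij)"
proof -
  have "frob_inner G H = (\<Sum>j<nc. \<Sum>i<nr. G $$ (i,j) * H $$ (i,j))"
    using assms by (auto simp: frob_inner_def mat_tr_def scalar_prod_def atLeast0LessThan intro!: sum.cong)
  also have "\<dots> = (\<Sum>i<nr. \<Sum>j<nc. G $$ (i,j) * H $$ (i,j))" by (rule sum.swap)
  finally show ?thesis by (simp add: sum.cartesian_product case_prod_beta)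
qed

lemma frob_norm_eq:
  assumes "H \<in> carrier_mat nr nc"
  shows "frob_norm H = L2_set (\<lambda>ij. H $$ ij) ({..<nr} \<times> {..<nc})"
  unfolding frob_norm_def frob_inner_eq[OF assms assms] L2_set_def by (simp add: power2_eq_square)

lemma frob_norm_nonneg [simp]: "0 \<le> frob_norm H"
  unfolding frob_norm_eq[of H "dim_row H" "dim_col H", OF carrier_matI[OF refl refl]] by simp

lemma frob_norm_sq: "frob_norm H ^ 2 = frob_inner H H"
proof -
  have "0 \<le> frob_inner H H"
    unfolding frob_inner_eq[of H "dim_row H" "dim_col H" H, OF carrier_matI[OF refl refl] carrier_matI[OF refl refl]]
    by (intro sum_nonneg) auto
  thus ?thesis by (simp add: frob_norm_def)
qed

lemma abs_frob_inner_le: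
  assumes G: "G \<in> carrier_mat nr nc" and H: "H \<in> carrier_mat nr nc"
  shows "\<bar>frob_inner G H\<bar> \<le> frob_norm G * frob_norm H"
proof -
  have "\<bar>frob_inner G H\<bar> \<le> (\<Sum>ij\<in>{..<nr} \<times> {..<nc}. \<bar>G $$ ij\<bar> * \<bar>H $$ ij\<bar>)"
    unfolding frob_inner_eq[OF G H] by (rule order_trans[OF sum_abs]) (simp add: abs_mult)
  also have "\<dots> \<le> frob_norm G * frob_norm H"
    unfolding frob_norm_eq[OF G] frob_norm_eq[OF H] by (rule L2_set_mult_ineq)
  finally show ?thesis .
qed

lemma abs_index_le_frob_norm:
  assumes H: "H \<in> carrier_mat nr nc" and "i < nr" "j < nc"
  shows "\<bar>H $$ (i,j)\<bar> \<le> frob_norm H"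
proof -
  have "H $$ (i,j) ^ 2 \<le> (\<Sum>ij\<in>{..<nr} \<times> {..<nc}. H $$ ij ^ 2)"
    using assms by (intro member_le_sum) auto
  hence "sqrt (H $$ (i,j) ^ 2) \<le> frob_norm H"
    unfolding frob_norm_eq[OF H] L2_set_def by (rule real_sqrt_le_mono)
  thus ?thesis by simp
qed

lemma frob_inner_linear:
  assumes "G \<in> carrier_mat nr nc" "H \<in> carrier_mat nr nc" "K \<in> carrier_mat nr nc"
  shows "frob_inner G (a \<cdot>\<^sub>m H + b \<cdot>\<^sub>m K) = a * frob_inner G H + b * frob_inner G K"
    and "frob_inner (a \<cdot>\<^sub>m H + b \<cdot>\<^sub>m K) G = a * frob_inner H G + b * frob_inner K G"
proof -
  have c: "a \<cdot>\<^sub>m H + b \<cdot>\<^sub>m K \<in> carrier_mat nr nc" using assms by auto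
  have i: "(a \<cdot>\<^sub>m H + b \<cdot>\<^sub>m K) $$ ij = a * H $$ ij + b * K $$ ij" if "ij \<in> {..<nr} \<times> {..<nc}" for ij
    using that assms by auto
  show "frob_inner G (a \<cdot>\<^sub>m H + b \<cdot>\<^sub>m K) = a * frob_inner G H + b * frob_inner G K"
    unfolding frob_inner_eq[OF assms(1) c] frob_inner_eq[OF assms(1,2)] frob_inner_eq[OF assms(1,3)]
      sum_distrib_left sum.distrib[symmetric]
    by (intro sum.cong refl) (simp add: i algebra_simps del: index_add_mat)
  show "frob_inner (a \<cdot>\<^sub>m H + b \<cdot>\<^sub>m K) G = a * frob_inner H G + b * frob_inner K G"
    unfolding frob_inner_eq[OF c assms(1)] frob_inner_eq[OF assms(2,1)] frob_inner_eq[OF assms(3,1)]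
      sum_distrib_left sum.distrib[symmetric]
    by (intro sum.cong refl) (simp add: i algebra_simps del: index_add_mat)
qed

text \<open>Matrices of one shape tending to zero, as the pullback of \<open>nhds 0\<close> along
  the norm. With this filter a Frechet gradient is a little-o statement, and the calculus of Landau
  symbols yields the rules of differentiation.\<close>

definition mat_nhds :: "nat \<Rightarrow> nat \<Rightarrow> real mat filter" where
  "mat_nhds nr nc = inf (filtercomap frob_norm (nhds 0)) (principal (carrier_mat nr nc))"

lemma eventually_mat_nhds:
  "eventually P (mat_nhds nr nc) \<longleftrightarrow> (\<exists>\<delta>>0. \<forall>H\<in>carrier_mat nr nc. frob_norm H < \<delta> \<longrightarrow> P H)"
proof -
  have "eventually P (mat_nhds nr nc) \<longleftrightarrow>
      (\<exists>S. open S \<and> 0 \<in> S \<and> (\<forall>H. frob_norm H \<in> S \<longrightarrow> H \<in> carrier_mat nr nc \<longrightarrow> P H))"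
    unfolding mat_nhds_def eventually_inf_principal eventually_filtercomap_nhds by blast
  also have "\<dots> \<longleftrightarrow> (\<exists>\<delta>>0. \<forall>H\<in>carrier_mat nr nc. frob_norm H < \<delta> \<longrightarrow> P H)" (is "?l \<longleftrightarrow> ?r")
  proof
    assume ?l
    then obtain S where S: "open S" "0 \<in> S" "\<And>H. frob_norm H \<in> S \<Longrightarrow> H \<in> carrier_mat nr nc \<Longrightarrow> P H" by blast
    obtain \<delta> where \<delta>: "\<delta> > 0" "\<And>y::real. dist y 0 < \<delta> \<Longrightarrow> y \<in> S" using S(1,2) unfolding open_dist by blast
    thus ?r using S(3) by (intro exI[of _ \<delta>]) (auto simp: dist_real_def)
  next
    assume ?r
    then obtain \<delta> where "\<delta> > 0" "\<And>H. H \<in> carrier_mat nr nc \<Longrightarrow> frob_norm H < \<delta> \<Longrightarrow> P H" by blast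
    thus ?l by (intro exI[of _ "{..<\<delta>}"]) auto
  qed
  finally show ?thesis .
qed

lemma has_frechet_grad_smallo:
  "has_frechet_grad nr nc f A G \<longleftrightarrow> G \<in> carrier_mat nr nc \<and>
     (\<lambda>H. f (A + H) - f A - frob_inner G H) \<in> o[mat_nhds nr nc](frob_norm)"
  unfolding has_frechet_grad_def smallo_def eventually_mat_nhds by auto

lemma has_frechet_gradD:
  assumes "has_frechet_grad nr nc f A G"
  shows "G \<in> carrier_mat nr nc" "(\<lambda>H. f (A + H) - f A - frob_inner G H) \<in> o[mat_nhds nr nc](frob_norm)"
  using assms unfolding has_frechet_grad_smallo by auto

lemma eventually_carrier_mat_nhds: "eventually (\<lambda>H. H \<in> carrier_mat nr nc) (mat_nhds nr nc)"
  unfolding eventually_mat_nhds by (auto intro: exI[of _ 1])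

lemma frob_inner_bigo:
  assumes G: "G \<in> carrier_mat nr nc"
  shows "(\<lambda>H. frob_inner G H) \<in> O[mat_nhds nr nc](frob_norm)"
  by (intro landau_o.bigI[of "frob_norm G + 1"])
     (auto intro!: eventually_mono[OF eventually_carrier_mat_nhds] order_trans[OF abs_frob_inner_le[OF G]] mult_right_mono add_nonneg_pos)

lemma frob_norm_tendsto_mat_nhds: "(frob_norm \<longlongrightarrow> 0) (mat_nhds nr nc)"
  unfolding mat_nhds_def by (rule tendsto_mono[OF inf_le1 filterlim_filtercomap])

lemma has_frechet_grad_bigo:
  assumes "has_frechet_grad nr nc f A G"
  shows "(\<lambda>H. f (A + H) - f A) \<in> O[mat_nhds nr nc](frob_norm)"
proof -
  have "(\<lambda>H. (f (A + H) - f A - frob_inner G H) + frob_inner G H) \<in> O[mat_nhds nr nc](frob_norm)"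
    using has_frechet_gradD[OF assms]
    by (intro sum_in_bigo(1)[OF landau_o.small_imp_big frob_inner_bigo])
  thus ?thesis by simp
qed

lemma frob_norm_smallo_1: "frob_norm \<in> o[mat_nhds nr nc](\<lambda>_. 1 :: real)"
  by (rule smalloI_tendsto) (auto intro: frob_norm_tendsto_mat_nhds)

text \<open>Probing with small multiples of a matrix unit isolates a single entry of the gradient.
  Uniqueness is what later identifies the gradients supplied by different orders of
  differentiability.\<close>

lemma has_frechet_grad_unique:
  assumes G: "has_frechet_grad nr nc f A G" and K: "has_frechet_grad nr nc f A K"
  shows "G = K"
proof (rule eq_matI)
  note Gc = has_frechet_gradD(1)[OF G] and Kc = has_frechet_gradD(1)[OF K]
  fix i j assume "i < dim_row K" "j < dim_col K"
  hence ij: "i < nr" "j < nc" using Kc by auto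
  define E where "E = (\<lambda>t. mat nr nc (\<lambda>ij. if ij = (i,j) then t else (0::real)))"
  have Ec: "E t \<in> carrier_mat nr nc" for t by (simp add: E_def)
  have EI: "frob_inner M (E t) = M $$ (i,j) * t" if "M \<in> carrier_mat nr nc" for M t
  proof -
    have "frob_inner M (E t) = (\<Sum>ij\<in>{..<nr} \<times> {..<nc}. if ij = (i,j) then M $$ (i,j) * t else 0)"
      unfolding frob_inner_eq[OF that Ec] by (intro sum.cong) (auto simp: E_def split: if_splits)
    thus ?thesis using ij by simp
  qed
  have En: "frob_norm (E t) = \<bar>t\<bar>" for t
    using ij unfolding frob_norm_def EI[OF Ec] by (simp add: E_def)
  have "\<bar>G $$ (i,j) - K $$ (i,j)\<bar> \<le> 0 + e" if e: "0 < e" for e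
  proof -
    obtain a where a: "a > 0" "\<And>H. H \<in> carrier_mat nr nc \<Longrightarrow> frob_norm H < a \<Longrightarrow>
        \<bar>f (A + H) - f A - frob_inner G H\<bar> \<le> e / 2 * frob_norm H"
      using G half_gt_zero[OF e] unfolding has_frechet_grad_def by metis
    obtain b where b: "b > 0" "\<And>H. H \<in> carrier_mat nr nc \<Longrightarrow> frob_norm H < b \<Longrightarrow>
        \<bar>f (A + H) - f A - frob_inner K H\<bar> \<le> e / 2 * frob_norm H"
      using K half_gt_zero[OF e] unfolding has_frechet_grad_def by metis
    define t where "t = min a b / 2"
    have t: "t > 0" "t < a" "t < b" using a b by (auto simp: t_def)
    have "\<bar>G $$ (i,j) * t - K $$ (i,j) * t\<bar> \<le> e * t"
      using a(2)[OF Ec, of t] b(2)[OF Ec, of t] t unfolding En EI[OF Gc] EI[OF Kc] by linarith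
    hence "\<bar>G $$ (i,j) - K $$ (i,j)\<bar> * t \<le> e * t"
      using t by (simp add: left_diff_distrib[symmetric] abs_mult)
    thus ?thesis using t by simp
  qed
  hence "\<bar>G $$ (i,j) - K $$ (i,j)\<bar> \<le> 0" by (rule field_le_epsilon)
  thus "G $$ (i,j) = K $$ (i,j)" by simp
next
  show "dim_row G = dim_row K" "dim_col G = dim_col K"
    using has_frechet_gradD(1)[OF G] has_frechet_gradD(1)[OF K] by (metis carrier_matD)+
qed

lemma has_frechet_grad_cong:
  assumes "\<And>A. A \<in> carrier_mat nr nc \<Longrightarrow> f A = g A" "A \<in> carrier_mat nr nc"
  shows "has_frechet_grad nr nc f A G \<longleftrightarrow> has_frechet_grad nr nc g A G"
  using assms unfolding has_frechet_grad_def by simp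

lemma has_frechet_grad_const: "has_frechet_grad nr nc (\<lambda>_. c) A (0\<^sub>m nr nc)"
proof -
  have "frob_inner (0\<^sub>m nr nc) H = 0" if "H \<in> carrier_mat nr nc" for H
    by (subst frob_inner_eq[OF zero_carrier_mat that], intro sum.neutral) auto
  thus ?thesis unfolding has_frechet_grad_def by (auto intro: exI[of _ 1])
qed

lemma has_frechet_grad_index:
  assumes ij: "i < nr" "j < nc" and A: "A \<in> carrier_mat nr nc"
  shows "has_frechet_grad nr nc (\<lambda>A. A $$ (i,j)) A (mat nr nc (\<lambda>ab. if ab = (i,j) then 1 else 0))"
proof -
  have "frob_inner (mat nr nc (\<lambda>ab. if ab = (i,j) then 1 else 0)) H = H $$ (i,j)" if "H \<in> carrier_mat nr nc" for H
  proof -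
    have "frob_inner (mat nr nc (\<lambda>ab. if ab = (i,j) then 1 else 0)) H
        = (\<Sum>ab\<in>{..<nr} \<times> {..<nc}. if ab = (i,j) then H $$ ab else 0)"
      unfolding frob_inner_eq[OF mat_carrier that] by (intro sum.cong) (auto split: if_splits)
    thus ?thesis using ij by simp
  qed
  thus ?thesis unfolding has_frechet_grad_def using ij A by (auto intro: exI[of _ 1])
qed

lemma has_frechet_grad_add:
  assumes f: "has_frechet_grad nr nc f A G" and g: "has_frechet_grad nr nc g A K"
  shows "has_frechet_grad nr nc (\<lambda>A. f A + g A) A (1 \<cdot>\<^sub>m G + 1 \<cdot>\<^sub>m K)"
proof -
  note F = has_frechet_gradD[OF f] and Gg = has_frechet_gradD[OF g]
  have "(\<lambda>H. (f (A + H) - f A - frob_inner G H) + (g (A + H) - g A - frob_inner K H)) \<in> o[mat_nhds nr nc](frob_norm)"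
    by (rule sum_in_smallo(1)[OF F(2) Gg(2)])
  moreover have "eventually (\<lambda>H. (f (A + H) - f A - frob_inner G H) + (g (A + H) - g A - frob_inner K H)
      = f (A + H) + g (A + H) - (f A + g A) - frob_inner (1 \<cdot>\<^sub>m G + 1 \<cdot>\<^sub>m K) H) (mat_nhds nr nc)"
    by (rule eventually_mono[OF eventually_carrier_mat_nhds])
       (use frob_inner_linear(2)[OF _ F(1) Gg(1), of _ 1 1] in simp)
  ultimately show ?thesis
    unfolding has_frechet_grad_smallo using F Gg by (auto simp: landau_o.small.in_cong)
qed

text \<open>The error of the product splits into the error of \<open>f\<close> times a bounded
  factor, a constant times the error of \<open>g\<close>, and the linear part of \<open>f\<close>
  times an increment of \<open>g\<close>, which tends to zero.\<close>

lemma has_frechet_grad_mult: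
  assumes f: "has_frechet_grad nr nc f A G" and g: "has_frechet_grad nr nc g A K"
  shows "has_frechet_grad nr nc (\<lambda>A. f A * g A) A (f A \<cdot>\<^sub>m K + g A \<cdot>\<^sub>m G)"
proof -
  note F = has_frechet_gradD[OF f] and Gg = has_frechet_gradD[OF g]
  have g0: "(\<lambda>H. g (A + H) - g A) \<in> o[mat_nhds nr nc](\<lambda>_. 1)"
    using has_frechet_grad_bigo[OF g] frob_norm_smallo_1 by (rule landau_o.big_small_trans)
  have "(\<lambda>H. (g (A + H) - g A) + g A) \<in> O[mat_nhds nr nc](\<lambda>_. 1)"
    by (rule sum_in_bigo(1)[OF landau_o.small_imp_big[OF g0]]) simp
  hence g1: "(\<lambda>H. g (A + H)) \<in> O[mat_nhds nr nc](\<lambda>_. 1)" by simp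
  have "(\<lambda>H. (f (A + H) - f A - frob_inner G H) * g (A + H)) \<in> o[mat_nhds nr nc](\<lambda>H. frob_norm H * 1)"
    using F g1 by (intro landau_o.small_big_mult)
  moreover have "(\<lambda>H. f A * (g (A + H) - g A - frob_inner K H)) \<in> o[mat_nhds nr nc](\<lambda>H. 1 * frob_norm H)"
    using Gg by (intro landau_o.big_small_mult) auto
  moreover have "(\<lambda>H. frob_inner G H * (g (A + H) - g A)) \<in> o[mat_nhds nr nc](\<lambda>H. frob_norm H * 1)"
    using frob_inner_bigo[OF F(1)] g0 by (intro landau_o.big_small_mult)
  ultimately have "(\<lambda>H. (f (A + H) - f A - frob_inner G H) * g (A + H) + f A * (g (A + H) - g A - frob_inner K H)
      + frob_inner G H * (g (A + H) - g A)) \<in> o[mat_nhds nr nc](frob_norm)"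
    by (intro sum_in_smallo(1)) simp_all
  moreover have "eventually (\<lambda>H. (f (A + H) - f A - frob_inner G H) * g (A + H) + f A * (g (A + H) - g A - frob_inner K H)
      + frob_inner G H * (g (A + H) - g A)
      = f (A + H) * g (A + H) - f A * g A - frob_inner (f A \<cdot>\<^sub>m K + g A \<cdot>\<^sub>m G) H) (mat_nhds nr nc)"
    by (rule eventually_mono[OF eventually_carrier_mat_nhds])
       (use frob_inner_linear(2)[OF _ Gg(1) F(1), of _ "f A" "g A"] in \<open>simp add: algebra_simps\<close>)
  ultimately show ?thesis
    unfolding has_frechet_grad_smallo using F Gg by (auto simp: landau_o.small.in_cong)
qed

lemma diff_times_cong:
  assumes "\<And>A. A \<in> carrier_mat nr nc \<Longrightarrow> f A = g A"
  shows "diff_times nr nc k f \<longleftrightarrow> diff_times nr nc k g"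
  using has_frechet_grad_cong[of nr nc f g] assms by (cases k) auto

lemma diff_times_const: "diff_times nr nc k (\<lambda>_. c)"
  by (induction k arbitrary: c) (auto intro!: exI[of _ "\<lambda>_. 0\<^sub>m nr nc"] has_frechet_grad_const)

lemma diff_times_index: "i < nr \<Longrightarrow> j < nc \<Longrightarrow> diff_times nr nc k (\<lambda>A. A $$ (i,j))"
  by (cases k) (auto intro!: exI[of _ "\<lambda>_. mat nr nc (\<lambda>ab. if ab = (i,j) then 1 else 0)"]
      has_frechet_grad_index diff_times_const)

lemma diff_times_add:
  "diff_times nr nc k f \<Longrightarrow> diff_times nr nc k g \<Longrightarrow> diff_times nr nc k (\<lambda>A. f A + g A)"
proof (induction k arbitrary: f g)
  case (Suc k)
  obtain G where G: "\<And>A. A \<in> carrier_mat nr nc \<Longrightarrow> has_frechet_grad nr nc f A (G A)"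
      "\<And>i j. i < nr \<Longrightarrow> j < nc \<Longrightarrow> diff_times nr nc k (\<lambda>A. G A $$ (i,j))" using Suc.prems(1) by auto
  obtain K where K: "\<And>A. A \<in> carrier_mat nr nc \<Longrightarrow> has_frechet_grad nr nc g A (K A)"
      "\<And>i j. i < nr \<Longrightarrow> j < nc \<Longrightarrow> diff_times nr nc k (\<lambda>A. K A $$ (i,j))" using Suc.prems(2) by auto
  have "diff_times nr nc k (\<lambda>A. (1 \<cdot>\<^sub>m G A + 1 \<cdot>\<^sub>m K A) $$ (i,j))" if ij: "i < nr" "j < nc" for i j
  proof -
    have "(1 \<cdot>\<^sub>m G A + 1 \<cdot>\<^sub>m K A) $$ (i,j) = G A $$ (i,j) + K A $$ (i,j)" if "A \<in> carrier_mat nr nc" for A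
      using has_frechet_gradD(1)[OF G(1)[OF that]] has_frechet_gradD(1)[OF K(1)[OF that]] ij by auto
    thus ?thesis using Suc.IH[OF G(2)[OF ij] K(2)[OF ij]] by (subst diff_times_cong) auto
  qed
  thus ?case using has_frechet_grad_add[OF G(1) K(1)]
    by (auto intro!: exI[of _ "\<lambda>A. 1 \<cdot>\<^sub>m G A + 1 \<cdot>\<^sub>m K A"])
qed simp

text \<open>The product rule leaves one factor undifferentiated, so the induction for products has
  to lower the order of that factor.\<close>

lemma diff_times_Suc_imp: "diff_times nr nc (Suc k) f \<Longrightarrow> diff_times nr nc k f"
proof (induction k arbitrary: f)
  case (Suc k)
  obtain G where "\<forall>A\<in>carrier_mat nr nc. has_frechet_grad nr nc f A (G A)"
      "\<forall>i<nr. \<forall>j<nc. diff_times nr nc (Suc k) (\<lambda>A. G A $$ (i,j))"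
    using Suc.prems unfolding diff_times.simps(2)[of nr nc "Suc k"] by blast
  thus ?case using Suc.IH unfolding diff_times.simps(2)[of nr nc k] by blast
qed simp

lemma diff_times_mult:
  "diff_times nr nc k f \<Longrightarrow> diff_times nr nc k g \<Longrightarrow> diff_times nr nc k (\<lambda>A. f A * g A)"
proof (induction k arbitrary: f g)
  case (Suc k)
  obtain G where G: "\<And>A. A \<in> carrier_mat nr nc \<Longrightarrow> has_frechet_grad nr nc f A (G A)"
      "\<And>i j. i < nr \<Longrightarrow> j < nc \<Longrightarrow> diff_times nr nc k (\<lambda>A. G A $$ (i,j))" using Suc.prems(1) by auto
  obtain K where K: "\<And>A. A \<in> carrier_mat nr nc \<Longrightarrow> has_frechet_grad nr nc g A (K A)"
      "\<And>i j. i < nr \<Longrightarrow> j < nc \<Longrightarrow> diff_times nr nc k (\<lambda>A. K A $$ (i,j))" using Suc.prems(2) by auto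
  have "diff_times nr nc k (\<lambda>A. (f A \<cdot>\<^sub>m K A + g A \<cdot>\<^sub>m G A) $$ (i,j))" if ij: "i < nr" "j < nc" for i j
  proof -
    have "(f A \<cdot>\<^sub>m K A + g A \<cdot>\<^sub>m G A) $$ (i,j) = f A * K A $$ (i,j) + g A * G A $$ (i,j)" if "A \<in> carrier_mat nr nc" for A
      using has_frechet_gradD(1)[OF G(1)[OF that]] has_frechet_gradD(1)[OF K(1)[OF that]] ij by auto
    thus ?thesis
      using diff_times_add[OF Suc.IH[OF diff_times_Suc_imp[OF Suc.prems(1)] K(2)[OF ij]]
          Suc.IH[OF diff_times_Suc_imp[OF Suc.prems(2)] G(2)[OF ij]]] by (subst diff_times_cong) auto
  qed
  thus ?case using has_frechet_grad_mult[OF G(1) K(1)]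
    by (auto intro!: exI[of _ "\<lambda>A. f A \<cdot>\<^sub>m K A + g A \<cdot>\<^sub>m G A"])
qed simp

text \<open>Each order \<open>k\<close> supplies its own gradient with entries differentiable
  \<open>k\<close> times; by uniqueness these gradients coincide, so one of them serves for all
  orders.\<close>

lemma smooth_grad:
  assumes "\<And>k. diff_times nr nc k f"
  obtains G where "\<And>A. A \<in> carrier_mat nr nc \<Longrightarrow> has_frechet_grad nr nc f A (G A)"
    "\<And>k i j. i < nr \<Longrightarrow> j < nc \<Longrightarrow> diff_times nr nc k (\<lambda>A. G A $$ (i,j))"
proof -
  have "\<forall>k. \<exists>G. (\<forall>A\<in>carrier_mat nr nc. has_frechet_grad nr nc f A (G A)) \<and>
     (\<forall>i<nr. \<forall>j<nc. diff_times nr nc k (\<lambda>A. G A $$ (i, j)))"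
    using assms[of "Suc _"] by simp
  then obtain G where G: "\<And>k A. A \<in> carrier_mat nr nc \<Longrightarrow> has_frechet_grad nr nc f A (G k A)"
     "\<And>k i j. i < nr \<Longrightarrow> j < nc \<Longrightarrow> diff_times nr nc k (\<lambda>A. G k A $$ (i, j))" by metis
  have G0: "G 0 A = G k A" if "A \<in> carrier_mat nr nc" for k A
    using has_frechet_grad_unique[OF G(1)[OF that] G(1)[OF that]] .
  have 0: "G 0 A $$ (i,j) = G k A $$ (i,j)" if "A \<in> carrier_mat nr nc" for k A i j
    by (rule arg_cong[OF G0[OF that]])
  have "diff_times nr nc k (\<lambda>A. G 0 A $$ (i,j))" if "i < nr" "j < nc" for k i j
  proof -
    have "diff_times nr nc k (\<lambda>A. G 0 A $$ (i,j)) = diff_times nr nc k (\<lambda>A. G k A $$ (i,j))"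
      by (rule diff_times_cong) (rule 0)
    thus ?thesis using G(2)[OF that, of k] by (rule iffD2)
  qed
  note 1 = this
  show ?thesis by (rule that[OF G(1)[of _ 0] 1])
qed

section \<open>Smooth functions on a set and their derivatives along curves\<close>

lemma smooth_on_const [intro]: "smooth_on nr nc M (\<lambda>_. c)"
  unfolding smooth_on_def using diff_times_const[of nr nc _ c] by (intro exI[of _ "\<lambda>_. c"]) auto

lemma smooth_on_index [intro]: "i < nr \<Longrightarrow> j < nc \<Longrightarrow> smooth_on nr nc M (\<lambda>A. A $$ (i,j))"
  unfolding smooth_on_def using diff_times_index by blast

lemma smooth_on_add [intro]:
  assumes "smooth_on nr nc M f" "smooth_on nr nc M g" shows "smooth_on nr nc M (\<lambda>A. f A + g A)"
proof -
  obtain F K where "\<And>k. diff_times nr nc k F" "\<And>p. p \<in> M \<Longrightarrow> f p = F p"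
    "\<And>k. diff_times nr nc k K" "\<And>p. p \<in> M \<Longrightarrow> g p = K p"
    using assms unfolding smooth_on_def by blast
  thus ?thesis unfolding smooth_on_def
    using diff_times_add[of nr nc _ F K] by (intro exI[of _ "\<lambda>A. F A + K A"]) auto
qed

lemma smooth_on_mult [intro]:
  assumes "smooth_on nr nc M f" "smooth_on nr nc M g" shows "smooth_on nr nc M (\<lambda>A. f A * g A)"
proof -
  obtain F K where "\<And>k. diff_times nr nc k F" "\<And>p. p \<in> M \<Longrightarrow> f p = F p"
    "\<And>k. diff_times nr nc k K" "\<And>p. p \<in> M \<Longrightarrow> g p = K p"
    using assms unfolding smooth_on_def by blast
  thus ?thesis unfolding smooth_on_def
    using diff_times_mult[of nr nc _ F K] by (intro exI[of _ "\<lambda>A. F A * K A"]) auto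
qed

lemma smooth_on_sum [intro]:
  assumes "\<And>a. a \<in> I \<Longrightarrow> smooth_on nr nc M (f a)" shows "smooth_on nr nc M (\<lambda>A. \<Sum>a\<in>I. f a A)"
  using assms by (induction I rule: infinite_finite_induct) auto

lemma smooth_on_diff [intro]:
  assumes "smooth_on nr nc M f" "smooth_on nr nc M g" shows "smooth_on nr nc M (\<lambda>A. f A - g A)"
  using smooth_on_add[OF assms(1) smooth_on_mult[OF smooth_on_const[of _ _ _ "-1"] assms(2)]] by simp

lemma smooth_on_cong:
  assumes "\<And>p. p \<in> M \<Longrightarrow> f p = g p" shows "smooth_on nr nc M f \<longleftrightarrow> smooth_on nr nc M g"
  using assms unfolding smooth_on_def by auto

text \<open>The increment \<open>H t = c t - p\<close> is entrywise \<open>O(t)\<close>, hence so is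
  its norm. A remainder that is little-o of the norm is therefore \<open>o(t)\<close>, and the
  linear part converges entrywise.\<close>

lemma has_frechet_grad_curve:
  assumes f: "has_frechet_grad nr nc f p G" and c: "curve_through M p Z c"
    and M: "M \<subseteq> carrier_mat nr nc" and Z: "Z \<in> carrier_mat nr nc"
  shows "((\<lambda>t. f (c t)) has_real_derivative frob_inner G Z) (at 0)"
proof -
  note F = has_frechet_gradD[OF f]
  have cc: "c t \<in> carrier_mat nr nc" for t using c M by (auto simp: curve_through_def)
  have c0: "c 0 = p" using c by (simp add: curve_through_def)
  have pc: "p \<in> carrier_mat nr nc" using cc[of 0] c0 by simp
  define H where "H = (\<lambda>t. c t - p)"
  have Hc: "H t \<in> carrier_mat nr nc" for t using cc pc by (simp add: H_def minus_carrier_mat)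
  have pH: "p + H t = c t" for t using cc[of t] pc by (intro eq_matI) (auto simp: H_def)
  have Hq: "((\<lambda>t. H t $$ ij / t) \<longlongrightarrow> Z $$ ij) (at 0)" if "ij \<in> {..<nr} \<times> {..<nc}" for ij
  proof -
    obtain i j where ij: "ij = (i,j)" "i < nr" "j < nc" using \<open>ij \<in> _\<close> by auto
    have "((\<lambda>t. c t $$ (i,j)) has_real_derivative Z $$ (i,j)) (at 0)"
      using c Z ij by (auto simp: curve_through_def)
    hence "((\<lambda>t. (c t $$ (i,j) - c 0 $$ (i,j)) / t) \<longlongrightarrow> Z $$ (i,j)) (at 0)" by (simp add: DERIV_def)
    moreover have "H t $$ (i,j) = c t $$ (i,j) - c 0 $$ (i,j)" for t
      using ij cc[of t] pc c0 by (auto simp: H_def)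
    ultimately show ?thesis using ij by simp
  qed
  have Hb: "(\<lambda>t. H t $$ ij) \<in> O[at 0](\<lambda>t. t)" if "ij \<in> {..<nr} \<times> {..<nc}" for ij
    by (rule bigoI_tendsto[OF Hq[OF that]]) (auto simp: eventually_at_filter)
  have "(\<lambda>t. \<Sum>ij\<in>{..<nr} \<times> {..<nc}. \<bar>H t $$ ij\<bar>) \<in> O[at 0](\<lambda>t. t)"
    using Hb by (intro big_sum_in_bigo) simp
  moreover have "(\<lambda>t. frob_norm (H t)) \<in> O[at 0](\<lambda>t. \<Sum>ij\<in>{..<nr} \<times> {..<nc}. \<bar>H t $$ ij\<bar>)"
    by (intro landau_o.bigI[of 1] always_eventually allI)
       (auto simp: frob_norm_eq[OF Hc] sum_nonneg L2_set_nonneg intro!: L2_set_le_sum_abs)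
  ultimately have nb: "(\<lambda>t. frob_norm (H t)) \<in> O[at 0](\<lambda>t. t)" by (rule landau_o.big_trans[rotated])
  have "(\<lambda>t. t) \<in> o[at 0](\<lambda>_. 1::real)" by (rule smalloI_tendsto) (auto intro: tendsto_eq_intros)
  hence "(\<lambda>t. frob_norm (H t)) \<in> o[at 0](\<lambda>_. 1::real)" using nb by (rule landau_o.big_small_trans[rotated])
  hence "((\<lambda>t. frob_norm (H t)) \<longlongrightarrow> 0) (at 0)" by (auto dest: smalloD_tendsto)
  hence Hl: "filterlim H (mat_nhds nr nc) (at 0)"
    unfolding mat_nhds_def filterlim_inf filterlim_principal filterlim_filtercomap_iff
    using Hc by (auto simp: o_def)
  have "(\<lambda>t. f (p + H t) - f p - frob_inner G (H t)) \<in> o[at 0](\<lambda>t. frob_norm (H t))"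
    by (rule landau_o.small.compose[OF F(2) Hl])
  hence "(\<lambda>t. f (c t) - f p - frob_inner G (H t)) \<in> o[at 0](\<lambda>t. t)"
    unfolding pH using nb by (rule landau_o.small_big_trans)
  hence 1: "((\<lambda>t. (f (c t) - f p - frob_inner G (H t)) / t) \<longlongrightarrow> 0) (at 0)"
    by (rule smalloD_tendsto)
  have "((\<lambda>t. \<Sum>ij\<in>{..<nr} \<times> {..<nc}. G $$ ij * (H t $$ ij / t)) \<longlongrightarrow> (\<Sum>ij\<in>{..<nr} \<times> {..<nc}. G $$ ij * Z $$ ij)) (at 0)"
    using Hq by (intro tendsto_intros)
  hence 2: "((\<lambda>t. frob_inner G (H t) / t) \<longlongrightarrow> frob_inner G Z) (at 0)"
    by (simp add: frob_inner_eq[OF F(1) Hc] frob_inner_eq[OF F(1) Z] sum_divide_distrib)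
  from tendsto_add[OF 1 2] have "((\<lambda>t. (f (c t) - f p) / t) \<longlongrightarrow> frob_inner G Z) (at 0)"
    by (simp add: diff_divide_distrib)
  thus ?thesis by (simp add: DERIV_def c0)
qed

text \<open>Without a curve through \<open>p\<close> of velocity \<open>Z\<close> every number would
  satisfy the description in \<open>diff_along\<close>; the assumption \<open>curve_ex\<close> is
  what pins the differential down.\<close>

locale curve_rich =
  fixes nr nc :: nat and M :: "real mat set" and T :: "real mat \<Rightarrow> real mat set"
  assumes M_carrier: "M \<subseteq> carrier_mat nr nc"
    and T_carrier: "p \<in> M \<Longrightarrow> T p \<subseteq> carrier_mat nr nc"
    and curve_ex: "p \<in> M \<Longrightarrow> Z \<in> T p \<Longrightarrow> \<exists>c. curve_through M p Z c"
begin

lemma diff_along_eqI: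
  assumes p: "p \<in> M" "Z \<in> T p"
    and d: "\<And>c. curve_through M p Z c \<Longrightarrow> ((\<lambda>t. f (c t)) has_real_derivative r) (at 0)"
  shows "diff_along M f p Z = r"
  unfolding diff_along_def
proof (rule the_equality)
  obtain c where c: "curve_through M p Z c" using curve_ex p by blast
  fix r' assume "\<forall>c. curve_through M p Z c \<longrightarrow> ((\<lambda>t. f (c t)) has_real_derivative r') (at 0)"
  thus "r' = r" using d[OF c] c DERIV_unique by blast
qed (use d in blast)

text \<open>Any smooth ambient extension has a gradient whose pairing with tangent vectors is the
  differential along the set. Its entries are again smooth, so that differentials along vector
  fields can be differentiated once more.\<close>

lemma smooth_on_grad:
  assumes "smooth_on nr nc M f"
  obtains G where "\<And>p. p \<in> M \<Longrightarrow> G p \<in> carrier_mat nr nc"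
    "\<And>p Z. p \<in> M \<Longrightarrow> Z \<in> T p \<Longrightarrow> diff_along M f p Z = frob_inner (G p) Z"
    "\<And>p Z c. p \<in> M \<Longrightarrow> Z \<in> T p \<Longrightarrow> curve_through M p Z c \<Longrightarrow> ((\<lambda>t. f (c t)) has_real_derivative frob_inner (G p) Z) (at 0)"
    "\<And>i j. i < nr \<Longrightarrow> j < nc \<Longrightarrow> smooth_on nr nc M (\<lambda>p. G p $$ (i,j))"
proof -
  obtain F where F: "\<And>k. diff_times nr nc k F" "\<And>p. p \<in> M \<Longrightarrow> f p = F p"
    using assms unfolding smooth_on_def by blast
  obtain G where G: "\<And>A. A \<in> carrier_mat nr nc \<Longrightarrow> has_frechet_grad nr nc F A (G A)"
    "\<And>k i j. i < nr \<Longrightarrow> j < nc \<Longrightarrow> diff_times nr nc k (\<lambda>A. G A $$ (i,j))"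
    using smooth_grad[OF F(1)] by blast
  have d: "((\<lambda>t. f (c t)) has_real_derivative frob_inner (G p) Z) (at 0)"
    if "p \<in> M" "Z \<in> T p" "curve_through M p Z c" for p Z c
  proof -
    have "((\<lambda>t. F (c t)) has_real_derivative frob_inner (G p) Z) (at 0)"
      using that M_carrier T_carrier by (intro has_frechet_grad_curve[OF G(1) that(3) M_carrier]) auto
    moreover have "f (c t) = F (c t)" for t using that F(2) by (auto simp: curve_through_def)
    ultimately show ?thesis by simp
  qed
  show ?thesis
  proof (rule that)
    show "G p \<in> carrier_mat nr nc" if "p \<in> M" for p
      using G(1) M_carrier that has_frechet_gradD(1) by blast
    show "diff_along M f p Z = frob_inner (G p) Z" if "p \<in> M" "Z \<in> T p" for p Z
      using that d by (intro diff_along_eqI) auto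
    show "smooth_on nr nc M (\<lambda>p. G p $$ (i,j))" if "i < nr" "j < nc" for i j
      unfolding smooth_on_def using G(2)[OF that] by blast
  qed (use d in auto)
qed

lemma has_derivative_along:
  assumes "smooth_on nr nc M f" "p \<in> M" "Z \<in> T p" "curve_through M p Z c"
  shows "((\<lambda>t. f (c t)) has_real_derivative diff_along M f p Z) (at 0)"
  using smooth_on_grad[OF assms(1)] assms(2-4) by metis

lemma diff_along_cong:
  assumes "\<And>q. q \<in> M \<Longrightarrow> f q = g q"
  shows "diff_along M f p Z = diff_along M g p Z"
proof -
  have "(\<lambda>t. f (c t)) = (\<lambda>t. g (c t))" if "curve_through M p Z c" for c
    using that assms by (auto simp: curve_through_def)
  thus ?thesis unfolding diff_along_def by (metis (no_types, lifting))
qed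

lemma diff_along_linear:
  assumes "smooth_on nr nc M f" "p \<in> M" "Z \<in> T p" "W \<in> T p" "a \<cdot>\<^sub>m Z + b \<cdot>\<^sub>m W \<in> T p"
  shows "diff_along M f p (a \<cdot>\<^sub>m Z + b \<cdot>\<^sub>m W) = a * diff_along M f p Z + b * diff_along M f p W"
proof -
  obtain G where "G p \<in> carrier_mat nr nc" "\<And>Z. Z \<in> T p \<Longrightarrow> diff_along M f p Z = frob_inner (G p) Z"
    using smooth_on_grad[OF assms(1)] assms(2) by metis
  thus ?thesis using assms T_carrier[OF assms(2)] by (auto intro!: frob_inner_linear)
qed

lemma smooth_on_diff_along:
  assumes f: "smooth_on nr nc M f" and X: "\<And>p. p \<in> M \<Longrightarrow> X p \<in> T p"
    "\<And>i j. i < nr \<Longrightarrow> j < nc \<Longrightarrow> smooth_on nr nc M (\<lambda>p. X p $$ (i,j))"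
  shows "smooth_on nr nc M (\<lambda>p. diff_along M f p (X p))"
proof -
  obtain G where G: "\<And>p. p \<in> M \<Longrightarrow> G p \<in> carrier_mat nr nc"
    "\<And>p Z. p \<in> M \<Longrightarrow> Z \<in> T p \<Longrightarrow> diff_along M f p Z = frob_inner (G p) Z"
    "\<And>i j. i < nr \<Longrightarrow> j < nc \<Longrightarrow> smooth_on nr nc M (\<lambda>p. G p $$ (i,j))"
    using smooth_on_grad[OF f] by metis
  have "smooth_on nr nc M (\<lambda>p. \<Sum>ij\<in>{..<nr} \<times> {..<nc}. G p $$ ij * X p $$ ij)"
    using G(3) X(2) by (intro smooth_on_sum smooth_on_mult) auto
  moreover have "diff_along M f p (X p) = (\<Sum>ij\<in>{..<nr} \<times> {..<nc}. G p $$ ij * X p $$ ij)" if "p \<in> M" for p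
    using G(2)[OF that X(1)[OF that]] frob_inner_eq[OF G(1)[OF that], of "X p"] X(1)[OF that] T_carrier[OF that]
    by auto
  ultimately show ?thesis by (subst smooth_on_cong) auto
qed

lemma diff_along_const: "p \<in> M \<Longrightarrow> Z \<in> T p \<Longrightarrow> diff_along M (\<lambda>_. r) p Z = 0"
  by (rule diff_along_eqI) auto

lemma diff_along_index:
  assumes "p \<in> M" "Z \<in> T p" "i < nr" "j < nc"
  shows "diff_along M (\<lambda>q. q $$ (i,j)) p Z = Z $$ (i,j)"
  using assms T_carrier[OF assms(1)] by (intro diff_along_eqI) (auto simp: curve_through_def)

lemma diff_along_add:
  assumes "smooth_on nr nc M f" "smooth_on nr nc M g" "p \<in> M" "Z \<in> T p"
  shows "diff_along M (\<lambda>q. f q + g q) p Z = diff_along M f p Z + diff_along M g p Z"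
  by (rule diff_along_eqI) (use assms has_derivative_along in \<open>auto intro!: derivative_intros\<close>)

lemma diff_along_mult:
  assumes "smooth_on nr nc M f" "smooth_on nr nc M g" "p \<in> M" "Z \<in> T p"
  shows "diff_along M (\<lambda>q. f q * g q) p Z = diff_along M f p Z * g p + f p * diff_along M g p Z"
proof (rule diff_along_eqI[OF assms(3,4)])
  fix c assume c: "curve_through M p Z c"
  hence "c 0 = p" by (simp add: curve_through_def)
  thus "((\<lambda>t. f (c t) * g (c t)) has_real_derivative diff_along M f p Z * g p + f p * diff_along M g p Z) (at 0)"
    using DERIV_mult[OF has_derivative_along[OF assms(1,3,4) c] has_derivative_along[OF assms(2-4) c]]
    by (simp add: algebra_simps)
qed

lemma diff_along_sum:
  assumes "\<And>a. a \<in> I \<Longrightarrow> smooth_on nr nc M (f a)" "p \<in> M" "Z \<in> T p"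
  shows "diff_along M (\<lambda>q. \<Sum>a\<in>I. f a q) p Z = (\<Sum>a\<in>I. diff_along M (f a) p Z)"
  by (rule diff_along_eqI) (use assms has_derivative_along in \<open>auto intro!: DERIV_sum\<close>)

lemma diff_along_cmult:
  assumes "smooth_on nr nc M f" "p \<in> M" "Z \<in> T p"
  shows "diff_along M (\<lambda>q. r * f q) p Z = r * diff_along M f p Z"
  using diff_along_mult[OF smooth_on_const assms] diff_along_const[OF assms(2,3)] by simp

end

section \<open>Powers of the orthogonal group\<close>

lemma block_index_less: "i < k \<Longrightarrow> a < d \<Longrightarrow> i * d + a < k * (d::nat)"
  by (metis add.commute div_less_iff_less_mult div_mult_self3 div_less gr_implies_not0 mult.commute not_less_zero add_cancel_right_left neq0_conv)

lemma row_block_carrier [simp]: "S \<in> carrier_mat n c \<Longrightarrow> row_block d S i \<in> carrier_mat d c"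
  by (simp add: row_block_def)

lemma row_block_index [simp]:
  "a < d \<Longrightarrow> b < dim_col S \<Longrightarrow> row_block d S i $$ (a,b) = S $$ (i * d + a, b)"
  by (simp add: row_block_def)

lemma vstack_carrier [simp]: "vstack d k A \<in> carrier_mat (k * d) d"
  by (simp add: vstack_def)

lemma vstack_dim [simp]: "dim_row (vstack d k A) = k * d" "dim_col (vstack d k A) = d"
  by (simp_all add: vstack_def)

lemma vstack_index [simp]:
  "i < k \<Longrightarrow> a < d \<Longrightarrow> b < d \<Longrightarrow> vstack d k A $$ (i * d + a, b) = A i $$ (a,b)"
  by (simp add: vstack_def block_index_less)

lemma row_block_vstack: "i < k \<Longrightarrow> A i \<in> carrier_mat d d \<Longrightarrow> row_block d (vstack d k A) i = A i"
  by (intro eq_matI) (auto simp: row_block_def)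

lemma mat_eq_blockI:
  assumes "A \<in> carrier_mat (k * d) c" "B \<in> carrier_mat (k * d) c"
    and "\<And>i a b. i < k \<Longrightarrow> a < d \<Longrightarrow> b < c \<Longrightarrow> A $$ (i * d + a, b) = B $$ (i * d + a, b)"
  shows "A = B"
proof (rule eq_matI)
  fix r b assume rb: "r < dim_row B" "b < dim_col B"
  hence "r < k * d" using assms by auto
  hence "r div d < k" "r mod d < d"
    by (auto simp: less_mult_imp_div_less) (metis mod_less_divisor mult_0_right not_less_zero neq0_conv)
  thus "A $$ (r,b) = B $$ (r,b)" using assms(3)[of "r div d" "r mod d" b] rb assms(2) by simp
qed (use assms in auto)

lemma row_block_eqI:
  assumes "A \<in> carrier_mat (k * d) c" "B \<in> carrier_mat (k * d) c"
    and "\<And>i. i < k \<Longrightarrow> row_block d A i = row_block d B i"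
  shows "A = B"
proof (rule mat_eq_blockI[OF assms(1,2)])
  fix i a b assume "i < k" "a < d" "b < c"
  thus "A $$ (i * d + a, b) = B $$ (i * d + a, b)"
    using arg_cong[OF assms(3)[of i], of "\<lambda>M. M $$ (a,b)"] assms(1,2) by simp
qed

lemma vstack_row_block: "S \<in> carrier_mat (k * d) d \<Longrightarrow> vstack d k (row_block d S) = S"
  by (rule mat_eq_blockI[of _ k d d]) auto

lemma vstack_cong: "(\<And>i. i < k \<Longrightarrow> A i = B i) \<Longrightarrow> vstack d k A = vstack d k B"
  by (rule mat_eq_blockI[of _ k d d]) auto

lemma sum_block_index:
  fixes f :: "nat \<Rightarrow> real"
  assumes "0 < d"
  shows "(\<Sum>r<k * d. f r) = (\<Sum>i<k. \<Sum>a<d. f (i * d + a))"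
proof (induction k)
  case (Suc k)
  have "(\<Sum>r<Suc k * d. f r) = (\<Sum>r<k * d. f r) + (\<Sum>r=k*d..<k*d+d. f r)"
    by (simp add: lessThan_atLeast0 sum.atLeastLessThan_concat add.commute)
  also have "(\<Sum>r=k*d..<k*d+d. f r) = (\<Sum>a<d. f (k * d + a))"
    using sum.shift_bounds_nat_ivl[of f 0 "k*d" d] by (simp add: lessThan_atLeast0 add.commute)
  finally show ?case using Suc.IH by simp
qed simp

lemma frob_inner_vstack:
  assumes "\<And>i. i < k \<Longrightarrow> A i \<in> carrier_mat d d" "\<And>i. i < k \<Longrightarrow> B i \<in> carrier_mat d d"
  shows "frob_inner (vstack d k A) (vstack d k B) = (\<Sum>i<k. frob_inner (A i) (B i))"
proof (cases "d = 0")
  case False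
  have e: "frob_inner X Y = (\<Sum>i<n. \<Sum>j<c. X $$ (i,j) * Y $$ (i,j))"
    if "X \<in> carrier_mat n c" "Y \<in> carrier_mat n c" for X Y n c
    using frob_inner_eq[OF that] by (simp add: sum.cartesian_product case_prod_beta)
  show ?thesis using False assms
    by (simp add: e[OF vstack_carrier vstack_carrier] e[OF assms] sum_block_index)
next
  case True
  thus ?thesis by (simp add: frob_inner_eq[OF vstack_carrier vstack_carrier] frob_inner_eq[OF assms])
qed

section \<open>Skew matrices as velocities of orthogonal matrices\<close>

lemma skew_matsD:
  assumes "W \<in> skew_mats d"
  shows "W \<in> carrier_mat d d" "W\<^sup>T = - W" "a < d \<Longrightarrow> b < d \<Longrightarrow> W $$ (a,b) = - W $$ (b,a)"
proof -
  show c: "W \<in> carrier_mat d d" "W\<^sup>T = - W" using assms by (auto simp: skew_mats_def)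
  assume "a < d" "b < d"
  thus "W $$ (a,b) = - W $$ (b,a)" using arg_cong[OF c(2), of "\<lambda>M. M $$ (b,a)"] c(1) by simp
qed

lemma skew_matsI:
  assumes "W \<in> carrier_mat d d" "\<And>a b. a < d \<Longrightarrow> b < d \<Longrightarrow> W $$ (a,b) = - W $$ (b,a)"
  shows "W \<in> skew_mats d"
proof -
  have "W\<^sup>T = - W"
  proof (rule eq_matI)
    fix a b assume "a < dim_row (- W)" "b < dim_col (- W)"
    thus "W\<^sup>T $$ (a,b) = (- W) $$ (a,b)" using assms(1) assms(2)[of b a] by simp
  qed (use assms(1) in auto)
  thus ?thesis using assms(1) by (simp add: skew_mats_def)
qed

lemma orth_mats_abs_le_1:
  assumes Q: "Q \<in> orth_mats d" and "a < d" "b < d"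
  shows "\<bar>Q $$ (a,b)\<bar> \<le> 1"
proof -
  note q = orth_matsD[OF Q]
  have "(\<Sum>c<d. Q $$ (c,b) * Q $$ (c,b)) = (Q\<^sup>T * Q) $$ (b,b)"
    using q(1) assms by (simp add: scalar_prod_def atLeast0LessThan)
  hence "(\<Sum>c<d. Q $$ (c,b) ^ 2) = 1" using q(2) assms by (simp add: power2_eq_square)
  moreover have "Q $$ (a,b) ^ 2 \<le> (\<Sum>c<d. Q $$ (c,b) ^ 2)"
    using assms by (intro member_le_sum) auto
  ultimately show ?thesis by (simp add: abs_square_le_1)
qed

text \<open>
  The Cayley transform \<open>R = (1 - tW)\<^sup>-\<^sup>1(1 + tW)\<close> with \<open>W = \<Omega>/2\<close> satisfies \<open>R - 1 = tW(R + 1)\<close>, so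
  boundedness of orthogonal matrices alone gives its continuity and then its derivative at \<open>0\<close>.
\<close>
lemma orth_mats_curve:
  assumes Om: "Om \<in> skew_mats d"
  obtains R where "\<And>t. R t \<in> orth_mats d" "R 0 = 1\<^sub>m d"
    "\<And>a b. a < d \<Longrightarrow> b < d \<Longrightarrow> ((\<lambda>t. R t $$ (a,b)) has_real_derivative Om $$ (a,b)) (at 0)"
proof -
  note om = skew_matsD[OF Om]
  define W where "W = (1/2) \<cdot>\<^sub>m Om"
  have W: "W \<in> carrier_mat d d" "\<And>a b. a < d \<Longrightarrow> b < d \<Longrightarrow> W $$ (a,b) = Om $$ (a,b) / 2"
    using om(1) by (auto simp: W_def)
  have Wskew: "W $$ (a,b) = - W $$ (b,a)" if "a < d" "b < d" for a b
    using W(2)[OF that] W(2)[OF that(2,1)] om(3)[OF that] by simp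
  have ex: "\<exists>R. R \<in> orth_mats d \<and>
      (\<forall>a<d. \<forall>b<d. R $$ (a,b) - (if a = b then 1 else 0) = t * (\<Sum>c<d. W $$ (a,c) * (R $$ (c,b) + (if c = b then 1 else 0))))" for t
  proof -
    define N where "N = 1\<^sub>m d - t \<cdot>\<^sub>m W"
    define P where "P = 1\<^sub>m d + t \<cdot>\<^sub>m W"
    have N: "N \<in> carrier_mat d d" and P: "P \<in> carrier_mat d d" using W by (auto simp: N_def P_def minus_carrier_mat)
    have NT: "N\<^sup>T = P"
    proof (rule eq_matI)
      fix i j assume "i < dim_row P" "j < dim_col P"
      thus "N\<^sup>T $$ (i,j) = P $$ (i,j)" using W(1) Wskew[of j i] by (simp add: N_def P_def)
    qed (use N P in auto)
    have NP: "N * P = P * N"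
    proof -
      define X where "X = t \<cdot>\<^sub>m W"
      have X: "X \<in> carrier_mat d d" using W by (simp add: X_def)
      have "N * P = (1\<^sub>m d + X) - (X + X * X)"
        using minus_mult_distrib_mat[OF one_carrier_mat X, of P d] mult_add_distrib_mat[OF X one_carrier_mat X] X P
        by (simp add: N_def P_def flip: X_def)
      moreover have "P * N = (1\<^sub>m d - X) + (X - X * X)"
        using add_mult_distrib_mat[OF one_carrier_mat X, of N d] mult_minus_distrib_mat[OF X one_carrier_mat X] X N
        by (simp add: N_def P_def flip: X_def)
      ultimately show ?thesis using X by (auto intro!: eq_matI simp del: index_mult_mat(1))
    qed
    \<comment> \<open>Taking the inner product of \<open>v = t W v\<close> with \<open>v\<close>
      gives squared length zero, because the quadratic form of a skew matrix vanishes. Hence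
      \<open>N\<close> is invertible for every \<open>t\<close>.\<close>
    have "v = 0\<^sub>v d" if v: "v \<in> carrier_vec d" "N *\<^sub>v v = 0\<^sub>v d" for v
    proof -
      have va: "v $ a = t * (\<Sum>b<d. W $$ (a,b) * v $ b)" if a: "a < d" for a
      proof -
        have "(N *\<^sub>v v) $ a = (\<Sum>b<d. (if a = b then v $ b else 0) - t * (W $$ (a,b) * v $ b))"
          unfolding mult_mat_vec_index[OF N v(1) a] using a W by (intro sum.cong) (auto simp: N_def algebra_simps)
        also have "\<dots> = v $ a - t * (\<Sum>b<d. W $$ (a,b) * v $ b)"
          using a by (simp add: sum_subtractf sum_distrib_left)
        finally show ?thesis using v(2) a by simp
      qed
      have "(\<Sum>a<d. v $ a * v $ a) = (\<Sum>a<d. v $ a * (t * (\<Sum>b<d. W $$ (a,b) * v $ b)))"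
        by (intro sum.cong refl arg_cong[where f="(*) _"] va) auto
      also have "\<dots> = t * (\<Sum>a<d. \<Sum>b<d. W $$ (a,b) * v $ a * v $ b)"
        by (simp add: sum_distrib_left mult_ac)
      finally have "(\<Sum>a<d. v $ a * v $ a) = t * (\<Sum>a<d. \<Sum>b<d. W $$ (a,b) * v $ a * v $ b)" .
      moreover have "(\<Sum>a<d. \<Sum>b<d. W $$ (a,b) * v $ a * v $ b) = 0"
      proof -
        have "(\<Sum>a<d. \<Sum>b<d. W $$ (a,b) * v $ a * v $ b) = (\<Sum>b<d. \<Sum>a<d. W $$ (a,b) * v $ a * v $ b)" by (rule sum.swap)
        also have "\<dots> = (\<Sum>b<d. \<Sum>a<d. - (W $$ (b,a) * v $ b * v $ a))"
        proof (intro sum.cong refl)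
          fix a b assume "a \<in> {..<d}" "b \<in> {..<d}"
          thus "W $$ (a,b) * v $ a * v $ b = - (W $$ (b,a) * v $ b * v $ a)" using Wskew[of a b] by simp
        qed
        finally show ?thesis by (simp add: sum_negf)
      qed
      ultimately have "(\<Sum>a<d. v $ a * v $ a) = 0" by simp
      hence "\<forall>a<d. v $ a = 0" by (subst (asm) sum_nonneg_eq_0_iff) auto
      thus ?thesis using v by (intro eq_vecI) auto
    qed
    hence "det N \<noteq> 0" using det_0_iff_vec_prod_zero[OF N] by auto
    then obtain B where B: "B \<in> carrier_mat d d" "B * N = 1\<^sub>m d" "N * B = 1\<^sub>m d"
      using det_non_zero_imp_unit[OF N] unfolding Units_def by (auto simp: ring_mat_def)
    define R where "R = B * P"
    have R: "R \<in> carrier_mat d d" using B P by (simp add: R_def)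
    have NR: "N * R = P" unfolding R_def using assoc_mult_mat[OF N B(1) P] B(3) P by simp
    have PT: "P\<^sup>T = N" using NT by (metis transpose_transpose)
    have "R * R\<^sup>T = B * P * (N * B\<^sup>T)"
      unfolding R_def transpose_mult[OF B(1) P] PT ..
    also have "\<dots> = B * (P * N) * B\<^sup>T" using B(1) P N by (simp add: assoc_mult_mat[of _ d d _ d _ d] mult_carrier_mat[of _ d d _ d])
    also have "\<dots> = B * (N * P) * B\<^sup>T" by (simp only: NP)
    also have "\<dots> = (B * N) * (P * B\<^sup>T)" using B(1) P N by (simp add: assoc_mult_mat[of _ d d _ d _ d] mult_carrier_mat[of _ d d _ d])
    also have "P * B\<^sup>T = (B * N)\<^sup>T" unfolding transpose_mult[OF B(1) N] NT ..
    finally have "R * R\<^sup>T = 1\<^sub>m d" by (simp add: B(2))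
    hence "R\<^sup>T * R = 1\<^sub>m d" using mat_mult_left_right_inverse[of R d "R\<^sup>T"] R by simp
    hence "R \<in> orth_mats d" using R by (simp add: orth_mats_def)
    moreover have "R $$ (a,b) - (if a = b then 1 else 0) = t * (\<Sum>c<d. W $$ (a,c) * (R $$ (c,b) + (if c = b then 1 else 0)))"
      if ab: "a < d" "b < d" for a b
    proof -
      have "(N * R) $$ (a,b) = (\<Sum>c<d. (if a = c then R $$ (c,b) else 0) - t * (W $$ (a,c) * R $$ (c,b)))"
        using ab R N W by (simp add: scalar_prod_def atLeast0LessThan) (auto simp: N_def algebra_simps intro!: sum.cong)
      also have "\<dots> = R $$ (a,b) - t * (\<Sum>c<d. W $$ (a,c) * R $$ (c,b))"
        using ab by (simp add: sum_subtractf sum_distrib_left)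
      finally have "R $$ (a,b) - t * (\<Sum>c<d. W $$ (a,c) * R $$ (c,b)) = (if a = b then 1 else 0) + t * W $$ (a,b)"
        using NR ab W(1) by (simp add: P_def)
      moreover have "(\<Sum>c<d. W $$ (a,c) * (if c = b then 1 else 0)) = W $$ (a,b)"
        using ab by (simp add: if_distrib[of "\<lambda>x. _ * x"] cong: if_cong)
      ultimately show ?thesis by (simp add: distrib_left sum.distrib algebra_simps)
    qed
    ultimately show ?thesis by blast
  qed
  define R where "R = (\<lambda>t. SOME R. R \<in> orth_mats d \<and>
      (\<forall>a<d. \<forall>b<d. R $$ (a,b) - (if a = b then 1 else 0) = t * (\<Sum>c<d. W $$ (a,c) * (R $$ (c,b) + (if c = b then 1 else 0)))))"
  have R: "R t \<in> orth_mats d" "\<And>a b. a < d \<Longrightarrow> b < d \<Longrightarrow> R t $$ (a,b) - (if a = b then 1 else 0) = t * (\<Sum>c<d. W $$ (a,c) * (R t $$ (c,b) + (if c = b then 1 else 0)))" for t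
    using someI_ex[OF ex[of t]] unfolding R_def by auto
  note Rc = orth_matsD(1)[OF R(1)]
  have R0: "R 0 = 1\<^sub>m d" using Rc[of 0] R(2)[of _ _ 0] by (intro eq_matI) auto
  have lim: "((\<lambda>t. R t $$ (a,b)) \<longlongrightarrow> (if a = b then 1 else 0)) (at 0)" if ab: "a < d" "b < d" for a b
  proof -
    have bnd: "\<bar>R t $$ (a,b) - (if a = b then 1 else 0)\<bar> \<le> \<bar>t\<bar> * (\<Sum>c<d. \<bar>W $$ (a,c)\<bar> * 2)" for t
    proof -
      have "\<bar>\<Sum>c<d. W $$ (a,c) * (R t $$ (c,b) + (if c = b then 1 else 0))\<bar> \<le> (\<Sum>c<d. \<bar>W $$ (a,c)\<bar> * 2)"
      proof (rule order_trans[OF sum_abs], rule sum_mono)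
        fix c assume "c \<in> {..<d}"
        hence "\<bar>R t $$ (c,b)\<bar> \<le> 1" using orth_mats_abs_le_1[OF R(1)] ab by simp
        hence "\<bar>R t $$ (c,b) + (if c = b then 1 else 0)\<bar> \<le> 2" by auto
        thus "\<bar>W $$ (a,c) * (R t $$ (c,b) + (if c = b then 1 else 0))\<bar> \<le> \<bar>W $$ (a,c)\<bar> * 2"
          unfolding abs_mult by (intro mult_left_mono) auto
      qed
      thus ?thesis unfolding R(2)[OF ab] abs_mult by (intro mult_left_mono) auto
    qed
    have "((\<lambda>t. R t $$ (a,b) - (if a = b then 1 else 0)) \<longlongrightarrow> 0) (at 0)"
      by (rule tendsto_0_le[OF tendsto_ident_at always_eventually]) (use bnd in \<open>simp only: real_norm_def\<close>, blast)
    thus ?thesis by (rule LIM_zero_cancel)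
  qed
  show ?thesis
  proof (rule that[of R])
    show "R t \<in> orth_mats d" for t by (rule R(1))
    show "R 0 = 1\<^sub>m d" by (rule R0)
    fix a b assume ab: "a < d" "b < d"
    \<comment> \<open>As \<open>R t\<close> tends to the identity, \<open>R t + 1\<close> tends to
      twice the identity; the factor \<open>1/2\<close> in \<open>W\<close> compensates for
      this.\<close>
    have "((\<lambda>t. \<Sum>c<d. W $$ (a,c) * (R t $$ (c,b) + (if c = b then 1 else 0))) \<longlongrightarrow>
        (\<Sum>c<d. W $$ (a,c) * ((if c = b then 1 else 0) + (if c = b then 1 else 0)))) (at 0)"
      using lim ab by (intro tendsto_intros) auto
    also have "(\<Sum>c<d. W $$ (a,c) * ((if c = b then 1 else 0) + (if c = b then 1 else 0))) = (\<Sum>c<d. if c = b then 2 * W $$ (a,c) else 0)"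
      by (intro sum.cong) auto
    also have "\<dots> = Om $$ (a,b)" using ab W(2)[OF ab] by simp
    finally have "((\<lambda>t. \<Sum>c<d. W $$ (a,c) * (R t $$ (c,b) + (if c = b then 1 else 0))) \<longlongrightarrow> Om $$ (a,b)) (at 0)" .
    moreover have "eventually (\<lambda>t. (\<Sum>c<d. W $$ (a,c) * (R t $$ (c,b) + (if c = b then 1 else 0))) = (R t $$ (a,b) - R 0 $$ (a,b)) / t) (at 0)"
      using ab R0 R(2)[OF ab] by (auto simp: eventually_at_filter)
    ultimately show "((\<lambda>t. R t $$ (a,b)) has_real_derivative Om $$ (a,b)) (at 0)"
      unfolding DERIV_def by (auto elim: Lim_transform_eventually)
  qed
qed

lemma orth_powerD:
  assumes "p \<in> orth_power d k"
  shows "p \<in> carrier_mat (k * d) d" "i < k \<Longrightarrow> row_block d p i \<in> orth_mats d"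
  using assms by (auto simp: orth_power_def)

lemma orth_power_vstackI:
  assumes "\<And>i. i < k \<Longrightarrow> A i \<in> orth_mats d"
  shows "vstack d k A \<in> orth_power d k"
  using assms by (auto simp: orth_power_def row_block_vstack orth_matsD(1))

section \<open>Tangent vectors in the left-invariant frame\<close>

definition skew_family :: "nat \<Rightarrow> nat \<Rightarrow> (nat \<Rightarrow> nat \<Rightarrow> nat \<Rightarrow> real) \<Rightarrow> bool" where
  "skew_family d k x \<longleftrightarrow> (\<forall>i<k. \<forall>a<d. \<forall>b<d. x i a b = - x i b a)"

text \<open>
  The left-invariant frame identifies the tangent vector \<open>[p\<^sub>i \<Omega>\<^sub>i]\<close> at \<open>p\<close> with the family \<open>\<Omega>\<^sub>i\<close>.
\<close>
definition frame_field :: "nat \<Rightarrow> nat \<Rightarrow> (nat \<Rightarrow> nat \<Rightarrow> nat \<Rightarrow> real) \<Rightarrow> real mat \<Rightarrow> real mat" where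
  "frame_field d k x p = vstack d k (\<lambda>i. row_block d p i * mat d d (\<lambda>(a,b). x i a b))"

text \<open>Block \<open>i\<close> of this is \<open>p\<^sub>i\<^sup>T Z\<^sub>i\<close>, which
  recovers the skew matrix because \<open>p\<^sub>i\<close> is orthogonal. Being polynomial in the
  entries of \<open>p\<close> and \<open>Z\<close>, it turns smooth fields into smooth
  coordinates.\<close>

definition frame_coord :: "nat \<Rightarrow> real mat \<Rightarrow> real mat \<Rightarrow> nat \<Rightarrow> nat \<Rightarrow> nat \<Rightarrow> real" where
  "frame_coord d p Z i a b = (\<Sum>c<d. p $$ (i * d + c, a) * Z $$ (i * d + c, b))"

lemma frame_field_carrier [simp]: "frame_field d k x p \<in> carrier_mat (k * d) d"
  by (simp add: frame_field_def)

lemma frame_field_dim [simp]: "dim_row (frame_field d k x p) = k * d" "dim_col (frame_field d k x p) = d"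
  by (simp_all add: frame_field_def)

lemma frame_field_index:
  assumes "p \<in> carrier_mat (k * d) d" "i < k" "a < d" "b < d"
  shows "frame_field d k x p $$ (i * d + a, b) = (\<Sum>c<d. p $$ (i * d + a, c) * x i c b)"
  using assms by (simp add: frame_field_def scalar_prod_def atLeast0LessThan) (simp add: row_block_def scalar_prod_def atLeast0LessThan)

lemma frame_field_cong:
  assumes "p \<in> carrier_mat (k * d) d" "\<And>i a b. i < k \<Longrightarrow> a < d \<Longrightarrow> b < d \<Longrightarrow> x i a b = y i a b"
  shows "frame_field d k x p = frame_field d k y p"
  using assms by (intro mat_eq_blockI[of _ k d d]) (simp_all add: frame_field_index)

lemma frame_field_linear:
  assumes "p \<in> carrier_mat (k * d) d"
  shows "u \<cdot>\<^sub>m frame_field d k x p + v \<cdot>\<^sub>m frame_field d k y p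
    = frame_field d k (\<lambda>i a b. u * x i a b + v * y i a b) p"
  using assms
  by (intro mat_eq_blockI[of _ k d d])
     (simp_all add: frame_field_index block_index_less sum.distrib sum_distrib_left distrib_left mult.left_commute)

lemma frame_field_diff:
  assumes "p \<in> carrier_mat (k * d) d"
  shows "frame_field d k x p - frame_field d k y p = frame_field d k (\<lambda>i a b. x i a b - y i a b) p"
  using assms
  by (intro mat_eq_blockI[of _ k d d])
     (simp_all add: frame_field_index block_index_less sum_subtractf right_diff_distrib minus_carrier_mat)

lemma skew_familyD:
  "skew_family d k x \<Longrightarrow> i < k \<Longrightarrow> a < d \<Longrightarrow> b < d \<Longrightarrow> x i a b = - x i b a"
  unfolding skew_family_def by blast

lemma frame_field_tangent:
  assumes x: "skew_family d k x" shows "frame_field d k x p \<in> orth_tangent d k p"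
proof -
  have "mat d d (\<lambda>(a,b). x i a b) \<in> skew_mats d" if "i < k" for i
  proof (rule skew_matsI)
    fix a b assume "a < d" "b < d"
    thus "mat d d (\<lambda>(a,b). x i a b) $$ (a,b) = - mat d d (\<lambda>(a,b). x i a b) $$ (b,a)"
      using skew_familyD[OF x that, of a b] by simp
  qed simp
  thus ?thesis unfolding orth_tangent_def frame_field_def
    by (intro CollectI exI[of _ "\<lambda>i. mat d d (\<lambda>(a,b). x i a b)"]) simp
qed

lemma frame_coord_vstack:
  assumes p: "p \<in> orth_power d k" and Om: "Om i \<in> carrier_mat d d" and i: "i < k" and ab: "a < d" "b < d"
  shows "frame_coord d p (vstack d k (\<lambda>i. row_block d p i * Om i)) i a b = Om i $$ (a,b)"
proof -
  note q = orth_matsD[OF orth_powerD(2)[OF p i]]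
  define Q where "Q = row_block d p i"
  have Q: "Q \<in> carrier_mat d d" "Q\<^sup>T * Q = 1\<^sub>m d" using q by (auto simp: Q_def)
  have "frame_coord d p (vstack d k (\<lambda>i. row_block d p i * Om i)) i a b = (\<Sum>c<d. Q $$ (c,a) * (Q * Om i) $$ (c,b))"
    unfolding frame_coord_def using i ab orth_powerD(1)[OF p]
    by (intro sum.cong refl) (simp add: Q_def del: index_mult_mat(1))
  also have "\<dots> = (Q\<^sup>T * (Q * Om i)) $$ (a,b)"
    using Q Om ab by (simp add: scalar_prod_def atLeast0LessThan)
  also have "Q\<^sup>T * (Q * Om i) = Om i"
    using assoc_mult_mat[of "Q\<^sup>T" d d Q d "Om i" d] Q Om by simp
  finally show ?thesis .
qed

lemma frame_coord_frame_field:
  assumes "p \<in> orth_power d k" "i < k" "a < d" "b < d"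
  shows "frame_coord d p (frame_field d k x p) i a b = x i a b"
  unfolding frame_field_def using assms by (subst frame_coord_vstack) auto

lemma orth_tangentD:
  assumes p: "p \<in> orth_power d k" and Z: "Z \<in> orth_tangent d k p"
  shows "skew_family d k (frame_coord d p Z)" "frame_field d k (frame_coord d p Z) p = Z"
    "Z \<in> carrier_mat (k * d) d"
proof -
  obtain Om where Om: "Z = vstack d k (\<lambda>i. row_block d p i * Om i)" "\<And>i. i < k \<Longrightarrow> Om i \<in> skew_mats d"
    using Z unfolding orth_tangent_def by auto
  have c: "frame_coord d p Z i a b = Om i $$ (a,b)" if "i < k" "a < d" "b < d" for i a b
    unfolding Om(1) using that skew_matsD(1)[OF Om(2)] by (intro frame_coord_vstack[OF p]) auto
  show "skew_family d k (frame_coord d p Z)"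
    unfolding skew_family_def using c skew_matsD(3)[OF Om(2)] by (metis)
  show "frame_field d k (frame_coord d p Z) p = Z"
    unfolding Om(1) frame_field_def
  proof (rule vstack_cong)
    fix i assume i: "i < k"
    have "mat d d (\<lambda>(a, b). frame_coord d p (vstack d k (\<lambda>i. row_block d p i * Om i)) i a b) = Om i"
      using c i skew_matsD(1)[OF Om(2)[OF i]] by (intro eq_matI) (auto simp: Om(1))
    thus "row_block d p i * mat d d (\<lambda>(a, b). frame_coord d p (vstack d k (\<lambda>i. row_block d p i * Om i)) i a b) = row_block d p i * Om i"
      by simp
  qed
  show "Z \<in> carrier_mat (k * d) d" by (simp add: Om(1))
qed

text \<open>Every block is multiplied on the right by its own Cayley curve, so all tangent vectors
  are velocities and \<open>diff_along\<close> is determined on them.\<close>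

lemma orth_power_curve:
  assumes p: "p \<in> orth_power d k" and Z: "Z \<in> orth_tangent d k p"
  shows "\<exists>c. curve_through (orth_power d k) p Z c"
proof -
  obtain Om where Om: "Z = vstack d k (\<lambda>i. row_block d p i * Om i)" "\<And>i. i < k \<Longrightarrow> Om i \<in> skew_mats d"
    using Z unfolding orth_tangent_def by auto
  have "\<exists>R. (\<forall>t. R t \<in> orth_mats d) \<and> R 0 = 1\<^sub>m d \<and>
      (\<forall>a<d. \<forall>b<d. ((\<lambda>t. R t $$ (a,b)) has_real_derivative Om i $$ (a,b)) (at 0))" if "i < k" for i
    using orth_mats_curve[OF Om(2)[OF that]] by metis
  then obtain R where R: "\<And>i t. i < k \<Longrightarrow> R i t \<in> orth_mats d" "\<And>i. i < k \<Longrightarrow> R i 0 = 1\<^sub>m d"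
    "\<And>i a b. i < k \<Longrightarrow> a < d \<Longrightarrow> b < d \<Longrightarrow> ((\<lambda>t. R i t $$ (a,b)) has_real_derivative Om i $$ (a,b)) (at 0)"
    by metis
  define c where "c = (\<lambda>t. vstack d k (\<lambda>i. row_block d p i * R i t))"
  have "c t \<in> orth_power d k" for t
    unfolding c_def using R(1) orth_powerD(2)[OF p] by (intro orth_power_vstackI orth_mats_mult)
  moreover have "c 0 = p"
  proof -
    have "c 0 = vstack d k (row_block d p)"
      unfolding c_def using R(2) orth_matsD(1)[OF orth_powerD(2)[OF p]] by (intro vstack_cong) (simp add: right_mult_one_mat[of _ d d])
    thus ?thesis using vstack_row_block[OF orth_powerD(1)[OF p]] by simp
  qed
  moreover have "((\<lambda>t. c t $$ (r,b)) has_real_derivative Z $$ (r,b)) (at 0)" if "r < k * d" "b < d" for r b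
  proof -
    define i a where "i = r div d" and "a = r mod d"
    have i: "i < k" "a < d" "r = i * d + a" using that less_mult_imp_div_less[of r k d]
      by (auto simp: i_def a_def)
    have Q: "row_block d p i \<in> carrier_mat d d" using orth_matsD(1)[OF orth_powerD(2)[OF p i(1)]] .
    have "c t $$ (r,b) = (\<Sum>e<d. row_block d p i $$ (a,e) * R i t $$ (e,b))" for t
      using i that Q orth_matsD(1)[OF R(1)[OF i(1)], of t]
      by (simp add: c_def scalar_prod_def atLeast0LessThan)
    moreover have "Z $$ (r,b) = (\<Sum>e<d. row_block d p i $$ (a,e) * Om i $$ (e,b))"
      using i that Q skew_matsD(1)[OF Om(2)[OF i(1)]]
      by (simp add: Om(1) scalar_prod_def atLeast0LessThan)
    moreover have "((\<lambda>t. \<Sum>e<d. row_block d p i $$ (a,e) * R i t $$ (e,b)) has_real_derivative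
        (\<Sum>e<d. row_block d p i $$ (a,e) * Om i $$ (e,b))) (at 0)"
      using R(3) i that by (intro DERIV_sum DERIV_cmult) auto
    ultimately show ?thesis by simp
  qed
  ultimately show ?thesis unfolding curve_through_def Om(1) by auto
qed

lemma curve_rich_orth_power: "curve_rich (k * d) d (orth_power d k) (orth_tangent d k)"
proof
  show "orth_power d k \<subseteq> carrier_mat (k * d) d" by (auto simp: orth_power_def)
  show "orth_tangent d k p \<subseteq> carrier_mat (k * d) d" for p by (auto simp: orth_tangent_def)
qed (use orth_power_curve in auto)

lemma smooth_on_frame_coord:
  assumes "\<And>r b. r < k * d \<Longrightarrow> b < d \<Longrightarrow> smooth_on (k * d) d M (\<lambda>p. Y p $$ (r,b))" "i < k" "a < d" "b < d"
  shows "smooth_on (k * d) d M (\<lambda>p. frame_coord d p (Y p) i a b)"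
  unfolding frame_coord_def using assms
  by (intro smooth_on_sum smooth_on_mult smooth_on_index assms(1)) (auto simp: block_index_less)

lemma smooth_on_frame_field:
  assumes M: "M \<subseteq> carrier_mat (k * d) d"
    and x: "\<And>i a b. i < k \<Longrightarrow> a < d \<Longrightarrow> b < d \<Longrightarrow> smooth_on (k * d) d M (\<lambda>p. x p i a b)"
    and rb: "r < k * d" "b < d"
  shows "smooth_on (k * d) d M (\<lambda>p. frame_field d k (x p) p $$ (r,b))"
proof -
  define i a where "i = r div d" and "a = r mod d"
  have i: "i < k" "a < d" "r = i * d + a" using rb less_mult_imp_div_less[of r k d]
    by (auto simp: i_def a_def)
  have "smooth_on (k * d) d M (\<lambda>p. \<Sum>c<d. p $$ (i * d + a, c) * x p i c b)"
    using x i rb by (intro smooth_on_sum smooth_on_mult smooth_on_index) auto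
  moreover have "frame_field d k (x p) p $$ (r,b) = (\<Sum>c<d. p $$ (i * d + a, c) * x p i c b)" if "p \<in> M" for p
    unfolding i(3) using that M i rb by (intro frame_field_index) auto
  ultimately show ?thesis by (subst smooth_on_cong) auto
qed

definition fam_inner :: "nat \<Rightarrow> (nat \<Rightarrow> nat \<Rightarrow> real) \<Rightarrow> (nat \<Rightarrow> nat \<Rightarrow> real) \<Rightarrow> real" where
  "fam_inner d A B = (\<Sum>a<d. \<Sum>b<d. A a b * B a b)"

definition fam_sum :: "nat \<Rightarrow> (nat \<Rightarrow> nat \<Rightarrow> nat \<Rightarrow> real) \<Rightarrow> nat \<Rightarrow> nat \<Rightarrow> real" where
  "fam_sum k x a b = (\<Sum>i<k. x i a b)"

text \<open>
  The horizontal lift of the family \<open>\<Xi>\<close> is conjugate to \<open>-\<sigma>/m, \<Xi>\<^sub>1 - \<sigma>/m, \<dots>\<close> with \<open>\<sigma> = \<Sum>\<^sub>i \<Xi>\<^sub>i\<close>, which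
  gives this expression for the quotient metric.
\<close>
definition frame_metric :: "nat \<Rightarrow> nat \<Rightarrow> (nat \<Rightarrow> nat \<Rightarrow> nat \<Rightarrow> real) \<Rightarrow> (nat \<Rightarrow> nat \<Rightarrow> nat \<Rightarrow> real) \<Rightarrow> real" where
  "frame_metric d k x y = (\<Sum>i<k. fam_inner d (x i) (y i)) - fam_inner d (fam_sum k x) (fam_sum k y) / real (Suc k)"

section \<open>The quotient metric\<close>

lemma sum_rotate:
  "(\<Sum>i\<in>I. \<Sum>a<n. \<Sum>b<c. f i a b) = (\<Sum>a<n. \<Sum>b<c. \<Sum>i\<in>I. f i a b)"
  by (rule trans[OF sum.swap]) (intro sum.cong refl sum.swap)

lemma frob_inner_double:
  assumes "G \<in> carrier_mat n c" "H \<in> carrier_mat n c"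
  shows "frob_inner G H = (\<Sum>i<n. \<Sum>j<c. G $$ (i,j) * H $$ (i,j))"
  using frob_inner_eq[OF assms] by (simp add: sum.cartesian_product case_prod_beta)

lemma frob_inner_transpose:
  assumes "A \<in> carrier_mat n c" "B \<in> carrier_mat n c"
  shows "frob_inner (A\<^sup>T) (B\<^sup>T) = frob_inner A B"
proof -
  have "frob_inner (A\<^sup>T) (B\<^sup>T) = (\<Sum>i<c. \<Sum>j<n. A $$ (j,i) * B $$ (j,i))"
    using assms by (subst frob_inner_eq[of _ c n]) (auto simp: sum.cartesian_product case_prod_beta intro!: sum.cong)
  also have "\<dots> = (\<Sum>j<n. \<Sum>i<c. A $$ (j,i) * B $$ (j,i))" by (rule sum.swap)
  finally show ?thesis using assms by (simp add: frob_inner_eq sum.cartesian_product case_prod_beta)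
qed

lemma frob_inner_orth_left:
  assumes Q: "Q \<in> orth_mats d" and A: "A \<in> carrier_mat d c" and B: "B \<in> carrier_mat d c"
  shows "frob_inner (Q * A) (Q * B) = frob_inner A B"
proof -
  note q = orth_matsD[OF Q]
  have QB: "Q * B \<in> carrier_mat d c" using q B by simp
  have "(Q * A)\<^sup>T * (Q * B) = A\<^sup>T * (Q\<^sup>T * (Q * B))"
    using transpose_mult[OF q(1) A] assoc_mult_mat[of "A\<^sup>T" c d "Q\<^sup>T" d "Q * B" c] q(1) A QB by simp
  also have "Q\<^sup>T * (Q * B) = B"
    using assoc_mult_mat[of "Q\<^sup>T" d d Q d B c] q B by simp
  finally show ?thesis unfolding frob_inner_def by simp
qed

lemma frob_inner_orth_right:
  assumes Q: "Q \<in> orth_mats d" and A: "A \<in> carrier_mat c d" and B: "B \<in> carrier_mat c d"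
  shows "frob_inner (A * Q) (B * Q) = frob_inner A B"
proof -
  note q = orth_matsD(1)[OF Q]
  have "frob_inner (A * Q) (B * Q) = frob_inner ((A * Q)\<^sup>T) ((B * Q)\<^sup>T)"
    using q A B frob_inner_transpose[of "A * Q" c d "B * Q"] by simp
  also have "\<dots> = frob_inner (Q\<^sup>T * A\<^sup>T) (Q\<^sup>T * B\<^sup>T)"
    by (simp add: transpose_mult[OF A q] transpose_mult[OF B q])
  also have "\<dots> = frob_inner A B"
    using frob_inner_orth_left[OF orth_mats_transpose[OF Q], of "A\<^sup>T" c "B\<^sup>T"] A B
      frob_inner_transpose[OF A B] by simp
  finally show ?thesis .
qed

lemma conj_index:
  fixes Q T :: "real mat"
  assumes "Q \<in> carrier_mat d d" "T \<in> carrier_mat d d" "a < d" "b < d"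
  shows "(Q\<^sup>T * T * Q) $$ (a,b) = (\<Sum>c<d. \<Sum>e<d. Q $$ (c,a) * T $$ (c,e) * Q $$ (e,b))"
  using assms by (auto simp: scalar_prod_def atLeast0LessThan sum_distrib_left mult.assoc)

lemma skew_mats_conj:
  assumes Q: "Q \<in> carrier_mat d d" and T: "T \<in> skew_mats d"
  shows "Q\<^sup>T * T * Q \<in> skew_mats d"
proof (rule skew_matsI)
  note t = skew_matsD[OF T]
  show "Q\<^sup>T * T * Q \<in> carrier_mat d d" using Q t by (auto intro!: mult_carrier_mat[of _ d d _ d])
  fix a b assume ab: "a < d" "b < d"
  have "(\<Sum>c<d. \<Sum>e<d. Q $$ (c,a) * T $$ (c,e) * Q $$ (e,b)) = (\<Sum>e<d. \<Sum>c<d. Q $$ (c,a) * T $$ (c,e) * Q $$ (e,b))"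
    by (rule sum.swap)
  also have "\<dots> = (\<Sum>e<d. \<Sum>c<d. - (Q $$ (e,b) * T $$ (e,c) * Q $$ (c,a)))"
  proof (intro sum.cong refl)
    fix e c assume "e \<in> {..<d}" "c \<in> {..<d}"
    thus "Q $$ (c,a) * T $$ (c,e) * Q $$ (e,b) = - (Q $$ (e,b) * T $$ (e,c) * Q $$ (c,a))"
      using t(3)[of c e] by simp
  qed
  finally show "(Q\<^sup>T * T * Q) $$ (a,b) = - (Q\<^sup>T * T * Q) $$ (b,a)"
    unfolding conj_index[OF Q t(1) ab] conj_index[OF Q t(1) ab(2,1)] by (simp add: sum_negf)
qed

lemma quot_proj_carrier [simp]: "quot_proj d (Suc k) S \<in> carrier_mat (k * d) d"
  by (simp add: quot_proj_def)

lemma quot_proj_index: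
  assumes "S \<in> carrier_mat (Suc k * d) d" "i < k" "a < d" "b < d"
  shows "quot_proj d (Suc k) S $$ (i * d + a, b) = (\<Sum>c<d. S $$ (Suc i * d + a, c) * S $$ (b, c))"
proof -
  have "quot_proj d (Suc k) S $$ (i * d + a, b) = (row_block d S (Suc i) * (row_block d S 0)\<^sup>T) $$ (a,b)"
    unfolding quot_proj_def using assms by (subst vstack_index) auto
  also have "\<dots> = (\<Sum>c<d. row_block d S (Suc i) $$ (a,c) * row_block d S 0 $$ (b,c))"
    using assms row_block_carrier[OF assms(1)] by (simp add: scalar_prod_def atLeast0LessThan row_block_def)
  also have "\<dots> = (\<Sum>c<d. S $$ (Suc i * d + a, c) * S $$ (b, c))"
    using assms by (intro sum.cong) auto
  finally show ?thesis .
qed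

lemma mult_transpose_index:
  assumes "X \<in> carrier_mat n m" "Y \<in> carrier_mat l m" "a < n" "b < l"
  shows "(X * Y\<^sup>T) $$ (a,b) = (\<Sum>c<m. X $$ (a,c) * Y $$ (b,c))"
  using assms by (simp add: scalar_prod_def atLeast0LessThan)

text \<open>The product rule for \<open>A B\<^sup>T\<close> with velocities \<open>A U\<close> and
  \<open>B V\<close> gives \<open>A U B\<^sup>T + A V\<^sup>T B\<^sup>T\<close>, and skewness of
  \<open>V\<close> turns this into \<open>A (U - V) B\<^sup>T\<close>. Only differences from the
  first member of the family are visible downstairs.\<close>

lemma mat_diff_along_quot_proj:
  assumes S: "S \<in> orth_power d (Suc k)" and Om: "\<And>i. i < Suc k \<Longrightarrow> Om i \<in> skew_mats d"
  shows "mat_diff_along (orth_power d (Suc k)) (quot_proj d (Suc k)) S (vstack d (Suc k) (\<lambda>i. row_block d S i * Om i))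
    = vstack d k (\<lambda>i. row_block d S (Suc i) * (Om (Suc i) - Om 0) * (row_block d S 0)\<^sup>T)" (is "?l = ?r")
proof (rule mat_eq_blockI[of _ k d d])
  interpret curve_rich "Suc k * d" d "orth_power d (Suc k)" "orth_tangent d (Suc k)"
    by (rule curve_rich_orth_power)
  define Z where "Z = vstack d (Suc k) (\<lambda>i. row_block d S i * Om i)"
  have Z: "Z \<in> orth_tangent d (Suc k) S" unfolding Z_def orth_tangent_def using Om by blast
  have qc: "quot_proj d (Suc k) S \<in> carrier_mat (k * d) d" by simp
  show "?l \<in> carrier_mat (k * d) d" using carrier_matD[OF qc] by (simp add: mat_diff_along_def)
  fix i a b assume i: "i < k" and a: "a < d" and b: "b < d"
  define A B U V where "A = row_block d S (Suc i)" and "B = row_block d S 0" and "U = Om (Suc i)" and "V = Om 0"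
  have c: "A \<in> carrier_mat d d" "B \<in> carrier_mat d d" "U \<in> carrier_mat d d" "V \<in> carrier_mat d d"
    using orth_matsD(1)[OF orth_powerD(2)[OF S]] skew_matsD(1)[OF Om] i by (auto simp: A_def B_def U_def V_def)
  have VT: "V\<^sup>T = - V" using skew_matsD(2)[OF Om] by (simp add: V_def)
  have Sc: "S \<in> carrier_mat (Suc k * d) d" using orth_powerD(1)[OF S] .
  have ib: "Suc i * d + a < Suc k * d" "b < Suc k * d" 
    using block_index_less[of "Suc i" "Suc k" a d] block_index_less[of 0 "Suc k" b d] i a b by auto
  have "?l $$ (i * d + a, b) = diff_along (orth_power d (Suc k)) (\<lambda>q. quot_proj d (Suc k) q $$ (i * d + a, b)) S Z"
    using carrier_matD[OF qc] block_index_less[OF i a] b by (simp add: mat_diff_along_def Z_def)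
  also have "\<dots> = diff_along (orth_power d (Suc k)) (\<lambda>q. \<Sum>c<d. q $$ (Suc i * d + a, c) * q $$ (b, c)) S Z"
    by (rule diff_along_cong) (rule quot_proj_index[OF orth_powerD(1) i a b])
  also have "\<dots> = (\<Sum>c<d. Z $$ (Suc i * d + a, c) * S $$ (b, c) + S $$ (Suc i * d + a, c) * Z $$ (b, c))"
  proof -
    note sm = smooth_on_index[of _ "Suc k * d" _ d "orth_power d (Suc k)"]
    have "diff_along (orth_power d (Suc k)) (\<lambda>q. q $$ (Suc i * d + a, c) * q $$ (b, c)) S Z
        = Z $$ (Suc i * d + a, c) * S $$ (b, c) + S $$ (Suc i * d + a, c) * Z $$ (b, c)" if "c < d" for c
      unfolding diff_along_mult[OF sm[OF ib(1) that] sm[OF ib(2) that] S Z] diff_along_index[OF S Z ib(1) that]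
        diff_along_index[OF S Z ib(2) that] ..
    moreover have "diff_along (orth_power d (Suc k)) (\<lambda>q. \<Sum>c<d. q $$ (Suc i * d + a, c) * q $$ (b, c)) S Z
        = (\<Sum>c<d. diff_along (orth_power d (Suc k)) (\<lambda>q. q $$ (Suc i * d + a, c) * q $$ (b, c)) S Z)"
      by (rule diff_along_sum[OF smooth_on_mult[OF sm[OF ib(1)] sm[OF ib(2)]] S Z]) simp_all
    ultimately show ?thesis by simp
  qed
  also have "\<dots> = (\<Sum>c<d. (A * U) $$ (a,c) * B $$ (b,c) + A $$ (a,c) * (B * V) $$ (b,c))"
  proof (intro sum.cong refl)
    fix c assume "c \<in> {..<d}"
    hence cd: "c < d" by simp
    have "Z $$ (Suc i * d + a, c) = (A * U) $$ (a,c)"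
      unfolding Z_def A_def U_def using i a cd by (subst vstack_index) auto
    moreover have "Z $$ (b, c) = (B * V) $$ (b,c)"
      using vstack_index[of 0 "Suc k" b d c] b cd by (simp add: Z_def B_def V_def)
    moreover have "S $$ (Suc i * d + a, c) = A $$ (a,c)" "S $$ (b,c) = B $$ (b,c)"
      using a b cd Sc by (auto simp: A_def B_def)
    ultimately show "Z $$ (Suc i * d + a, c) * S $$ (b, c) + S $$ (Suc i * d + a, c) * Z $$ (b, c)
      = (A * U) $$ (a,c) * B $$ (b,c) + A $$ (a,c) * (B * V) $$ (b,c)" by simp
  qed
  also have "\<dots> = (A * U * B\<^sup>T + A * (B * V)\<^sup>T) $$ (a,b)"
  proof -
    have AU: "A * U \<in> carrier_mat d d" and BV: "B * V \<in> carrier_mat d d" using c by auto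
    have "(A * U * B\<^sup>T) $$ (a,b) = (\<Sum>c<d. (A * U) $$ (a,c) * B $$ (b,c))"
      by (rule mult_transpose_index[OF AU c(2) a b])
    moreover have "(A * (B * V)\<^sup>T) $$ (a,b) = (\<Sum>c<d. A $$ (a,c) * (B * V) $$ (b,c))"
      by (rule mult_transpose_index[OF c(1) BV a b])
    moreover have "A * (B * V)\<^sup>T \<in> carrier_mat d d" using c(1) BV by auto
    ultimately show ?thesis using a b carrier_matD[of "A * (B * V)\<^sup>T" d d] by (simp add: sum.distrib del: index_mult_mat)
  qed
  also have "A * U * B\<^sup>T + A * (B * V)\<^sup>T = A * (U - V) * B\<^sup>T"
  proof -
    have "A * (B * V)\<^sup>T = - (A * V * B\<^sup>T)"
      unfolding transpose_mult[OF c(2,4)] VT using c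
      by (simp add: assoc_mult_mat[of _ d d _ d _ d] mult_carrier_mat[of _ d d _ d])
    moreover have "A * (U - V) * B\<^sup>T = A * U * B\<^sup>T - A * V * B\<^sup>T"
      using c by (simp add: mult_minus_distrib_mat[of _ d d _ d] minus_mult_distrib_mat[of _ d d _ _ d] mult_carrier_mat[of _ d d _ d])
    moreover have "A * U * B\<^sup>T \<in> carrier_mat d d" "A * V * B\<^sup>T \<in> carrier_mat d d"
      using c by (auto intro!: mult_carrier_mat[of _ d d _ d])
    ultimately show ?thesis by (simp add: add_uminus_minus_mat)
  qed
  finally show "?l $$ (i * d + a, b) = ?r $$ (i * d + a, b)"
    using i a b by (simp add: A_def B_def U_def V_def del: index_mult_mat)
qed simp

lemma quot_proj_surj:
  assumes "p \<in> orth_power d k"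
  shows "\<exists>S. S \<in> orth_power d (Suc k) \<and> quot_proj d (Suc k) S = p"
proof -
  define A where "A = (\<lambda>i. case i of 0 \<Rightarrow> 1\<^sub>m d | Suc i \<Rightarrow> row_block d p i)"
  have A: "A i \<in> orth_mats d" if "i < Suc k" for i
    using that orth_powerD(2)[OF assms] orth_mats_one by (auto simp: A_def split: nat.splits)
  have "quot_proj d (Suc k) (vstack d (Suc k) A) = vstack d k (row_block d p)"
    unfolding quot_proj_def
  proof (simp, rule vstack_cong)
    fix i assume i: "i < k"
    have "row_block d (vstack d (Suc k) A) (Suc i) = A (Suc i)" "row_block d (vstack d (Suc k) A) 0 = A 0"
      using i by (auto intro!: row_block_vstack orth_matsD(1)[OF A])
    hence "row_block d (vstack d (Suc k) A) (Suc i) = row_block d p i" "row_block d (vstack d (Suc k) A) 0 = 1\<^sub>m d"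
      by (simp_all add: A_def)
    thus "row_block d (vstack d (Suc k) A) (Suc i) * (row_block d (vstack d (Suc k) A) 0)\<^sup>T = row_block d p i"
      using orth_matsD(1)[OF orth_powerD(2)[OF assms i]] by (simp add: right_mult_one_mat[of _ d d])
  qed
  also have "\<dots> = p" using vstack_row_block orth_powerD(1)[OF assms] by blast
  finally show ?thesis using orth_power_vstackI[of "Suc k" A d] A by blast
qed

section \<open>Horizontal lifts at a fixed point of the fibre\<close>

context
  fixes d k :: nat and S p :: "real mat"
  assumes S: "S \<in> orth_power d (Suc k)" and Sp: "quot_proj d (Suc k) S = p"
begin

text \<open>The family \<open>0, \<Xi>\<^sub>1, \<dots>, \<Xi>\<^sub>k\<close> minus its mean over
  the \<open>k + 1\<close> views: the sum becomes zero, as horizontality demands, while the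
  differences from the first member remain the \<Xi>'s.\<close>

definition lift_conj :: "(nat \<Rightarrow> nat \<Rightarrow> nat \<Rightarrow> real) \<Rightarrow> nat \<Rightarrow> real mat" where
  "lift_conj x i = mat d d (\<lambda>(a,b). (case i of 0 \<Rightarrow> 0 | Suc j \<Rightarrow> x j a b) - fam_sum k x a b / real (Suc k))"

text \<open>The blocks below are
  \<open>p\<^sub>i = S\<^sub>i\<^sub>+\<^sub>1 S\<^sub>0\<^sup>T\<close>, so conjugation by
  \<open>S\<^sub>0\<close> carries a family from the frame at \<open>p\<close> to the frame at
  \<open>S\<close>.\<close>

definition lift_family :: "(nat \<Rightarrow> nat \<Rightarrow> nat \<Rightarrow> real) \<Rightarrow> nat \<Rightarrow> real mat" where
  "lift_family x i = (row_block d S 0)\<^sup>T * lift_conj x i * row_block d S 0"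

lemma S0: "row_block d S 0 \<in> orth_mats d"
  using orth_powerD(2)[OF S, of 0] by simp

lemma lift_conj_carrier [simp]: "lift_conj x i \<in> carrier_mat d d"
  by (simp add: lift_conj_def)

lemma lift_family_carrier [simp]: "lift_family x i \<in> carrier_mat d d"
  unfolding lift_family_def using orth_matsD(1)[OF S0] by (intro mult_carrier_mat[of _ d d]) auto

lemma lift_family_skew:
  assumes x: "skew_family d k x" and i: "i < Suc k"
  shows "lift_family x i \<in> skew_mats d"
  unfolding lift_family_def
proof (rule skew_mats_conj[OF orth_matsD(1)[OF S0]], rule skew_matsI)
  fix a b assume ab: "a < d" "b < d"
  have "fam_sum k x a b = - fam_sum k x b a"
    unfolding fam_sum_def sum_negf[symmetric] using skew_familyD[OF x _ ab] by (intro sum.cong) auto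
  moreover have "(case i of 0 \<Rightarrow> 0 | Suc j \<Rightarrow> x j a b) = - (case i of 0 \<Rightarrow> 0 | Suc j \<Rightarrow> x j b a)"
    using i skew_familyD[OF x _ ab] by (auto split: nat.splits)
  ultimately show "lift_conj x i $$ (a,b) = - lift_conj x i $$ (b,a)"
    using ab by (simp add: lift_conj_def)
qed simp

lemma lift_family_sum: "mat_sum d d (lift_family x) {..<Suc k} = 0\<^sub>m d d"
proof (rule eq_matI)
  fix a b assume "a < dim_row (0\<^sub>m d d :: real mat)" "b < dim_col (0\<^sub>m d d :: real mat)"
  hence ab: "a < d" "b < d" by auto
  define Q where "Q = row_block d S 0"
  have Q: "Q \<in> carrier_mat d d" using orth_matsD(1)[OF S0] by (simp add: Q_def)
  have z: "(\<Sum>i<Suc k. lift_conj x i $$ (c,e)) = 0" if "c < d" "e < d" for c e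
  proof -
    define s r where "s = fam_sum k x c e" and "r = real (Suc k)"
    have "(\<Sum>i<Suc k. lift_conj x i $$ (c,e)) = s - s / r - real k * (s / r)"
      using that by (subst sum.lessThan_Suc_shift) (simp add: lift_conj_def sum_subtractf s_def r_def, simp add: fam_sum_def)
    moreover have "r \<noteq> 0" "real k = r - 1" by (auto simp: r_def)
    ultimately show ?thesis by (simp add: field_simps)
  qed
  have "mat_sum d d (lift_family x) {..<Suc k} $$ (a,b) = (\<Sum>i<Suc k. (\<Sum>c<d. \<Sum>e<d. Q $$ (c,a) * lift_conj x i $$ (c,e) * Q $$ (e,b)))"
    using ab by (simp only: mat_sum_index lift_family_def conj_index[OF Q lift_conj_carrier ab] flip: Q_def)
  also have "\<dots> = (\<Sum>c<d. \<Sum>i<Suc k. \<Sum>e<d. Q $$ (c,a) * lift_conj x i $$ (c,e) * Q $$ (e,b))" by (rule sum.swap)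
  also have "\<dots> = (\<Sum>c<d. \<Sum>e<d. \<Sum>i<Suc k. Q $$ (c,a) * lift_conj x i $$ (c,e) * Q $$ (e,b))" by (intro sum.cong refl sum.swap)
  also have "\<dots> = (\<Sum>c<d. \<Sum>e<d. Q $$ (c,a) * (\<Sum>i<Suc k. lift_conj x i $$ (c,e)) * Q $$ (e,b))"
    by (simp only: sum_distrib_left sum_distrib_right)
  also have "\<dots> = 0" using z by simp
  finally show "mat_sum d d (lift_family x) {..<Suc k} $$ (a,b) = 0\<^sub>m d d $$ (a,b)" using ab by simp
qed (simp_all add: mat_sum_def)

lemma lift_family_proj:
  assumes i: "i < k"
  shows "row_block d S (Suc i) * (lift_family x (Suc i) - lift_family x 0) * (row_block d S 0)\<^sup>T
    = row_block d p i * mat d d (\<lambda>(a,b). x i a b)"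
proof -
  define Q A X where "Q = row_block d S 0" and "A = row_block d S (Suc i)" and "X = mat d d (\<lambda>(a,b). x i a b)"
  have Q: "Q \<in> carrier_mat d d" "Q\<^sup>T * Q = 1\<^sub>m d" "Q * Q\<^sup>T = 1\<^sub>m d" using orth_matsD[OF S0] by (auto simp: Q_def)
  have A: "A \<in> carrier_mat d d" using orth_matsD(1)[OF orth_powerD(2)[OF S]] i by (simp add: A_def)
  have X: "X \<in> carrier_mat d d" by (simp add: X_def)
  have p: "row_block d p i = A * Q\<^sup>T"
    using i A Q by (simp add: Sp[symmetric] quot_proj_def row_block_vstack A_def Q_def)
  note as = assoc_mult_mat[of _ d d _ d _ d] mult_carrier_mat[of _ d d _ d]
  have "lift_family x (Suc i) - lift_family x 0 = Q\<^sup>T * (lift_conj x (Suc i) - lift_conj x 0) * Q"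
    unfolding lift_family_def Q_def[symmetric] using Q(1)
    by (simp add: mult_minus_distrib_mat[of _ d d _ d] minus_mult_distrib_mat[of _ d d _ _ d] mult_carrier_mat[of _ d d _ d])
  also have "lift_conj x (Suc i) - lift_conj x 0 = X"
    by (intro eq_matI) (auto simp: lift_conj_def X_def)
  finally have "A * (lift_family x (Suc i) - lift_family x 0) * Q\<^sup>T = A * (Q\<^sup>T * X * Q) * Q\<^sup>T" by simp
  also have "\<dots> = A * Q\<^sup>T * X * (Q * Q\<^sup>T)" using A Q(1) X by (simp add: as)
  also have "\<dots> = A * Q\<^sup>T * X" using A Q X by (simp add: right_mult_one_mat[of _ d d] as(2))
  finally show ?thesis by (simp add: p A_def Q_def X_def)
qed

lemma lift_proj:
  assumes x: "skew_family d k x"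
  shows "mat_diff_along (orth_power d (Suc k)) (quot_proj d (Suc k)) S (vstack d (Suc k) (\<lambda>i. row_block d S i * lift_family x i))
    = vstack d k (\<lambda>i. row_block d S (Suc i) * (lift_family x (Suc i) - lift_family x 0) * (row_block d S 0)\<^sup>T)"
  by (rule mat_diff_along_quot_proj[OF S]) (rule lift_family_skew[OF x])

text \<open>For uniqueness, the projection determines the differences of the family from its first
  member, and the vanishing sum then determines that member itself.\<close>

lemma horizontal_lift_eq:
  assumes x: "skew_family d k x"
  shows "horizontal_lift d (Suc k) S (frame_field d k x p) = vstack d (Suc k) (\<lambda>i. row_block d S i * lift_family x i)"
    (is "_ = ?Z")
  unfolding horizontal_lift_def
proof (rule the_equality, intro conjI)
  show "?Z \<in> horizontal_space d (Suc k) S"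
    unfolding horizontal_space_def using lift_family_skew[OF x] lift_family_sum by blast
  show proj: "mat_diff_along (orth_power d (Suc k)) (quot_proj d (Suc k)) S ?Z = frame_field d k x p"
    unfolding lift_proj[OF x] frame_field_def
    by (rule vstack_cong) (rule lift_family_proj)
  fix Z assume Z: "Z \<in> horizontal_space d (Suc k) S \<and>
      mat_diff_along (orth_power d (Suc k)) (quot_proj d (Suc k)) S Z = frame_field d k x p"
  then obtain Om where Om: "Z = vstack d (Suc k) (\<lambda>i. row_block d S i * Om i)"
    "\<And>i. i < Suc k \<Longrightarrow> Om i \<in> skew_mats d" "mat_sum d d Om {..<Suc k} = 0\<^sub>m d d"
    unfolding horizontal_space_def by blast
  have Zproj: "mat_diff_along (orth_power d (Suc k)) (quot_proj d (Suc k)) S Z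
      = vstack d k (\<lambda>i. row_block d S (Suc i) * (Om (Suc i) - Om 0) * (row_block d S 0)\<^sup>T)"
    unfolding Om(1) by (rule mat_diff_along_quot_proj[OF S]) (rule Om(2))
  have eq: "Om (Suc i) - Om 0 = lift_family x (Suc i) - lift_family x 0" if i: "i < k" for i
  proof -
    define Q A where "Q = row_block d S 0" and "A = row_block d S (Suc i)"
    have Q: "Q \<in> carrier_mat d d" "Q\<^sup>T * Q = 1\<^sub>m d" using orth_matsD[OF S0] by (auto simp: Q_def)
    have A: "A \<in> carrier_mat d d" "A\<^sup>T * A = 1\<^sub>m d" using orth_matsD[OF orth_powerD(2)[OF S]] i by (auto simp: A_def)
    have "vstack d k (\<lambda>i. row_block d S (Suc i) * (Om (Suc i) - Om 0) * (row_block d S 0)\<^sup>T)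
        = vstack d k (\<lambda>i. row_block d S (Suc i) * (lift_family x (Suc i) - lift_family x 0) * (row_block d S 0)\<^sup>T)"
      using Z proj unfolding Zproj lift_proj[OF x] by simp
    hence e: "row_block d (vstack d k (\<lambda>i. row_block d S (Suc i) * (Om (Suc i) - Om 0) * (row_block d S 0)\<^sup>T)) i
        = row_block d (vstack d k (\<lambda>i. row_block d S (Suc i) * (lift_family x (Suc i) - lift_family x 0) * (row_block d S 0)\<^sup>T)) i"
      by simp
    have c: "Om (Suc i) - Om 0 \<in> carrier_mat d d" "lift_family x (Suc i) - lift_family x 0 \<in> carrier_mat d d"
      using skew_matsD(1)[OF Om(2)] i by (auto intro!: minus_carrier_mat)
    have "A * (Om (Suc i) - Om 0) * Q\<^sup>T = A * (lift_family x (Suc i) - lift_family x 0) * Q\<^sup>T"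
      using e i A(1) Q(1) c by (simp add: row_block_vstack mult_carrier_mat[of _ d d _ d] flip: A_def Q_def)
    hence "A\<^sup>T * (A * (Om (Suc i) - Om 0) * Q\<^sup>T) * Q = A\<^sup>T * (A * (lift_family x (Suc i) - lift_family x 0) * Q\<^sup>T) * Q" by simp
    moreover have "A\<^sup>T * (A * M * Q\<^sup>T) * Q = M" if M: "M \<in> carrier_mat d d" for M
    proof -
      have "A\<^sup>T * (A * M * Q\<^sup>T) * Q = (A\<^sup>T * A) * M * (Q\<^sup>T * Q)"
        using A(1) Q(1) M by (simp add: assoc_mult_mat[of _ d d _ d _ d] mult_carrier_mat[of _ d d _ d])
      thus ?thesis using A Q M by (simp add: right_mult_one_mat[of _ d d])
    qed
    ultimately show ?thesis using c by simp
  qed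
  have eq': "Om (Suc i) $$ (a,b) - Om 0 $$ (a,b) = lift_family x (Suc i) $$ (a,b) - lift_family x 0 $$ (a,b)"
    if "i < k" "a < d" "b < d" for i a b
    using arg_cong[OF eq[OF that(1)], of "\<lambda>M. M $$ (a,b)"] that skew_matsD(1)[OF Om(2), of 0] lift_family_carrier[of x 0]
    by (auto simp del: lift_family_carrier)
  have O0: "Om 0 $$ (a,b) = lift_family x 0 $$ (a,b)" if ab: "a < d" "b < d" for a b
  proof -
    have s: "(\<Sum>i<Suc k. F i $$ (a,b)) = 0" if "mat_sum d d F {..<Suc k} = 0\<^sub>m d d" for F
      using arg_cong[OF that, of "\<lambda>M. M $$ (a,b)"] ab by simp
    have "(\<Sum>i<Suc k. Om i $$ (a,b)) - (\<Sum>i<Suc k. lift_family x i $$ (a,b)) = 0"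
      using s[OF Om(3)] s[OF lift_family_sum] by simp
    also have "(\<Sum>i<Suc k. Om i $$ (a,b)) - (\<Sum>i<Suc k. lift_family x i $$ (a,b))
        = (\<Sum>i<Suc k. Om i $$ (a,b) - lift_family x i $$ (a,b))" by (simp only: sum_subtractf)
    also have "\<dots> = (\<Sum>i<Suc k. Om 0 $$ (a,b) - lift_family x 0 $$ (a,b))"
    proof (intro sum.cong refl)
      fix i assume "i \<in> {..<Suc k}"
      thus "Om i $$ (a,b) - lift_family x i $$ (a,b) = Om 0 $$ (a,b) - lift_family x 0 $$ (a,b)"
        using eq'[OF _ ab, of "i - 1"] by (cases i) auto
    qed
    finally show ?thesis by simp
  qed
  show "Z = ?Z" unfolding Om(1)
  proof (rule vstack_cong)
    fix i assume i: "i < Suc k"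
    have "Om i = lift_family x i"
    proof (rule eq_matI)
      fix a b assume "a < dim_row (lift_family x i)" "b < dim_col (lift_family x i)"
      hence ab: "a < d" "b < d" using carrier_matD[OF lift_family_carrier[of x i]] by auto
      thus "Om i $$ (a,b) = lift_family x i $$ (a,b)" using O0[OF ab] eq'[OF _ ab, of "i - 1"] i by (cases i) auto
    qed (use skew_matsD(1)[OF Om(2)[OF i]] carrier_matD[OF lift_family_carrier[of x i]] in auto)
    thus "row_block d S i * Om i = row_block d S i * lift_family x i" by simp
  qed
qed

text \<open>The orthogonal factors drop out of the Frobenius product. What remains is the covariance
  identity for \<open>k + 1\<close> values one of which is zero: the sum of centred products is the
  sum of products minus the product of the totals over \<open>k + 1\<close>.\<close>

lemma frob_inner_horizontal_lift:
  assumes x: "skew_family d k x" and y: "skew_family d k y"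
  shows "frob_inner (horizontal_lift d (Suc k) S (frame_field d k x p)) (horizontal_lift d (Suc k) S (frame_field d k y p))
    = frame_metric d k x y"
proof -
  have "frob_inner (horizontal_lift d (Suc k) S (frame_field d k x p)) (horizontal_lift d (Suc k) S (frame_field d k y p))
      = (\<Sum>i<Suc k. frob_inner (row_block d S i * lift_family x i) (row_block d S i * lift_family y i))"
    unfolding horizontal_lift_eq[OF x] horizontal_lift_eq[OF y]
    using orth_matsD(1)[OF orth_powerD(2)[OF S]]
    by (intro frob_inner_vstack mult_carrier_mat[OF _ lift_family_carrier]) auto
  also have "\<dots> = (\<Sum>i<Suc k. frob_inner (lift_conj x i) (lift_conj y i))"
  proof (intro sum.cong refl)
    fix i assume "i \<in> {..<Suc k}"
    hence "frob_inner (row_block d S i * lift_family x i) (row_block d S i * lift_family y i)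
        = frob_inner (lift_family x i) (lift_family y i)"
      using frob_inner_orth_left[OF orth_powerD(2)[OF S] lift_family_carrier lift_family_carrier] by simp
    also have "\<dots> = frob_inner (lift_conj x i) (lift_conj y i)"
    proof -
      have c: "(row_block d S 0)\<^sup>T * lift_conj z i \<in> carrier_mat d d" for z
        using orth_matsD(1)[OF S0] by (intro mult_carrier_mat[of _ d d]) auto
      show ?thesis
        unfolding lift_family_def frob_inner_orth_right[OF S0 c c]
        by (rule frob_inner_orth_left[OF orth_mats_transpose[OF S0] lift_conj_carrier lift_conj_carrier])
    qed
    finally show "frob_inner (row_block d S i * lift_family x i) (row_block d S i * lift_family y i)
        = frob_inner (lift_conj x i) (lift_conj y i)" .
  qed
  also have "\<dots> = (\<Sum>i<Suc k. \<Sum>a<d. \<Sum>b<d. lift_conj x i $$ (a,b) * lift_conj y i $$ (a,b))"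
    by (simp only: frob_inner_double[OF lift_conj_carrier lift_conj_carrier])
  also have "\<dots> = (\<Sum>a<d. \<Sum>b<d. \<Sum>i<Suc k. lift_conj x i $$ (a,b) * lift_conj y i $$ (a,b))"
    by (rule sum_rotate)
  also have "\<dots> = (\<Sum>a<d. \<Sum>b<d. (\<Sum>i<k. x i a b * y i a b) - fam_sum k x a b * fam_sum k y a b / real (Suc k))"
  proof (intro sum.cong refl)
    fix a b assume ab: "a \<in> {..<d}" "b \<in> {..<d}"
    define s t r where "s = fam_sum k x a b" and "t = fam_sum k y a b" and "r = real (Suc k)"
    have r: "r \<noteq> 0" "real k = r - 1" by (auto simp: r_def)
    have "(\<Sum>i<Suc k. lift_conj x i $$ (a,b) * lift_conj y i $$ (a,b))
        = (s / r) * (t / r) + (\<Sum>i<k. (x i a b - s / r) * (y i a b - t / r))"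
      using ab by (subst sum.lessThan_Suc_shift) (simp add: lift_conj_def s_def t_def r_def)
    also have "(\<Sum>i<k. (x i a b - s / r) * (y i a b - t / r))
        = (\<Sum>i<k. x i a b * y i a b) - s * (t / r) - (s / r) * t + real k * ((s / r) * (t / r))"
    proof -
      have "(\<Sum>i<k. (x i a b - u) * (y i a b - v))
          = (\<Sum>i<k. x i a b * y i a b) - (\<Sum>i<k. x i a b) * v - u * (\<Sum>i<k. y i a b) + real k * (u * v)" for u v
        by (induction k) (auto simp: algebra_simps)
      thus ?thesis by (simp add: s_def t_def fam_sum_def)
    qed
    also have "(s / r) * (t / r) + ((\<Sum>i<k. x i a b * y i a b) - s * (t / r) - (s / r) * t + real k * ((s / r) * (t / r)))
        = (\<Sum>i<k. x i a b * y i a b) - s * t / r"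
      unfolding r(2) using r(1) by (simp add: field_simps)
    finally show "(\<Sum>i<Suc k. lift_conj x i $$ (a,b) * lift_conj y i $$ (a,b))
        = (\<Sum>i<k. x i a b * y i a b) - fam_sum k x a b * fam_sum k y a b / real (Suc k)"
      by (simp add: s_def t_def r_def)
  qed
  also have "\<dots> = frame_metric d k x y"
    by (simp only: frame_metric_def fam_inner_def sum_subtractf sum_divide_distrib
        sum_rotate[where I="{..<k}"])
  finally show ?thesis .
qed

end

text \<open>The right-hand side does not mention the fibre point, so the choice of it inside
  \<open>quot_metric\<close> is immaterial.\<close>

theorem quot_metric_eq:
  assumes p: "p \<in> orth_power d k" and Z: "Z \<in> orth_tangent d k p" and W: "W \<in> orth_tangent d k p"
  shows "quot_metric d (Suc k) p Z W = frame_metric d k (frame_coord d p Z) (frame_coord d p W)"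
proof -
  define S where "S = (SOME S. S \<in> orth_power d (Suc k) \<and> quot_proj d (Suc k) S = p)"
  have S: "S \<in> orth_power d (Suc k)" "quot_proj d (Suc k) S = p"
    using someI_ex[OF quot_proj_surj[OF p]] unfolding S_def by auto
  have "quot_metric d (Suc k) p Z W = frob_inner (horizontal_lift d (Suc k) S Z) (horizontal_lift d (Suc k) S W)"
    unfolding quot_metric_def Let_def S_def ..
  also have "\<dots> = frame_metric d k (frame_coord d p Z) (frame_coord d p W)"
    using frob_inner_horizontal_lift[OF S orth_tangentD(1)[OF p Z] orth_tangentD(1)[OF p W]]
    unfolding orth_tangentD(2)[OF p Z] orth_tangentD(2)[OF p W] .
  finally show ?thesis .
qed

section \<open>The Levi-Civita connection\<close>

definition fam_comm :: "nat \<Rightarrow> (nat \<Rightarrow> nat \<Rightarrow> real) \<Rightarrow> (nat \<Rightarrow> nat \<Rightarrow> real) \<Rightarrow> nat \<Rightarrow> nat \<Rightarrow> real" where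
  "fam_comm d A B a b = (\<Sum>c<d. A a c * B c b - B a c * A c b)"

lemma fam_comm_swap: "fam_comm d A B a b = - fam_comm d B A a b"
  by (simp add: fam_comm_def sum_subtractf)

lemma fam_comm_skew:
  assumes "\<And>a b. a < d \<Longrightarrow> b < d \<Longrightarrow> A a b = - A b a" "\<And>a b. a < d \<Longrightarrow> b < d \<Longrightarrow> B a b = - B b a"
    and "a < d" "b < d"
  shows "fam_comm d A B a b = - fam_comm d A B b a"
  unfolding fam_comm_def sum_negf[symmetric]
proof (intro sum.cong refl)
  fix c assume "c \<in> {..<d}"
  hence c: "c < d" by simp
  have "A a c = - A c a" "B a c = - B c a" by (rule assms(1,2)[OF assms(3) c])+
  moreover have "A c b = - A b c" "B c b = - B b c" by (rule assms(1,2)[OF c assms(4)])+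
  ultimately show "A a c * B c b - B a c * A c b = - (A b c * B c a - B b c * A c a)" by simp
qed

lemma fam_comm_sum:
  "(\<Sum>i\<in>I. fam_comm d A (x i) a b) = fam_comm d A (\<lambda>a b. \<Sum>i\<in>I. x i a b) a b"
proof -
  have "(\<Sum>i\<in>I. fam_comm d A (x i) a b) = (\<Sum>c<d. \<Sum>i\<in>I. A a c * x i c b - x i a c * A c b)"
    unfolding fam_comm_def by (rule sum.swap)
  thus ?thesis by (simp add: fam_comm_def sum_subtractf sum_distrib_left sum_distrib_right)
qed

lemma fam_inner_commute: "fam_inner d A B = fam_inner d B A"
  by (simp add: fam_inner_def mult.commute)

lemma fam_inner_cong:
  assumes "\<And>a b. a < d \<Longrightarrow> b < d \<Longrightarrow> A a b = A' a b" "\<And>a b. a < d \<Longrightarrow> b < d \<Longrightarrow> B a b = B' a b"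
  shows "fam_inner d A B = fam_inner d A' B'"
  unfolding fam_inner_def using assms by simp

lemma fam_inner_add: "fam_inner d (\<lambda>a b. A a b + B a b) C = fam_inner d A C + fam_inner d B C"
  by (simp add: fam_inner_def distrib_right sum.distrib)

lemma fam_inner_scale: "fam_inner d (\<lambda>a b. r * A a b) C = r * fam_inner d A C"
  by (simp add: fam_inner_def sum_distrib_left mult.assoc)

lemma fam_inner_sum: "fam_inner d (\<lambda>a b. \<Sum>i\<in>I. A i a b) C = (\<Sum>i\<in>I. fam_inner d (A i) C)"
proof -
  have "(\<Sum>i\<in>I. fam_inner d (A i) C) = (\<Sum>a<d. \<Sum>b<d. \<Sum>i\<in>I. A i a b * C a b)"
    unfolding fam_inner_def by (rule sum_rotate)
  thus ?thesis by (simp add: fam_inner_def sum_distrib_right)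
qed

text \<open>Ad-invariance: bracketing with a skew matrix is a skew operator for the Frobenius
  product. Both halves of the commutator are handled by renaming summation indices and transposing
  \<open>A\<close> once.\<close>

lemma fam_inner_comm_swap:
  assumes A: "\<And>a b. a < d \<Longrightarrow> b < d \<Longrightarrow> A a b = - A b a"
  shows "fam_inner d (fam_comm d A B) C = - fam_inner d (fam_comm d A C) B"
proof -
  have 1: "(\<Sum>a<d. \<Sum>b<d. \<Sum>c<d. A a c * B c b * C a b) = - (\<Sum>a<d. \<Sum>b<d. \<Sum>c<d. A a c * C c b * B a b)"
  proof -
    have "(\<Sum>a<d. \<Sum>b<d. \<Sum>c<d. A a c * B c b * C a b) = (\<Sum>a<d. \<Sum>c<d. \<Sum>b<d. A a c * B c b * C a b)"
      by (intro sum.cong refl sum.swap)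
    also have "\<dots> = (\<Sum>c<d. \<Sum>a<d. \<Sum>b<d. A a c * B c b * C a b)" by (rule sum.swap)
    also have "\<dots> = (\<Sum>c<d. \<Sum>a<d. \<Sum>b<d. - (A c a * C a b * B c b))"
    proof (intro sum.cong refl)
      fix c a b assume "c \<in> {..<d}" "a \<in> {..<d}"
      thus "A a c * B c b * C a b = - (A c a * C a b * B c b)" using A[of a c] by simp
    qed
    also have "\<dots> = - (\<Sum>c<d. \<Sum>a<d. \<Sum>b<d. A c a * C a b * B c b)" by (simp add: sum_negf)
    also have "(\<Sum>c<d. \<Sum>a<d. \<Sum>b<d. A c a * C a b * B c b) = (\<Sum>c<d. \<Sum>b<d. \<Sum>a<d. A c a * C a b * B c b)"
      by (intro sum.cong refl sum.swap)
    finally show ?thesis .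
  qed
  have 2: "(\<Sum>a<d. \<Sum>b<d. \<Sum>c<d. B a c * A c b * C a b) = - (\<Sum>a<d. \<Sum>b<d. \<Sum>c<d. C a c * A c b * B a b)"
  proof -
    have "(\<Sum>a<d. \<Sum>b<d. \<Sum>c<d. B a c * A c b * C a b) = (\<Sum>a<d. \<Sum>c<d. \<Sum>b<d. B a c * A c b * C a b)"
      by (intro sum.cong refl sum.swap)
    also have "\<dots> = (\<Sum>a<d. \<Sum>c<d. \<Sum>b<d. - (C a b * A b c * B a c))"
    proof (intro sum.cong refl)
      fix a c b assume "c \<in> {..<d}" "b \<in> {..<d}"
      thus "B a c * A c b * C a b = - (C a b * A b c * B a c)" using A[of c b] by simp
    qed
    finally show ?thesis by (simp add: sum_negf)
  qed
  show ?thesis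
    using 1 2 unfolding fam_inner_def fam_comm_def
    by (simp add: sum_distrib_right left_diff_distrib sum_subtractf)
qed

text \<open>The Koszul formula for left-invariant fields, with respect to the frame metric.\<close>
definition lc_term :: "nat \<Rightarrow> nat \<Rightarrow> (nat \<Rightarrow> nat \<Rightarrow> nat \<Rightarrow> real) \<Rightarrow> (nat \<Rightarrow> nat \<Rightarrow> nat \<Rightarrow> real) \<Rightarrow> nat \<Rightarrow> nat \<Rightarrow> nat \<Rightarrow> real" where
  "lc_term d k x y i a b = (fam_comm d (x i) (y i) a b
     + (fam_comm d (fam_sum k y) (x i) a b + fam_comm d (fam_sum k x) (y i) a b) / real (Suc k)) / 2"

lemma fam_sum_skew:
  assumes "skew_family d k x" "a < d" "b < d" shows "fam_sum k x a b = - fam_sum k x b a"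
  unfolding fam_sum_def sum_negf[symmetric] using skew_familyD[OF assms(1) _ assms(2,3)] by (intro sum.cong) auto

lemma lc_term_skew:
  assumes x: "skew_family d k x" and y: "skew_family d k y" and i: "i < k" and ab: "a < d" "b < d"
  shows "lc_term d k x y i a b = - lc_term d k x y i b a"
proof -
  note X = skew_familyD[OF x i] and Y = skew_familyD[OF y i]
  have "fam_comm d (x i) (y i) a b = - fam_comm d (x i) (y i) b a"
    by (rule fam_comm_skew[OF X Y ab])
  moreover have "fam_comm d (fam_sum k y) (x i) a b = - fam_comm d (fam_sum k y) (x i) b a"
    by (rule fam_comm_skew[OF fam_sum_skew[OF y] X ab])
  moreover have "fam_comm d (fam_sum k x) (y i) a b = - fam_comm d (fam_sum k x) (y i) b a"
    by (rule fam_comm_skew[OF fam_sum_skew[OF x] Y ab])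
  ultimately show ?thesis by (simp add: lc_term_def field_simps)
qed

text \<open>The part of \<open>lc_term\<close> divided by \<open>k + 1\<close> is symmetric in
  \<open>x\<close> and \<open>y\<close> and cancels, and the two halves of the bracket add
  up.\<close>

lemma lc_term_torsion: "lc_term d k x y i a b - lc_term d k y x i a b = fam_comm d (x i) (y i) a b"
proof -
  define q where "q = (fam_comm d (fam_sum k y) (x i) a b + fam_comm d (fam_sum k x) (y i) a b) / real (Suc k)"
  have "lc_term d k x y i a b = (fam_comm d (x i) (y i) a b + q) / 2"
    "lc_term d k y x i a b = (- fam_comm d (x i) (y i) a b + q) / 2"
    using fam_comm_swap[of d "y i" "x i" a b] by (simp_all add: lc_term_def q_def add.commute)
  thus ?thesis by simp
qed

text \<open>Summed over the views the correction terms become the bracket of the two totals in both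
  orders, which is zero.\<close>

lemma fam_sum_lc_term: "fam_sum k (lc_term d k x y) a b = (\<Sum>i<k. fam_comm d (x i) (y i) a b) / 2"
proof -
  have "fam_sum k (lc_term d k x y) a b = ((\<Sum>i<k. fam_comm d (x i) (y i) a b)
     + ((\<Sum>i<k. fam_comm d (fam_sum k y) (x i) a b) + (\<Sum>i<k. fam_comm d (fam_sum k x) (y i) a b)) / real (Suc k)) / 2"
    by (simp only: fam_sum_def[of k "lc_term d k x y"] lc_term_def sum_divide_distrib[symmetric] sum.distrib)
  also have "(\<Sum>i<k. fam_comm d (fam_sum k y) (x i) a b) = fam_comm d (fam_sum k y) (fam_sum k x) a b"
    by (simp add: fam_comm_sum fam_sum_def[abs_def])
  also have "(\<Sum>i<k. fam_comm d (fam_sum k x) (y i) a b) = fam_comm d (fam_sum k x) (fam_sum k y) a b"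
    by (simp add: fam_comm_sum fam_sum_def[abs_def])
  finally show ?thesis using fam_comm_swap[of d "fam_sum k x" "fam_sum k y" a b] by simp
qed

lemma frame_metric_commute: "frame_metric d k x y = frame_metric d k y x"
  by (simp add: frame_metric_def fam_inner_commute)

lemma frame_metric_add:
  "frame_metric d k (\<lambda>i a b. x i a b + y i a b) z = frame_metric d k x z + frame_metric d k y z"
proof -
  have "fam_sum k (\<lambda>i a b. x i a b + y i a b) = (\<lambda>a b. fam_sum k x a b + fam_sum k y a b)"
    by (simp add: fam_sum_def fun_eq_iff sum.distrib)
  thus ?thesis by (simp add: frame_metric_def fam_inner_add sum.distrib add_divide_distrib)
qed

lemma frame_metric_cong:
  assumes "\<And>i a b. i < k \<Longrightarrow> a < d \<Longrightarrow> b < d \<Longrightarrow> x i a b = x' i a b"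
    "\<And>i a b. i < k \<Longrightarrow> a < d \<Longrightarrow> b < d \<Longrightarrow> y i a b = y' i a b"
  shows "frame_metric d k x y = frame_metric d k x' y'"
proof -
  have "fam_inner d (x i) (y i) = fam_inner d (x' i) (y' i)" if "i < k" for i
    using assms that by (intro fam_inner_cong) auto
  moreover have "fam_inner d (fam_sum k x) (fam_sum k y) = fam_inner d (fam_sum k x') (fam_sum k y')"
    using assms by (intro fam_inner_cong) (auto simp: fam_sum_def)
  ultimately show ?thesis by (simp add: frame_metric_def)
qed

lemma frame_metric_lc_term:
  "2 * frame_metric d k (lc_term d k x y) v = (\<Sum>i<k. fam_inner d (fam_comm d (x i) (y i)) (v i)
    + (fam_inner d (fam_comm d (fam_sum k y) (x i)) (v i) + fam_inner d (fam_comm d (fam_sum k x) (y i)) (v i)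
      - fam_inner d (fam_comm d (x i) (y i)) (fam_sum k v)) / real (Suc k))"
proof -
  have 1: "fam_inner d (lc_term d k x y i) (v i) = 1/2 * (fam_inner d (fam_comm d (x i) (y i)) (v i)
    + 1 / real (Suc k) * (fam_inner d (fam_comm d (fam_sum k y) (x i)) (v i) + fam_inner d (fam_comm d (fam_sum k x) (y i)) (v i)))" for i
  proof -
    have "lc_term d k x y i = (\<lambda>a b. 1/2 * (fam_comm d (x i) (y i) a b
        + 1 / real (Suc k) * (fam_comm d (fam_sum k y) (x i) a b + fam_comm d (fam_sum k x) (y i) a b)))"
      by (simp add: lc_term_def fun_eq_iff)
    thus ?thesis by (simp only: fam_inner_scale fam_inner_add)
  qed
  have "fam_sum k (lc_term d k x y) = (\<lambda>a b. 1/2 * (\<Sum>i<k. fam_comm d (x i) (y i) a b))"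
    by (simp add: fun_eq_iff fam_sum_lc_term)
  hence 2: "fam_inner d (fam_sum k (lc_term d k x y)) (fam_sum k v) = 1/2 * (\<Sum>i<k. fam_inner d (fam_comm d (x i) (y i)) (fam_sum k v))"
    by (simp only: fam_inner_scale fam_inner_sum)
  define r where "r = real (Suc k)"
  have r: "r \<noteq> 0" by (simp add: r_def)
  have 3: "(\<Sum>i<k. 1/2 * (T1 i + 1 / r * (T2 i + T3 i))) - 1/2 * (\<Sum>i<k. T4 i) / r
      = 1/2 * (\<Sum>i<k. T1 i + (T2 i + T3 i - T4 i) / r)" for T1 T2 T3 T4
    by (simp only: sum_distrib_left[symmetric] sum.distrib sum_subtractf sum_divide_distrib[symmetric])
       (use r in \<open>simp add: field_simps\<close>)
  show ?thesis unfolding frame_metric_def 1 2 r_def[symmetric] 3 by simp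
qed

text \<open>For fixed \<open>x\<close> the map \<open>y \<mapsto> lc_term d k x y\<close> is skew
  for the frame metric, which is metric compatibility for constant frame coordinates. Doubled, the
  sum falls into four groups of brackets, each cancelling by ad-invariance.\<close>

lemma frame_metric_lc_term_skew:
  assumes x: "skew_family d k x" and y: "skew_family d k y" and v: "skew_family d k v"
  shows "frame_metric d k (lc_term d k x y) v + frame_metric d k y (lc_term d k x v) = 0"
proof -
  let ?t = "\<lambda>A B C. fam_inner d (fam_comm d A B) C"
  have sw: "?t A B C = - ?t B A C" for A B C
  proof -
    have "fam_comm d A B = (\<lambda>a b. (-1) * fam_comm d B A a b)"
      using fam_comm_swap[of d A B] by (simp add: fun_eq_iff)
    thus ?thesis by (simp only: fam_inner_scale)
  qed
  have "2 * (frame_metric d k (lc_term d k x y) v + frame_metric d k (lc_term d k x v) y)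
    = (\<Sum>i<k. (?t (x i) (y i) (v i) + ?t (x i) (v i) (y i)) + ((?t (fam_sum k x) (y i) (v i) + ?t (fam_sum k x) (v i) (y i))
        + (?t (fam_sum k y) (x i) (v i) - ?t (x i) (v i) (fam_sum k y)) + (?t (fam_sum k v) (x i) (y i) - ?t (x i) (y i) (fam_sum k v))) / real (Suc k))"
    unfolding distrib_left frame_metric_lc_term sum.distrib[symmetric]
    by (intro sum.cong refl) (simp add: add_divide_distrib diff_divide_distrib)
  also have "\<dots> = 0"
  proof (intro sum.neutral ballI)
    fix i assume "i \<in> {..<k}"
    hence "i < k" by simp
    note X = skew_familyD[OF x this]
    have "?t (x i) (y i) (v i) + ?t (x i) (v i) (y i) = 0" using fam_inner_comm_swap[OF X, where B="y i" and C="v i"] by simp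
    moreover have "?t (fam_sum k x) (y i) (v i) + ?t (fam_sum k x) (v i) (y i) = 0"
      using fam_inner_comm_swap[OF fam_sum_skew[OF x], where B="y i" and C="v i"] by simp
    moreover have "?t (fam_sum k y) (x i) (v i) - ?t (x i) (v i) (fam_sum k y) = 0"
      using fam_inner_comm_swap[OF X, where B="v i" and C="fam_sum k y"] sw[of "fam_sum k y" "x i" "v i"] by simp
    moreover have "?t (fam_sum k v) (x i) (y i) - ?t (x i) (y i) (fam_sum k v) = 0"
      using fam_inner_comm_swap[OF X, where B="y i" and C="fam_sum k v"] sw[of "fam_sum k v" "x i" "y i"] by simp
    ultimately show "(?t (x i) (y i) (v i) + ?t (x i) (v i) (y i)) + ((?t (fam_sum k x) (y i) (v i) + ?t (fam_sum k x) (v i) (y i))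
        + (?t (fam_sum k y) (x i) (v i) - ?t (x i) (v i) (fam_sum k y)) + (?t (fam_sum k v) (x i) (y i) - ?t (x i) (y i) (fam_sum k v))) / real (Suc k) = 0"
      by simp
  qed
  finally show ?thesis using frame_metric_commute[of d k y] by simp
qed

lemma lc_term_linear_left:
  "lc_term d k (\<lambda>i a b. u * x i a b + v * y i a b) z i a b = u * lc_term d k x z i a b + v * lc_term d k y z i a b"
proof -
  have s: "fam_sum k (\<lambda>i a b. u * x i a b + v * y i a b) = (\<lambda>a b. u * fam_sum k x a b + v * fam_sum k y a b)"
    by (simp add: fam_sum_def fun_eq_iff sum.distrib sum_distrib_left)
  have c1: "fam_comm d (\<lambda>a b. u * A a b + v * B a b) C a b = u * fam_comm d A C a b + v * fam_comm d B C a b" for A B C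
    by (simp add: fam_comm_def sum_distrib_left sum.distrib[symmetric] algebra_simps)
  have c2: "fam_comm d C (\<lambda>a b. u * A a b + v * B a b) a b = u * fam_comm d C A a b + v * fam_comm d C B a b" for A B C
    by (simp add: fam_comm_def sum_distrib_left sum.distrib[symmetric] algebra_simps)
  show ?thesis unfolding lc_term_def s c1 c2 by (simp add: add_divide_distrib algebra_simps)
qed

text \<open>Exchanging the arguments changes the term by a bracket, which is bilinear, so linearity
  carries over from the left argument.\<close>

lemma lc_term_linear_right:
  "lc_term d k z (\<lambda>i a b. u * x i a b + v * y i a b) i a b = u * lc_term d k z x i a b + v * lc_term d k z y i a b"
proof -
  have sw: "lc_term d k p q i a b = lc_term d k q p i a b + fam_comm d (p i) (q i) a b" for p q
    using lc_term_torsion[of d k p q i a b] by simp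
  have c: "fam_comm d C (\<lambda>a b. u * A a b + v * B a b) a b = u * fam_comm d C A a b + v * fam_comm d C B a b" for A B C
    by (simp add: fam_comm_def sum_distrib_left sum.distrib[symmetric] algebra_simps)
  show ?thesis
    unfolding sw[of z "\<lambda>i a b. u * x i a b + v * y i a b"] sw[of z x] sw[of z y] lc_term_linear_left c
    by (simp add: distrib_left)
qed

lemma frame_coord_linear:
  assumes "Z \<in> carrier_mat (k * d) d" "W \<in> carrier_mat (k * d) d" "i < k" "b < d"
  shows "frame_coord d p (u \<cdot>\<^sub>m Z + v \<cdot>\<^sub>m W) i a b = u * frame_coord d p Z i a b + v * frame_coord d p W i a b"
  unfolding frame_coord_def sum_distrib_left sum.distrib[symmetric]
proof (intro sum.cong refl)
  fix c assume "c \<in> {..<d}"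
  hence "(u \<cdot>\<^sub>m Z + v \<cdot>\<^sub>m W) $$ (i * d + c, b) = u * Z $$ (i * d + c, b) + v * W $$ (i * d + c, b)"
    using assms block_index_less[OF assms(3), of c d] by simp
  thus "p $$ (i * d + c, a) * (u \<cdot>\<^sub>m Z + v \<cdot>\<^sub>m W) $$ (i * d + c, b)
      = u * (p $$ (i * d + c, a) * Z $$ (i * d + c, b)) + v * (p $$ (i * d + c, a) * W $$ (i * d + c, b))"
    by (simp add: distrib_left)
qed

lemma orth_tangent_linear:
  assumes p: "p \<in> orth_power d k" and Z: "Z \<in> orth_tangent d k p" and W: "W \<in> orth_tangent d k p"
  shows "u \<cdot>\<^sub>m Z + v \<cdot>\<^sub>m W \<in> orth_tangent d k p"
proof -
  note z = orth_tangentD[OF p Z] and w = orth_tangentD[OF p W]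
  define x y where "x = frame_coord d p Z" and "y = frame_coord d p W"
  have "u \<cdot>\<^sub>m Z + v \<cdot>\<^sub>m W = u \<cdot>\<^sub>m frame_field d k x p + v \<cdot>\<^sub>m frame_field d k y p"
    using z w by (simp add: x_def y_def)
  also have "\<dots> = frame_field d k (\<lambda>i a b. u * x i a b + v * y i a b) p"
    by (rule frame_field_linear[OF orth_powerD(1)[OF p]])
  finally show ?thesis
  proof (simp only:, intro frame_field_tangent)
    show "skew_family d k (\<lambda>i a b. u * x i a b + v * y i a b)"
      unfolding skew_family_def
    proof (intro allI impI)
      fix i a b assume "i < k" "a < d" "b < d"
      thus "u * x i a b + v * y i a b = - (u * x i b a + v * y i b a)"
        using skew_familyD[OF z(1), of i a b] skew_familyD[OF w(1), of i a b] by (simp add: x_def y_def)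
    qed
  qed
qed

lemma DERIV_fam_inner:
  assumes "\<And>a b. a < d \<Longrightarrow> b < d \<Longrightarrow> ((\<lambda>t. A t a b) has_real_derivative A' a b) (at s)"
    "\<And>a b. a < d \<Longrightarrow> b < d \<Longrightarrow> ((\<lambda>t. B t a b) has_real_derivative B' a b) (at s)"
  shows "((\<lambda>t. fam_inner d (A t) (B t)) has_real_derivative fam_inner d A' (B s) + fam_inner d (A s) B') (at s)"
  unfolding fam_inner_def sum.distrib[symmetric]
proof (intro DERIV_sum)
  fix a b assume "a \<in> {..<d}" "b \<in> {..<d}"
  thus "((\<lambda>t. A t a b * B t a b) has_real_derivative A' a b * B s a b + A s a b * B' a b) (at s)"
    using DERIV_mult[OF assms(1) assms(2), of a b a b] by (simp add: algebra_simps)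
qed

lemma DERIV_frame_metric:
  assumes y: "\<And>i a b. i < k \<Longrightarrow> a < d \<Longrightarrow> b < d \<Longrightarrow> ((\<lambda>t. y t i a b) has_real_derivative y' i a b) (at s)"
    and v: "\<And>i a b. i < k \<Longrightarrow> a < d \<Longrightarrow> b < d \<Longrightarrow> ((\<lambda>t. v t i a b) has_real_derivative v' i a b) (at s)"
  shows "((\<lambda>t. frame_metric d k (y t) (v t)) has_real_derivative frame_metric d k y' (v s) + frame_metric d k (y s) v') (at s)"
proof -
  have 1: "((\<lambda>t. \<Sum>i<k. fam_inner d (y t i) (v t i)) has_real_derivative
      (\<Sum>i<k. fam_inner d (y' i) (v s i) + fam_inner d (y s i) (v' i))) (at s)"
    using y v by (intro DERIV_sum DERIV_fam_inner) auto
  have "((\<lambda>t. fam_sum k (y t) a b) has_real_derivative fam_sum k y' a b) (at s)"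
    "((\<lambda>t. fam_sum k (v t) a b) has_real_derivative fam_sum k v' a b) (at s)" if "a < d" "b < d" for a b
    using y v that unfolding fam_sum_def by (auto intro!: DERIV_sum)
  hence 2: "((\<lambda>t. fam_inner d (fam_sum k (y t)) (fam_sum k (v t))) has_real_derivative
      fam_inner d (fam_sum k y') (fam_sum k (v s)) + fam_inner d (fam_sum k (y s)) (fam_sum k v')) (at s)"
    by (intro DERIV_fam_inner)
  show ?thesis unfolding frame_metric_def
    using DERIV_diff[OF 1 DERIV_cdivide[OF 2, of "real (Suc k)"]]
    by (simp add: sum.distrib add_divide_distrib algebra_simps)
qed

lemma fam_comm_cong:
  assumes "\<And>a b. a < d \<Longrightarrow> b < d \<Longrightarrow> A a b = A' a b" "\<And>a b. a < d \<Longrightarrow> b < d \<Longrightarrow> B a b = B' a b" "a < d" "b < d"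
  shows "fam_comm d A B a b = fam_comm d A' B' a b"
  unfolding fam_comm_def using assms by simp

lemma lc_term_cong:
  assumes x: "\<And>i a b. i < k \<Longrightarrow> a < d \<Longrightarrow> b < d \<Longrightarrow> x i a b = x' i a b"
    and y: "\<And>i a b. i < k \<Longrightarrow> a < d \<Longrightarrow> b < d \<Longrightarrow> y i a b = y' i a b"
    and i: "i < k" "a < d" "b < d"
  shows "lc_term d k x y i a b = lc_term d k x' y' i a b"
proof -
  have "fam_sum k x a b = fam_sum k x' a b" "fam_sum k y a b = fam_sum k y' a b" if "a < d" "b < d" for a b
    using x y that by (simp_all add: fam_sum_def)
  thus ?thesis unfolding lc_term_def using x y i
    by (intro arg_cong2[where f="(/)"] arg_cong2[where f="(+)"] refl fam_comm_cong) auto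
qed

lemma frame_coord_smult:
  assumes "Z \<in> carrier_mat (k * d) d" "i < k" "b < d"
  shows "frame_coord d p (u \<cdot>\<^sub>m Z) i a b = u * frame_coord d p Z i a b"
  unfolding frame_coord_def sum_distrib_left
  using assms block_index_less[OF assms(2)] by (intro sum.cong) auto

text \<open>\<open>z \<mapsto> z + \<sigma>(z)\<close> inverts the Gram operator of the frame metric.\<close>
lemma frame_metric_raise:
  "frame_metric d k (\<lambda>i a b. h i a b + fam_sum k h a b) z = (\<Sum>i<k. fam_inner d (h i) (z i))"
proof -
  have 1: "fam_sum k (\<lambda>i a b. h i a b + fam_sum k h a b) = (\<lambda>a b. real (Suc k) * fam_sum k h a b)"
    by (simp add: fun_eq_iff fam_sum_def sum.distrib algebra_simps)
  have 2: "(\<Sum>i<k. fam_inner d (fam_sum k h) (z i)) = fam_inner d (fam_sum k h) (fam_sum k z)"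
    by (subst (1 2) fam_inner_commute) (simp add: fam_inner_sum fam_sum_def[of k z, abs_def])
  show ?thesis unfolding frame_metric_def 1 fam_inner_scale
    by (simp add: fam_inner_add sum.distrib 2)
qed

lemma frob_inner_frame_field:
  assumes G: "G \<in> carrier_mat (k * d) d" and q: "q \<in> carrier_mat (k * d) d"
  shows "frob_inner G (frame_field d k z q) = (\<Sum>i<k. fam_inner d (frame_coord d q G i) (z i))"
proof -
  have "frob_inner G (frame_field d k z q)
      = frob_inner (vstack d k (row_block d G)) (vstack d k (\<lambda>i. row_block d q i * mat d d (\<lambda>(a,b). z i a b)))"
    by (simp add: vstack_row_block[OF G] frame_field_def)
  also have "\<dots> = (\<Sum>i<k. frob_inner (row_block d G i) (row_block d q i * mat d d (\<lambda>(a,b). z i a b)))"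
    using G q by (intro frob_inner_vstack) (auto intro!: mult_carrier_mat[of _ d d])
  also have "\<dots> = (\<Sum>i<k. fam_inner d (frame_coord d q G i) (z i))"
  proof (intro sum.cong refl)
    fix i assume "i \<in> {..<k}"
    have c: "row_block d G i \<in> carrier_mat d d" "row_block d q i \<in> carrier_mat d d"
      "row_block d q i * mat d d (\<lambda>(a,b). z i a b) \<in> carrier_mat d d"
      using G q by (auto intro!: mult_carrier_mat[of _ d d])
    have "frob_inner (row_block d G i) (row_block d q i * mat d d (\<lambda>(a,b). z i a b))
      = (\<Sum>c<d. \<Sum>b<d. \<Sum>a<d. G $$ (i * d + c, b) * (q $$ (i * d + c, a) * z i a b))"
    proof -
      have "(row_block d q i * mat d d (\<lambda>(a,b). z i a b)) $$ (c,b) = (\<Sum>a<d. q $$ (i * d + c, a) * z i a b)"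
        if "c < d" "b < d" for c b
        using q that by (simp add: row_block_def scalar_prod_def atLeast0LessThan)
      thus ?thesis unfolding frob_inner_double[OF c(1,3)] using G by (simp add: sum_distrib_left)
    qed
    also have "\<dots> = (\<Sum>c<d. \<Sum>a<d. \<Sum>b<d. G $$ (i * d + c, b) * (q $$ (i * d + c, a) * z i a b))"
      by (intro sum.cong refl sum.swap)
    also have "\<dots> = (\<Sum>a<d. \<Sum>b<d. \<Sum>c<d. G $$ (i * d + c, b) * (q $$ (i * d + c, a) * z i a b))"
      by (rule sum_rotate)
    also have "\<dots> = fam_inner d (frame_coord d q G i) (z i)"
      unfolding fam_inner_def frame_coord_def sum_distrib_right
      by (intro sum.cong refl) (simp only: mult_ac)
    finally show "frob_inner (row_block d G i) (row_block d q i * mat d d (\<lambda>(a,b). z i a b))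
      = fam_inner d (frame_coord d q G i) (z i)" .
  qed
  finally show ?thesis .
qed

text \<open>Symmetric and skew matrices are orthogonal, so against a skew matrix only the skew part
  counts.\<close>

lemma fam_inner_skew_part:
  assumes "\<And>a b. a < d \<Longrightarrow> b < d \<Longrightarrow> B a b = - B b a"
  shows "fam_inner d (\<lambda>a b. (A a b - A b a) / 2) B = fam_inner d A B"
proof -
  have "fam_inner d (\<lambda>a b. A b a) B = (\<Sum>b<d. \<Sum>a<d. A b a * B a b)"
    unfolding fam_inner_def by (rule sum.swap)
  also have "\<dots> = (\<Sum>b<d. \<Sum>a<d. - (A b a * B b a))"
  proof (intro sum.cong refl)
    fix b a assume "b \<in> {..<d}" "a \<in> {..<d}"
    thus "A b a * B a b = - (A b a * B b a)" using assms[of a b] by simp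
  qed
  finally have "fam_inner d (\<lambda>a b. A b a) B = - fam_inner d A B" by (simp add: fam_inner_def sum_negf)
  moreover have "fam_inner d (\<lambda>a b. (A a b - A b a) / 2) B = (fam_inner d A B - fam_inner d (\<lambda>a b. A b a) B) / 2"
    by (simp add: fam_inner_def left_diff_distrib diff_divide_distrib sum_subtractf sum_divide_distrib)
  ultimately show ?thesis by simp
qed

text \<open>There are \<open>Suc k\<close> views, which turns the \<open>m - 1\<close> blocks of the
  quotient into \<open>k\<close>.\<close>

locale orth_quot =
  fixes d k :: nat
begin

sublocale curve_rich "k * d" d "orth_power d k" "orth_tangent d k"
  by (rule curve_rich_orth_power)

abbreviation "M \<equiv> orth_power d k"
abbreviation "T \<equiv> orth_tangent d k"
abbreviation "R \<equiv> orth_quotient d (Suc k)"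
abbreviation "sm \<equiv> smooth_on (k * d) d M"

lemma R_simps [simp]: "mrows R = k * d" "mcols R = d" "mpts R = M" "mtangent R = T"
  by (simp_all add: orth_quotient_def)

lemma metric_eq: "p \<in> M \<Longrightarrow> Z \<in> T p \<Longrightarrow> W \<in> T p \<Longrightarrow>
    mmetric R p Z W = frame_metric d k (frame_coord d p Z) (frame_coord d p W)"
  by (simp add: orth_quotient_def quot_metric_eq)

lemma smooth_functions_iff: "f \<in> smooth_functions R \<longleftrightarrow> sm f"
  by (simp add: smooth_functions_def)

lemma vector_fieldsD:
  assumes "X \<in> vector_fields R"
  shows "p \<in> M \<Longrightarrow> X p \<in> T p" "r < k * d \<Longrightarrow> b < d \<Longrightarrow> sm (\<lambda>p. X p $$ (r,b))"
    "p \<in> M \<Longrightarrow> X p \<in> carrier_mat (k * d) d"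
    "p \<in> M \<Longrightarrow> skew_family d k (frame_coord d p (X p))"
    "p \<in> M \<Longrightarrow> frame_field d k (frame_coord d p (X p)) p = X p"
  using assms orth_tangentD[of p d k "X p"] by (auto simp: vector_fields_def smooth_functions_def)

lemma coord_smooth:
  assumes "X \<in> vector_fields R" "i < k" "a < d" "b < d"
  shows "sm (\<lambda>q. frame_coord d q (X q) i a b)"
  by (rule smooth_on_frame_coord) (use assms vector_fieldsD in auto)

lemma frame_field_vector_field:
  assumes "\<And>i a b. i < k \<Longrightarrow> a < d \<Longrightarrow> b < d \<Longrightarrow> sm (\<lambda>q. x q i a b)" "\<And>q. q \<in> M \<Longrightarrow> skew_family d k (x q)"
  shows "(\<lambda>q. frame_field d k (x q) q) \<in> vector_fields R"
  unfolding vector_fields_def smooth_functions_def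
  using assms smooth_on_frame_field[OF M_carrier, of x] frame_field_tangent by auto

definition coord_deriv :: "(real mat \<Rightarrow> real mat) \<Rightarrow> (real mat \<Rightarrow> real mat) \<Rightarrow> real mat \<Rightarrow> nat \<Rightarrow> nat \<Rightarrow> nat \<Rightarrow> real" where
  "coord_deriv X Y p i a b = diff_along M (\<lambda>q. frame_coord d q (Y q) i a b) p (X p)"

text \<open>The derivative of the frame coordinates plus the Christoffel term of the frame, whose
  coefficients are constant because the metric is constant in frame coordinates.\<close>

definition connection :: "(real mat \<Rightarrow> real mat) \<Rightarrow> (real mat \<Rightarrow> real mat) \<Rightarrow> real mat \<Rightarrow> real mat" where
  "connection X Y p = frame_field d k (\<lambda>i a b. coord_deriv X Y p i a b
     + lc_term d k (frame_coord d p (X p)) (frame_coord d p (Y p)) i a b) p"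

lemma coord_deriv_skew:
  assumes X: "X \<in> vector_fields R" and Y: "Y \<in> vector_fields R" and p: "p \<in> M"
  shows "skew_family d k (coord_deriv X Y p)"
  unfolding skew_family_def
proof (intro allI impI)
  fix i a b assume i: "i < k" "a < d" "b < d"
  have "coord_deriv X Y p i a b = diff_along M (\<lambda>q. (-1) * frame_coord d q (Y q) i b a) p (X p)"
    unfolding coord_deriv_def
  proof (rule diff_along_cong)
    fix q assume "q \<in> M"
    thus "frame_coord d q (Y q) i a b = (-1) * frame_coord d q (Y q) i b a"
      using skew_familyD[OF vector_fieldsD(4)[OF Y] i] by simp
  qed
  also have "\<dots> = - coord_deriv X Y p i b a"
    unfolding coord_deriv_def diff_along_cmult[OF coord_smooth[OF Y i(1,3,2)] p vector_fieldsD(1)[OF X p]] by simp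
  finally show "coord_deriv X Y p i a b = - coord_deriv X Y p i b a" .
qed

lemma lc_term_smooth:
  assumes "X \<in> vector_fields R" "Y \<in> vector_fields R" "i < k" "a < d" "b < d"
  shows "sm (\<lambda>p. lc_term d k (frame_coord d p (X p)) (frame_coord d p (Y p)) i a b)"
proof -
  have half: "(x + y / r) / 2 = (1/2) * (x + (1/r) * y)" for x y r :: real by simp
  have *: "sm (\<lambda>p. frame_coord d p (X p) j e c)" "sm (\<lambda>p. frame_coord d p (Y p) j e c)" if "j < k" "e < d" "c < d" for j e c
    using assms coord_smooth that by auto
  show ?thesis
    unfolding lc_term_def fam_comm_def fam_sum_def half
    using assms by (intro smooth_on_mult smooth_on_add smooth_on_sum smooth_on_diff smooth_on_const *) auto
qed

lemma connection_family_skew: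
  assumes X: "X \<in> vector_fields R" and Y: "Y \<in> vector_fields R" and p: "p \<in> M"
  shows "skew_family d k (\<lambda>i a b. coord_deriv X Y p i a b
     + lc_term d k (frame_coord d p (X p)) (frame_coord d p (Y p)) i a b)"
  unfolding skew_family_def
proof (intro allI impI)
  fix i a b assume i: "i < k" "a < d" "b < d"
  show "coord_deriv X Y p i a b + lc_term d k (frame_coord d p (X p)) (frame_coord d p (Y p)) i a b
    = - (coord_deriv X Y p i b a + lc_term d k (frame_coord d p (X p)) (frame_coord d p (Y p)) i b a)"
    using skew_familyD[OF coord_deriv_skew[OF assms] i]
      lc_term_skew[OF vector_fieldsD(4)[OF X p] vector_fieldsD(4)[OF Y p] i] by simp
qed

lemma connection_vector_field:
  assumes X: "X \<in> vector_fields R" and Y: "Y \<in> vector_fields R"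
  shows "connection X Y \<in> vector_fields R"
  unfolding connection_def
proof (rule frame_field_vector_field)
  fix i a b assume i: "i < k" "a < d" "b < d"
  have "sm (\<lambda>p. coord_deriv X Y p i a b)"
    unfolding coord_deriv_def
    by (rule smooth_on_diff_along[OF coord_smooth[OF Y i]]) (use vector_fieldsD[OF X] in auto)
  thus "sm (\<lambda>p. coord_deriv X Y p i a b + lc_term d k (frame_coord d p (X p)) (frame_coord d p (Y p)) i a b)"
    using lc_term_smooth[OF X Y i] by (rule smooth_on_add)
qed (rule connection_family_skew[OF X Y])

lemma connection_linear_left:
  assumes X: "X \<in> vector_fields R" and X': "X' \<in> vector_fields R" and Y: "Y \<in> vector_fields R" and p: "p \<in> M"
  shows "connection (\<lambda>q. f q \<cdot>\<^sub>m X q + h q \<cdot>\<^sub>m X' q) Y p = f p \<cdot>\<^sub>m connection X Y p + h p \<cdot>\<^sub>m connection X' Y p"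
  unfolding connection_def frame_field_linear[OF orth_powerD(1)[OF p]]
proof (rule frame_field_cong[OF orth_powerD(1)[OF p]])
  fix i a b assume i: "i < k" "a < d" "b < d"
  note x = vector_fieldsD(1)[OF X p] vector_fieldsD(1)[OF X' p]
  have "coord_deriv (\<lambda>q. f q \<cdot>\<^sub>m X q + h q \<cdot>\<^sub>m X' q) Y p i a b = f p * coord_deriv X Y p i a b + h p * coord_deriv X' Y p i a b"
    unfolding coord_deriv_def by (rule diff_along_linear[OF coord_smooth[OF Y i] p x orth_tangent_linear[OF p x]])
  moreover have "lc_term d k (frame_coord d p (f p \<cdot>\<^sub>m X p + h p \<cdot>\<^sub>m X' p)) (frame_coord d p (Y p)) i a b
      = lc_term d k (\<lambda>i a b. f p * frame_coord d p (X p) i a b + h p * frame_coord d p (X' p) i a b) (frame_coord d p (Y p)) i a b"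
    by (rule lc_term_cong) (use i frame_coord_linear vector_fieldsD(3)[OF X p] vector_fieldsD(3)[OF X' p] in auto)
  ultimately show "coord_deriv (\<lambda>q. f q \<cdot>\<^sub>m X q + h q \<cdot>\<^sub>m X' q) Y p i a b
      + lc_term d k (frame_coord d p (f p \<cdot>\<^sub>m X p + h p \<cdot>\<^sub>m X' p)) (frame_coord d p (Y p)) i a b
    = f p * (coord_deriv X Y p i a b + lc_term d k (frame_coord d p (X p)) (frame_coord d p (Y p)) i a b)
      + h p * (coord_deriv X' Y p i a b + lc_term d k (frame_coord d p (X' p)) (frame_coord d p (Y p)) i a b)"
    by (simp add: lc_term_linear_left algebra_simps)
qed

lemma connection_linear_right:
  assumes X: "X \<in> vector_fields R" and Y: "Y \<in> vector_fields R" and Y': "Y' \<in> vector_fields R" and p: "p \<in> M"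
  shows "connection X (\<lambda>q. u \<cdot>\<^sub>m Y q + v \<cdot>\<^sub>m Y' q) p = u \<cdot>\<^sub>m connection X Y p + v \<cdot>\<^sub>m connection X Y' p"
  unfolding connection_def frame_field_linear[OF orth_powerD(1)[OF p]]
proof (rule frame_field_cong[OF orth_powerD(1)[OF p]])
  fix i a b assume i: "i < k" "a < d" "b < d"
  note x = vector_fieldsD(1)[OF X p]
  note c = frame_coord_linear[OF vector_fieldsD(3)[OF Y] vector_fieldsD(3)[OF Y']]
  have "coord_deriv X (\<lambda>q. u \<cdot>\<^sub>m Y q + v \<cdot>\<^sub>m Y' q) p i a b
      = diff_along M (\<lambda>q. u * frame_coord d q (Y q) i a b + v * frame_coord d q (Y' q) i a b) p (X p)"
    unfolding coord_deriv_def by (rule diff_along_cong) (rule c[OF _ _ i(1,3)])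
  also have "\<dots> = u * coord_deriv X Y p i a b + v * coord_deriv X Y' p i a b"
    unfolding coord_deriv_def
    by (subst diff_along_add[OF smooth_on_mult[OF smooth_on_const coord_smooth[OF Y i]] smooth_on_mult[OF smooth_on_const coord_smooth[OF Y' i]] p x])
       (simp only: diff_along_cmult[OF coord_smooth[OF Y i] p x] diff_along_cmult[OF coord_smooth[OF Y' i] p x])
  finally have "coord_deriv X (\<lambda>q. u \<cdot>\<^sub>m Y q + v \<cdot>\<^sub>m Y' q) p i a b = u * coord_deriv X Y p i a b + v * coord_deriv X Y' p i a b" .
  moreover have "lc_term d k (frame_coord d p (X p)) (frame_coord d p (u \<cdot>\<^sub>m Y p + v \<cdot>\<^sub>m Y' p)) i a b
      = lc_term d k (frame_coord d p (X p)) (\<lambda>i a b. u * frame_coord d p (Y p) i a b + v * frame_coord d p (Y' p) i a b) i a b"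
    by (rule lc_term_cong) (use i c[OF p p] in auto)
  ultimately show "coord_deriv X (\<lambda>q. u \<cdot>\<^sub>m Y q + v \<cdot>\<^sub>m Y' q) p i a b
      + lc_term d k (frame_coord d p (X p)) (frame_coord d p (u \<cdot>\<^sub>m Y p + v \<cdot>\<^sub>m Y' p)) i a b
    = u * (coord_deriv X Y p i a b + lc_term d k (frame_coord d p (X p)) (frame_coord d p (Y p)) i a b)
      + v * (coord_deriv X Y' p i a b + lc_term d k (frame_coord d p (X p)) (frame_coord d p (Y' p)) i a b)"
    by (simp add: lc_term_linear_right algebra_simps)
qed

lemma connection_leibniz:
  assumes X: "X \<in> vector_fields R" and Y: "Y \<in> vector_fields R" and f: "sm f" and p: "p \<in> M"
  shows "connection X (\<lambda>q. f q \<cdot>\<^sub>m Y q) p = diff_along M f p (X p) \<cdot>\<^sub>m Y p + f p \<cdot>\<^sub>m connection X Y p"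
proof -
  note x = vector_fieldsD(1)[OF X p]
  note c = frame_coord_smult[OF vector_fieldsD(3)[OF Y]]
  have "diff_along M f p (X p) \<cdot>\<^sub>m Y p + f p \<cdot>\<^sub>m connection X Y p
     = diff_along M f p (X p) \<cdot>\<^sub>m frame_field d k (frame_coord d p (Y p)) p + f p \<cdot>\<^sub>m connection X Y p"
    using vector_fieldsD(5)[OF Y p] by simp
  also have "\<dots> = connection X (\<lambda>q. f q \<cdot>\<^sub>m Y q) p"
    unfolding connection_def frame_field_linear[OF orth_powerD(1)[OF p]]
  proof (rule frame_field_cong[OF orth_powerD(1)[OF p]])
    fix i a b assume i: "i < k" "a < d" "b < d"
    have "coord_deriv X (\<lambda>q. f q \<cdot>\<^sub>m Y q) p i a b = diff_along M (\<lambda>q. f q * frame_coord d q (Y q) i a b) p (X p)"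
      unfolding coord_deriv_def by (rule diff_along_cong) (rule c[OF _ i(1,3)])
    also have "\<dots> = diff_along M f p (X p) * frame_coord d p (Y p) i a b + f p * coord_deriv X Y p i a b"
      unfolding coord_deriv_def by (rule diff_along_mult[OF f coord_smooth[OF Y i] p x])
    finally have 1: "coord_deriv X (\<lambda>q. f q \<cdot>\<^sub>m Y q) p i a b
      = diff_along M f p (X p) * frame_coord d p (Y p) i a b + f p * coord_deriv X Y p i a b" .
    \<comment> \<open>The summand with coefficient \<open>0\<close> brings a single multiple into
      the two-term shape of \<open>lc_term_linear_right\<close>.\<close>
    have "lc_term d k (frame_coord d p (X p)) (frame_coord d p (f p \<cdot>\<^sub>m Y p)) i a b
        = lc_term d k (frame_coord d p (X p)) (\<lambda>i a b. f p * frame_coord d p (Y p) i a b + 0 * frame_coord d p (Y p) i a b) i a b"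
      by (rule lc_term_cong) (use i c[OF p] in auto)
    thus "diff_along M f p (X p) * frame_coord d p (Y p) i a b
        + f p * (coord_deriv X Y p i a b + lc_term d k (frame_coord d p (X p)) (frame_coord d p (Y p)) i a b)
      = coord_deriv X (\<lambda>q. f q \<cdot>\<^sub>m Y q) p i a b + lc_term d k (frame_coord d p (X p)) (frame_coord d p (f p \<cdot>\<^sub>m Y p)) i a b"
      unfolding 1 lc_term_linear_right by (simp add: distrib_left)
  qed
  finally show ?thesis by simp
qed

text \<open>With coordinates \<open>x\<close> and \<open>y\<close> of the fields,
  \<open>Y = p y\<close> blockwise, and moving along \<open>X\<close> changes \<open>p\<close> by
  \<open>p x\<close>. The product rule yields \<open>p (x y + X y)\<close>, where \<open>X y\<close>
  is the derivative of the coordinates.\<close>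

lemma diff_along_field_entry:
  assumes X: "X \<in> vector_fields R" and Y: "Y \<in> vector_fields R" and p: "p \<in> M"
    and i: "i < k" "a < d" "b < d"
  shows "diff_along M (\<lambda>q. Y q $$ (i * d + a, b)) p (X p) = (\<Sum>e<d. p $$ (i * d + a, e) *
      ((\<Sum>c<d. frame_coord d p (X p) i e c * frame_coord d p (Y p) i c b) + coord_deriv X Y p i e b))"
proof -
  note x = vector_fieldsD(1)[OF X p]
  note ix = block_index_less[OF i(1,2)]
  have e: "V q $$ (i * d + a, c) = (\<Sum>e<d. q $$ (i * d + a, e) * frame_coord d q (V q) i e c)"
    if "V \<in> vector_fields R" "q \<in> M" "c < d" for V q c
    using frame_field_index[OF orth_powerD(1)[OF that(2)] i(1,2) that(3), of "frame_coord d q (V q)"]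
      vector_fieldsD(5)[OF that(1,2)] by simp
  have "diff_along M (\<lambda>q. Y q $$ (i * d + a, b)) p (X p)
      = diff_along M (\<lambda>q. \<Sum>c<d. q $$ (i * d + a, c) * frame_coord d q (Y q) i c b) p (X p)"
    by (rule diff_along_cong) (rule e[OF Y _ i(3)])
  also have "\<dots> = (\<Sum>c<d. diff_along M (\<lambda>q. q $$ (i * d + a, c) * frame_coord d q (Y q) i c b) p (X p))"
    by (rule diff_along_sum[OF smooth_on_mult[OF smooth_on_index[OF ix] coord_smooth[OF Y i(1) _ i(3)]] p x]) auto
  also have "\<dots> = (\<Sum>c<d. X p $$ (i * d + a, c) * frame_coord d p (Y p) i c b + p $$ (i * d + a, c) * coord_deriv X Y p i c b)"
  proof (intro sum.cong refl)
    fix c assume "c \<in> {..<d}"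
    hence c: "c < d" by simp
    show "diff_along M (\<lambda>q. q $$ (i * d + a, c) * frame_coord d q (Y q) i c b) p (X p)
        = X p $$ (i * d + a, c) * frame_coord d p (Y p) i c b + p $$ (i * d + a, c) * coord_deriv X Y p i c b"
      unfolding diff_along_mult[OF smooth_on_index[OF ix c] coord_smooth[OF Y i(1) c i(3)] p x] coord_deriv_def
        diff_along_index[OF p x ix c] ..
  qed
  also have "\<dots> = (\<Sum>c<d. (\<Sum>e<d. p $$ (i * d + a, e) * frame_coord d p (X p) i e c) * frame_coord d p (Y p) i c b)
      + (\<Sum>c<d. p $$ (i * d + a, c) * coord_deriv X Y p i c b)"
    by (simp add: sum.distrib e[OF X p])
  also have "(\<Sum>c<d. (\<Sum>e<d. p $$ (i * d + a, e) * frame_coord d p (X p) i e c) * frame_coord d p (Y p) i c b)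
      = (\<Sum>e<d. \<Sum>c<d. p $$ (i * d + a, e) * frame_coord d p (X p) i e c * frame_coord d p (Y p) i c b)"
    unfolding sum_distrib_right by (rule sum.swap)
  finally show ?thesis by (simp add: distrib_left sum.distrib sum_distrib_left mult.assoc)
qed

text \<open>By the product rule the Lie bracket has frame coordinates
  \<open>X y - Y x + [x, y]\<close>; the last term appears because left-invariant fields do not
  commute, and it is exactly the torsion of \<open>lc_term\<close>.\<close>

lemma connection_torsion:
  assumes X: "X \<in> vector_fields R" and Y: "Y \<in> vector_fields R" and p: "p \<in> M"
  shows "connection X Y p - connection Y X p = lie_bracket R X Y p"
proof (rule mat_eq_blockI[of _ k d d])
  have c: "mat_diff_along M V p Z \<in> carrier_mat (k * d) d" if "V \<in> vector_fields R" for V Z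
    using carrier_matD[OF vector_fieldsD(3)[OF that p]] by (simp add: mat_diff_along_def)
  show "connection X Y p - connection Y X p \<in> carrier_mat (k * d) d"
    by (simp add: connection_def minus_carrier_mat)
  show "lie_bracket R X Y p \<in> carrier_mat (k * d) d"
    using c[OF X] by (simp add: lie_bracket_def minus_carrier_mat)
  fix i a b assume i: "i < k" "a < d" "b < d"
  note ix = block_index_less[OF i(1,2)]
  have d: "mat_diff_along M V p Z $$ (i * d + a, b) = diff_along M (\<lambda>q. V q $$ (i * d + a, b)) p Z"
    if "V \<in> vector_fields R" for V Z
    using carrier_matD[OF vector_fieldsD(3)[OF that p]] ix i by (simp add: mat_diff_along_def)
  have "lie_bracket R X Y p $$ (i * d + a, b)
      = diff_along M (\<lambda>q. Y q $$ (i * d + a, b)) p (X p) - diff_along M (\<lambda>q. X q $$ (i * d + a, b)) p (Y p)"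
    using carrier_matD[OF c[OF X]] ix i by (simp add: lie_bracket_def d[OF X] d[OF Y])
  also have "\<dots> = (\<Sum>e<d. p $$ (i * d + a, e) * (coord_deriv X Y p i e b - coord_deriv Y X p i e b
      + fam_comm d (frame_coord d p (X p) i) (frame_coord d p (Y p) i) e b))"
    unfolding diff_along_field_entry[OF X Y p i] diff_along_field_entry[OF Y X p i] sum_subtractf[symmetric]
    by (intro sum.cong refl) (simp add: fam_comm_def sum_subtractf algebra_simps)
  also have "\<dots> = (connection X Y p - connection Y X p) $$ (i * d + a, b)"
    unfolding connection_def frame_field_diff[OF orth_powerD(1)[OF p]] frame_field_index[OF orth_powerD(1)[OF p] i]
    by (intro sum.cong refl arg_cong2[where f="(*)"]) (simp flip: lc_term_torsion[where k=k])
  finally show "(connection X Y p - connection Y X p) $$ (i * d + a, b) = lie_bracket R X Y p $$ (i * d + a, b)" by simp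
qed

lemma connection_coord:
  assumes "p \<in> M" "i < k" "a < d" "b < d"
  shows "frame_coord d p (connection X Y p) i a b = coord_deriv X Y p i a b
     + lc_term d k (frame_coord d p (X p)) (frame_coord d p (Y p)) i a b"
  unfolding connection_def using assms by (rule frame_coord_frame_field)

text \<open>The metric has constant coefficients in frame coordinates, so its derivative only
  involves the derivatives of the coordinates; the \<open>lc_term\<close> contributions of the two
  fields cancel by skewness.\<close>

lemma connection_metric:
  assumes X: "X \<in> vector_fields R" and Y: "Y \<in> vector_fields R" and V: "V \<in> vector_fields R" and p: "p \<in> M"
  shows "diff_along M (\<lambda>q. mmetric R q (Y q) (V q)) p (X p)
    = mmetric R p (connection X Y p) (V p) + mmetric R p (Y p) (connection X V p)"
proof -
  note x = vector_fieldsD(1)[OF X p]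
  have "diff_along M (\<lambda>q. mmetric R q (Y q) (V q)) p (X p)
      = diff_along M (\<lambda>q. frame_metric d k (frame_coord d q (Y q)) (frame_coord d q (V q))) p (X p)"
    by (rule diff_along_cong) (rule metric_eq; simp add: vector_fieldsD(1) Y V)
  also have "\<dots> = frame_metric d k (coord_deriv X Y p) (frame_coord d p (V p)) + frame_metric d k (frame_coord d p (Y p)) (coord_deriv X V p)"
  proof (rule diff_along_eqI[OF p x])
    fix c assume c: "curve_through M p (X p) c"
    hence c0: "c 0 = p" by (simp add: curve_through_def)
    show "((\<lambda>t. frame_metric d k (frame_coord d (c t) (Y (c t))) (frame_coord d (c t) (V (c t)))) has_real_derivative
       frame_metric d k (coord_deriv X Y p) (frame_coord d p (V p)) + frame_metric d k (frame_coord d p (Y p)) (coord_deriv X V p)) (at 0)"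
      using DERIV_frame_metric[of k d "\<lambda>t. frame_coord d (c t) (Y (c t))" "coord_deriv X Y p" 0
          "\<lambda>t. frame_coord d (c t) (V (c t))" "coord_deriv X V p"]
        has_derivative_along[OF coord_smooth[OF Y] p x c] has_derivative_along[OF coord_smooth[OF V] p x c]
      unfolding coord_deriv_def c0 by blast
  qed
  also have "\<dots> = mmetric R p (connection X Y p) (V p) + mmetric R p (Y p) (connection X V p)"
  proof -
    note t = vector_fieldsD(1)[OF connection_vector_field[OF X Y] p] vector_fieldsD(1)[OF connection_vector_field[OF X V] p]
    let ?x = "frame_coord d p (X p)" and ?y = "frame_coord d p (Y p)" and ?v = "frame_coord d p (V p)"
    have "mmetric R p (connection X Y p) (V p)
        = frame_metric d k (\<lambda>i a b. coord_deriv X Y p i a b + lc_term d k ?x ?y i a b) ?v"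
      unfolding metric_eq[OF p t(1) vector_fieldsD(1)[OF V p]]
      by (rule frame_metric_cong) (simp_all add: connection_coord[OF p])
    moreover have "mmetric R p (Y p) (connection X V p)
        = frame_metric d k (\<lambda>i a b. coord_deriv X V p i a b + lc_term d k ?x ?v i a b) ?y"
      unfolding metric_eq[OF p vector_fieldsD(1)[OF Y p] t(2)] frame_metric_commute[of d k ?y]
      by (rule frame_metric_cong) (simp_all add: connection_coord[OF p])
    ultimately show ?thesis
      using frame_metric_lc_term_skew[OF vector_fieldsD(4)[OF X p] vector_fieldsD(4)[OF Y p] vector_fieldsD(4)[OF V p]]
      by (simp add: frame_metric_add frame_metric_commute[of d k ?y])
  qed
  finally show ?thesis .
qed

theorem levi_civita_connection: "levi_civita R connection"
  unfolding levi_civita_def R_simps smooth_functions_iff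
  by (intro conjI ballI allI connection_vector_field connection_linear_left connection_linear_right
      connection_leibniz connection_torsion connection_metric) (simp_all add: smooth_functions_iff)

end

section \<open>Gradient and Hessian\<close>

context orth_quot begin

lemma metric_linear_left:
  assumes p: "p \<in> M" and Z: "Z \<in> T p" and W: "W \<in> T p" and V: "V \<in> T p"
  shows "mmetric R p (u \<cdot>\<^sub>m Z + v \<cdot>\<^sub>m W) V = u * mmetric R p Z V + v * mmetric R p W V"
proof -
  let ?z = "frame_coord d p Z" and ?w = "frame_coord d p W" and ?v = "frame_coord d p V"
  have s: "frame_metric d k (\<lambda>i a b. r * x i a b) y = r * frame_metric d k x y" for r x y
  proof -
    have "fam_sum k (\<lambda>i a b. r * x i a b) = (\<lambda>a b. r * fam_sum k x a b)"
      by (simp add: fam_sum_def fun_eq_iff sum_distrib_left)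
    thus ?thesis unfolding frame_metric_def
      by (simp add: fam_inner_scale sum_distrib_left[symmetric] right_diff_distrib)
  qed
  have "mmetric R p (u \<cdot>\<^sub>m Z + v \<cdot>\<^sub>m W) V = frame_metric d k (\<lambda>i a b. u * ?z i a b + v * ?w i a b) ?v"
    unfolding metric_eq[OF p orth_tangent_linear[OF p Z W] V]
    using orth_tangentD(3)[OF p Z] orth_tangentD(3)[OF p W]
    by (intro frame_metric_cong refl frame_coord_linear) auto
  thus ?thesis by (simp add: frame_metric_add s metric_eq[OF p] Z W V)
qed

lemma skew_family_raise:
  assumes "skew_family d k h" shows "skew_family d k (\<lambda>i a b. h i a b + fam_sum k h a b)"
  unfolding skew_family_def
proof (intro allI impI)
  fix i a b assume i: "i < k" "a < d" "b < d"
  show "h i a b + fam_sum k h a b = - (h i b a + fam_sum k h b a)"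
    using skew_familyD[OF assms i] fam_sum_skew[OF assms i(2,3)] by simp
qed

lemma zero_tangent: "0\<^sub>m (k * d) d = frame_field d k (\<lambda>i a b. 0) p" if "p \<in> M"
  by (rule mat_eq_blockI[of _ k d d]) (simp_all add: frame_field_index[OF orth_powerD(1)[OF that]] block_index_less)

text \<open>Pairing \<open>Z\<close> with the raised family of its own coordinates gives the plain
  sum of their squares.\<close>

lemma metric_nondegenerate:
  assumes p: "p \<in> M" and Z: "Z \<in> T p" and 0: "\<And>W. W \<in> T p \<Longrightarrow> mmetric R p Z W = 0"
  shows "Z = 0\<^sub>m (k * d) d"
proof -
  define z where "z = frame_coord d p Z"
  note z = orth_tangentD(1,2)[OF p Z, folded z_def]
  define w where "w = (\<lambda>i a b. z i a b + fam_sum k z a b)"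
  have W: "frame_field d k w p \<in> T p"
    unfolding w_def by (rule frame_field_tangent[OF skew_family_raise[OF z(1)]])
  have "0 = frame_metric d k (frame_coord d p (frame_field d k w p)) z"
    using 0[OF W] unfolding metric_eq[OF p Z W] z_def by (simp add: frame_metric_commute)
  also have "\<dots> = frame_metric d k w z"
    by (rule frame_metric_cong) (simp_all add: frame_coord_frame_field[OF p])
  also have "\<dots> = (\<Sum>i<k. \<Sum>a<d. \<Sum>b<d. z i a b * z i a b)"
    unfolding w_def frame_metric_raise fam_inner_def ..
  finally have s: "(\<Sum>i<k. \<Sum>a<d. \<Sum>b<d. z i a b * z i a b) = 0" by simp
  have "z i a b = 0" if i: "i < k" "a < d" "b < d" for i a b
  proof -
    have "z i a b * z i a b \<le> (\<Sum>b<d. z i a b * z i a b)" using i by (intro member_le_sum) auto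
    also have "\<dots> \<le> (\<Sum>a<d. \<Sum>b<d. z i a b * z i a b)"
      using i by (intro member_le_sum) (auto intro: sum_nonneg)
    also have "\<dots> \<le> (\<Sum>i<k. \<Sum>a<d. \<Sum>b<d. z i a b * z i a b)"
      using i by (intro member_le_sum) (auto intro!: sum_nonneg)
    finally show ?thesis using s by (simp add: mult_le_0_iff) linarith
  qed
  hence "frame_field d k z p = frame_field d k (\<lambda>i a b. 0) p"
    by (intro frame_field_cong[OF orth_powerD(1)[OF p]]) auto
  thus ?thesis using z(2) zero_tangent[OF p] by simp
qed

text \<open>The ambient gradient is brought to frame coordinates and reduced to its skew part
  \<open>h\<close>, which represents the differential for the sum of Frobenius products; adding
  \<open>fam_sum k h\<close> represents it for the frame metric. The formula is smooth in the point,
  so the gradient is a vector field to which a connection applies.\<close>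

lemma riem_grad:
  assumes f: "sm f"
  shows "riem_grad R f \<in> vector_fields R"
    and "\<And>q Z. q \<in> M \<Longrightarrow> Z \<in> T q \<Longrightarrow> mmetric R q (riem_grad R f q) Z = diff_along M f q Z"
proof -
  obtain G where G: "\<And>p. p \<in> M \<Longrightarrow> G p \<in> carrier_mat (k * d) d"
    "\<And>p Z. p \<in> M \<Longrightarrow> Z \<in> T p \<Longrightarrow> diff_along M f p Z = frob_inner (G p) Z"
    "\<And>i j. i < k * d \<Longrightarrow> j < d \<Longrightarrow> sm (\<lambda>p. G p $$ (i,j))"
    using smooth_on_grad[OF f] by metis
  define h where "h = (\<lambda>q i a b. (frame_coord d q (G q) i a b - frame_coord d q (G q) i b a) / 2)"
  define g where "g = (\<lambda>q. frame_field d k (\<lambda>i a b. h q i a b + fam_sum k (h q) a b) q)"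
  have hs: "skew_family d k (h q)" for q by (simp add: skew_family_def h_def field_simps)
  have hsm: "sm (\<lambda>q. h q i a b)" if "i < k" "a < d" "b < d" for i a b
  proof -
    have "sm (\<lambda>q. (1/2) * (frame_coord d q (G q) i a b - frame_coord d q (G q) i b a))"
      using that G(3) by (intro smooth_on_mult smooth_on_const smooth_on_diff smooth_on_frame_coord) auto
    thus ?thesis by (simp add: h_def)
  qed
  have gv: "g \<in> vector_fields R"
    unfolding g_def
  proof (rule frame_field_vector_field)
    show "sm (\<lambda>q. h q i a b + fam_sum k (h q) a b)" if "i < k" "a < d" "b < d" for i a b
      unfolding fam_sum_def using that hsm by (intro smooth_on_add smooth_on_sum) auto
  qed (rule skew_family_raise[OF hs])
  have gm: "mmetric R q (g q) Z = diff_along M f q Z" if q: "q \<in> M" and Z: "Z \<in> T q" for q Z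
  proof -
    define z where "z = frame_coord d q Z"
    note z = orth_tangentD(1,2)[OF q Z, folded z_def]
    have "mmetric R q (g q) Z = frame_metric d k (\<lambda>i a b. h q i a b + fam_sum k (h q) a b) z"
      unfolding metric_eq[OF q vector_fieldsD(1)[OF gv q] Z] z_def[symmetric]
      by (rule frame_metric_cong) (simp_all add: g_def frame_coord_frame_field[OF q])
    also have "\<dots> = (\<Sum>i<k. fam_inner d (frame_coord d q (G q) i) (z i))"
      unfolding frame_metric_raise h_def
      by (intro sum.cong refl fam_inner_skew_part skew_familyD[OF z(1)]) auto
    also have "\<dots> = diff_along M f q Z"
      unfolding G(2)[OF q Z] using frob_inner_frame_field[OF G(1)[OF q] orth_powerD(1)[OF q], of z] z(2) by simp
    finally show ?thesis .
  qed
  \<comment> \<open>Uniqueness for the description of the gradient: two candidates differ by a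
    tangent vector orthogonal to the whole tangent space.\<close>
  have eq: "riem_grad R f q = g q" if q: "q \<in> M" for q
    unfolding riem_grad_def R_simps
  proof (rule the_equality)
    show "g q \<in> T q \<and> (\<forall>Z\<in>T q. mmetric R q (g q) Z = diff_along M f q Z)"
      using gm[OF q] vector_fieldsD(1)[OF gv q] by blast
  next
    fix Y assume Y: "Y \<in> T q \<and> (\<forall>Z\<in>T q. mmetric R q Y Z = diff_along M f q Z)"
    note gT = vector_fieldsD(1)[OF gv q]
    have "1 \<cdot>\<^sub>m Y + (-1) \<cdot>\<^sub>m g q = 0\<^sub>m (k * d) d"
    proof (rule metric_nondegenerate[OF q])
      show "1 \<cdot>\<^sub>m Y + (-1) \<cdot>\<^sub>m g q \<in> T q" using Y gT by (intro orth_tangent_linear[OF q]) auto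
      show "mmetric R q (1 \<cdot>\<^sub>m Y + (-1) \<cdot>\<^sub>m g q) W = 0" if "W \<in> T q" for W
        using Y gm[OF q that] that by (subst metric_linear_left[OF q _ gT that]) auto
    qed
    hence e: "(1 \<cdot>\<^sub>m Y + (-1) \<cdot>\<^sub>m g q) $$ (r,b) = 0" if "r < k * d" "b < d" for r b using that by simp
    have c: "Y \<in> carrier_mat (k * d) d" "g q \<in> carrier_mat (k * d) d"
      using orth_tangentD(3)[OF q] Y gT by auto
    show "Y = g q"
    proof (rule eq_matI)
      fix r b assume "r < dim_row (g q)" "b < dim_col (g q)"
      thus "Y $$ (r,b) = g q $$ (r,b)" using e[of r b] c by simp
    qed (use c in auto)
  qed
  show "mmetric R q (riem_grad R f q) Z = diff_along M f q Z" if "q \<in> M" "Z \<in> T q" for q Z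
    using gm that eq by simp
  have "sm (\<lambda>q. riem_grad R f q $$ (r,b))" if "r < k * d" "b < d" for r b
    using vector_fieldsD(2)[OF gv that] eq by (subst smooth_on_cong[of _ _ "\<lambda>q. g q $$ (r,b)"]) auto
  thus "riem_grad R f \<in> vector_fields R"
    using vector_fieldsD(1)[OF gv] eq by (auto simp: vector_fields_def smooth_functions_def)
qed

lemma riem_grad_zero:
  assumes f: "sm f" and p: "p \<in> M" and crit: "riem_grad R f p = 0\<^sub>m (k * d) d" and Z: "Z \<in> T p"
  shows "mmetric R p (riem_grad R f p) Z = 0" "diff_along M f p Z = 0"
proof -
  have "frame_coord d p (riem_grad R f p) i a b = 0" if "i < k" "a < d" "b < d" for i a b
    unfolding crit frame_coord_def using that by (simp add: block_index_less)
  hence "frame_metric d k (frame_coord d p (riem_grad R f p)) (frame_coord d p Z)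
      = frame_metric d k (\<lambda>i a b. 0) (frame_coord d p Z)"
    by (intro frame_metric_cong) auto
  thus "mmetric R p (riem_grad R f p) Z = 0"
    unfolding metric_eq[OF p vector_fieldsD(1)[OF riem_grad(1)[OF f] p] Z]
    by (simp add: frame_metric_def fam_inner_def fam_sum_def)
  thus "diff_along M f p Z = 0" using riem_grad(2)[OF f p Z] by simp
qed

text \<open>
  At a critical point metric compatibility alone determines the Hessian, whichever Levi-Civita
  connection and extension of \<open>Z\<close> are chosen.
\<close>
theorem riem_hess_critical:
  assumes f: "sm f" and p: "p \<in> M" and crit: "riem_grad R f p = 0\<^sub>m (k * d) d"
    and Z: "Z \<in> T p" and w: "skew_family d k w"
  shows "riem_hess R f p Z \<in> T p"
    and "mmetric R p (riem_hess R f p Z) (frame_field d k w p)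
      = diff_along M (\<lambda>q. diff_along M f q (frame_field d k w q)) p Z"
proof -
  define D where "D = (SOME nabla. levi_civita R nabla)"
  \<comment> \<open>The explicit connection is the witness that makes the chosen one satisfy the
    axioms.\<close>
  have D: "levi_civita R D" unfolding D_def by (rule someI[of _ connection]) (rule levi_civita_connection)
  define X where "X = (SOME X. X \<in> vector_fields R \<and> X p = Z)"
  \<comment> \<open>A tangent vector extends to the field with constant frame coordinates.\<close>
  have "X \<in> vector_fields R \<and> X p = Z"
    unfolding X_def
  proof (rule someI[of _ "\<lambda>q. frame_field d k (frame_coord d p Z) q"], intro conjI)
    show "(\<lambda>q. frame_field d k (frame_coord d p Z) q) \<in> vector_fields R"
      by (rule frame_field_vector_field) (auto intro: orth_tangentD(1)[OF p Z])
    show "frame_field d k (frame_coord d p Z) p = Z" by (rule orth_tangentD(2)[OF p Z])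
  qed
  hence X: "X \<in> vector_fields R" "X p = Z" by auto
  define V where "V = (\<lambda>q. frame_field d k w q)"
  have V: "V \<in> vector_fields R" unfolding V_def by (rule frame_field_vector_field) (auto intro: w)
  note g = riem_grad(1)[OF f]
  have h: "riem_hess R f p Z = D X (riem_grad R f) p"
    unfolding riem_hess_def Let_def D_def X_def ..
  have Dv: "D X Y \<in> vector_fields R" if "Y \<in> vector_fields R" for Y
  proof -
    have "\<forall>X\<in>vector_fields R. \<forall>Y\<in>vector_fields R. D X Y \<in> vector_fields R"
      using D unfolding levi_civita_def by (rule conjunct1)
    thus ?thesis using X(1) that by blast
  qed
  show "riem_hess R f p Z \<in> T p" unfolding h by (rule vector_fieldsD(1)[OF Dv[OF g] p])
  have "diff_along M (\<lambda>q. mmetric R q (riem_grad R f q) (V q)) p (X p)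
      = mmetric R p (D X (riem_grad R f) p) (V p) + mmetric R p (riem_grad R f p) (D X V p)"
  proof -
    have "\<forall>X\<in>vector_fields R. \<forall>Y\<in>vector_fields R. \<forall>V\<in>vector_fields R. \<forall>p\<in>M.
        diff_along M (\<lambda>q. mmetric R q (Y q) (V q)) p (X p)
          = mmetric R p (D X Y p) (V p) + mmetric R p (Y p) (D X V p)"
      using D unfolding levi_civita_def R_simps by (elim conjE) assumption
    thus ?thesis using X(1) g V p by blast
  qed
  moreover have "mmetric R p (riem_grad R f p) (D X V p) = 0"
    by (rule riem_grad_zero(1)[OF f p crit vector_fieldsD(1)[OF Dv[OF V] p]])
  moreover have "diff_along M (\<lambda>q. mmetric R q (riem_grad R f q) (V q)) p (X p) = diff_along M (\<lambda>q. diff_along M f q (V q)) p (X p)"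
    by (rule diff_along_cong) (rule riem_grad(2)[OF f]; simp add: vector_fieldsD(1)[OF V])
  ultimately show "mmetric R p (riem_hess R f p Z) (frame_field d k w p)
      = diff_along M (\<lambda>q. diff_along M f q (frame_field d k w q)) p Z"
    by (simp add: h X(2) V_def)
qed

end

section \<open>The bilinear form of the matrix L(S)\<close>

lemma block_diag_carrier:
  assumes "\<And>i. i < m \<Longrightarrow> A i \<in> carrier_mat d d"
  shows "block_diag m A \<in> carrier_mat (m * d) (m * d)"
  using assms
proof (induction m)
  case (Suc m)
  have e: "block_diag (Suc m) A = four_block_mat (block_diag m A) (0\<^sub>m (dim_row (block_diag m A)) (dim_col (A m)))
      (0\<^sub>m (dim_row (A m)) (dim_col (block_diag m A))) (A m)"
    by (simp add: block_diag_def diag_block_mat_last Let_def)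
  have "block_diag m A \<in> carrier_mat (m * d) (m * d)" "A m \<in> carrier_mat d d" using Suc by auto
  thus ?case unfolding e using four_block_carrier_mat[of "block_diag m A" "m * d" "m * d" "A m" d d]
    by (simp add: add.commute)
qed (simp add: block_diag_def)

lemma block_diag_index:
  assumes "\<And>i. i < m \<Longrightarrow> A i \<in> carrier_mat d d" "i < m" "j < m" "a < d" "b < d"
  shows "block_diag m A $$ (i * d + a, j * d + b) = (if i = j then A i $$ (a,b) else 0)"
  using assms
proof (induction m)
  case (Suc m)
  have e: "block_diag (Suc m) A = four_block_mat (block_diag m A) (0\<^sub>m (dim_row (block_diag m A)) (dim_col (A m)))
      (0\<^sub>m (dim_row (A m)) (dim_col (block_diag m A))) (A m)"
    by (simp add: block_diag_def diag_block_mat_last Let_def)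
  have c: "block_diag m A \<in> carrier_mat (m * d) (m * d)" "A m \<in> carrier_mat d d"
    using Suc block_diag_carrier[of m A d] by auto
  have ij: "i * d + a < Suc m * d" "j * d + b < Suc m * d"
    using Suc.prems by (auto intro: block_index_less simp del: mult_Suc)
  have lt: "l * d + x < m * d \<longleftrightarrow> l < m" if "l < Suc m" "x < d" for l x
    using that block_index_less[of l m x d] by (cases "l = m") auto
  show ?case
    unfolding e using ij carrier_matD[OF c(1)] carrier_matD[OF c(2)] Suc.prems(2-5) lt[of i a] lt[of j b] Suc.IH[OF Suc.prems(1)]
    by (cases "i < m"; cases "j < m") (auto simp: less_Suc_eq)
qed simp

lemma block_diag_mult_vstack:
  assumes d: "0 < d" and A: "\<And>i. i < m \<Longrightarrow> A i \<in> carrier_mat d d" and y: "\<And>i. i < m \<Longrightarrow> y i \<in> carrier_mat d d"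
  shows "block_diag m A * vstack d m y = vstack d m (\<lambda>i. A i * y i)"
proof (rule mat_eq_blockI[of _ m d d])
  show "block_diag m A * vstack d m y \<in> carrier_mat (m * d) d"
    using block_diag_carrier[of m A d] A by (intro mult_carrier_mat) auto
  fix i a b assume i: "i < m" "a < d" "b < d"
  have "(block_diag m A * vstack d m y) $$ (i * d + a, b)
      = (\<Sum>r<m * d. block_diag m A $$ (i * d + a, r) * vstack d m y $$ (r, b))"
    using block_diag_carrier[of m A d, OF A] i block_index_less[OF i(1,2)]
    by (simp add: scalar_prod_def atLeast0LessThan)
  also have "\<dots> = (\<Sum>j<m. \<Sum>c<d. (if j = i then A i $$ (a,c) * y i $$ (c,b) else 0))"
    unfolding sum_block_index[OF d] using i
    by (intro sum.cong refl) (auto simp: block_diag_index[of m A d, OF A])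
  also have "\<dots> = (\<Sum>c<d. A i $$ (a,c) * y i $$ (c,b))"
    using i by (subst sum.swap) simp
  finally show "(block_diag m A * vstack d m y) $$ (i * d + a, b) = vstack d m (\<lambda>i. A i * y i) $$ (i * d + a, b)"
    using i A[OF i(1)] y[OF i(1)] by (simp add: scalar_prod_def atLeast0LessThan)
qed simp

definition block_mult :: "nat \<Rightarrow> nat \<Rightarrow> real mat \<Rightarrow> (nat \<Rightarrow> real mat) \<Rightarrow> real mat" where
  "block_mult d m S y = vstack d m (\<lambda>i. row_block d S i * y i)"

text \<open>Summing the blocks \<open>S\<^sub>i\<^sup>T C\<^sub>i\<^sub>j S\<^sub>j\<close> over
  \<open>j\<close> collapses to this product, so it is the diagonal block \<open>i\<close> of
  \<open>C_hat_at\<close>.\<close>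

definition C_hat_block :: "nat \<Rightarrow> real mat \<Rightarrow> real mat \<Rightarrow> nat \<Rightarrow> real mat" where
  "C_hat_block d C S i = (row_block d S i)\<^sup>T * row_block d (C * S) i"

text \<open>The form \<open>tr(Y\<^sup>T L(S) Z)\<close> with the block-diagonal factors moved onto
  the families; \<open>L_at_form\<close> identifies the two.\<close>

definition L_form :: "nat \<Rightarrow> nat \<Rightarrow> real mat \<Rightarrow> real mat \<Rightarrow> (nat \<Rightarrow> real mat) \<Rightarrow> (nat \<Rightarrow> real mat) \<Rightarrow> real" where
  "L_form d m C S y z = frob_inner (block_mult d m S y) (C * block_mult d m S z)
     - (\<Sum>i<m. frob_inner (y i) (C_hat_block d C S i * z i))"

lemma block_mult_carrier [simp]: "block_mult d m S y \<in> carrier_mat (m * d) d"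
  by (simp add: block_mult_def)

lemma frob_inner_adjoint:
  assumes "A \<in> carrier_mat n c" "N \<in> carrier_mat n l" "B \<in> carrier_mat l c"
  shows "frob_inner A (N * B) = frob_inner (N\<^sup>T * A) B"
  unfolding frob_inner_def using assms
  by (simp add: transpose_mult[of _ l n _ c] assoc_mult_mat[of _ c n _ l _ c])

context
  fixes d m :: nat and C S :: "real mat"
  assumes d: "0 < d" and C: "C \<in> carrier_mat (m * d) (m * d)" and S: "S \<in> carrier_mat (m * d) d"
begin

lemma block_diag_row_blocks_carrier: "block_diag m (row_block d S) \<in> carrier_mat (m * d) (m * d)"
  using S by (intro block_diag_carrier) auto

lemma row_block_mult_carrier: "row_block d (C * S) i \<in> carrier_mat d d"
  by (rule row_block_carrier[OF mult_carrier_mat[OF C S]])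

lemma C_hat_block_carrier: "C_hat_block d C S i \<in> carrier_mat d d"
  unfolding C_hat_block_def using S row_block_mult_carrier by (intro mult_carrier_mat[of _ d d]) auto

lemma C_at_carrier: "C_at d m C S \<in> carrier_mat (m * d) (m * d)"
  unfolding C_at_def using block_diag_row_blocks_carrier C by (intro mult_carrier_mat[of _ "m * d" "m * d"]) auto

lemma C_at_mult:
  assumes y: "\<And>i. i < m \<Longrightarrow> y i \<in> carrier_mat d d"
  shows "C_at d m C S * vstack d m y = (block_diag m (row_block d S))\<^sup>T * (C * block_mult d m S y)"
proof -
  let ?B = "block_diag m (row_block d S)"
  have "C_at d m C S * vstack d m y = ?B\<^sup>T * (C * (?B * vstack d m y))"
    unfolding C_at_def using block_diag_row_blocks_carrier C
    by (simp add: assoc_mult_mat[of _ "m * d" "m * d" _ "m * d" _ d] assoc_mult_mat[of _ "m * d" "m * d" _ "m * d" _ "m * d"]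
        mult_carrier_mat[of _ "m * d" "m * d" _ d] mult_carrier_mat[of _ "m * d" "m * d" _ "m * d"])
  also have "?B * vstack d m y = block_mult d m S y"
    unfolding block_mult_def using S y by (intro block_diag_mult_vstack[OF d]) auto
  finally show ?thesis .
qed

text \<open>The block row sums of \<open>C(S)\<close> are obtained by multiplying it with a stack of
  identity matrices, and the block-diagonal matrix of \<open>S\<close> sends that stack to
  \<open>S\<close> itself.\<close>

lemma C_hat_at_eq: "C_hat_at d m C S = block_diag m (C_hat_block d C S)"
proof -
  have "mat_sum d d (\<lambda>j. mat_block d (C_at d m C S) i j) {..<m} = C_hat_block d C S i" if i: "i < m" for i
  proof (rule eq_matI)
    fix a b assume "a < dim_row (C_hat_block d C S i)" "b < dim_col (C_hat_block d C S i)"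
    hence ab: "a < d" "b < d" using carrier_matD[OF C_hat_block_carrier[of i]] by auto
    let ?J = "vstack d m (\<lambda>_. 1\<^sub>m d)" and ?B = "block_diag m (row_block d S)"
    have "mat_sum d d (\<lambda>j. mat_block d (C_at d m C S) i j) {..<m} $$ (a,b) = (\<Sum>j<m. C_at d m C S $$ (i * d + a, j * d + b))"
      using ab by (simp add: mat_block_def)
    also have "\<dots> = (\<Sum>j<m. \<Sum>c<d. C_at d m C S $$ (i * d + a, j * d + c) * ?J $$ (j * d + c, b))"
      using ab by (intro sum.cong refl) (simp add: if_distrib[of "\<lambda>x. _ * x"] cong: if_cong)
    also have "\<dots> = (C_at d m C S * ?J) $$ (i * d + a, b)"
      using C_at_carrier i ab block_index_less[OF i ab(1)] sum_block_index[OF d, of "\<lambda>r. C_at d m C S $$ (i * d + a, r) * ?J $$ (r, b)" m]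
      by (simp add: scalar_prod_def atLeast0LessThan)
    also have "C_at d m C S * ?J = ?B\<^sup>T * (C * S)"
    proof -
      have "block_mult d m S (\<lambda>_. 1\<^sub>m d) = S"
        unfolding block_mult_def using S vstack_row_block[OF S]
        by (simp add: right_mult_one_mat[OF row_block_carrier[OF S]])
      thus ?thesis by (subst C_at_mult) auto
    qed
    also have "(?B\<^sup>T * (C * S)) $$ (i * d + a, b) = (\<Sum>r<m * d. ?B $$ (r, i * d + a) * (C * S) $$ (r, b))"
    proof -
      have "C * S \<in> carrier_mat (m * d) d" using C S by auto
      thus ?thesis using block_diag_row_blocks_carrier i ab block_index_less[OF i ab(1)]
        by (simp add: index_mult_mat(1)[of _ "?B\<^sup>T"] scalar_prod_def atLeast0LessThan del: index_mult_mat)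
    qed
    also have "\<dots> = (\<Sum>j<m. \<Sum>c<d. if j = i then row_block d S i $$ (c,a) * row_block d (C * S) i $$ (c,b) else 0)"
      unfolding sum_block_index[OF d] using i ab S C
      by (intro sum.cong refl) (auto simp: block_diag_index[of m "row_block d S" d] simp del: index_mult_mat(1))
    also have "\<dots> = (\<Sum>c<d. row_block d S i $$ (c,a) * row_block d (C * S) i $$ (c,b))"
      using i by (subst sum.swap) simp
    also have "\<dots> = C_hat_block d C S i $$ (a,b)"
    proof -
      show ?thesis unfolding C_hat_block_def using row_block_carrier[OF S, of d i] row_block_mult_carrier[of i] ab
        by (simp add: index_mult_mat(1)[of _ "(row_block d S i)\<^sup>T"] scalar_prod_def atLeast0LessThan del: index_mult_mat row_block_index)
    qed
    finally show "mat_sum d d (\<lambda>j. mat_block d (C_at d m C S) i j) {..<m} $$ (a,b) = C_hat_block d C S i $$ (a,b)" .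
  qed (use carrier_matD[OF C_hat_block_carrier[of i]] in \<open>auto simp: mat_sum_def\<close>)
  hence "map (\<lambda>i. mat_sum d d (\<lambda>j. mat_block d (C_at d m C S) i j) {..<m}) [0..<m] = map (C_hat_block d C S) [0..<m]"
    by simp
  thus ?thesis unfolding C_hat_at_def block_diag_def by (rule arg_cong[where f=diag_block_mat])
qed

lemma L_at_carrier: "L_at d m C S \<in> carrier_mat (m * d) (m * d)"
  unfolding L_at_def C_hat_at_eq using block_diag_carrier[of m "C_hat_block d C S" d] C_hat_block_carrier
  by (auto intro!: minus_carrier_mat)

theorem L_at_form:
  assumes y: "\<And>i. i < m \<Longrightarrow> y i \<in> carrier_mat d d" and z: "\<And>i. i < m \<Longrightarrow> z i \<in> carrier_mat d d"
  shows "mat_tr ((vstack d m y)\<^sup>T * L_at d m C S * vstack d m z) = L_form d m C S y z"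
proof -
  let ?B = "block_diag m (row_block d S)" and ?Y = "vstack d m y" and ?Z = "vstack d m z"
  have H: "C_hat_at d m C S \<in> carrier_mat (m * d) (m * d)"
    unfolding C_hat_at_eq using block_diag_carrier[of m "C_hat_block d C S" d] C_hat_block_carrier by auto
  have BY: "?B * ?Y = block_mult d m S y"
    unfolding block_mult_def using S y by (intro block_diag_mult_vstack[OF d]) auto
  have CZ: "C * block_mult d m S z \<in> carrier_mat (m * d) d" using C by auto
  have CZ': "C_at d m C S * ?Z = ?B\<^sup>T * (C * block_mult d m S z)" by (rule C_at_mult) (rule z)
  have "L_at d m C S * ?Z = ?B\<^sup>T * (C * block_mult d m S z) - vstack d m (\<lambda>i. C_hat_block d C S i * z i)"
    unfolding L_at_def minus_mult_distrib_mat[OF C_at_carrier H vstack_carrier] CZ'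
    unfolding C_hat_at_eq by (simp add: block_diag_mult_vstack[OF d C_hat_block_carrier z])
  hence "mat_tr (?Y\<^sup>T * L_at d m C S * ?Z)
      = frob_inner ?Y (?B\<^sup>T * (C * block_mult d m S z) - vstack d m (\<lambda>i. C_hat_block d C S i * z i))"
    unfolding frob_inner_def using assoc_mult_mat[OF _ L_at_carrier vstack_carrier, of "?Y\<^sup>T" d] by simp
  also have "\<dots> = frob_inner ?Y (?B\<^sup>T * (C * block_mult d m S z)) - frob_inner ?Y (vstack d m (\<lambda>i. C_hat_block d C S i * z i))"
  proof -
    have c: "?B\<^sup>T * (C * block_mult d m S z) \<in> carrier_mat (m * d) d" using block_diag_row_blocks_carrier CZ by auto
    have "frob_inner A (X - W) = frob_inner A X - frob_inner A W"
      if "A \<in> carrier_mat (m * d) d" "X \<in> carrier_mat (m * d) d" "W \<in> carrier_mat (m * d) d" for A X W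
      using that by (subst (1 2 3) frob_inner_eq[of _ "m * d" d])
        (auto simp: minus_carrier_mat right_diff_distrib sum_subtractf[symmetric] intro!: sum.cong)
    thus ?thesis using c by auto
  qed
  also have "frob_inner ?Y (?B\<^sup>T * (C * block_mult d m S z)) = frob_inner (block_mult d m S y) (C * block_mult d m S z)"
    using frob_inner_adjoint[of ?Y "m * d" d "?B\<^sup>T" "m * d" "C * block_mult d m S z"] block_diag_row_blocks_carrier CZ BY by simp
  also have "frob_inner ?Y (vstack d m (\<lambda>i. C_hat_block d C S i * z i)) = (\<Sum>i<m. frob_inner (y i) (C_hat_block d C S i * z i))"
    using y z C_hat_block_carrier by (intro frob_inner_vstack mult_carrier_mat[of _ d d]) auto
  finally show ?thesis by (simp add: L_form_def)
qed

end

section \<open>The form on families for a symmetric stress matrix\<close>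

lemma row_block_mult:
  assumes "X \<in> carrier_mat (m * d) c" "V \<in> carrier_mat c e" "i < m"
  shows "row_block d (X * V) i = row_block d X i * V"
proof (rule eq_matI)
  fix a b assume "a < dim_row (row_block d X i * V)" "b < dim_col (row_block d X i * V)"
  hence ab: "a < d" "b < e" using assms by (auto simp: row_block_def)
  show "row_block d (X * V) i $$ (a,b) = (row_block d X i * V) $$ (a,b)"
    using assms ab block_index_less[OF assms(3) ab(1)]
    by (simp add: row_block_def scalar_prod_def)
qed (use assms in \<open>auto simp: row_block_def\<close>)

lemma transpose_mult_index:
  assumes "X \<in> carrier_mat m n" "Y \<in> carrier_mat m l" "a < n" "b < l"
  shows "(X\<^sup>T * Y) $$ (a,b) = (\<Sum>c<m. X $$ (c,a) * Y $$ (c,b))"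
  using assms by (simp add: scalar_prod_def atLeast0LessThan)

lemma block_mult_const:
  assumes S: "S \<in> carrier_mat (m * d) d" and V: "V \<in> carrier_mat d d"
  shows "block_mult d m S (\<lambda>_. V) = S * V"
proof (rule row_block_eqI)
  fix i assume i: "i < m"
  have "row_block d S i * V \<in> carrier_mat d d" using S V by (intro mult_carrier_mat[of _ d d]) auto
  thus "row_block d (block_mult d m S (\<lambda>_. V)) i = row_block d (S * V) i"
    unfolding block_mult_def using row_block_mult[OF S V i] i by (simp add: row_block_vstack)
qed (use S V in auto)

lemma block_mult_linear:
  assumes S: "S \<in> carrier_mat (m * d) d" and y: "\<And>i. i < m \<Longrightarrow> y i \<in> carrier_mat d d" and z: "\<And>i. i < m \<Longrightarrow> z i \<in> carrier_mat d d"
  shows "block_mult d m S (\<lambda>i. u \<cdot>\<^sub>m y i + v \<cdot>\<^sub>m z i) = u \<cdot>\<^sub>m block_mult d m S y + v \<cdot>\<^sub>m block_mult d m S z"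
proof (rule mat_eq_blockI[of _ m d d])
  fix i a b assume i: "i < m" "a < d" "b < d"
  have r: "row_block d S i \<in> carrier_mat d d" using S by simp
  have "row_block d S i * (u \<cdot>\<^sub>m y i + v \<cdot>\<^sub>m z i) = u \<cdot>\<^sub>m (row_block d S i * y i) + v \<cdot>\<^sub>m (row_block d S i * z i)"
    using r y[OF i(1)] z[OF i(1)]
    by (simp add: mult_add_distrib_mat[OF r, of _ d] mult_smult_distrib[OF r, of _ d])
  thus "block_mult d m S (\<lambda>i. u \<cdot>\<^sub>m y i + v \<cdot>\<^sub>m z i) $$ (i * d + a, b)
      = (u \<cdot>\<^sub>m block_mult d m S y + v \<cdot>\<^sub>m block_mult d m S z) $$ (i * d + a, b)"
    using i block_index_less[OF i(1,2)] r y[OF i(1)] z[OF i(1)]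
    by (simp add: block_mult_def mult_carrier_mat[of _ d d _ d] del: index_mult_mat(1))
qed auto

lemma frob_inner_block_mult:
  assumes S: "S \<in> carrier_mat (m * d) d" and y: "\<And>i. i < m \<Longrightarrow> y i \<in> carrier_mat d d" and X: "X \<in> carrier_mat (m * d) d"
  shows "frob_inner (block_mult d m S y) X = (\<Sum>i<m. frob_inner (y i) ((row_block d S i)\<^sup>T * row_block d X i))"
proof -
  have "frob_inner (block_mult d m S y) X = frob_inner (vstack d m (\<lambda>i. row_block d S i * y i)) (vstack d m (row_block d X))"
    by (simp add: block_mult_def vstack_row_block[OF X])
  also have "\<dots> = (\<Sum>i<m. frob_inner (row_block d S i * y i) (row_block d X i))"
    using row_block_carrier[OF S] row_block_carrier[OF X] y by (intro frob_inner_vstack mult_carrier_mat[of _ d d]) auto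
  also have "\<dots> = (\<Sum>i<m. frob_inner (y i) ((row_block d S i)\<^sup>T * row_block d X i))"
  proof (intro sum.cong refl)
    fix i assume "i \<in> {..<m}"
    hence "y i \<in> carrier_mat d d" using y by simp
    thus "frob_inner (row_block d S i * y i) (row_block d X i) = frob_inner (y i) ((row_block d S i)\<^sup>T * row_block d X i)"
      using frob_inner_adjoint[of "y i" d d "(row_block d S i)\<^sup>T" d "row_block d X i"] row_block_carrier[OF S] row_block_carrier[OF X]
      by simp
  qed
  finally show ?thesis .
qed

lemma frob_inner_commute:
  assumes "A \<in> carrier_mat n c" "B \<in> carrier_mat n c" shows "frob_inner A B = frob_inner B A"
  using assms by (simp add: frob_inner_eq mult.commute)

lemma frob_inner_symmetric_mat:
  assumes "A \<in> carrier_mat n c" "B \<in> carrier_mat n c" "N \<in> carrier_mat n n" "N\<^sup>T = N"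
  shows "frob_inner A (N * B) = frob_inner B (N * A)"
  using frob_inner_adjoint[OF assms(1,3,2)] frob_inner_commute[of "N * A" n c B] assms by simp

context
  fixes d m :: nat and C S :: "real mat"
  assumes d: "0 < d" and C: "C \<in> carrier_mat (m * d) (m * d)" and Csym: "C\<^sup>T = C" and S: "S \<in> carrier_mat (m * d) d"
begin

lemmas C_hat_carrier = C_hat_block_carrier[OF d C S]

lemma L_form_linear_right:
  assumes y: "\<And>i. i < m \<Longrightarrow> y i \<in> carrier_mat d d" and z: "\<And>i. i < m \<Longrightarrow> z i \<in> carrier_mat d d"
    and w: "\<And>i. i < m \<Longrightarrow> w i \<in> carrier_mat d d"
  shows "L_form d m C S y (\<lambda>i. u \<cdot>\<^sub>m z i + v \<cdot>\<^sub>m w i) = u * L_form d m C S y z + v * L_form d m C S y w"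
proof -
  let ?b = "block_mult d m S"
  have bl: "?b (\<lambda>i. u \<cdot>\<^sub>m z i + v \<cdot>\<^sub>m w i) = u \<cdot>\<^sub>m ?b z + v \<cdot>\<^sub>m ?b w"
    by (rule block_mult_linear[OF S]) (simp_all add: z w)
  have "C * (u \<cdot>\<^sub>m ?b z + v \<cdot>\<^sub>m ?b w) = u \<cdot>\<^sub>m (C * ?b z) + v \<cdot>\<^sub>m (C * ?b w)"
    by (simp add: mult_add_distrib_mat[OF C, of _ d] mult_smult_distrib[OF C, of _ d])
  moreover have "C * ?b x \<in> carrier_mat (m * d) d" for x by (rule mult_carrier_mat[OF C]) simp
  ultimately have 1: "frob_inner (?b y) (C * ?b (\<lambda>i. u \<cdot>\<^sub>m z i + v \<cdot>\<^sub>m w i))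
      = u * frob_inner (?b y) (C * ?b z) + v * frob_inner (?b y) (C * ?b w)"
    unfolding bl by (simp add: frob_inner_linear(1)[of _ "m * d" d])
  have 2: "frob_inner (y i) (C_hat_block d C S i * (u \<cdot>\<^sub>m z i + v \<cdot>\<^sub>m w i))
      = u * frob_inner (y i) (C_hat_block d C S i * z i) + v * frob_inner (y i) (C_hat_block d C S i * w i)" if i: "i < m" for i
  proof -
    note c = C_hat_carrier[of i]
    have "C_hat_block d C S i * (u \<cdot>\<^sub>m z i + v \<cdot>\<^sub>m w i) = u \<cdot>\<^sub>m (C_hat_block d C S i * z i) + v \<cdot>\<^sub>m (C_hat_block d C S i * w i)"
      using z[OF i] w[OF i] by (simp add: mult_add_distrib_mat[OF c, of _ d] mult_smult_distrib[OF c, of _ d])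
    thus ?thesis using y[OF i] mult_carrier_mat[OF c z[OF i]] mult_carrier_mat[OF c w[OF i]]
      by (simp add: frob_inner_linear(1)[of _ d d])
  qed
  show ?thesis unfolding L_form_def 1 by (simp add: 2 sum.distrib sum_distrib_left algebra_simps)
qed

text \<open>On a constant family both terms of the form equal the sum of the products of
  \<open>y\<^sub>i\<close> with \<open>S\<^sub>i\<^sup>T (C S)\<^sub>i V\<close>: subtracting the
  block row sums makes constants a part of the kernel.\<close>

lemma L_form_const_right:
  assumes y: "\<And>i. i < m \<Longrightarrow> y i \<in> carrier_mat d d" and V: "V \<in> carrier_mat d d"
  shows "L_form d m C S y (\<lambda>_. V) = 0"
proof -
  have CS: "C * S \<in> carrier_mat (m * d) d" using C S by auto
  have "C * block_mult d m S (\<lambda>_. V) = (C * S) * V"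
    unfolding block_mult_const[OF S V] using assoc_mult_mat[OF C S V] by simp
  hence "frob_inner (block_mult d m S y) (C * block_mult d m S (\<lambda>_. V))
      = (\<Sum>i<m. frob_inner (y i) ((row_block d S i)\<^sup>T * row_block d ((C * S) * V) i))"
    using frob_inner_block_mult[OF S y mult_carrier_mat[OF CS V]] by simp
  also have "\<dots> = (\<Sum>i<m. frob_inner (y i) (C_hat_block d C S i * V))"
    unfolding C_hat_block_def using row_block_carrier[OF S] row_block_carrier[OF CS] V
    by (intro sum.cong refl) (simp add: row_block_mult[OF CS V] assoc_mult_mat[of _ d d _ d _ d])
  finally show ?thesis by (simp add: L_form_def)
qed

text \<open>The sum of all blocks is \<open>S\<^sup>T C S\<close>. This gives the symmetry of the
  first block once the others are known to be symmetric.\<close>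

lemma sum_C_hat_symmetric:
  assumes ab: "a < d" "b < d"
  shows "(\<Sum>i<m. C_hat_block d C S i $$ (a,b)) = (\<Sum>i<m. C_hat_block d C S i $$ (b,a))"
proof -
  have CS: "C * S \<in> carrier_mat (m * d) d" using C S by auto
  have e: "(\<Sum>i<m. C_hat_block d C S i $$ (a,b)) = (S\<^sup>T * (C * S)) $$ (a,b)" if "a < d" "b < d" for a b
  proof -
    have "C_hat_block d C S i $$ (a,b) = (\<Sum>c<d. S $$ (i * d + c, a) * (C * S) $$ (i * d + c, b))" if "i < m" for i
      unfolding C_hat_block_def transpose_mult_index[OF row_block_carrier[OF S] row_block_carrier[OF CS] \<open>a < d\<close> \<open>b < d\<close>]
      using S CS \<open>a < d\<close> \<open>b < d\<close> by (simp del: index_mult_mat(1))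
    moreover have "(S\<^sup>T * (C * S)) $$ (a,b) = (\<Sum>r<m * d. S $$ (r, a) * (C * S) $$ (r, b))"
      by (rule transpose_mult_index[OF S CS that])
    ultimately show ?thesis by (simp add: sum_block_index[OF d])
  qed
  have "(S\<^sup>T * (C * S))\<^sup>T = (C * S)\<^sup>T * S" using transpose_mult[of "S\<^sup>T" d "m * d" "C * S" d] S CS by simp
  also have "\<dots> = S\<^sup>T * (C * S)"
    using transpose_mult[OF C S] Csym assoc_mult_mat[of "S\<^sup>T" d "m * d" C "m * d" S d] S C by simp
  finally have "(S\<^sup>T * (C * S))\<^sup>T $$ (a,b) = (S\<^sup>T * (C * S)) $$ (a,b)" by simp
  thus ?thesis unfolding e[OF ab] e[OF ab(2,1)] using ab S CS by (simp del: index_mult_mat(1))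
qed

lemma L_form_commute:
  assumes K: "\<And>i. i < m \<Longrightarrow> (C_hat_block d C S i)\<^sup>T = C_hat_block d C S i"
    and y: "\<And>i. i < m \<Longrightarrow> y i \<in> carrier_mat d d" and z: "\<And>i. i < m \<Longrightarrow> z i \<in> carrier_mat d d"
  shows "L_form d m C S y z = L_form d m C S z y"
  unfolding L_form_def
  using frob_inner_symmetric_mat[OF block_mult_carrier block_mult_carrier C Csym, of S y S z]
    frob_inner_symmetric_mat[OF y z C_hat_carrier K]
  by (auto intro!: arg_cong2[where f="(-)"] sum.cong)

text \<open>
  For orthogonal \<open>R\<close> and \<open>y = R - 1\<close> one has \<open>y + y\<^sup>T = - y y\<^sup>T\<close>, so at a critical point the linear
  term of the objective is itself quadratic in \<open>y\<close> and the second-order expansion is exact.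
\<close>
lemma objective_exact:
  assumes K: "\<And>i. i < m \<Longrightarrow> (C_hat_block d C S i)\<^sup>T = C_hat_block d C S i"
    and R: "\<And>i. i < m \<Longrightarrow> R i \<in> orth_mats d"
  shows "frob_inner (block_mult d m S R) (C * block_mult d m S R) - frob_inner S (C * S)
    = L_form d m C S (\<lambda>i. R i - 1\<^sub>m d) (\<lambda>i. R i - 1\<^sub>m d)"
proof -
  define y where "y = (\<lambda>i. R i - 1\<^sub>m d)"
  note r = orth_matsD[OF R]
  have y: "y i \<in> carrier_mat d d" if "i < m" for i using r(1)[OF that] by (simp add: y_def minus_carrier_mat)
  define Y where "Y = block_mult d m S y"
  have Yc: "Y \<in> carrier_mat (m * d) d" by (simp add: Y_def)
  have SR: "block_mult d m S R = 1 \<cdot>\<^sub>m S + 1 \<cdot>\<^sub>m Y"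
  proof -
    have "block_mult d m S (\<lambda>i. 1 \<cdot>\<^sub>m 1\<^sub>m d + 1 \<cdot>\<^sub>m y i) = 1 \<cdot>\<^sub>m block_mult d m S (\<lambda>_. 1\<^sub>m d) + 1 \<cdot>\<^sub>m Y"
      unfolding Y_def by (rule block_mult_linear[OF S]) (simp_all add: y)
    also have "block_mult d m S (\<lambda>_. 1\<^sub>m d) = S"
      using block_mult_const[OF S one_carrier_mat] S by simp
    also have "block_mult d m S (\<lambda>i. 1 \<cdot>\<^sub>m 1\<^sub>m d + 1 \<cdot>\<^sub>m y i) = block_mult d m S R"
      unfolding block_mult_def
    proof (rule vstack_cong)
      fix i assume i: "i < m"
      have "1 \<cdot>\<^sub>m 1\<^sub>m d + 1 \<cdot>\<^sub>m y i = R i" using r(1)[OF i] by (intro eq_matI) (auto simp: y_def)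
      thus "row_block d S i * (1 \<cdot>\<^sub>m 1\<^sub>m d + 1 \<cdot>\<^sub>m y i) = row_block d S i * R i" by simp
    qed
    finally show ?thesis .
  qed
  have CS: "C * S \<in> carrier_mat (m * d) d" and CY: "C * Y \<in> carrier_mat (m * d) d" using C S Yc by auto
  have "C * (1 \<cdot>\<^sub>m S + 1 \<cdot>\<^sub>m Y) = 1 \<cdot>\<^sub>m (C * S) + 1 \<cdot>\<^sub>m (C * Y)"
    using mult_add_distrib_mat[OF C, of "1 \<cdot>\<^sub>m S" d "1 \<cdot>\<^sub>m Y"] mult_smult_distrib[OF C S, of 1] mult_smult_distrib[OF C Yc, of 1] S Yc
    by simp
  hence "frob_inner (block_mult d m S R) (C * block_mult d m S R)
      = frob_inner S (C * S) + frob_inner S (C * Y) + frob_inner Y (C * S) + frob_inner Y (C * Y)"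
    unfolding SR using frob_inner_linear(2)[of "1 \<cdot>\<^sub>m (C * S) + 1 \<cdot>\<^sub>m (C * Y)" "m * d" d S Y 1 1]
      frob_inner_linear(1)[OF S CS CY, of 1 1] frob_inner_linear(1)[OF Yc CS CY, of 1 1] S Yc CS CY by simp
  also have "frob_inner S (C * Y) = frob_inner Y (C * S)"
    by (rule frob_inner_symmetric_mat[OF S Yc C Csym])
  finally have 1: "frob_inner (block_mult d m S R) (C * block_mult d m S R) - frob_inner S (C * S)
      = 2 * frob_inner Y (C * S) + frob_inner Y (C * Y)" by simp
  have 2: "2 * frob_inner (y i) (C_hat_block d C S i) = - frob_inner (y i) (C_hat_block d C S i * y i)" if i: "i < m" for i
  proof -
    define X where "X = C_hat_block d C S i"
    have X: "X \<in> carrier_mat d d" "X\<^sup>T = X" using C_hat_carrier K[OF i] by (auto simp: X_def)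
    note yc = y[OF i] and rc = r[OF i]
    have yy: "y i * (y i)\<^sup>T = - (1 \<cdot>\<^sub>m y i + 1 \<cdot>\<^sub>m (y i)\<^sup>T)"
    proof -
      have "(y i)\<^sup>T = (R i)\<^sup>T - 1\<^sub>m d" using transpose_minus[OF rc(1) one_carrier_mat] by (simp add: y_def)
      hence "y i * (y i)\<^sup>T = R i * (R i)\<^sup>T - (R i)\<^sup>T - (R i - 1\<^sub>m d)"
        using rc(1) unfolding y_def
        by (simp add: minus_mult_distrib_mat[of _ d d _ _ d] mult_minus_distrib_mat[of _ d d _ d] minus_carrier_mat)
      thus ?thesis using rc(1) by (intro eq_matI) (auto simp: rc(3) y_def)
    qed
    have "frob_inner (y i) (X * y i) = frob_inner (y i * (y i)\<^sup>T) X"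
    proof -
      have "frob_inner (y i) (X * y i) = frob_inner ((y i)\<^sup>T) ((y i)\<^sup>T * X)"
        using frob_inner_transpose[of "y i" d d "X * y i"] transpose_mult[OF X(1) yc] X yc by simp
      also have "\<dots> = frob_inner (y i * (y i)\<^sup>T) X"
        using frob_inner_adjoint[of "(y i)\<^sup>T" d d "(y i)\<^sup>T" d X] X yc by simp
      finally show ?thesis .
    qed
    also have "\<dots> = - (frob_inner (y i) X + frob_inner ((y i)\<^sup>T) X)"
    proof -
      have "frob_inner (- W) X = - frob_inner W X" if "W \<in> carrier_mat d d" for W
        using that X by (simp add: frob_inner_eq[of _ d d] sum_negf[symmetric] del: sum_negf) (auto intro!: sum.cong)
      thus ?thesis unfolding yy using yc X(1) frob_inner_linear(2)[OF X(1) yc, of "(y i)\<^sup>T" 1 1] by simp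
    qed
    also have "frob_inner ((y i)\<^sup>T) X = frob_inner (y i) X"
      using frob_inner_transpose[OF yc X(1)] X(2) by simp
    finally show ?thesis by (simp add: X_def)
  qed
  have "2 * frob_inner Y (C * S) = (\<Sum>i<m. 2 * frob_inner (y i) (C_hat_block d C S i))"
  proof -
    have "frob_inner Y (C * S) = (\<Sum>i<m. frob_inner (y i) (C_hat_block d C S i))"
      unfolding Y_def C_hat_block_def by (rule frob_inner_block_mult[OF S _ CS]) (rule y)
    thus ?thesis by (simp add: sum_distrib_left)
  qed
  also have "\<dots> = - (\<Sum>i<m. frob_inner (y i) (C_hat_block d C S i * y i))"
    by (simp add: 2 sum_negf)
  finally show ?thesis unfolding 1 by (simp add: L_form_def Y_def y_def)
qed

lemma C_hat_block_right_mult: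
  assumes Q: "Q \<in> carrier_mat d d" and i: "i < m"
  shows "C_hat_block d C (S * Q) i = Q\<^sup>T * C_hat_block d C S i * Q"
proof -
  have CS: "C * S \<in> carrier_mat (m * d) d" using C S by auto
  have "C * (S * Q) = (C * S) * Q" using assoc_mult_mat[OF C S Q] by simp
  thus ?thesis unfolding C_hat_block_def using row_block_mult[OF S Q i] row_block_mult[OF CS Q i]
      transpose_mult[OF row_block_carrier[OF S] Q, of d i] row_block_carrier[OF S, of d i] row_block_carrier[OF CS, of d i] Q
    by (simp add: assoc_mult_mat[of _ d d _ d _ d] mult_carrier_mat[of _ d d _ d])
qed

text \<open>Since \<open>S\<^sub>i Q y\<^sub>i = S\<^sub>i (Q y\<^sub>i Q\<^sup>T) Q\<close>, moving
  the base point by \<open>Q\<close> conjugates the family, and the trailing orthogonal factor is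
  invisible to the Frobenius product.\<close>

lemma L_form_conj:
  assumes Q: "Q \<in> orth_mats d"
    and y: "\<And>i. i < m \<Longrightarrow> y i \<in> carrier_mat d d" and z: "\<And>i. i < m \<Longrightarrow> z i \<in> carrier_mat d d"
  shows "L_form d m C (S * Q) y z = L_form d m C S (\<lambda>i. Q * y i * Q\<^sup>T) (\<lambda>i. Q * z i * Q\<^sup>T)"
proof -
  note q = orth_matsD[OF Q]
  have QT: "Q\<^sup>T \<in> orth_mats d" using Q by (rule orth_mats_transpose)
  note as = assoc_mult_mat[of _ d d _ d _ d] mult_carrier_mat[of _ d d _ d]
  have bm: "block_mult d m S (\<lambda>i. Q * x i * Q\<^sup>T) = block_mult d m (S * Q) x * Q\<^sup>T"
    if x: "\<And>i. i < m \<Longrightarrow> x i \<in> carrier_mat d d" for x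
  proof (rule row_block_eqI[of _ m d d])
    show "block_mult d m (S * Q) x * Q\<^sup>T \<in> carrier_mat (m * d) d" using q by (intro mult_carrier_mat) auto
    fix i assume i: "i < m"
    have "row_block d (block_mult d m (S * Q) x * Q\<^sup>T) i = row_block d (block_mult d m (S * Q) x) i * Q\<^sup>T"
      using q i by (intro row_block_mult) auto
    also have "row_block d (block_mult d m (S * Q) x) i = row_block d S i * Q * x i"
      unfolding block_mult_def using i row_block_mult[OF S q(1) i] row_block_carrier[OF S, of d i] q(1) x[OF i]
      by (subst row_block_vstack) (auto simp: as(2))
    finally show "row_block d (block_mult d m S (\<lambda>i. Q * x i * Q\<^sup>T)) i = row_block d (block_mult d m (S * Q) x * Q\<^sup>T) i"
      using i row_block_carrier[OF S, of d i] q(1) x[OF i]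
      by (simp add: block_mult_def row_block_vstack as)
  qed simp
  have 1: "frob_inner (block_mult d m S (\<lambda>i. Q * y i * Q\<^sup>T)) (C * block_mult d m S (\<lambda>i. Q * z i * Q\<^sup>T))
      = frob_inner (block_mult d m (S * Q) y) (C * block_mult d m (S * Q) z)"
  proof -
    have "C * (block_mult d m (S * Q) z * Q\<^sup>T) = C * block_mult d m (S * Q) z * Q\<^sup>T"
      using assoc_mult_mat[OF C block_mult_carrier, of "Q\<^sup>T" d] q by simp
    moreover have "block_mult d m S (\<lambda>i. Q * y i * Q\<^sup>T) = block_mult d m (S * Q) y * Q\<^sup>T" by (rule bm) (rule y)
    moreover have "block_mult d m S (\<lambda>i. Q * z i * Q\<^sup>T) = block_mult d m (S * Q) z * Q\<^sup>T" by (rule bm) (rule z)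
    ultimately show ?thesis
      using frob_inner_orth_right[OF QT block_mult_carrier mult_carrier_mat[OF C block_mult_carrier]] by simp
  qed
  have 2: "frob_inner (Q * y i * Q\<^sup>T) (C_hat_block d C S i * (Q * z i * Q\<^sup>T)) = frob_inner (y i) (C_hat_block d C (S * Q) i * z i)"
    if i: "i < m" for i
  proof -
    note c = C_hat_carrier[of i]
    have "C_hat_block d C (S * Q) i * z i = Q\<^sup>T * (C_hat_block d C S i * (Q * z i))"
      unfolding C_hat_block_right_mult[OF q(1) i] using c q(1) z[OF i] by (simp add: as)
    hence "frob_inner (y i) (C_hat_block d C (S * Q) i * z i) = frob_inner (Q * y i) (C_hat_block d C S i * (Q * z i))"
      using frob_inner_adjoint[OF y[OF i], of "Q\<^sup>T" d "C_hat_block d C S i * (Q * z i)"] q(1) c z[OF i] by (simp add: as(2))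
    also have "\<dots> = frob_inner (Q * y i * Q\<^sup>T) (C_hat_block d C S i * (Q * z i) * Q\<^sup>T)"
      using frob_inner_orth_right[OF QT, of "Q * y i" d "C_hat_block d C S i * (Q * z i)"] q(1) c z[OF i] y[OF i] by (simp add: as(2))
    also have "C_hat_block d C S i * (Q * z i) * Q\<^sup>T = C_hat_block d C S i * (Q * z i * Q\<^sup>T)"
      using q(1) c z[OF i] by (simp add: as)
    finally show ?thesis by simp
  qed
  show ?thesis unfolding L_form_def 1 by (simp add: 2)
qed

end

section \<open>The objective along the section\<close>

declare mult_Suc [simp del]

lemma DERIV_frob_inner:
  assumes N: "N \<in> carrier_mat n n" and A: "\<And>t. A t \<in> carrier_mat n c" and B: "\<And>t. B t \<in> carrier_mat n c"
    and A': "A' \<in> carrier_mat n c" and B': "B' \<in> carrier_mat n c"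
    and dA: "\<And>i j. i < n \<Longrightarrow> j < c \<Longrightarrow> ((\<lambda>t. A t $$ (i,j)) has_real_derivative A' $$ (i,j)) (at s)"
    and dB: "\<And>i j. i < n \<Longrightarrow> j < c \<Longrightarrow> ((\<lambda>t. B t $$ (i,j)) has_real_derivative B' $$ (i,j)) (at s)"
  shows "((\<lambda>t. frob_inner (A t) (N * B t)) has_real_derivative frob_inner A' (N * B s) + frob_inner (A s) (N * B')) (at s)"
proof -
  have e: "frob_inner X (N * Y) = (\<Sum>i<n. \<Sum>j<c. X $$ (i,j) * (\<Sum>l<n. N $$ (i,l) * Y $$ (l,j)))"
    if "X \<in> carrier_mat n c" "Y \<in> carrier_mat n c" for X Y
    unfolding frob_inner_double[OF that(1) mult_carrier_mat[OF N that(2)]]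
    using N that(2) by (auto simp: scalar_prod_def atLeast0LessThan intro!: sum.cong)
  show ?thesis
    unfolding e[OF A B] e[OF A' B] e[OF A B'] sum.distrib[symmetric]
  proof (intro DERIV_sum)
    fix i j assume ij: "i \<in> {..<n}" "j \<in> {..<c}"
    have "((\<lambda>t. \<Sum>l<n. N $$ (i,l) * B t $$ (l,j)) has_real_derivative (\<Sum>l<n. N $$ (i,l) * B' $$ (l,j))) (at s)"
      using dB ij by (intro DERIV_sum DERIV_cmult) auto
    from DERIV_mult[OF dA this, of i j]
    show "((\<lambda>t. A t $$ (i,j) * (\<Sum>l<n. N $$ (i,l) * B t $$ (l,j))) has_real_derivative
        A' $$ (i,j) * (\<Sum>l<n. N $$ (i,l) * B s $$ (l,j)) + A s $$ (i,j) * (\<Sum>l<n. N $$ (i,l) * B' $$ (l,j))) (at s)"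
      using ij by (simp add: algebra_simps)
  qed
qed

lemma smooth_on_frob_inner:
  assumes N: "N \<in> carrier_mat n n" and A: "\<And>p. p \<in> M \<Longrightarrow> A p \<in> carrier_mat n c" and B: "\<And>p. p \<in> M \<Longrightarrow> B p \<in> carrier_mat n c"
    and sA: "\<And>i j. i < n \<Longrightarrow> j < c \<Longrightarrow> smooth_on nr nc M (\<lambda>p. A p $$ (i,j))"
    and sB: "\<And>i j. i < n \<Longrightarrow> j < c \<Longrightarrow> smooth_on nr nc M (\<lambda>p. B p $$ (i,j))"
  shows "smooth_on nr nc M (\<lambda>p. frob_inner (A p) (N * B p))"
proof -
  have "smooth_on nr nc M (\<lambda>p. \<Sum>i<n. \<Sum>j<c. A p $$ (i,j) * (\<Sum>l<n. N $$ (i,l) * B p $$ (l,j)))"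
    using sA sB by (intro smooth_on_sum smooth_on_mult smooth_on_const) auto
  moreover have "frob_inner (A p) (N * B p) = (\<Sum>i<n. \<Sum>j<c. A p $$ (i,j) * (\<Sum>l<n. N $$ (i,l) * B p $$ (l,j)))"
    if "p \<in> M" for p
    unfolding frob_inner_double[OF A[OF that] mult_carrier_mat[OF N B[OF that]]]
    using N B[OF that] by (auto simp: scalar_prod_def atLeast0LessThan intro!: sum.cong)
  ultimately show ?thesis by (subst smooth_on_cong) auto
qed

text \<open>A section of the quotient map.\<close>
definition section_lift :: "nat \<Rightarrow> nat \<Rightarrow> real mat \<Rightarrow> real mat" where
  "section_lift d k q = vstack d (Suc k) (\<lambda>i. case i of 0 \<Rightarrow> 1\<^sub>m d | Suc j \<Rightarrow> row_block d q j)"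

text \<open>Along the section the first view stays at the identity, so the first member of its
  velocity is zero.\<close>

definition family_lift :: "nat \<Rightarrow> (nat \<Rightarrow> nat \<Rightarrow> nat \<Rightarrow> real) \<Rightarrow> nat \<Rightarrow> real mat" where
  "family_lift d z i = mat d d (\<lambda>(a,b). case i of 0 \<Rightarrow> 0 | Suc j \<Rightarrow> z j a b)"

lemma section_lift_carrier [simp]: "section_lift d k q \<in> carrier_mat (Suc k * d) d"
  unfolding section_lift_def by (rule vstack_carrier)

lemma family_lift_carrier [simp]: "family_lift d z i \<in> carrier_mat d d"
  by (simp add: family_lift_def)

lemma family_lift_skew:
  assumes z: "skew_family d k z" and i: "i < Suc k"
  shows "family_lift d z i \<in> skew_mats d"
proof (rule skew_matsI)
  fix a b assume ab: "a < d" "b < d"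
  show "family_lift d z i $$ (a,b) = - family_lift d z i $$ (b,a)"
  proof (cases i)
    case (Suc j)
    thus ?thesis using skew_familyD[OF z _ ab, of j] ab i by (simp add: family_lift_def)
  qed (use ab in \<open>simp add: family_lift_def\<close>)
qed simp

lemma section_lift_block:
  assumes "q \<in> carrier_mat (k * d) d" "i < Suc k"
  shows "row_block d (section_lift d k q) i = (case i of 0 \<Rightarrow> 1\<^sub>m d | Suc j \<Rightarrow> row_block d q j)"
  unfolding section_lift_def using assms by (subst row_block_vstack) (auto split: nat.splits)

lemma section_lift_index:
  assumes "i < Suc k" "a < d" "b < d" "q \<in> carrier_mat (k * d) d"
  shows "section_lift d k q $$ (i * d + a, b) = (case i of 0 \<Rightarrow> (if a = b then 1 else 0) | Suc j \<Rightarrow> q $$ (j * d + a, b))"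
  unfolding section_lift_def using assms by (subst vstack_index) (auto split: nat.splits)

lemma section_lift_append:
  assumes q: "q \<in> carrier_mat (k * d) d"
  shows "1\<^sub>m d @\<^sub>r q = section_lift d k q"
proof (rule mat_eq_blockI[of _ "Suc k" d d])
  show c: "1\<^sub>m d @\<^sub>r q \<in> carrier_mat (Suc k * d) d"
    using carrier_append_rows[OF one_carrier_mat q] by (simp add: mult_Suc)
  fix i a b assume i: "i < Suc k" "a < d" "b < d"
  show "(1\<^sub>m d @\<^sub>r q) $$ (i * d + a, b) = section_lift d k q $$ (i * d + a, b)"
    unfolding section_lift_index[OF i q] append_rows_def
    using i q block_index_less[OF i(1,2)] by (subst index_mat_four_block) (auto simp: mult_Suc split: nat.splits)
qed simp

section \<open>First and second derivatives of the objective\<close>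

locale orth_objective = orth_quot d k for d k +
  fixes C :: "real mat"
  assumes d: "0 < d" and C: "C \<in> carrier_mat (Suc k * d) (Suc k * d)" and Csym: "C\<^sup>T = C"
begin

abbreviation "F \<equiv> quot_objective d C"
abbreviation "sl \<equiv> section_lift d k"
abbreviation "bm \<equiv> block_mult d (Suc k)"

lemma objective_eq:
  assumes "q \<in> M" shows "F q = frob_inner (sl q) (C * sl q)"
proof -
  have X: "sl q \<in> carrier_mat (Suc k * d) d" by simp
  have CX: "C * sl q \<in> carrier_mat (Suc k * d) d" using C X by (rule mult_carrier_mat)
  have "F q = mat_tr (C * sl q * (sl q)\<^sup>T)"
    using section_lift_append[OF orth_powerD(1)[OF assms]] by (simp add: quot_objective_def)
  also have "\<dots> = (\<Sum>r<Suc k * d. \<Sum>b<d. (C * sl q) $$ (r,b) * sl q $$ (r,b))"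
    unfolding mat_tr_def using mult_transpose_index[OF CX X] C by (auto intro!: sum.cong simp del: index_mult_mat(1))
  also have "\<dots> = frob_inner (sl q) (C * sl q)"
    unfolding frob_inner_double[OF X CX] by (simp add: mult.commute)
  finally show ?thesis .
qed

lemma section_lift_smooth:
  assumes "r < Suc k * d" "b < d" shows "sm (\<lambda>q. sl q $$ (r,b))"
proof -
  define i a where "i = r div d" and "a = r mod d"
  have i: "i < Suc k" "a < d" "r = i * d + a" using assms less_mult_imp_div_less[of r "Suc k" d] d
    by (auto simp: i_def a_def)
  have "sm (\<lambda>q. case i of 0 \<Rightarrow> (if a = b then 1 else 0) | Suc j \<Rightarrow> q $$ (j * d + a, b))"
    using i assms by (cases i) (auto intro!: smooth_on_const smooth_on_index block_index_less)
  moreover have "sl q $$ (r,b) = (case i of 0 \<Rightarrow> (if a = b then 1 else 0) | Suc j \<Rightarrow> q $$ (j * d + a, b))" if "q \<in> M" for q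
    unfolding i(3) by (rule section_lift_index[OF i(1,2) assms(2) orth_powerD(1)[OF that]])
  ultimately show ?thesis by (subst smooth_on_cong) auto
qed

lemma objective_smooth: "sm F"
proof -
  have "sm (\<lambda>q. frob_inner (sl q) (C * sl q))"
    by (rule smooth_on_frob_inner[OF C, where c=d]) (auto intro: section_lift_smooth)
  thus ?thesis using objective_eq by (subst smooth_on_cong) auto
qed

lemma section_lift_curve:
  assumes p: "p \<in> M" and c: "curve_through M p (frame_field d k z p) c" and r: "r < Suc k * d" "b < d"
  shows "((\<lambda>t. sl (c t) $$ (r,b)) has_real_derivative bm (sl p) (family_lift d z) $$ (r,b)) (at 0)"
proof -
  define i a where "i = r div d" and "a = r mod d"
  have i: "i < Suc k" "a < d" "r = i * d + a" using r less_mult_imp_div_less[of r "Suc k" d] d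
    by (auto simp: i_def a_def)
  note pc = orth_powerD(1)[OF p]
  have ct: "c t \<in> carrier_mat (k * d) d" for t using c orth_powerD(1) by (auto simp: curve_through_def)
  have e: "bm (sl p) (family_lift d z) $$ (r,b) = (row_block d (sl p) i * family_lift d z i) $$ (a,b)"
    unfolding block_mult_def i(3) using i r by (simp del: index_mult_mat(1))
  show ?thesis
  proof (cases i)
    case 0
    have "family_lift d z i = 0\<^sub>m d d" by (rule eq_matI) (auto simp: family_lift_def 0)
    hence "(row_block d (sl p) i * family_lift d z i) $$ (a,b) = 0"
      using i r right_mult_zero_mat[OF row_block_carrier[OF section_lift_carrier], of d d k p i d] by simp
    thus ?thesis unfolding e unfolding i(3) section_lift_index[OF i(1,2) r(2) ct] by (simp add: 0)
  next
    case (Suc j)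
    hence j: "j < k" using i by simp
    have fz: "family_lift d z i = mat d d (\<lambda>(a,b). z j a b)" by (simp add: family_lift_def Suc)
    have "(row_block d (sl p) i * family_lift d z i) $$ (a,b) = (\<Sum>c<d. p $$ (j * d + a, c) * z j c b)"
      unfolding section_lift_block[OF pc i(1)] fz using Suc i r pc
      by (simp add: row_block_def scalar_prod_def atLeast0LessThan)
    also have "\<dots> = frame_field d k z p $$ (j * d + a, b)"
      by (rule frame_field_index[OF pc j i(2) r(2), symmetric])
    finally have e2: "(row_block d (sl p) i * family_lift d z i) $$ (a,b) = frame_field d k z p $$ (j * d + a, b)" .
    have "((\<lambda>t. c t $$ (j * d + a, b)) has_real_derivative frame_field d k z p $$ (j * d + a, b)) (at 0)"
      using c block_index_less[OF j i(2)] r by (auto simp: curve_through_def)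
    thus ?thesis unfolding e e2 unfolding i(3) section_lift_index[OF i(1,2) r(2) ct] by (simp add: Suc)
  qed
qed

lemma diff_along_objective:
  assumes p: "p \<in> M" and z: "skew_family d k z"
  shows "diff_along M F p (frame_field d k z p) = 2 * frob_inner (bm (sl p) (family_lift d z)) (C * sl p)"
proof -
  have "diff_along M F p (frame_field d k z p) = diff_along M (\<lambda>q. frob_inner (sl q) (C * sl q)) p (frame_field d k z p)"
    by (rule diff_along_cong) (rule objective_eq)
  also have "\<dots> = frob_inner (bm (sl p) (family_lift d z)) (C * sl p) + frob_inner (sl p) (C * bm (sl p) (family_lift d z))"
  proof (rule diff_along_eqI[OF p frame_field_tangent[OF z]])
    fix c assume c: "curve_through M p (frame_field d k z p) c"
    have c0: "c 0 = p" using c by (simp add: curve_through_def)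
    show "((\<lambda>t. frob_inner (sl (c t)) (C * sl (c t))) has_real_derivative
      frob_inner (bm (sl p) (family_lift d z)) (C * sl p) + frob_inner (sl p) (C * bm (sl p) (family_lift d z))) (at 0)"
      using DERIV_frob_inner[OF C, of "\<lambda>t. sl (c t)" d "\<lambda>t. sl (c t)", OF section_lift_carrier section_lift_carrier
          block_mult_carrier block_mult_carrier section_lift_curve[OF p c] section_lift_curve[OF p c]]
      unfolding c0 .
  qed
  also have "frob_inner (sl p) (C * bm (sl p) (family_lift d z)) = frob_inner (bm (sl p) (family_lift d z)) (C * sl p)"
    by (rule frob_inner_symmetric_mat[OF section_lift_carrier block_mult_carrier C Csym])
  finally show ?thesis by simp
qed

lemma diff_along_objective_sum:
  assumes p: "p \<in> M" and z: "skew_family d k z"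
  shows "diff_along M F p (frame_field d k z p) = 2 * (\<Sum>i<Suc k. frob_inner (family_lift d z i) (C_hat_block d C (sl p) i))"
proof -
  have CS: "C * sl p \<in> carrier_mat (Suc k * d) d" using C by (rule mult_carrier_mat) simp
  have "frob_inner (bm (sl p) (family_lift d z)) (C * sl p)
      = (\<Sum>i<Suc k. frob_inner (family_lift d z i) (C_hat_block d C (sl p) i))"
    unfolding C_hat_block_def by (rule frob_inner_block_mult[OF section_lift_carrier _ CS]) simp
  thus ?thesis unfolding diff_along_objective[OF assms] by simp
qed

text \<open>For a later view the test direction moves that view alone, by its block minus the
  transposed block; the derivative of the objective is then a sum of squares, which criticality
  makes zero. The first view cannot be moved within the section, and its block is settled by the
  symmetry of the sum of all blocks.\<close>

lemma C_hat_symmetric: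
  assumes p: "p \<in> M" and crit: "riem_grad R F p = 0\<^sub>m (k * d) d" and i: "i < Suc k"
  shows "(C_hat_block d C (sl p) i)\<^sup>T = C_hat_block d C (sl p) i"
proof -
  let ?K = "C_hat_block d C (sl p)"
  note K = C_hat_block_carrier[OF d C section_lift_carrier, of p]
  have pos: "?K (Suc j) $$ (a,b) = ?K (Suc j) $$ (b,a)" if j: "j < k" and ab: "a < d" "b < d" for j a b
  proof -
    define z where "z = (\<lambda>i a b. if i = j then ?K (Suc j) $$ (a,b) - ?K (Suc j) $$ (b,a) else 0)"
    have z: "skew_family d k z" by (simp add: skew_family_def z_def)
    have "0 = (\<Sum>i<Suc k. frob_inner (family_lift d z i) (?K i))"
      using riem_grad_zero(2)[OF objective_smooth p crit frame_field_tangent[OF z]]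
      unfolding diff_along_objective_sum[OF p z] by simp
    also have "\<dots> = (\<Sum>i<k. \<Sum>a<d. \<Sum>b<d. z i a b * ?K (Suc i) $$ (a,b))"
      unfolding frob_inner_double[OF family_lift_carrier K]
      by (subst sum.lessThan_Suc_shift) (simp add: family_lift_def)
    also have "\<dots> = (\<Sum>i<k. if i = j then (\<Sum>a<d. \<Sum>b<d. z j a b * ?K (Suc j) $$ (a,b)) else 0)"
      by (intro sum.cong refl) (auto simp: z_def)
    also have "\<dots> = fam_inner d (z j) (\<lambda>a b. ?K (Suc j) $$ (a,b))"
      using j by (simp add: fam_inner_def)
    also have "\<dots> = fam_inner d (\<lambda>a b. ?K (Suc j) $$ (a,b)) (z j)" by (rule fam_inner_commute)
    also have "\<dots> = fam_inner d (\<lambda>a b. (?K (Suc j) $$ (a,b) - ?K (Suc j) $$ (b,a)) / 2) (z j)"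
      by (rule fam_inner_skew_part[symmetric]) (rule skew_familyD[OF z j])
    also have "\<dots> = (\<Sum>a<d. \<Sum>b<d. (?K (Suc j) $$ (a,b) - ?K (Suc j) $$ (b,a))^2 / 2)"
      by (simp add: fam_inner_def z_def power2_eq_square)
    finally have s: "(\<Sum>a<d. \<Sum>b<d. (?K (Suc j) $$ (a,b) - ?K (Suc j) $$ (b,a))^2 / 2) = 0" by simp
    have "(?K (Suc j) $$ (a,b) - ?K (Suc j) $$ (b,a))^2 / 2 \<le> (\<Sum>b<d. (?K (Suc j) $$ (a,b) - ?K (Suc j) $$ (b,a))^2 / 2)"
      using ab by (intro member_le_sum) auto
    also have "\<dots> \<le> (\<Sum>a<d. \<Sum>b<d. (?K (Suc j) $$ (a,b) - ?K (Suc j) $$ (b,a))^2 / 2)"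
      using ab by (intro member_le_sum[where f="\<lambda>a. \<Sum>b<d. _ a b"]) (auto intro!: sum_nonneg)
    finally show ?thesis using s by simp
  qed
  have all: "?K i $$ (a,b) = ?K i $$ (b,a)" if ab: "a < d" "b < d" for a b
  proof (cases i)
    case 0
    have "?K 0 $$ (a,b) + (\<Sum>j<k. ?K (Suc j) $$ (a,b)) = ?K 0 $$ (b,a) + (\<Sum>j<k. ?K (Suc j) $$ (b,a))"
      using sum_C_hat_symmetric[OF d C Csym section_lift_carrier ab, of p]
      unfolding sum.lessThan_Suc_shift .
    moreover have "(\<Sum>j<k. ?K (Suc j) $$ (a,b)) = (\<Sum>j<k. ?K (Suc j) $$ (b,a))"
      using pos ab by (intro sum.cong) auto
    ultimately show ?thesis by (simp add: 0)
  next
    case (Suc j)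
    thus ?thesis using pos[of j] ab i by simp
  qed
  show ?thesis using K[of i] all by (intro eq_matI) auto
qed

text \<open>Differentiating twice produces the product of two directions paired with a block of the
  diagonal correction. Skewness of both directions and symmetry of the block bring this to the shape
  of the second term of \<open>L_form\<close>.\<close>

lemma frob_inner_skew_swap:
  assumes W: "W \<in> skew_mats d" and Z: "Z \<in> skew_mats d" and K: "K \<in> carrier_mat d d" "K\<^sup>T = K"
  shows "frob_inner (Z * W) K = - frob_inner W (K * Z)"
proof -
  note w = skew_matsD[OF W] and z = skew_matsD[OF Z]
  have neg: "frob_inner A (- B) = - frob_inner A B" "frob_inner (- A) B = - frob_inner A B"
    if "A \<in> carrier_mat d d" "B \<in> carrier_mat d d" for A B
    using that by (auto simp: frob_inner_eq[of _ d d] sum_negf[symmetric] simp del: sum_negf intro!: sum.cong)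
  have ZK: "Z * K \<in> carrier_mat d d" and KZ: "K * Z \<in> carrier_mat d d" using z K by auto
  have "frob_inner (Z * W) K = frob_inner W (Z\<^sup>T * K)"
  proof -
    have "Z\<^sup>T \<in> carrier_mat d d" using z(1) by simp
    from frob_inner_adjoint[OF w(1) this K(1)] show ?thesis by simp
  qed
  also have "\<dots> = - frob_inner W (Z * K)" using neg(1)[OF w(1) ZK] z(1,2) K by simp
  also have "frob_inner W (Z * K) = frob_inner (W\<^sup>T) ((Z * K)\<^sup>T)"
    using frob_inner_transpose[OF w(1) ZK] by simp
  also have "(Z * K)\<^sup>T = - (K * Z)" using transpose_mult[OF z(1) K(1)] z(1,2) K by simp
  also have "frob_inner (W\<^sup>T) (- (K * Z)) = frob_inner W (K * Z)"
    using neg w(1,2) KZ by simp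
  finally show ?thesis .
qed

text \<open>The first derivative is twice the product of \<open>S w\<close> with \<open>C S\<close>,
  and moving in direction \<open>z\<close> replaces \<open>S\<close> by \<open>S z\<close>. One of
  the two resulting terms is the \<open>C\<close> part of the form; the other, the product of
  \<open>S z w\<close> with \<open>C S\<close>, is minus the correction part.\<close>

lemma diff_along_objective_twice:
  assumes p: "p \<in> M" and crit: "riem_grad R F p = 0\<^sub>m (k * d) d" and z: "skew_family d k z" and w: "skew_family d k w"
  shows "diff_along M (\<lambda>q. diff_along M F q (frame_field d k w q)) p (frame_field d k z p)
    = 2 * L_form d (Suc k) C (sl p) (family_lift d w) (family_lift d z)"
proof -
  let ?w = "family_lift d w" and ?z = "family_lift d z"
  let ?E = "frob_inner (bm (bm (sl p) ?z) ?w) (C * sl p) + frob_inner (bm (sl p) ?w) (C * bm (sl p) ?z)"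
  have "diff_along M (\<lambda>q. diff_along M F q (frame_field d k w q)) p (frame_field d k z p)
      = diff_along M (\<lambda>q. 2 * frob_inner (bm (sl q) ?w) (C * sl q)) p (frame_field d k z p)"
    by (rule diff_along_cong) (rule diff_along_objective[OF _ w])
  also have "\<dots> = 2 * ?E"
  proof (rule diff_along_eqI[OF p frame_field_tangent[OF z]])
    fix c assume c: "curve_through M p (frame_field d k z p) c"
    have c0: "c 0 = p" using c by (simp add: curve_through_def)
    have dw: "((\<lambda>t. bm (sl (c t)) ?w $$ (r,b)) has_real_derivative bm (bm (sl p) ?z) ?w $$ (r,b)) (at 0)"
      if r: "r < Suc k * d" "b < d" for r b
    proof -
      define i a where "i = r div d" and "a = r mod d"
      have i: "i < Suc k" "a < d" "r = i * d + a" using r less_mult_imp_div_less[of r "Suc k" d] d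
        by (auto simp: i_def a_def)
      have e: "bm X ?w $$ (r,b) = (\<Sum>e<d. X $$ (i * d + a, e) * ?w i $$ (e,b))" if "X \<in> carrier_mat (Suc k * d) d" for X
        unfolding block_mult_def i(3) using that i r carrier_matD[OF family_lift_carrier[of d w i]]
        by (simp add: row_block_def scalar_prod_def atLeast0LessThan)
      have "((\<lambda>t. \<Sum>e<d. sl (c t) $$ (i * d + a, e) * ?w i $$ (e,b)) has_real_derivative
          (\<Sum>e<d. bm (sl p) ?z $$ (i * d + a, e) * ?w i $$ (e,b))) (at 0)"
        using section_lift_curve[OF p c block_index_less[OF i(1,2)]]
        by (intro DERIV_sum DERIV_cmult_right) auto
      thus ?thesis unfolding e[OF section_lift_carrier] e[OF block_mult_carrier] .
    qed
    have "((\<lambda>t. frob_inner (bm (sl (c t)) ?w) (C * sl (c t))) has_real_derivative ?E) (at 0)"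
      using DERIV_frob_inner[OF C, of "\<lambda>t. bm (sl (c t)) ?w" d "\<lambda>t. sl (c t)", OF block_mult_carrier section_lift_carrier
          block_mult_carrier block_mult_carrier dw section_lift_curve[OF p c]]
      unfolding c0 .
    thus "((\<lambda>t. 2 * frob_inner (bm (sl (c t)) ?w) (C * sl (c t))) has_real_derivative 2 * ?E) (at 0)"
      by (rule DERIV_cmult)
  qed
  also have "frob_inner (bm (bm (sl p) ?z) ?w) (C * sl p) = - (\<Sum>i<Suc k. frob_inner (?w i) (C_hat_block d C (sl p) i * ?z i))"
  proof -
    have CS: "C * sl p \<in> carrier_mat (Suc k * d) d" using C by (rule mult_carrier_mat) simp
    have "bm (bm (sl p) ?z) ?w = bm (sl p) (\<lambda>i. ?z i * ?w i)"
      unfolding block_mult_def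
    proof (rule vstack_cong)
      fix i assume i: "i < Suc k"
      have r: "row_block d (sl p) i \<in> carrier_mat d d" by (rule row_block_carrier[OF section_lift_carrier])
      have "row_block d (vstack d (Suc k) (\<lambda>i. row_block d (sl p) i * ?z i)) i = row_block d (sl p) i * ?z i"
        using i mult_carrier_mat[OF r family_lift_carrier] by (rule row_block_vstack)
      thus "row_block d (vstack d (Suc k) (\<lambda>i. row_block d (sl p) i * ?z i)) i * ?w i = row_block d (sl p) i * (?z i * ?w i)"
        using assoc_mult_mat[OF r family_lift_carrier family_lift_carrier] by simp
    qed
    hence "frob_inner (bm (bm (sl p) ?z) ?w) (C * sl p)
        = (\<Sum>i<Suc k. frob_inner (?z i * ?w i) (C_hat_block d C (sl p) i))"
      unfolding C_hat_block_def
      by (simp only:) (rule frob_inner_block_mult[OF section_lift_carrier mult_carrier_mat[OF family_lift_carrier family_lift_carrier] CS])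
    also have "\<dots> = (\<Sum>i<Suc k. - frob_inner (?w i) (C_hat_block d C (sl p) i * ?z i))"
      by (intro sum.cong refl frob_inner_skew_swap family_lift_skew[OF w] family_lift_skew[OF z]
          C_hat_block_carrier[OF d C section_lift_carrier] C_hat_symmetric[OF p crit]) auto
    finally show ?thesis by (simp only: sum_negf)
  qed
  finally show ?thesis unfolding L_form_def by simp
qed

theorem hess_metric:
  assumes p: "p \<in> M" and crit: "riem_grad R F p = 0\<^sub>m (k * d) d" and z: "skew_family d k z" and w: "skew_family d k w"
  shows "mmetric R p (riem_hess R F p (frame_field d k z p)) (frame_field d k w p)
    = 2 * L_form d (Suc k) C (sl p) (family_lift d w) (family_lift d z)"
  using riem_hess_critical(2)[OF objective_smooth p crit frame_field_tangent[OF z] w]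
    diff_along_objective_twice[OF assms] by simp

text \<open>The relative rotations \<open>p\<^sub>j\<^sup>T q\<^sub>j\<close> carry the lift of
  \<open>p\<close> to the lift of \<open>q\<close> by right multiplication, so the exact expansion
  applies.\<close>

theorem objective_difference:
  assumes p: "p \<in> M" and crit: "riem_grad R F p = 0\<^sub>m (k * d) d" and q: "q \<in> M"
  defines "y \<equiv> \<lambda>i. (case i of 0 \<Rightarrow> 1\<^sub>m d | Suc j \<Rightarrow> (row_block d p j)\<^sup>T * row_block d q j) - 1\<^sub>m d"
  shows "F q - F p = L_form d (Suc k) C (sl p) y y"
proof -
  define Q where "Q = (\<lambda>i. case i of 0 \<Rightarrow> 1\<^sub>m d | Suc j \<Rightarrow> (row_block d p j)\<^sup>T * row_block d q j)"
  have Q: "Q i \<in> orth_mats d" if "i < Suc k" for i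
    using that orth_mats_one orth_powerD(2)[OF p] orth_powerD(2)[OF q]
    by (auto simp: Q_def intro!: orth_mats_mult orth_mats_transpose split: nat.splits)
  have "bm (sl p) Q = sl q"
    unfolding block_mult_def section_lift_def[of d k q]
  proof (rule vstack_cong)
    fix i assume i: "i < Suc k"
    show "row_block d (sl p) i * Q i = (case i of 0 \<Rightarrow> 1\<^sub>m d | Suc j \<Rightarrow> row_block d q j)"
    proof (cases i)
      case 0
      thus ?thesis using section_lift_block[OF orth_powerD(1)[OF p] i] by (simp add: Q_def)
    next
      case (Suc j)
      hence j: "j < k" using i by simp
      note a = orth_matsD[OF orth_powerD(2)[OF p j]] and b = orth_matsD(1)[OF orth_powerD(2)[OF q j]]
      have "row_block d p j * ((row_block d p j)\<^sup>T * row_block d q j) = row_block d q j"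
        using assoc_mult_mat[OF a(1), of "(row_block d p j)\<^sup>T" d "row_block d q j" d] a b by simp
      thus ?thesis using section_lift_block[OF orth_powerD(1)[OF p] i] by (simp add: Q_def Suc)
    qed
  qed
  thus ?thesis
    using objective_exact[OF d C Csym section_lift_carrier, of p Q] C_hat_symmetric[OF p crit] Q
    unfolding objective_eq[OF p] objective_eq[OF q] by (simp add: y_def Q_def)
qed

end

section \<open>Coordinates of families of skew matrices\<close>

lemma upper_pairs_Suc: "upper_pairs (Suc d) = upper_pairs d @ map (\<lambda>r. (r,d)) [0..<d]"
  by (simp add: upper_pairs_def)

lemma set_upper_pairs: "set (upper_pairs d) = {(r,s). r < s \<and> s < d}"
  by (induction d) (auto simp: upper_pairs_Suc upper_pairs_def less_Suc_eq)

lemma distinct_upper_pairs: "distinct (upper_pairs d)"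
proof (induction d)
  case (Suc d)
  have "distinct (map (\<lambda>r. (r,d)) [0..<d])" by (simp add: distinct_map inj_on_def)
  thus ?case using Suc by (auto simp: upper_pairs_Suc set_upper_pairs)
qed (simp add: upper_pairs_def)

lemma length_upper_pairs: "length (upper_pairs d) = d * (d - 1) div 2"
proof -
  have "2 * length (upper_pairs d) = d * (d - 1)"
  proof (induction d)
    case (Suc d)
    thus ?case by (cases d) (auto simp: upper_pairs_Suc algebra_simps)
  qed (simp add: upper_pairs_def)
  thus ?thesis by simp
qed

lemma upper_pairs_nth:
  assumes "c < length (upper_pairs d)"
  obtains r s where "upper_pairs d ! c = (r,s)" "r < s" "s < d"
  using nth_mem[OF assms] unfolding set_upper_pairs by auto

lemma upper_pairs_index:
  assumes "r < s" "s < d"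
  obtains c where "c < length (upper_pairs d)" "upper_pairs d ! c = (r,s)"
  using assms set_upper_pairs[of d] by (metis (mono_tags, lifting) case_prodI in_set_conv_nth mem_Collect_eq)

lemma sum_upper_pairs:
  "(\<Sum>c<length (upper_pairs d). f (upper_pairs d ! c)) = (\<Sum>rs\<in>{(r,s). r < s \<and> s < d}. f rs)"
proof -
  have "(\<Sum>c<length (upper_pairs d). f (upper_pairs d ! c)) = sum_list (map f (upper_pairs d))"
    by (simp add: sum_list_sum_nth atLeast0LessThan)
  also have "\<dots> = sum f (set (upper_pairs d))"
    by (rule sum_list_distinct_conv_sum_set[OF distinct_upper_pairs])
  finally show ?thesis by (simp add: set_upper_pairs)
qed

definition pairs_skew :: "nat \<Rightarrow> (nat \<times> nat \<Rightarrow> real vec) \<Rightarrow> nat \<Rightarrow> real mat" where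
  "pairs_skew d w i = mat d d (\<lambda>(p,q). if p < q then w (p,q) $ i else if q < p then - w (q,p) $ i else 0)"

lemma pairs_skew_carrier [simp]: "pairs_skew d w i \<in> carrier_mat d d"
  by (simp add: pairs_skew_def)

lemma pairs_skew_skew: "pairs_skew d w i \<in> skew_mats d"
  by (rule skew_matsI) (auto simp: pairs_skew_def)

lemma stack_pairs_carrier [simp]: "stack_pairs d m w \<in> carrier_vec (length (upper_pairs d) * m)"
  by (simp add: stack_pairs_def)

lemma stack_pairs_index:
  "c < length (upper_pairs d) \<Longrightarrow> i < m \<Longrightarrow> stack_pairs d m w $ (c * m + i) = w (upper_pairs d ! c) $ i"
  by (simp add: stack_pairs_def block_index_less)

lemma stack_pairs_surj:
  assumes v: "v \<in> carrier_vec (length (upper_pairs d) * m)"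
  obtains w where "\<And>rs. w rs \<in> carrier_vec m" "stack_pairs d m w = v"
proof -
  define pos where "pos = (\<lambda>rs. SOME c. c < length (upper_pairs d) \<and> upper_pairs d ! c = rs)"
  have pos: "pos (upper_pairs d ! c) = c" if "c < length (upper_pairs d)" for c
  proof -
    have "pos (upper_pairs d ! c) < length (upper_pairs d) \<and> upper_pairs d ! pos (upper_pairs d ! c) = upper_pairs d ! c"
      unfolding pos_def by (rule someI[of _ c]) (use that in simp)
    thus ?thesis using nth_eq_iff_index_eq[OF distinct_upper_pairs, of "pos (upper_pairs d ! c)" d c] that by simp
  qed
  define w where "w = (\<lambda>rs. vec m (\<lambda>i. v $ (pos rs * m + i)))"
  have "stack_pairs d m w = v"
  proof (rule eq_vecI)
    fix a assume "a < dim_vec v"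
    hence a: "a < length (upper_pairs d) * m" using v by simp
    hence "0 < m" by (cases m) auto
    moreover have "a div m < length (upper_pairs d)" using a by (simp add: less_mult_imp_div_less)
    ultimately show "stack_pairs d m w $ a = v $ a" using a by (simp add: stack_pairs_def w_def pos)
  qed (use v in \<open>simp add: stack_pairs_def\<close>)
  thus ?thesis using that[of w] by (simp add: w_def)
qed

section \<open>The matrix acting on stacked entries above the diagonal\<close>

context
  fixes d m :: nat and L :: "real mat"
  assumes d: "0 < d" and m: "0 < m" and L: "L \<in> carrier_mat (m * d) (m * d)"
begin

lemma Pbar_carrier: "Pbar d m \<in> carrier_mat (length (upper_pairs d) * m) (d * d * m)"
  by (simp add: Pbar_def)

text \<open>A block row \<open>(r, s)\<close> of \<open>Pbar\<close> carries \<open>+1\<close> at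
  \<open>(r, s)\<close> and \<open>-1\<close> at \<open>(s, r)\<close>. Its transpose thus expands
  the entries above the diagonal to whole skew matrices in column-major order, with the view as
  fastest index.\<close>

lemma Pbar_transpose_vec:
  assumes i: "p < d" "q < d" "i < m"
  shows "((Pbar d m)\<^sup>T *\<^sub>v stack_pairs d m w) $ ((q * d + p) * m + i) = pairs_skew d w i $$ (p,q)"
proof -
  let ?up = "upper_pairs d" and ?b = "(q * d + p) * m + i"
  have b: "?b < d * d * m" using i by (intro block_index_less)
  have "((Pbar d m)\<^sup>T *\<^sub>v stack_pairs d m w) $ ?b
      = (\<Sum>a<length ?up * m. Pbar d m $$ (a, ?b) * stack_pairs d m w $ a)"
    using mult_mat_vec_index[of "(Pbar d m)\<^sup>T" "d * d * m" "length ?up * m" "stack_pairs d m w" ?b] Pbar_carrier b by simp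
  also have "\<dots> = (\<Sum>c<length ?up. \<Sum>j<m. Pbar d m $$ (c * m + j, ?b) * stack_pairs d m w $ (c * m + j))"
    by (rule sum_block_index[OF m])
  also have "\<dots> = (\<Sum>c<length ?up. \<Sum>j<m. Pbar_block m (?up ! c) (p, q) $$ (j, i) * w (?up ! c) $ j)"
  proof (intro sum.cong refl)
    fix c j assume "c \<in> {..<length ?up}" "j \<in> {..<m}"
    hence c: "c < length ?up" "j < m" by auto
    have "?b div m = q * d + p" "?b mod m = i" using i by auto
    moreover have "(q * d + p) mod d = p" "(q * d + p) div d = q" using i by auto
    moreover have "c * m + j < length ?up * m" using c by (rule block_index_less)
    ultimately have "Pbar d m $$ (c * m + j, ?b) = Pbar_block m (?up ! c) (p, q) $$ (j, i)"
      using b c by (simp add: Pbar_def)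
    thus "Pbar d m $$ (c * m + j, ?b) * stack_pairs d m w $ (c * m + j) = Pbar_block m (?up ! c) (p, q) $$ (j, i) * w (?up ! c) $ j"
      using stack_pairs_index[OF c] by simp
  qed
  also have "\<dots> = (\<Sum>rs\<in>{(r,s). r < s \<and> s < d}. \<Sum>j<m. Pbar_block m rs (p, q) $$ (j, i) * w rs $ j)"
    by (rule sum_upper_pairs)
  also have "\<dots> = (\<Sum>rs\<in>{(r,s). r < s \<and> s < d}. (if rs = (p,q) then w (p,q) $ i else if rs = (q,p) then - w (q,p) $ i else 0))"
  proof (intro sum.cong refl, clarify)
    fix r s assume rs: "r < s" "s < d"
    have e: "Pbar_block m (r,s) (p,q) $$ (j,i) = (if (r,s) = (p,q) then (if j = i then 1 else 0) else if (r,s) = (q,p) then (if j = i then -1 else 0) else 0)"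
      if "j < m" for j
      using i rs that by (auto simp: Pbar_block_def)
    have "(\<Sum>j<m. Pbar_block m (r,s) (p,q) $$ (j,i) * w (r,s) $ j)
        = (\<Sum>j<m. if j = i then (if (r,s) = (p,q) then w (p,q) $ i else if (r,s) = (q,p) then - w (q,p) $ i else 0) else 0)"
      by (intro sum.cong refl) (auto simp: e)
    thus "(\<Sum>j<m. Pbar_block m (r,s) (p,q) $$ (j,i) * w (r,s) $ j)
        = (if (r,s) = (p,q) then w (p,q) $ i else if (r,s) = (q,p) then - w (q,p) $ i else 0)"
      using i by simp
  qed
  also have "\<dots> = pairs_skew d w i $$ (p,q)"
  proof -
    have f: "finite {(r,s). r < s \<and> s < d}" unfolding set_upper_pairs[symmetric] by simp
    consider "p < q" | "q < p" | "p = q" by linarith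
    thus ?thesis
    proof cases
      case 1
      have "(\<Sum>rs\<in>{(r,s). r < s \<and> s < d}. (if rs = (p,q) then w (p,q) $ i else if rs = (q,p) then - w (q,p) $ i else 0))
          = (\<Sum>rs\<in>{(r,s). r < s \<and> s < d}. if rs = (p,q) then w (p,q) $ i else 0)"
        using 1 by (intro sum.cong) auto
      also have "\<dots> = w (p,q) $ i" unfolding sum.delta[OF f] using i 1 by simp
      also have "\<dots> = pairs_skew d w i $$ (p,q)" using i 1 by (simp add: pairs_skew_def)
      finally show ?thesis .
    next
      case 2
      have "(\<Sum>rs\<in>{(r,s). r < s \<and> s < d}. (if rs = (p,q) then w (p,q) $ i else if rs = (q,p) then - w (q,p) $ i else 0))
          = (\<Sum>rs\<in>{(r,s). r < s \<and> s < d}. if rs = (q,p) then - w (q,p) $ i else 0)"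
        using 2 by (intro sum.cong) auto
      also have "\<dots> = - w (q,p) $ i" unfolding sum.delta[OF f] using i 2 by simp
      also have "\<dots> = pairs_skew d w i $$ (p,q)" using i 2 by (simp add: pairs_skew_def)
      finally show ?thesis .
    next
      case 3
      thus ?thesis using i by (auto simp: pairs_skew_def intro!: sum.neutral)
    qed
  qed
  finally show ?thesis .
qed

text \<open>Conjugation by \<open>P\<close> regroups the indices by coordinate instead of by view:
  position \<open>p * m + i\<close> stands for \<open>i * d + p\<close>.\<close>

lemma perm_P_conj_index:
  assumes t: "t < m * d" "t' < m * d"
  shows "(perm_P d m * L * (perm_P d m)\<^sup>T) $$ (t,t') = L $$ ((t mod m) * d + t div m, (t' mod m) * d + t' div m)"
proof -
  have P: "perm_P d m \<in> carrier_mat (m * d) (m * d)" by (simp add: perm_P_def)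
  have s: "(x mod m) * d + x div m < m * d" if "x < m * d" for x
    using that m by (intro block_index_less) (auto simp: less_mult_imp_div_less mult.commute)
  have PL: "(perm_P d m * L) $$ (t,b) = L $$ ((t mod m) * d + t div m, b)" if "b < m * d" for b
  proof -
    have "(perm_P d m * L) $$ (t,b) = (\<Sum>c<m * d. perm_P d m $$ (t,c) * L $$ (c,b))"
      using P L t that by (simp add: scalar_prod_def atLeast0LessThan)
    also have "\<dots> = (\<Sum>c<m * d. if c = (t mod m) * d + t div m then L $$ (c,b) else 0)"
      using t by (intro sum.cong refl) (auto simp: perm_P_def)
    finally show ?thesis using s[OF t(1)] by simp
  qed
  have "(perm_P d m * L * (perm_P d m)\<^sup>T) $$ (t,t') = (\<Sum>b<m * d. (perm_P d m * L) $$ (t,b) * perm_P d m $$ (t',b))"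
    by (rule mult_transpose_index[OF mult_carrier_mat[OF P L] P t])
  also have "\<dots> = (\<Sum>b<m * d. if b = (t' mod m) * d + t' div m then L $$ ((t mod m) * d + t div m, b) else 0)"
  proof (intro sum.cong refl)
    fix b assume "b \<in> {..<m * d}"
    hence b: "b < m * d" by simp
    show "(perm_P d m * L) $$ (t,b) * perm_P d m $$ (t',b)
        = (if b = (t' mod m) * d + t' div m then L $$ ((t mod m) * d + t div m, b) else 0)"
      unfolding PL[OF b] using b t by (simp add: perm_P_def)
  qed
  finally show ?thesis using s[OF t(2)] by simp
qed

text \<open>The factor \<open>1\<^sub>m d\<close> of the Kronecker product keeps the columns
  \<open>q\<close> of the skew matrices apart, so the form is a sum over columns of the form of
  \<open>L\<close>.\<close>

lemma kron_perm_quad: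
  assumes "u \<in> carrier_vec (d * d * m)" "u' \<in> carrier_vec (d * d * m)"
  shows "u \<bullet> (kron (1\<^sub>m d) (perm_P d m * L * (perm_P d m)\<^sup>T) *\<^sub>v u')
    = (\<Sum>q<d. \<Sum>p<d. \<Sum>i<m. \<Sum>p'<d. \<Sum>i'<m. u $ ((q * d + p) * m + i) * (L $$ (i * d + p, i' * d + p') * u' $ ((q * d + p') * m + i')))"
proof -
  let ?K = "perm_P d m * L * (perm_P d m)\<^sup>T"
  have P: "perm_P d m \<in> carrier_mat (m * d) (m * d)" by (simp add: perm_P_def)
  have K: "?K \<in> carrier_mat (m * d) (m * d)" using P L by (intro mult_carrier_mat[of _ _ "m * d"]) auto
  have kd: "kron (1\<^sub>m d) ?K \<in> carrier_mat (d * d * m) (d * d * m)"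
    unfolding kron_def carrier_matD[OF K] carrier_matD[OF one_carrier_mat] by (simp add: mult.assoc mult.left_commute mult.commute)
  have bi: "(q * d + p) * m + i < d * d * m" if "q < d" "p < d" "i < m" for q p i
    using that by (intro block_index_less)
  have spl: "(\<Sum>b<d * d * m. g b) = (\<Sum>q<d. \<Sum>p<d. \<Sum>i<m. g ((q * d + p) * m + i))" for g :: "nat \<Rightarrow> real"
    unfolding sum_block_index[OF m] sum_block_index[OF d] ..
  have ent: "kron (1\<^sub>m d) ?K $$ ((q * d + p) * m + i, (q' * d + p') * m + i') = (if q = q' then L $$ (i * d + p, i' * d + p') else 0)"
    if "q < d" "p < d" "i < m" "q' < d" "p' < d" "i' < m" for q p i q' p' i'
  proof -
    have t: "p * m + i < m * d" "p' * m + i' < m * d"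
      using that block_index_less[of p d i m] block_index_less[of p' d i' m] by (auto simp: mult.commute)
    have dm: "((q * d + p) * m + i) div (m * d) = q" "((q * d + p) * m + i) mod (m * d) = p * m + i"
      if "p * m + i < m * d" for q p i
    proof -
      have e: "(q * d + p) * m + i = q * (m * d) + (p * m + i)" by (simp add: algebra_simps)
      have "(q * n + x) div n = q" "(q * n + x) mod n = x" if "x < n" for x n :: nat using that by simp_all
      from this[OF that] show "((q * d + p) * m + i) div (m * d) = q" "((q * d + p) * m + i) mod (m * d) = p * m + i"
        unfolding e .
    qed
    have "kron (1\<^sub>m d) ?K $$ ((q * d + p) * m + i, (q' * d + p') * m + i')
        = 1\<^sub>m d $$ (q, q') * ?K $$ (p * m + i, p' * m + i')"
    proof -
      have "d * d * m = d * (m * d)" by simp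
      hence "(q * d + p) * m + i < d * (m * d)" "(q' * d + p') * m + i' < d * (m * d)"
        using bi[OF that(1-3)] bi[OF that(4-6)] by (simp_all only:)
      thus ?thesis unfolding kron_def
        by (simp only: carrier_matD[OF K] carrier_matD[OF one_carrier_mat] index_mat dm[OF t(1)] dm[OF t(2)] split)
    qed
    also have "?K $$ (p * m + i, p' * m + i') = L $$ (i * d + p, i' * d + p')"
      unfolding perm_P_conj_index[OF t] using that by simp
    finally show ?thesis using that by simp
  qed
  have inner: "(\<Sum>q'<d. \<Sum>p'<d. \<Sum>i'<m. (if q = q' then L $$ (i * d + p, i' * d + p') * u' $ ((q' * d + p') * m + i') else 0))
        = (\<Sum>p'<d. \<Sum>i'<m. L $$ (i * d + p, i' * d + p') * u' $ ((q * d + p') * m + i'))" if "q < d" for q p i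
  proof -
    have "(\<Sum>q'<d. \<Sum>p'<d. \<Sum>i'<m. (if q = q' then L $$ (i * d + p, i' * d + p') * u' $ ((q' * d + p') * m + i') else 0))
        = (\<Sum>q'<d. if q = q' then (\<Sum>p'<d. \<Sum>i'<m. L $$ (i * d + p, i' * d + p') * u' $ ((q' * d + p') * m + i')) else 0)"
      by (intro sum.cong refl) auto
    thus ?thesis using that by simp
  qed
  have "u \<bullet> (kron (1\<^sub>m d) ?K *\<^sub>v u') = (\<Sum>b<d * d * m. u $ b * (\<Sum>b'<d * d * m. kron (1\<^sub>m d) ?K $$ (b,b') * u' $ b'))"
    using kd assms mult_mat_vec_index[OF kd assms(2)]
    by (simp add: scalar_prod_def[of u] atLeast0LessThan del: index_mult_mat_vec cong: sum.cong_simp)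
  also have "\<dots> = (\<Sum>q<d. \<Sum>p<d. \<Sum>i<m. u $ ((q * d + p) * m + i) *
      (\<Sum>q'<d. \<Sum>p'<d. \<Sum>i'<m. (if q = q' then L $$ (i * d + p, i' * d + p') * u' $ ((q' * d + p') * m + i') else 0)))"
    unfolding spl by (intro sum.cong refl arg_cong2[where f="(*)"]) (auto simp: ent)
  also have "\<dots> = (\<Sum>q<d. \<Sum>p<d. \<Sum>i<m. u $ ((q * d + p) * m + i) *
      (\<Sum>p'<d. \<Sum>i'<m. L $$ (i * d + p, i' * d + p') * u' $ ((q * d + p') * m + i')))"
    by (intro sum.cong refl) (simp only: lessThan_iff inner)
  finally show ?thesis unfolding sum_distrib_left .
qed

text \<open>The order of summation is that of \<open>kron_perm_quad\<close>, so that the two forms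
  can be compared term by term.\<close>

lemma mat_tr_vstack:
  assumes "\<And>i. i < m \<Longrightarrow> y i \<in> carrier_mat d d" "\<And>i. i < m \<Longrightarrow> z i \<in> carrier_mat d d"
  shows "mat_tr ((vstack d m y)\<^sup>T * L * vstack d m z)
    = (\<Sum>q<d. \<Sum>p<d. \<Sum>i<m. \<Sum>p'<d. \<Sum>i'<m. y i $$ (p,q) * (L $$ (i * d + p, i' * d + p') * z i' $$ (p',q)))"
proof -
  have LZ: "L * vstack d m z \<in> carrier_mat (m * d) d" using L by (rule mult_carrier_mat) simp
  have "mat_tr ((vstack d m y)\<^sup>T * L * vstack d m z) = frob_inner (vstack d m y) (L * vstack d m z)"
    unfolding frob_inner_def using assoc_mult_mat[OF _ L vstack_carrier, of "(vstack d m y)\<^sup>T" d] by simp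
  also have "\<dots> = (\<Sum>r<m * d. \<Sum>q<d. vstack d m y $$ (r,q) * (\<Sum>r'<m * d. L $$ (r,r') * vstack d m z $$ (r',q)))"
    unfolding frob_inner_double[OF vstack_carrier LZ] using L
    by (intro sum.cong refl) (simp add: scalar_prod_def atLeast0LessThan)
  also have "\<dots> = (\<Sum>i<m. \<Sum>p<d. \<Sum>q<d. y i $$ (p,q) * (\<Sum>i'<m. \<Sum>p'<d. L $$ (i * d + p, i' * d + p') * z i' $$ (p',q)))"
    unfolding sum_block_index[OF d] by (intro sum.cong refl) simp
  also have "\<dots> = (\<Sum>i<m. \<Sum>p<d. \<Sum>q<d. \<Sum>p'<d. \<Sum>i'<m. y i $$ (p,q) * (L $$ (i * d + p, i' * d + p') * z i' $$ (p',q)))"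
    unfolding sum_distrib_left by (intro sum.cong refl sum.swap)
  also have "\<dots> = (\<Sum>p<d. \<Sum>q<d. \<Sum>i<m. \<Sum>p'<d. \<Sum>i'<m. y i $$ (p,q) * (L $$ (i * d + p, i' * d + p') * z i' $$ (p',q)))"
    by (rule sum_rotate)
  also have "\<dots> = (\<Sum>q<d. \<Sum>p<d. \<Sum>i<m. \<Sum>p'<d. \<Sum>i'<m. y i $$ (p,q) * (L $$ (i * d + p, i' * d + p') * z i' $$ (p',q)))"
    by (rule sum.swap)
  finally show ?thesis .
qed

abbreviation "LL \<equiv> Pbar d m * kron (1\<^sub>m d) (perm_P d m * L * (perm_P d m)\<^sup>T) * (Pbar d m)\<^sup>T"

lemma kron_perm_carrier: "kron (1\<^sub>m d) (perm_P d m * L * (perm_P d m)\<^sup>T) \<in> carrier_mat (d * d * m) (d * d * m)"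
proof -
  have "dim_row (perm_P d m * L * (perm_P d m)\<^sup>T) = m * d" "dim_col (perm_P d m * L * (perm_P d m)\<^sup>T) = m * d"
    by (auto simp: perm_P_def)
  thus ?thesis by (simp add: kron_def mult_ac)
qed

lemma LL_carrier: "LL \<in> carrier_mat (length (upper_pairs d) * m) (length (upper_pairs d) * m)"
  using Pbar_carrier kron_perm_carrier by (intro mult_carrier_mat[of _ _ "d * d * m"]) auto

text \<open>\<open>Pbar\<close> on the left and its transpose on the right turn both stacked vectors
  into vectorised skew families; the middle factor applies \<open>L\<close> to each column, and
  summing over columns gives the trace.\<close>

theorem LL_bilinear:
  "stack_pairs d m w \<bullet> (LL *\<^sub>v stack_pairs d m w')
    = mat_tr ((vstack d m (pairs_skew d w))\<^sup>T * L * vstack d m (pairs_skew d w'))"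
proof -
  let ?K = "kron (1\<^sub>m d) (perm_P d m * L * (perm_P d m)\<^sup>T)"
  let ?v = "stack_pairs d m w" and ?v' = "stack_pairs d m w'"
  define u u' where "u = (Pbar d m)\<^sup>T *\<^sub>v ?v" and "u' = (Pbar d m)\<^sup>T *\<^sub>v ?v'"
  have PT: "(Pbar d m)\<^sup>T \<in> carrier_mat (d * d * m) (length (upper_pairs d) * m)" using Pbar_carrier by simp
  have u: "u \<in> carrier_vec (d * d * m)" "u' \<in> carrier_vec (d * d * m)"
    unfolding u_def u'_def using mult_mat_vec_carrier[OF PT stack_pairs_carrier] by auto
  have "LL *\<^sub>v ?v' = Pbar d m *\<^sub>v (?K *\<^sub>v u')"
    unfolding u'_def using assoc_mult_mat_vec[OF mult_carrier_mat[OF Pbar_carrier kron_perm_carrier] PT stack_pairs_carrier]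
      assoc_mult_mat_vec[OF Pbar_carrier kron_perm_carrier mult_mat_vec_carrier[OF PT stack_pairs_carrier]] by simp
  hence "?v \<bullet> (LL *\<^sub>v ?v') = u \<bullet> (?K *\<^sub>v u')"
    using transpose_vec_mult_scalar[OF Pbar_carrier mult_mat_vec_carrier[OF kron_perm_carrier u(2)] stack_pairs_carrier]
    by (simp add: u_def)
  also have "\<dots> = mat_tr ((vstack d m (pairs_skew d w))\<^sup>T * L * vstack d m (pairs_skew d w'))"
    unfolding kron_perm_quad[OF u] mat_tr_vstack[OF pairs_skew_carrier pairs_skew_carrier]
    unfolding u_def u'_def by (intro sum.cong refl) (simp add: Pbar_transpose_vec)
  finally show ?thesis .
qed

end

section \<open>Positivity modulo constant families\<close>

lemma L_form_cong:
  assumes "\<And>i. i < m \<Longrightarrow> y i = y' i" "\<And>i. i < m \<Longrightarrow> z i = z' i"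
  shows "L_form d m C S y z = L_form d m C S y' z'"
proof -
  have "block_mult d m S y = block_mult d m S y'" "block_mult d m S z = block_mult d m S z'"
    unfolding block_mult_def using assms by (auto intro!: vstack_cong)
  moreover have "(\<Sum>i<m. frob_inner (y i) (C_hat_block d C S i * z i)) = (\<Sum>i<m. frob_inner (y' i) (C_hat_block d C S i * z' i))"
    using assms by (intro sum.cong) auto
  ultimately show ?thesis unfolding L_form_def by simp
qed

lemma mat_index_bilinear:
  assumes "A \<in> carrier_mat n n" "i < n" "j < n"
  shows "unit_vec n i \<bullet> (A *\<^sub>v unit_vec n j) = (A $$ (i,j) :: real)"
  using assms by (simp add: scalar_prod_left_unit[of _ n])

text \<open>
  The hypothesis \<open>C_hat_sym\<close> is what criticality of the objective at \<open>S\<close> amounts to.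
\<close>
locale stress_form =
  fixes d m :: nat and C S :: "real mat"
  assumes d: "0 < d" and m: "0 < m" and C: "C \<in> carrier_mat (m * d) (m * d)" and Csym: "C\<^sup>T = C"
    and S: "S \<in> carrier_mat (m * d) d"
    and C_hat_sym: "\<And>i. i < m \<Longrightarrow> (C_hat_block d C S i)\<^sup>T = C_hat_block d C S i"
begin

abbreviation "Lf \<equiv> L_form d m C S"

lemmas form_linear_right = L_form_linear_right[OF d C Csym S]
lemmas form_const_right = L_form_const_right[OF d C Csym S]

lemma form_commute:
  assumes y: "\<And>i. i < m \<Longrightarrow> y i \<in> carrier_mat d d" and z: "\<And>i. i < m \<Longrightarrow> z i \<in> carrier_mat d d"
  shows "Lf y z = Lf z y"
  by (rule L_form_commute[OF d C Csym S]) (fact C_hat_sym y z)+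

lemma form_quadratic:
  assumes y: "\<And>i. i < m \<Longrightarrow> y i \<in> carrier_mat d d" and z: "\<And>i. i < m \<Longrightarrow> z i \<in> carrier_mat d d"
  shows "Lf (\<lambda>i. u \<cdot>\<^sub>m y i + v \<cdot>\<^sub>m z i) (\<lambda>i. u \<cdot>\<^sub>m y i + v \<cdot>\<^sub>m z i) = u^2 * Lf y y + 2 * u * v * Lf y z + v^2 * Lf z z"
proof -
  let ?s = "\<lambda>i. u \<cdot>\<^sub>m y i + v \<cdot>\<^sub>m z i"
  have s: "?s i \<in> carrier_mat d d" if "i < m" for i using y[OF that] z[OF that] by simp
  have 1: "Lf ?s ?s = u * Lf ?s y + v * Lf ?s z" by (rule form_linear_right) (fact s y z)+
  have 2: "Lf ?s y = Lf y ?s" by (rule form_commute) (fact s y)+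
  have 6: "Lf ?s z = Lf z ?s" by (rule form_commute) (fact s z)+
  have 3: "Lf y ?s = u * Lf y y + v * Lf y z" by (rule form_linear_right) (fact y z)+
  have 4: "Lf z ?s = u * Lf z y + v * Lf z z" by (rule form_linear_right) (fact y z)+
  have 5: "Lf z y = Lf y z" by (rule form_commute) (fact y z)+
  show ?thesis unfolding 1 2 6 3 4 5 by (simp add: power2_eq_square algebra_simps)
qed

lemma form_shift:
  assumes y: "\<And>i. i < m \<Longrightarrow> y i \<in> carrier_mat d d" and V: "V \<in> carrier_mat d d"
  shows "Lf (\<lambda>i. y i - V) (\<lambda>i. y i - V) = Lf y y"
proof -
  have "Lf (\<lambda>i. y i - V) (\<lambda>i. y i - V) = Lf (\<lambda>i. 1 \<cdot>\<^sub>m y i + (-1) \<cdot>\<^sub>m V) (\<lambda>i. 1 \<cdot>\<^sub>m y i + (-1) \<cdot>\<^sub>m V)"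
  proof -
    have e: "y i - V = 1 \<cdot>\<^sub>m y i + (-1) \<cdot>\<^sub>m V" if "i < m" for i
      using y[OF that] V by (intro eq_matI) auto
    show ?thesis by (rule L_form_cong) (fact e)+
  qed
  also have "\<dots> = 1^2 * Lf y y + 2 * 1 * (-1) * Lf y (\<lambda>_. V) + (-1)^2 * Lf (\<lambda>_. V) (\<lambda>_. V)"
    by (rule form_quadratic) (fact y, rule V)
  also have "Lf y (\<lambda>_. V) = 0" by (rule form_const_right) (fact y V)+
  also have "Lf (\<lambda>_. V) (\<lambda>_. V) = 0" by (rule form_const_right) (rule V)+
  also have "1^2 * Lf y y + 2 * 1 * (-1) * 0 + (-1)^2 * 0 = Lf y y" by simp
  finally show ?thesis .
qed

lemma mat_tr_form:
  assumes "\<And>i. i < m \<Longrightarrow> \<Omega> i \<in> skew_mats d"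
  shows "mat_tr ((vstack d m \<Omega>)\<^sup>T * L_at d m C S * vstack d m \<Omega>) = Lf \<Omega> \<Omega>"
  by (rule L_at_form[OF d C S]; rule skew_matsD(1)[OF assms])

text \<open>The condition on families that are not all equal, which serves as the hub: every other
  condition is compared with it.\<close>

definition form_positive :: bool where
  "form_positive \<longleftrightarrow> (\<forall>\<Omega>. (\<forall>i<m. \<Omega> i \<in> skew_mats d) \<and> (\<exists>i<m. \<exists>j<m. \<Omega> i \<noteq> \<Omega> j) \<longrightarrow> 0 < Lf \<Omega> \<Omega>)"

lemma form_positiveD:
  "form_positive \<Longrightarrow> (\<And>i. i < m \<Longrightarrow> \<Omega> i \<in> skew_mats d) \<Longrightarrow> i < m \<Longrightarrow> j < m \<Longrightarrow> \<Omega> i \<noteq> \<Omega> j \<Longrightarrow> 0 < Lf \<Omega> \<Omega>"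
  unfolding form_positive_def by blast

lemma form_positive_iff_trace:
  "(\<forall>\<Omega>. (\<forall>i<m. \<Omega> i \<in> skew_mats d) \<and> (\<exists>i<m. \<exists>j<m. \<Omega> i \<noteq> \<Omega> j) \<longrightarrow>
       0 < mat_tr ((vstack d m \<Omega>)\<^sup>T * L_at d m C S * vstack d m \<Omega>)) \<longleftrightarrow> form_positive"
  unfolding form_positive_def using mat_tr_form by auto

text \<open>Subtracting the mean \<open>V\<close> does not change the form, keeps skewness and makes
  the sum zero; a family that is not constant cannot become zero. Conversely a constant family with
  sum zero vanishes because \<open>m\<close> is positive.\<close>

lemma form_positive_iff_centered:
  "(\<forall>\<Omega>. (\<forall>i<m. \<Omega> i \<in> skew_mats d) \<and> mat_sum d d \<Omega> {..<m} = 0\<^sub>m d d \<and> (\<exists>i<m. \<Omega> i \<noteq> 0\<^sub>m d d) \<longrightarrow>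
       0 < mat_tr ((vstack d m \<Omega>)\<^sup>T * L_at d m C S * vstack d m \<Omega>)) \<longleftrightarrow> form_positive" (is "?P \<longleftrightarrow> _")
proof
  assume P: ?P
  show form_positive unfolding form_positive_def
  proof (intro allI impI, elim conjE exE)
    fix \<Omega> i j assume sk: "\<forall>i<m. \<Omega> i \<in> skew_mats d" and ij: "i < m" "j < m" "\<Omega> i \<noteq> \<Omega> j"
    define V where "V = mat d d (\<lambda>ab. (\<Sum>i<m. \<Omega> i $$ ab) / real m)"
    have V: "V \<in> carrier_mat d d" by (simp add: V_def)
    have cO: "\<Omega> i \<in> carrier_mat d d" if "i < m" for i using skew_matsD(1) sk that by auto
    have Vs: "V $$ (a,b) = - V $$ (b,a)" if "a < d" "b < d" for a b
    proof -
      have "(\<Sum>i<m. \<Omega> i $$ (a,b)) = (\<Sum>i<m. - \<Omega> i $$ (b,a))"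
        using sk that by (intro sum.cong refl skew_matsD(3)) auto
      thus ?thesis using that by (simp add: V_def sum_negf)
    qed
    have sk': "\<Omega> i - V \<in> skew_mats d" if "i < m" for i
    proof (rule skew_matsI)
      fix a b assume ab: "a < d" "b < d"
      have "(\<Omega> i - V) $$ (a,b) = \<Omega> i $$ (a,b) - V $$ (a,b)" "(\<Omega> i - V) $$ (b,a) = \<Omega> i $$ (b,a) - V $$ (b,a)"
        using ab V by auto
      moreover have "\<Omega> i $$ (a,b) = - \<Omega> i $$ (b,a)" using sk that ab by (intro skew_matsD(3)) auto
      ultimately show "(\<Omega> i - V) $$ (a,b) = - (\<Omega> i - V) $$ (b,a)" using Vs[OF ab] by linarith
    qed (use cO[OF that] V in auto)
    have sum0: "mat_sum d d (\<lambda>i. \<Omega> i - V) {..<m} = 0\<^sub>m d d"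
    proof (rule eq_matI)
      fix a b assume "a < dim_row (0\<^sub>m d d)" "b < dim_col (0\<^sub>m d d)"
      hence ab: "a < d" "b < d" by auto
      have "mat_sum d d (\<lambda>i. \<Omega> i - V) {..<m} $$ (a,b) = (\<Sum>i<m. \<Omega> i $$ (a,b) - V $$ (a,b))"
        using ab V by (simp add: mat_sum_def)
      also have "\<dots> = 0" using ab m by (simp add: sum_subtractf V_def)
      finally show "mat_sum d d (\<lambda>i. \<Omega> i - V) {..<m} $$ (a,b) = 0\<^sub>m d d $$ (a,b)" using ab by simp
    qed (auto simp: mat_sum_def)
    have nz: "\<Omega> i - V \<noteq> 0\<^sub>m d d \<or> \<Omega> j - V \<noteq> 0\<^sub>m d d"
    proof (rule ccontr)
      assume "\<not> ?thesis"
      hence "\<Omega> i - V = 0\<^sub>m d d" "\<Omega> j - V = 0\<^sub>m d d" by auto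
      hence e: "\<Omega> i - V = \<Omega> j - V" by simp
      have "\<Omega> i = \<Omega> j"
      proof (rule eq_matI)
        fix a b assume "a < dim_row (\<Omega> j)" "b < dim_col (\<Omega> j)"
        hence ab: "a < d" "b < d" using cO[OF ij(2)] by auto
        have "(\<Omega> i - V) $$ (a,b) = (\<Omega> j - V) $$ (a,b)" by (simp only: e)
        thus "\<Omega> i $$ (a,b) = \<Omega> j $$ (a,b)" using ab V by simp
      qed (use cO[OF ij(1)] cO[OF ij(2)] in auto)
      thus False using ij by simp
    qed
    have ex: "\<exists>i<m. \<Omega> i - V \<noteq> 0\<^sub>m d d" using nz ij by auto
    have all: "\<forall>i<m. \<Omega> i - V \<in> skew_mats d" using sk' by simp
    have "0 < mat_tr ((vstack d m (\<lambda>i. \<Omega> i - V))\<^sup>T * L_at d m C S * vstack d m (\<lambda>i. \<Omega> i - V))"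
      by (rule spec[OF P, THEN mp]) (intro conjI all sum0 ex)
    also have "\<dots> = Lf (\<lambda>i. \<Omega> i - V) (\<lambda>i. \<Omega> i - V)" by (rule mat_tr_form) (fact sk')
    also have "\<dots> = Lf \<Omega> \<Omega>" by (rule form_shift) (fact cO V)+
    finally show "0 < Lf \<Omega> \<Omega>" .
  qed
next
  assume pos: form_positive
  show ?P
  proof (intro allI impI, elim conjE exE)
    fix \<Omega> i assume sk: "\<forall>i<m. \<Omega> i \<in> skew_mats d" and s: "mat_sum d d \<Omega> {..<m} = 0\<^sub>m d d"
      and i: "i < m" "\<Omega> i \<noteq> 0\<^sub>m d d"
    have "\<exists>j<m. \<Omega> j \<noteq> \<Omega> i"
    proof (rule ccontr)
      assume "\<not> ?thesis"
      hence e: "\<Omega> j = \<Omega> i" if "j < m" for j using that by auto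
      have "\<Omega> i = 0\<^sub>m d d"
      proof (rule eq_matI)
        fix a b assume "a < dim_row (0\<^sub>m d d)" "b < dim_col (0\<^sub>m d d)"
        hence ab: "a < d" "b < d" by auto
        have "(\<Sum>j<m. \<Omega> j $$ (a,b)) = mat_sum d d \<Omega> {..<m} $$ (a,b)" using ab by (simp add: mat_sum_def)
        moreover have "(\<Sum>j<m. \<Omega> j $$ (a,b)) = real m * \<Omega> i $$ (a,b)" using e by simp
        ultimately show "\<Omega> i $$ (a,b) = 0\<^sub>m d d $$ (a,b)" using s ab m by simp
      qed (use skew_matsD(1)[of "\<Omega> i" d] sk i in auto)
      thus False using i by simp
    qed
    then obtain j where "j < m" "\<Omega> j \<noteq> \<Omega> i" by blast
    thus "0 < mat_tr ((vstack d m \<Omega>)\<^sup>T * L_at d m C S * vstack d m \<Omega>)"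
      using form_positiveD[OF pos, of \<Omega> j i] sk i mat_tr_form[of \<Omega>] by auto
  qed
qed

lemma LL_at_bilinear: "stack_pairs d m w \<bullet> (LL_at d m C S *\<^sub>v stack_pairs d m w') = Lf (pairs_skew d w) (pairs_skew d w')"
  unfolding LL_at_def calL_at_def LL_bilinear[OF d m L_at_carrier[OF d C S]]
  by (rule L_at_form[OF d C S]; rule pairs_skew_carrier)

lemma LL_at_quad_form: "quad_form (LL_at d m C S) (stack_pairs d m w) = Lf (pairs_skew d w) (pairs_skew d w)"
  unfolding quad_form_def by (rule LL_at_bilinear)

lemma LL_at_carrier: "LL_at d m C S \<in> carrier_mat (length (upper_pairs d) * m) (length (upper_pairs d) * m)"
  unfolding LL_at_def calL_at_def by (rule LL_carrier[OF d m L_at_carrier[OF d C S]])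

text \<open>Entries are values of the bilinear form at unit vectors, and every vector is a stack, so
  the symmetry of the form on families passes to the matrix.\<close>

lemma LL_at_symmetric: "(LL_at d m C S)\<^sup>T = LL_at d m C S"
proof (rule eq_matI)
  let ?n = "length (upper_pairs d) * m" and ?A = "LL_at d m C S"
  note A = LL_at_carrier
  fix i j assume "i < dim_row ?A" "j < dim_col ?A"
  hence ij: "i < ?n" "j < ?n" using A by auto
  obtain w where w: "stack_pairs d m w = unit_vec ?n i" using stack_pairs_surj[OF unit_vec_carrier] by metis
  obtain w' where w': "stack_pairs d m w' = unit_vec ?n j" using stack_pairs_surj[OF unit_vec_carrier] by metis
  have "?A $$ (j,i) = ?A $$ (i,j)"
    unfolding mat_index_bilinear[OF A ij, symmetric] mat_index_bilinear[OF A ij(2,1), symmetric]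
    unfolding w[symmetric] w'[symmetric] LL_at_bilinear by (rule form_commute; rule pairs_skew_carrier)
  thus "?A\<^sup>T $$ (i,j) = ?A $$ (i,j)" using A ij by simp
qed (use LL_at_carrier in auto)

lemma pairs_skew_of_family:
  assumes sk: "\<Omega> i \<in> skew_mats d" and i: "i < m"
  shows "pairs_skew d (\<lambda>rs. vec m (\<lambda>i. \<Omega> i $$ rs)) i = \<Omega> i"
proof (rule eq_matI)
  fix a b assume "a < dim_row (\<Omega> i)" "b < dim_col (\<Omega> i)"
  hence ab: "a < d" "b < d" using skew_matsD(1)[OF sk] by auto
  have "pairs_skew d (\<lambda>rs. vec m (\<lambda>i. \<Omega> i $$ rs)) i $$ (a,b)
      = (if a < b then \<Omega> i $$ (a,b) else if b < a then - \<Omega> i $$ (b,a) else 0)"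
    using ab i by (simp add: pairs_skew_def)
  also have "\<dots> = \<Omega> i $$ (a,b)"
  proof (cases "a = b")
    case True
    have "\<Omega> i $$ (a,a) = 0" using skew_matsD(3)[OF sk ab(1) ab(1)] by linarith
    thus ?thesis using True by simp
  next
    case False
    thus ?thesis unfolding skew_matsD(3)[OF sk ab(2,1)] by simp
  qed
  finally show "pairs_skew d (\<lambda>rs. vec m (\<lambda>i. \<Omega> i $$ rs)) i $$ (a,b) = \<Omega> i $$ (a,b)" .
qed (use skew_matsD(1)[OF sk] in \<open>auto simp: pairs_skew_def\<close>)

text \<open>A skew family is constant across the views exactly if each entry above the diagonal is,
  and the vectors \<open>w (r, s)\<close> collect these entries over the views.\<close>

lemma form_positive_iff_quad_form:
  "(\<forall>w. (\<forall>r s. r < s \<and> s < d \<longrightarrow> w (r, s) \<in> carrier_vec m) \<and> (\<exists>r s. r < s \<and> s < d \<and> \<not> constant_vec (w (r, s))) \<longrightarrow>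
       0 < quad_form (LL_at d m C S) (stack_pairs d m w)) \<longleftrightarrow> form_positive" (is "?P \<longleftrightarrow> _")
proof
  assume P: ?P
  show form_positive unfolding form_positive_def
  proof (intro allI impI, elim conjE exE)
    fix \<Omega> i j assume sk: "\<forall>i<m. \<Omega> i \<in> skew_mats d" and ij: "i < m" "j < m" "\<Omega> i \<noteq> \<Omega> j"
    define w where "w = (\<lambda>rs. vec m (\<lambda>i. \<Omega> i $$ rs))"
    have pw: "pairs_skew d w i = \<Omega> i" if "i < m" for i
      unfolding w_def by (rule pairs_skew_of_family) (use sk that in auto)
    have nc: "\<exists>r s. r < s \<and> s < d \<and> \<not> constant_vec (w (r,s))"
    proof (rule ccontr)
      assume "\<not> ?thesis"
      hence c: "constant_vec (w (r,s))" if "r < s" "s < d" for r s using that by blast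
      have e: "w (r,s) $ i = w (r,s) $ j" if rs: "r < s" "s < d" for r s
      proof -
        obtain x where "w (r,s) = x \<cdot>\<^sub>v vec (dim_vec (w (r,s))) (\<lambda>_. 1)"
          using c[OF rs] unfolding constant_vec_def by blast
        hence x: "w (r,s) = x \<cdot>\<^sub>v vec m (\<lambda>_. 1)" by (simp add: w_def)
        show ?thesis unfolding x using ij by simp
      qed
      have "pairs_skew d w i = pairs_skew d w j"
        by (rule eq_matI) (auto simp: pairs_skew_def e)
      thus False using pw[OF ij(1)] pw[OF ij(2)] ij(3) by simp
    qed
    have "0 < quad_form (LL_at d m C S) (stack_pairs d m w)"
      using P nc by (auto simp: w_def)
    also have "\<dots> = Lf \<Omega> \<Omega>" unfolding LL_at_quad_form by (rule L_form_cong) (fact pw)+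
    finally show "0 < Lf \<Omega> \<Omega>" .
  qed
next
  assume pos: form_positive
  show ?P
  proof (intro allI impI, elim conjE exE)
    fix w r s assume w: "\<forall>r s. r < s \<and> s < d \<longrightarrow> w (r, s) \<in> carrier_vec m"
      and rs: "r < s" "s < d" "\<not> constant_vec (w (r,s))"
    have wc: "w (r,s) \<in> carrier_vec m" using w rs by blast
    have "\<exists>i<m. pairs_skew d w i \<noteq> pairs_skew d w 0"
    proof (rule ccontr)
      assume "\<not> ?thesis"
      hence e: "pairs_skew d w i = pairs_skew d w 0" if "i < m" for i using that by blast
      have e0: "w (r,s) $ i = w (r,s) $ 0" if "i < m" for i
        using arg_cong[OF e[OF that], of "\<lambda>A. A $$ (r,s)"] rs by (simp add: pairs_skew_def)
      have "w (r,s) = w (r,s) $ 0 \<cdot>\<^sub>v vec m (\<lambda>_. 1)"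
      proof (rule eq_vecI)
        fix i assume "i < dim_vec (w (r,s) $ 0 \<cdot>\<^sub>v vec m (\<lambda>_. 1))"
        hence i: "i < m" by simp
        show "w (r,s) $ i = (w (r,s) $ 0 \<cdot>\<^sub>v vec m (\<lambda>_. 1)) $ i" unfolding e0[OF i] using i by simp
      qed (use wc in simp)
      hence "constant_vec (w (r,s))" unfolding constant_vec_def carrier_vecD[OF wc] by (rule exI)
      thus False using rs by simp
    qed
    then obtain i where "i < m" "pairs_skew d w i \<noteq> pairs_skew d w 0" by blast
    thus "0 < quad_form (LL_at d m C S) (stack_pairs d m w)"
      unfolding LL_at_quad_form by (intro form_positiveD[OF pos pairs_skew_skew _ m])
  qed
qed

section \<open>Vectors with constant blocks as an explicit part of the kernel\<close>

lemma constant_vecE: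
  assumes "constant_vec v" "v \<in> carrier_vec n" obtains c where "\<And>i. i < n \<Longrightarrow> v $ i = c"
proof -
  obtain c where c: "v = c \<cdot>\<^sub>v vec (dim_vec v) (\<lambda>_. 1)" using assms(1) unfolding constant_vec_def by blast
  have "v $ i = c" if "i < n" for i by (subst c) (use assms(2) that in simp)
  thus ?thesis using that by blast
qed

lemma constant_vecI:
  assumes "v \<in> carrier_vec n" "\<And>i. i < n \<Longrightarrow> v $ i = c" shows "constant_vec v"
proof -
  have "v = c \<cdot>\<^sub>v vec (dim_vec v) (\<lambda>_. 1)" using assms by (intro eq_vecI) auto
  thus ?thesis unfolding constant_vec_def by blast
qed

text \<open>The range of this matrix consists of the stacked vectors all of whose blocks are constant.\<close>
definition const_blocks :: "real mat" where
  "const_blocks = mat (length (upper_pairs d) * m) (length (upper_pairs d)) (\<lambda>(a,c). if a div m = c then 1 else 0)"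

lemma const_blocks_carrier: "const_blocks \<in> carrier_mat (length (upper_pairs d) * m) (length (upper_pairs d))"
  by (simp add: const_blocks_def)

lemma const_blocks_index:
  assumes "u \<in> carrier_vec (length (upper_pairs d))" "c < length (upper_pairs d)" "i < m"
  shows "(const_blocks *\<^sub>v u) $ (c * m + i) = u $ c"
proof -
  have b: "c * m + i < length (upper_pairs d) * m" using assms by (intro block_index_less)
  have "(const_blocks *\<^sub>v u) $ (c * m + i) = (\<Sum>c'<length (upper_pairs d). const_blocks $$ (c * m + i, c') * u $ c')"
    by (rule mult_mat_vec_index[OF const_blocks_carrier assms(1) b])
  also have "\<dots> = (\<Sum>c'<length (upper_pairs d). if c = c' then u $ c' else 0)"
    using b assms(3) by (intro sum.cong refl) (auto simp: const_blocks_def)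
  finally show ?thesis using assms(2) by simp
qed

lemma pairs_skew_const_blocks:
  assumes u: "u \<in> carrier_vec (length (upper_pairs d))" and w: "stack_pairs d m w = const_blocks *\<^sub>v u" and i: "i < m"
  shows "pairs_skew d w i = pairs_skew d w 0"
proof -
  have "w (r,s) $ i = w (r,s) $ 0" if rs: "r < s" "s < d" for r s
  proof -
    obtain c where c: "c < length (upper_pairs d)" "upper_pairs d ! c = (r,s)" by (rule upper_pairs_index[OF rs])
    have "w (r,s) $ j = u $ c" if "j < m" for j
      using stack_pairs_index[OF c(1) that, of w] const_blocks_index[OF u c(1) that] w c(2) by simp
    from this[OF i] this[OF m] show ?thesis by simp
  qed
  thus ?thesis by (intro eq_matI) (auto simp: pairs_skew_def)
qed

text \<open>Each entry of the product is the form between the family of a unit vector and a constant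
  family.\<close>

lemma LL_at_const_blocks:
  assumes u: "u \<in> carrier_vec (length (upper_pairs d))"
  shows "LL_at d m C S *\<^sub>v (const_blocks *\<^sub>v u) = 0\<^sub>v (length (upper_pairs d) * m)"
proof (rule eq_vecI)
  let ?n = "length (upper_pairs d) * m" and ?A = "LL_at d m C S"
  have Vu: "const_blocks *\<^sub>v u \<in> carrier_vec ?n" using const_blocks_carrier u by (rule mult_mat_vec_carrier)
  fix a assume "a < dim_vec (0\<^sub>v ?n)"
  hence a: "a < ?n" by simp
  obtain w where w: "stack_pairs d m w = const_blocks *\<^sub>v u" using stack_pairs_surj[OF Vu] by metis
  obtain w' where w': "stack_pairs d m w' = unit_vec ?n a" using stack_pairs_surj[OF unit_vec_carrier] by metis
  have "(?A *\<^sub>v (const_blocks *\<^sub>v u)) $ a = unit_vec ?n a \<bullet> (?A *\<^sub>v (const_blocks *\<^sub>v u))"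
    using scalar_prod_left_unit[OF mult_mat_vec_carrier[OF LL_at_carrier Vu] a] by simp
  also have "\<dots> = Lf (pairs_skew d w') (pairs_skew d w)"
    unfolding w[symmetric] w'[symmetric] by (rule LL_at_bilinear)
  also have "\<dots> = Lf (pairs_skew d w') (\<lambda>_. pairs_skew d w 0)"
    by (rule L_form_cong) (rule refl, rule pairs_skew_const_blocks[OF u w])
  also have "\<dots> = 0" by (rule form_const_right) (rule pairs_skew_carrier)+
  finally show "(?A *\<^sub>v (const_blocks *\<^sub>v u)) $ a = 0\<^sub>v ?n $ a" using a by simp
qed (use LL_at_carrier in auto)

lemma stack_pairs_in_range_iff:
  assumes w: "\<And>rs. w rs \<in> carrier_vec m"
  shows "(\<exists>u\<in>carrier_vec (length (upper_pairs d)). stack_pairs d m w = const_blocks *\<^sub>v u)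
    \<longleftrightarrow> (\<forall>r s. r < s \<and> s < d \<longrightarrow> constant_vec (w (r,s)))"
proof (intro iffI allI impI)
  fix r s assume "\<exists>u\<in>carrier_vec (length (upper_pairs d)). stack_pairs d m w = const_blocks *\<^sub>v u" and rs: "r < s \<and> s < d"
  then obtain u where u: "u \<in> carrier_vec (length (upper_pairs d))" "stack_pairs d m w = const_blocks *\<^sub>v u" by blast
  obtain c where c: "c < length (upper_pairs d)" "upper_pairs d ! c = (r,s)" using rs upper_pairs_index by metis
  have "w (r,s) $ j = u $ c" if "j < m" for j
    using stack_pairs_index[OF c(1) that, of w] const_blocks_index[OF u(1) c(1) that] u(2) c(2) by simp
  thus "constant_vec (w (r,s))" by (rule constant_vecI[OF w])
next
  let ?N = "length (upper_pairs d)"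
  assume c: "\<forall>r s. r < s \<and> s < d \<longrightarrow> constant_vec (w (r,s))"
  define u where "u = vec ?N (\<lambda>c. w (upper_pairs d ! c) $ 0)"
  have u: "u \<in> carrier_vec ?N" by (simp add: u_def)
  have "stack_pairs d m w = const_blocks *\<^sub>v u"
  proof (rule eq_vecI)
    fix a assume "a < dim_vec (const_blocks *\<^sub>v u)"
    hence a: "a < ?N * m" using const_blocks_carrier by simp
    define b i where "b = a div m" and "i = a mod m"
    have bi: "a = b * m + i" "b < ?N" "i < m"
      using a m by (auto simp: b_def i_def less_mult_imp_div_less)
    obtain r s where rs: "upper_pairs d ! b = (r,s)" "r < s" "s < d" by (rule upper_pairs_nth[OF bi(2)])
    obtain x where x: "\<And>i. i < m \<Longrightarrow> w (r,s) $ i = x" using constant_vecE[OF _ w[of "(r,s)"]] c rs by blast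
    show "stack_pairs d m w $ a = (const_blocks *\<^sub>v u) $ a"
      unfolding bi(1) stack_pairs_index[OF bi(2,3)] const_blocks_index[OF u bi(2,3)] using bi(2) rs x m bi(3)
      by (simp add: u_def)
  qed (simp add: stack_pairs_def const_blocks_def)
  thus "\<exists>u\<in>carrier_vec ?N. stack_pairs d m w = const_blocks *\<^sub>v u" using u by blast
qed

lemma form_positive_iff_range:
  "(\<forall>v\<in>carrier_vec (length (upper_pairs d) * m).
      (\<forall>u\<in>carrier_vec (length (upper_pairs d)). v \<noteq> const_blocks *\<^sub>v u) \<longrightarrow> 0 < quad_form (LL_at d m C S) v) \<longleftrightarrow> form_positive"
  (is "?P \<longleftrightarrow> _")
  unfolding form_positive_iff_quad_form[symmetric]
proof (intro iffI allI impI ballI, elim conjE exE)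
  fix w r s assume P: ?P and w: "\<forall>r s. r < s \<and> s < d \<longrightarrow> w (r, s) \<in> carrier_vec m"
    and rs: "r < s" "s < d" "\<not> constant_vec (w (r,s))"
  \<comment> \<open>\<open>w\<close> is known to have length \<open>m\<close> only on pairs above
    the diagonal. \<open>w'\<close> has that length everywhere and produces the same stacked
    vector.\<close>
  define w' where "w' = (\<lambda>rs. vec m (\<lambda>i. w rs $ i))"
  have e: "w' (r,s) = w (r,s)" if "r < s" "s < d" for r s
  proof -
    have "w (r,s) \<in> carrier_vec m" using w that by blast
    thus ?thesis by (intro eq_vecI) (auto simp: w'_def)
  qed
  have st: "stack_pairs d m w' = stack_pairs d m w"
    using m by (intro eq_vecI) (auto simp: stack_pairs_def w'_def)
  have "\<not> constant_vec (w' (r,s))" using e rs by simp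
  hence "\<forall>u\<in>carrier_vec (length (upper_pairs d)). stack_pairs d m w \<noteq> const_blocks *\<^sub>v u"
    using stack_pairs_in_range_iff[of w'] rs unfolding st by (auto simp: w'_def)
  thus "0 < quad_form (LL_at d m C S) (stack_pairs d m w)" using P stack_pairs_carrier by blast
next
  fix v assume P: "\<forall>w. (\<forall>r s. r < s \<and> s < d \<longrightarrow> w (r, s) \<in> carrier_vec m) \<and> (\<exists>r s. r < s \<and> s < d \<and> \<not> constant_vec (w (r, s))) \<longrightarrow>
       0 < quad_form (LL_at d m C S) (stack_pairs d m w)"
    and v: "v \<in> carrier_vec (length (upper_pairs d) * m)" and nr: "\<forall>u\<in>carrier_vec (length (upper_pairs d)). v \<noteq> const_blocks *\<^sub>v u"
  obtain w where w: "\<And>rs. w rs \<in> carrier_vec m" "stack_pairs d m w = v"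
    by (rule stack_pairs_surj[OF v], rule that)
  have "\<exists>r s. r < s \<and> s < d \<and> \<not> constant_vec (w (r,s))"
    using stack_pairs_in_range_iff[of w, OF w(1)] nr unfolding w(2) by blast
  thus "0 < quad_form (LL_at d m C S) v" using P w by blast
qed

text \<open>The constant blocks give a part of the kernel of dimension \<open>N = d(d-1)/2\<close>,
  one for each pair, inside a space of dimension \<open>N m\<close>. Form positivity is positivity
  off this part, and the rank in question is \<open>N m - N\<close>.\<close>

lemma form_positive_iff_rank:
  "pos_semidef (LL_at d m C S) \<and> mat_rank (LL_at d m C S) = (m - 1) * (d * (d - 1) div 2) \<longleftrightarrow> form_positive"
  "0 < eigval_asc (d * (d - 1) div 2 + 1) (LL_at d m C S) \<longleftrightarrow> form_positive"
proof -
  let ?N = "length (upper_pairs d)"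
  have inj: "u = 0\<^sub>v ?N" if u: "u \<in> carrier_vec ?N" "const_blocks *\<^sub>v u = 0\<^sub>v (?N * m)" for u
  proof (rule eq_vecI)
    fix c assume "c < dim_vec (0\<^sub>v ?N)"
    hence c: "c < ?N" by simp
    show "u $ c = 0\<^sub>v ?N $ c"
      using const_blocks_index[OF u(1) c m] u(2) c block_index_less[OF c m] by simp
  qed (use u in simp)
  note psd = psd_with_kernel_iff[OF LL_at_carrier LL_at_symmetric const_blocks_carrier]
  have 1: "form_positive \<longleftrightarrow> pos_semidef (LL_at d m C S) \<and> mat_rank (LL_at d m C S) = ?N * m - ?N"
    unfolding form_positive_iff_range[symmetric] by (rule psd(1)) (fact inj LL_at_const_blocks)+
  have 2: "pos_semidef (LL_at d m C S) \<and> mat_rank (LL_at d m C S) = ?N * m - ?N \<longleftrightarrow> 0 < eigval_asc (?N + 1) (LL_at d m C S)"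
    by (rule psd(2)) (fact inj LL_at_const_blocks)+
  have "?N * m - ?N = (m - 1) * (d * (d - 1) div 2)"
    unfolding length_upper_pairs[symmetric] by (simp add: diff_mult_distrib2 mult.commute)
  thus "pos_semidef (LL_at d m C S) \<and> mat_rank (LL_at d m C S) = (m - 1) * (d * (d - 1) div 2) \<longleftrightarrow> form_positive"
    "0 < eigval_asc (d * (d - 1) div 2 + 1) (LL_at d m C S) \<longleftrightarrow> form_positive"
    using 1 2 unfolding length_upper_pairs by simp_all
qed

end

section \<open>Coercivity\<close>

lemma frob_norm_le_entries:
  assumes H: "H \<in> carrier_mat nr nc" and B: "\<And>i j. i < nr \<Longrightarrow> j < nc \<Longrightarrow> \<bar>H $$ (i,j)\<bar> \<le> B"
  shows "frob_norm H \<le> real nr * real nc * B"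
proof -
  have "frob_norm H \<le> (\<Sum>ij\<in>{..<nr} \<times> {..<nc}. \<bar>H $$ ij\<bar>)"
    unfolding frob_norm_eq[OF H] by (rule L2_set_le_sum_abs)
  also have "\<dots> \<le> (\<Sum>ij\<in>{..<nr} \<times> {..<nc}. B)" using B by (intro sum_mono) auto
  finally show ?thesis by simp
qed

lemma quad_form_add:
  assumes "A \<in> carrier_mat n n" "B \<in> carrier_mat n n" "v \<in> carrier_vec n"
  shows "quad_form (A + B) v = quad_form A v + quad_form B v"
  unfolding quad_form_def add_mult_distrib_mat_vec[OF assms]
  by (rule scalar_prod_add_distrib[OF assms(3)]) (use assms in \<open>auto intro: mult_mat_vec_carrier\<close>)

lemma vstack_frob_norm_entry:
  assumes "i < m" "a < d" "b < d" shows "\<bar>y i $$ (a,b)\<bar> \<le> frob_norm (vstack d m y)"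
  using abs_index_le_frob_norm[OF vstack_carrier block_index_less[OF assms(1,2)] assms(3), of y] assms by simp

lemma vstack_frob_norm_le:
  assumes "\<And>i a b. i < m \<Longrightarrow> a < d \<Longrightarrow> b < d \<Longrightarrow> \<bar>y i $$ (a,b)\<bar> \<le> B"
  shows "frob_norm (vstack d m y) \<le> real (m * d) * real d * B"
proof (rule frob_norm_le_entries[OF vstack_carrier])
  fix r b assume rb: "r < m * d" "b < d"
  hence "0 < d" "r div d < m" by (auto simp: less_mult_imp_div_less)
  thus "\<bar>vstack d m y $$ (r,b)\<bar> \<le> B" using assms[of "r div d" "r mod d" b] rb by (simp add: vstack_def)
qed

lemma vstack_frob_norm_sq:
  assumes "0 < d"
  shows "frob_norm (vstack d m y) ^ 2 = (\<Sum>i<m. \<Sum>a<d. \<Sum>b<d. (y i $$ (a,b))^2)"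
  unfolding frob_norm_sq frob_inner_double[OF vstack_carrier vstack_carrier] sum_block_index[OF assms]
  by (intro sum.cong refl) (simp add: power2_eq_square)

context stress_form
begin

abbreviation "fn y \<equiv> frob_norm (vstack d m y)"

text \<open>Written as a polynomial in the entries, the form can be bounded and passed to the limit
  entry by entry.\<close>

lemma form_expand:
  assumes "\<And>i. i < m \<Longrightarrow> y i \<in> carrier_mat d d" "\<And>i. i < m \<Longrightarrow> z i \<in> carrier_mat d d"
  shows "Lf y z = (\<Sum>q<d. \<Sum>p<d. \<Sum>i<m. \<Sum>p'<d. \<Sum>i'<m.
    y i $$ (p,q) * (L_at d m C S $$ (i * d + p, i' * d + p') * z i' $$ (p',q)))"
proof -
  have "Lf y z = mat_tr ((vstack d m y)\<^sup>T * L_at d m C S * vstack d m z)"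
    by (rule L_at_form[OF d C S, symmetric]) (fact assms)+
  also have "\<dots> = (\<Sum>q<d. \<Sum>p<d. \<Sum>i<m. \<Sum>p'<d. \<Sum>i'<m.
    y i $$ (p,q) * (L_at d m C S $$ (i * d + p, i' * d + p') * z i' $$ (p',q)))"
    by (rule mat_tr_vstack[OF d m L_at_carrier[OF d C S]]) (fact assms)+
  finally show ?thesis .
qed

lemma form_bounded:
  obtains K where "0 \<le> K" "\<And>y z. (\<And>i. i < m \<Longrightarrow> y i \<in> carrier_mat d d) \<Longrightarrow> (\<And>i. i < m \<Longrightarrow> z i \<in> carrier_mat d d)
    \<Longrightarrow> \<bar>Lf y z\<bar> \<le> K * (fn y * fn z)"
proof
  define K where "K = (\<Sum>q<d. \<Sum>p<d. \<Sum>i<m. \<Sum>p'<d. \<Sum>i'<m. \<bar>L_at d m C S $$ (i * d + p, i' * d + p')\<bar>)"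
  show "0 \<le> K" unfolding K_def by (intro sum_nonneg) auto
  fix y z :: "nat \<Rightarrow> real mat"
  assume yz: "\<And>i. i < m \<Longrightarrow> y i \<in> carrier_mat d d" "\<And>i. i < m \<Longrightarrow> z i \<in> carrier_mat d d"
  have "\<bar>Lf y z\<bar> \<le> (\<Sum>q<d. \<Sum>p<d. \<Sum>i<m. \<Sum>p'<d. \<Sum>i'<m. \<bar>L_at d m C S $$ (i * d + p, i' * d + p')\<bar> * (fn y * fn z))"
  proof -
    have "Lf y z = (\<Sum>q<d. \<Sum>p<d. \<Sum>i<m. \<Sum>p'<d. \<Sum>i'<m.
        y i $$ (p,q) * (L_at d m C S $$ (i * d + p, i' * d + p') * z i' $$ (p',q)))"
      by (rule form_expand) (fact yz)+
    thus ?thesis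
  proof (simp only:, intro order_trans[OF sum_abs] sum_mono)
    fix q p i p' i' assume "q \<in> {..<d}" "p \<in> {..<d}" "i \<in> {..<m}" "p' \<in> {..<d}" "i' \<in> {..<m}"
    hence e: "\<bar>y i $$ (p,q)\<bar> \<le> fn y" "\<bar>z i' $$ (p',q)\<bar> \<le> fn z" by (auto intro: vstack_frob_norm_entry)
    have "\<bar>y i $$ (p,q)\<bar> * \<bar>z i' $$ (p',q)\<bar> \<le> fn y * fn z" using e by (intro mult_mono) auto
    from mult_left_mono[OF this, of "\<bar>L_at d m C S $$ (i * d + p, i' * d + p')\<bar>"]
    show "\<bar>y i $$ (p,q) * (L_at d m C S $$ (i * d + p, i' * d + p') * z i' $$ (p',q))\<bar>
        \<le> \<bar>L_at d m C S $$ (i * d + p, i' * d + p')\<bar> * (fn y * fn z)"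
      by (simp add: abs_mult mult_ac)
  qed
  qed
  thus "\<bar>Lf y z\<bar> \<le> K * (fn y * fn z)" unfolding K_def sum_distrib_right .
qed

text \<open>Families vanishing at the first view meet the constant ones only in zero, so there
  positivity modulo constants becomes definiteness, and in finite dimension definiteness gives a
  uniform lower bound.\<close>

lemma form_positive_coercive:
  assumes pos: form_positive
  obtains c where "0 < c"
    "\<And>\<Omega>. (\<And>i. i < m \<Longrightarrow> \<Omega> i \<in> skew_mats d) \<Longrightarrow> \<Omega> 0 = 0\<^sub>m d d \<Longrightarrow> c * fn \<Omega> ^ 2 \<le> Lf \<Omega> \<Omega>"
proof -
  let ?N = "length (upper_pairs d)" and ?A = "LL_at d m C S"
  let ?n = "?N * m"
  \<comment> \<open>Penalising the \<open>0\<close>th entry of each block removes the kernel, the vectors with constant blocks.\<close>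
  define G :: "real mat" where "G = mat ?n ?n (\<lambda>(a,b). if a = b \<and> a mod m = 0 then 1 else 0)"
  have G: "G \<in> carrier_mat ?n ?n" by (simp add: G_def)
  have qG: "quad_form G v = (\<Sum>a<?n. if a mod m = 0 then (v $ a)^2 else 0)" if v: "v \<in> carrier_vec ?n" for v
  proof -
    have Gv: "(G *\<^sub>v v) $ a = (if a mod m = 0 then v $ a else 0)" if a: "a < ?n" for a
    proof -
      have "(G *\<^sub>v v) $ a = (\<Sum>b<?n. G $$ (a,b) * v $ b)" by (rule mult_mat_vec_index[OF G v a])
      also have "\<dots> = (\<Sum>b<?n. if a = b then (if a mod m = 0 then v $ b else 0) else 0)"
        using a by (intro sum.cong refl) (auto simp: G_def)
      finally show ?thesis using a by simp
    qed
    have "quad_form G v = (\<Sum>a<?n. v $ a * (G *\<^sub>v v) $ a)"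
      unfolding quad_form_def scalar_prod_def using G by (simp add: atLeast0LessThan)
    also have "\<dots> = (\<Sum>a<?n. if a mod m = 0 then (v $ a)^2 else 0)"
    proof (intro sum.cong refl)
      fix a assume "a \<in> {..<?n}"
      thus "v $ a * (G *\<^sub>v v) $ a = (if a mod m = 0 then (v $ a)^2 else 0)"
        unfolding lessThan_iff by (subst Gv) (auto simp: power2_eq_square)
    qed
    finally show ?thesis .
  qed
  have qG0: "0 \<le> quad_form G v" if "v \<in> carrier_vec ?n" for v unfolding qG[OF that] by (intro sum_nonneg) auto
  have sym: "(?A + G)\<^sup>T = ?A + G"
  proof -
    have "G\<^sup>T = G" by (intro eq_matI) (auto simp: G_def)
    thus ?thesis using transpose_add[OF LL_at_carrier G] LL_at_symmetric by simp
  qed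
  \<comment> \<open>Off the range of \<open>const_blocks\<close> the form itself is positive. On
    that range it vanishes, and the penalty sees each constant block through its first
    entry.\<close>
  have pd: "0 < quad_form (?A + G) v" if v: "v \<in> carrier_vec ?n" "v \<noteq> 0\<^sub>v ?n" for v
  proof (cases "\<exists>u\<in>carrier_vec ?N. v = const_blocks *\<^sub>v u")
    case False
    hence "0 < quad_form ?A v" using pos v form_positive_iff_range by blast
    thus ?thesis unfolding quad_form_add[OF LL_at_carrier G v(1)] using qG0[OF v(1)] by linarith
  next
    case True
    then obtain u where u: "u \<in> carrier_vec ?N" "v = const_blocks *\<^sub>v u" by blast
    have A0: "quad_form ?A v = 0" unfolding quad_form_def u(2) LL_at_const_blocks[OF u(1)] using v(1) u(2) by simp
    have "\<exists>c<?N. u $ c \<noteq> 0"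
    proof (rule ccontr)
      assume "\<not> ?thesis"
      hence "u = 0\<^sub>v ?N" using u(1) by (intro eq_vecI) auto
      hence "v = 0\<^sub>v ?n" using u(2) mult_mat_zero_vec[OF const_blocks_carrier] by simp
      thus False using v(2) by simp
    qed
    then obtain c where c: "c < ?N" "u $ c \<noteq> 0" by blast
    have a: "c * m + 0 < ?n" using c(1) m by (intro block_index_less)
    have "0 < (u $ c)^2" using c(2) by simp
    also have "\<dots> = (if (c * m + 0) mod m = 0 then (v $ (c * m + 0))^2 else 0)"
      using const_blocks_index[OF u(1) c(1) m] u(2) by simp
    also have "\<dots> \<le> (\<Sum>a<?n. if a mod m = 0 then (v $ a)^2 else 0)"
      by (rule member_le_sum[where f="\<lambda>a. if a mod m = 0 then (v $ a)^2 else 0"]) (use a in auto)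
    finally show ?thesis unfolding quad_form_add[OF LL_at_carrier G v(1)] A0 qG[OF v(1)] by simp
  qed
  obtain c where c: "0 < c" "\<And>v. v \<in> carrier_vec ?n \<Longrightarrow> c * (v \<bullet> v) \<le> quad_form (?A + G) v"
    using pos_def_lower_bound[OF add_carrier_mat[OF G, of ?A] sym pd] by blast
  \<comment> \<open>\<open>v\<close> contains every entry above the diagonal, so each squared entry
    of the family is at most \<open>v \<bullet> v\<close>; the divisor counts the
    \<open>m d d\<close> entries of the stack.\<close>
  have bound: "c / (real (m * d) * real d) * fn \<Omega> ^ 2 \<le> Lf \<Omega> \<Omega>"
    if sk: "\<And>i. i < m \<Longrightarrow> \<Omega> i \<in> skew_mats d" and O0: "\<Omega> 0 = 0\<^sub>m d d" for \<Omega>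
  proof -
    define w where "w = (\<lambda>rs. vec m (\<lambda>i. \<Omega> i $$ rs))"
    define v where "v = stack_pairs d m w"
    have v: "v \<in> carrier_vec ?n" by (simp add: v_def)
    have vv: "v \<bullet> v = (\<Sum>a<?n. (v $ a)^2)" using v by (simp add: scalar_prod_def atLeast0LessThan power2_eq_square)
    \<comment> \<open>The penalised entries all belong to the first view, where the family is
      zero.\<close>
    have "quad_form G v = 0" unfolding qG[OF v]
    proof (rule sum.neutral, intro ballI)
      fix a assume "a \<in> {..<?n}"
      hence a: "a < ?n" "a div m < ?N" by (auto simp: less_mult_imp_div_less)
      obtain r s where rs: "upper_pairs d ! (a div m) = (r,s)" "r < s" "s < d" by (rule upper_pairs_nth[OF a(2)])
      have "v $ a = 0" if "a mod m = 0" using a(1) that rs m O0 by (simp add: v_def stack_pairs_def w_def)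
      thus "(if a mod m = 0 then (v $ a)^2 else 0) = 0" by simp
    qed
    moreover have "quad_form ?A v = Lf \<Omega> \<Omega>"
      unfolding v_def LL_at_quad_form by (rule L_form_cong; unfold w_def; rule pairs_skew_of_family; (rule sk)?)
    ultimately have lb: "c * (v \<bullet> v) \<le> Lf \<Omega> \<Omega>"
      using c(2)[OF v] unfolding quad_form_add[OF LL_at_carrier G v] by simp
    have up: "(\<Omega> i $$ (r,s))^2 \<le> v \<bullet> v" if i: "i < m" and rs: "r < s" "s < d" for i r s
    proof -
      obtain c where c: "c < ?N" "upper_pairs d ! c = (r,s)" by (rule upper_pairs_index[OF rs])
      have "(\<Omega> i $$ (r,s))^2 = (v $ (c * m + i))^2"
        unfolding v_def stack_pairs_index[OF c(1) i] c(2) using i by (simp add: w_def)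
      also have "\<dots> \<le> (\<Sum>a<?n. (v $ a)^2)"
        by (rule member_le_sum[where f="\<lambda>a. (v $ a)^2"]) (use block_index_less[OF c(1) i] in auto)
      finally show ?thesis unfolding vv .
    qed
    have all: "(\<Omega> i $$ (a,b))^2 \<le> v \<bullet> v" if i: "i < m" and ab: "a < d" "b < d" for i a b
    proof -
      have e: "\<Omega> i $$ (a,b) = - \<Omega> i $$ (b,a)" by (rule skew_matsD(3)[OF sk[OF i] ab])
      consider "a < b" | "b < a" | "a = b" by linarith
      thus ?thesis
      proof cases
        case 2
        show ?thesis unfolding e using up[OF i 2 ab(1)] by simp
      next
        case 3
        hence "\<Omega> i $$ (a,b) = 0" using e by simp
        moreover have "0 \<le> v \<bullet> v" unfolding vv by (intro sum_nonneg) auto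
        ultimately show ?thesis by simp
      qed (use up[OF i _ ab(2)] in simp)
    qed
    have "fn \<Omega> ^ 2 \<le> (\<Sum>i<m. \<Sum>a<d. \<Sum>b<d. v \<bullet> v)"
      unfolding vstack_frob_norm_sq[OF d] using all by (intro sum_mono) auto
    hence "c * fn \<Omega> ^ 2 \<le> c * (real (m * d) * real d * (v \<bullet> v))" using c(1) by (intro mult_left_mono) auto
    also have "\<dots> \<le> real (m * d) * real d * Lf \<Omega> \<Omega>" using mult_left_mono[OF lb, of "real (m * d) * real d"] by (simp add: mult_ac)
    finally show ?thesis using d m by (simp add: field_simps)
  qed
  show ?thesis by (rule that[of "c / (real (m * d) * real d)"]) (use c(1) d m bound in auto)
qed

text \<open>
  Splitting \<open>y = Q - 1\<close> into its skew part \<open>\<omega>\<close> and its symmetric part \<open>-(1/2) y y\<^sup>T\<close>, which is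
  of second order, reduces the claim to coercivity on \<open>\<omega>\<close>.
\<close>
lemma form_positive_near_identity:
  assumes pos: form_positive
  obtains \<delta> where "0 < \<delta>"
    "\<And>Q. (\<And>i. i < m \<Longrightarrow> Q i \<in> orth_mats d) \<Longrightarrow> Q 0 = 1\<^sub>m d \<Longrightarrow> fn (\<lambda>i. Q i - 1\<^sub>m d) < \<delta>
      \<Longrightarrow> 0 \<le> Lf (\<lambda>i. Q i - 1\<^sub>m d) (\<lambda>i. Q i - 1\<^sub>m d)"
proof -
  obtain c where c: "0 < c" "\<And>\<Omega>. (\<And>i. i < m \<Longrightarrow> \<Omega> i \<in> skew_mats d) \<Longrightarrow> \<Omega> 0 = 0\<^sub>m d d \<Longrightarrow> c * fn \<Omega> ^ 2 \<le> Lf \<Omega> \<Omega>"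
    using form_positive_coercive[OF pos] by blast
  obtain K where K: "0 \<le> K" "\<And>y z. (\<And>i. i < m \<Longrightarrow> y i \<in> carrier_mat d d) \<Longrightarrow> (\<And>i. i < m \<Longrightarrow> z i \<in> carrier_mat d d)
    \<Longrightarrow> \<bar>Lf y z\<bar> \<le> K * (fn y * fn z)"
    using form_bounded by blast
  \<comment> \<open>With \<open>r\<close> the norm of \<open>Q - 1\<close> and
    \<open>r \<le> 1\<close>, the symmetric part has norm at most \<open>a r\<^sup>2\<close> and the
    skew part at most \<open>b r\<close>. \<open>B\<close> collects the coefficients of
    \<open>r\<^sup>3\<close> lost against the leading term \<open>c r\<^sup>2 / 2\<close>, and
    \<delta> is chosen so that \<open>B r\<close> stays below \<open>c / 2\<close>; dividing by
    \<open>B + 1\<close> avoids the case \<open>B = 0\<close>.\<close>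
  define a where "a = real (m * d) * real d * real d"
  define b where "b = 2 + 2 * a^2"
  define B where "B = c * a^2 + 2 * K * b * a + K * a^2"
  have a0: "0 \<le> a" by (simp add: a_def)
  have b1: "1 \<le> b" by (simp add: b_def)
  have B0: "0 \<le> B" using c K a0 b1 by (auto simp: B_def intro!: add_nonneg_nonneg mult_nonneg_nonneg)
  define \<delta> where "\<delta> = min 1 (c / 2 / (B + 1))"
  have \<delta>: "0 < \<delta>" using c(1) B0 by (simp add: \<delta>_def)
  show ?thesis
  proof (rule that[OF \<delta>])
    fix Q :: "nat \<Rightarrow> real mat"
    assume Q: "\<And>i. i < m \<Longrightarrow> Q i \<in> orth_mats d" and Q0: "Q 0 = 1\<^sub>m d" and small: "fn (\<lambda>i. Q i - 1\<^sub>m d) < \<delta>"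
    define y where "y = (\<lambda>i. Q i - 1\<^sub>m d)"
    define w where "w = (\<lambda>i. mat d d (\<lambda>(a,b). (Q i $$ (a,b) - Q i $$ (b,a)) / 2))"
    define s where "s = (\<lambda>i. mat d d (\<lambda>(a,b). (Q i $$ (a,b) + Q i $$ (b,a)) / 2 - (if a = b then 1 else 0)))"
    have Qc: "Q i \<in> carrier_mat d d" if "i < m" for i using orth_matsD(1)[OF Q[OF that]] .
    have ws: "w i \<in> carrier_mat d d" "s i \<in> carrier_mat d d" for i by (auto simp: w_def s_def)
    have yi: "y i $$ (a,b) = w i $$ (a,b) + s i $$ (a,b)" if "i < m" "a < d" "b < d" for i a b
      using Qc[OF that(1)] that by (simp add: y_def w_def s_def field_simps)
    have y: "y i = 1 \<cdot>\<^sub>m w i + 1 \<cdot>\<^sub>m s i" if "i < m" for i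
      using yi[OF that] ws Qc[OF that] by (intro eq_matI) (auto simp: y_def w_def s_def simp del: index_add_mat(1) index_minus_mat(1), auto)
    define r where "r = fn y"
    have r: "0 \<le> r" "r < \<delta>" "r \<le> 1" using small by (auto simp: r_def y_def \<delta>_def)
    have sn: "fn s \<le> a * r^2"
    proof -
      have "\<bar>s i $$ (e,f)\<bar> \<le> real d * r^2" if i: "i < m" and ef: "e < d" "f < d" for i e f
      proof -
        have "(\<Sum>g<d. y i $$ (e,g) * y i $$ (f,g)) = - 2 * s i $$ (e,f)"
        proof -
          have QQ: "(\<Sum>g<d. Q i $$ (e,g) * Q i $$ (f,g)) = (if e = f then 1 else 0)"
          proof -
            have "(\<Sum>g<d. Q i $$ (e,g) * Q i $$ (f,g)) = (Q i * (Q i)\<^sup>T) $$ (e,f)"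
              by (rule mult_transpose_index[OF Qc[OF i] Qc[OF i] ef, symmetric])
            thus ?thesis using orth_matsD(3)[OF Q[OF i]] ef by simp
          qed
          have "(\<Sum>g<d. y i $$ (e,g) * y i $$ (f,g)) = (\<Sum>g<d. Q i $$ (e,g) * Q i $$ (f,g)
              - (if g = f then Q i $$ (e,g) else 0) - (if g = e then Q i $$ (f,g) else 0) + (if g = e then (if e = f then 1 else 0) else 0))"
            using Qc[OF i] ef by (intro sum.cong refl) (auto simp: y_def algebra_simps)
          also have "\<dots> = (if e = f then 1 else 0) - Q i $$ (e,f) - Q i $$ (f,e) + (if e = f then 1 else 0)"
            using ef by (simp only: sum.distrib sum_subtractf QQ) simp
          finally show ?thesis using ef by (simp add: s_def field_simps)
        qed
        hence "2 * \<bar>s i $$ (e,f)\<bar> = \<bar>\<Sum>g<d. y i $$ (e,g) * y i $$ (f,g)\<bar>" by simp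
        also have "\<dots> \<le> (\<Sum>g<d. r^2)"
        proof (intro order_trans[OF sum_abs] sum_mono)
          fix g assume "g \<in> {..<d}"
          hence "\<bar>y i $$ (e,g)\<bar> \<le> r" "\<bar>y i $$ (f,g)\<bar> \<le> r"
            using i ef unfolding r_def by (auto intro: vstack_frob_norm_entry)
          thus "\<bar>y i $$ (e,g) * y i $$ (f,g)\<bar> \<le> r^2"
            unfolding abs_mult power2_eq_square using r(1) by (intro mult_mono) auto
        qed
        finally have "2 * \<bar>s i $$ (e,f)\<bar> \<le> real d * r^2" by simp
        thus ?thesis by linarith
      qed
      from vstack_frob_norm_le[of m d s, OF this] show ?thesis by (simp add: a_def mult_ac)
    qed
    have s2: "fn s ^ 2 \<le> a^2 * r^4"
      using power_mono[OF sn, of 2] by (simp add: power_mult_distrib flip: power_mult)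
    have s2r: "fn s ^ 2 \<le> a^2 * r^3" "fn s ^ 2 \<le> a^2 * r^2"
      using s2 power_decreasing[of 3 4 r] power_decreasing[of 2 4 r] r mult_left_mono[of "r^4" "r^3" "a^2"] mult_left_mono[of "r^4" "r^2" "a^2"]
      by auto
    \<comment> \<open>Used twice: with \<open>y\<close> on the left it bounds the skew part from
      below, with the skew part on the left it bounds it from above.\<close>
    have sq: "fn u ^ 2 \<le> 2 * fn v ^ 2 + 2 * fn x ^ 2"
      if "\<And>i a b. i < m \<Longrightarrow> a < d \<Longrightarrow> b < d \<Longrightarrow> \<bar>u i $$ (a,b)\<bar> \<le> \<bar>v i $$ (a,b)\<bar> + \<bar>x i $$ (a,b)\<bar>" for u v x
    proof -
      have "(u i $$ (a,b))^2 \<le> 2 * (v i $$ (a,b))^2 + 2 * (x i $$ (a,b))^2" if "i < m" "a < d" "b < d" for i a b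
      proof -
        have "(u i $$ (a,b))^2 \<le> (\<bar>v i $$ (a,b)\<bar> + \<bar>x i $$ (a,b)\<bar>)^2"
          using power_mono[OF \<open>i < m \<Longrightarrow> a < d \<Longrightarrow> b < d \<Longrightarrow> \<bar>u i $$ (a,b)\<bar> \<le> _\<close>[OF that], of 2] by simp
        also have "\<dots> \<le> 2 * (v i $$ (a,b))^2 + 2 * (x i $$ (a,b))^2"
          using sum_squares_bound[of "\<bar>v i $$ (a,b)\<bar>" "\<bar>x i $$ (a,b)\<bar>"] by (simp add: power2_sum)
        finally show ?thesis .
      qed
      thus ?thesis unfolding vstack_frob_norm_sq[OF d] sum_distrib_left sum.distrib[symmetric]
        by (intro sum_mono) auto
    qed
    have w_lower: "r^2 \<le> 2 * fn w ^ 2 + 2 * fn s ^ 2" unfolding r_def by (rule sq) (simp add: yi)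
    have "fn w ^ 2 \<le> 2 * r^2 + 2 * fn s ^ 2" unfolding r_def by (rule sq) (simp add: yi)
    also have "\<dots> \<le> b * r^2" using s2r(2) by (simp add: b_def algebra_simps)
    also have "\<dots> \<le> b^2 * r^2" using b1 by (intro mult_right_mono) (auto simp: power2_eq_square)
    finally have "fn w ^ 2 \<le> (b * r)^2" by (simp add: power_mult_distrib)
    hence w_upper: "fn w \<le> b * r" by (rule power2_le_imp_le) (use b1 r in simp)
    have wsk: "w i \<in> skew_mats d" for i by (rule skew_matsI) (auto simp: w_def field_simps)
    have w0: "w 0 = 0\<^sub>m d d" unfolding w_def Q0 by (intro eq_matI) auto
    have "Lf y y = Lf (\<lambda>i. 1 \<cdot>\<^sub>m w i + 1 \<cdot>\<^sub>m s i) (\<lambda>i. 1 \<cdot>\<^sub>m w i + 1 \<cdot>\<^sub>m s i)" by (rule L_form_cong) (fact y)+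
    also have "\<dots> = 1^2 * Lf w w + 2 * 1 * 1 * Lf w s + 1^2 * Lf s s" by (rule form_quadratic) (rule ws)+
    finally have e: "Lf y y = Lf w w + 2 * Lf w s + Lf s s" by simp
    have "c * (r^2 / 2 - a^2 * r^3) \<le> c * fn w ^ 2" using w_lower s2r(1) c(1) by (intro mult_left_mono) auto
    also have "\<dots> \<le> Lf w w" by (rule c(2)) (rule wsk w0)+
    finally have 1: "c * (r^2 / 2 - a^2 * r^3) \<le> Lf w w" .
    have "\<bar>Lf w s\<bar> \<le> K * (fn w * fn s)" by (rule K(2)) (rule ws)+
    also have "\<dots> \<le> K * ((b * r) * (a * r^2))" using K(1) w_upper sn b1 r by (intro mult_left_mono mult_mono) auto
    finally have 2: "\<bar>Lf w s\<bar> \<le> K * b * a * r^3" by (simp add: power2_eq_square power3_eq_cube mult_ac)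
    have "\<bar>Lf s s\<bar> \<le> K * (fn s * fn s)" by (rule K(2)) (rule ws)+
    also have "\<dots> \<le> K * (a^2 * r^3)" using K(1) s2r(1) by (intro mult_left_mono) (auto simp: power2_eq_square)
    finally have 3: "\<bar>Lf s s\<bar> \<le> K * a^2 * r^3" by (simp add: mult_ac)
    have "B * r \<le> (B + 1) * (c / 2 / (B + 1))"
      using r B0 c(1) by (intro mult_mono) (auto simp: \<delta>_def)
    also have "\<dots> = c / 2"
    proof -
      have "B + 1 \<noteq> 0" using B0 by linarith
      thus ?thesis by (rule nonzero_mult_div_cancel_left[of "B + 1" "c / 2", unfolded times_divide_eq_right[symmetric]])
    qed
    finally have "0 \<le> r^2 * (c / 2 - B * r)" by (intro mult_nonneg_nonneg) auto
    also have "\<dots> = c * (r^2 / 2 - a^2 * r^3) - 2 * (K * b * a * r^3) - K * a^2 * r^3"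
      by (simp add: B_def power2_eq_square power3_eq_cube algebra_simps)
    also have "\<dots> \<le> Lf y y" unfolding e using 1 2 3 by linarith
    finally show "0 \<le> Lf (\<lambda>i. Q i - 1\<^sub>m d) (\<lambda>i. Q i - 1\<^sub>m d)" unfolding y_def .
  qed
qed

end

section \<open>Local minima\<close>

lemma real_quadratic_nonneg:
  assumes "\<And>s::real. 0 \<le> 2 * s * b + s^2 * c" shows "b = 0"
proof (rule ccontr)
  assume b: "b \<noteq> 0"
  \<comment> \<open>Any positive \<open>e\<close> with \<open>c < 2 * e\<close> will do: at
    \<open>s = - b / e\<close> the expression equals \<open>b\<^sup>2 (c - 2 e) / e\<^sup>2\<close>,
    which is negative.\<close>
  define e where "e = \<bar>c\<bar> + 1"
  have e: "0 < e" "c < 2 * e" by (auto simp: e_def)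
  have "0 \<le> e^2 * (2 * (- b / e) * b + (- b / e)^2 * c)" using assms[of "- b / e"] by (intro mult_nonneg_nonneg) auto
  also have "\<dots> = b^2 * (c - 2 * e)" using e(1) by (simp add: power2_eq_square field_simps)
  finally have "0 \<le> b^2 * (c - 2 * e)" .
  moreover have "b^2 * (c - 2 * e) < 0" using b e by (intro mult_pos_neg) auto
  ultimately show False by simp
qed

lemma family_lift_linear:
  "family_lift d (\<lambda>i a b. u * z i a b + v * w i a b) i = u \<cdot>\<^sub>m family_lift d z i + v \<cdot>\<^sub>m family_lift d w i"
  by (rule eq_matI) (auto simp: family_lift_def split: nat.splits)

definition relative_family :: "nat \<Rightarrow> real mat \<Rightarrow> real mat \<Rightarrow> nat \<Rightarrow> real mat" where
  "relative_family d p q i = (case i of 0 \<Rightarrow> 1\<^sub>m d | Suc j \<Rightarrow> (row_block d p j)\<^sup>T * row_block d q j)"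

lemma relative_family_orth:
  assumes "p \<in> orth_power d k" "q \<in> orth_power d k" "i < Suc k"
  shows "relative_family d p q i \<in> orth_mats d"
  using assms orth_mats_one orth_powerD(2)[OF assms(1)] orth_powerD(2)[OF assms(2)]
  by (auto simp: relative_family_def intro!: orth_mats_mult orth_mats_transpose split: nat.splits)

text \<open>Since \<open>p\<^sub>j\<^sup>T p\<^sub>j\<close> is the identity, the deviation of the
  relative rotation from the identity is linear in \<open>q - p\<close>. This gives both its
  derivative along curves and its bound by the distance from \<open>p\<close>.\<close>

lemma relative_family_index:
  assumes p: "p \<in> orth_power d k" and q: "q \<in> orth_power d k" and j: "j < k" and ab: "a < d" "b < d"
  shows "(relative_family d p q (Suc j) - 1\<^sub>m d) $$ (a,b) = (\<Sum>c<d. p $$ (j * d + c, a) * (q $$ (j * d + c, b) - p $$ (j * d + c, b)))"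
proof -
  have 1: "((row_block d p j)\<^sup>T * row_block d q j) $$ (a,b) = (\<Sum>c<d. p $$ (j * d + c, a) * q $$ (j * d + c, b))"
    if "q \<in> orth_power d k" for q
    using transpose_mult_index[OF row_block_carrier[OF orth_powerD(1)[OF p]] row_block_carrier[OF orth_powerD(1)[OF that]] ab, of d j j]
      orth_powerD(1)[OF p] orth_powerD(1)[OF that] ab by (simp add: row_block_index)
  have "1\<^sub>m d $$ (a,b) = (\<Sum>c<d. p $$ (j * d + c, a) * p $$ (j * d + c, b))"
    using 1[OF p] orth_matsD(2)[OF orth_powerD(2)[OF p j]] by simp
  moreover have "(relative_family d p q (Suc j) - 1\<^sub>m d) $$ (a,b) = (\<Sum>c<d. p $$ (j * d + c, a) * q $$ (j * d + c, b)) - 1\<^sub>m d $$ (a,b)"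
    unfolding relative_family_def using 1[OF q] ab by (simp del: index_mult_mat(1) index_one_mat(1))
  ultimately show ?thesis by (simp add: right_diff_distrib sum_subtractf)
qed

lemma relative_family_0: "relative_family d p q 0 = 1\<^sub>m d"
  by (simp add: relative_family_def)

context orth_objective
begin

context
  fixes p assumes p: "p \<in> M" and crit: "riem_grad R F p = 0\<^sub>m (k * d) d"
begin

interpretation sf: stress_form d "Suc k" C "sl p"
  by unfold_locales (use d C Csym C_hat_symmetric[OF p crit] in auto)

abbreviation "rel q \<equiv> \<lambda>i. relative_family d p q i - 1\<^sub>m d"

lemma objective_difference': "q \<in> M \<Longrightarrow> F q - F p = sf.Lf (rel q) (rel q)"
  using objective_difference[OF p crit] unfolding relative_family_def by simp

lemma rel_carrier: "rel q i \<in> carrier_mat d d" by (rule minus_carrier_mat) simp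

lemma hess_metric_self: "skew_family d k z \<Longrightarrow>
    mmetric R p (riem_hess R F p (frame_field d k z p)) (frame_field d k z p) = 2 * sf.Lf (family_lift d z) (family_lift d z)"
  by (rule hess_metric[OF p crit])

lemma frame_field_eq_0_iff:
  "frame_field d k z p = 0\<^sub>m (k * d) d \<longleftrightarrow> (\<forall>i<k. \<forall>a<d. \<forall>b<d. z i a b = 0)"
proof
  assume 0: "frame_field d k z p = 0\<^sub>m (k * d) d"
  show "\<forall>i<k. \<forall>a<d. \<forall>b<d. z i a b = 0"
  proof (intro allI impI)
    fix i a b assume i: "i < k" "a < d" "b < d"
    have "z i a b = frame_coord d p (0\<^sub>m (k * d) d) i a b" unfolding 0[symmetric] by (rule frame_coord_frame_field[OF p i, symmetric])
    thus "z i a b = 0" using i by (simp add: frame_coord_def block_index_less)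
  qed
next
  assume "\<forall>i<k. \<forall>a<d. \<forall>b<d. z i a b = 0"
  hence "frame_field d k z p = frame_field d k (\<lambda>i a b. 0) p" by (intro frame_field_cong[OF orth_powerD(1)[OF p]]) auto
  thus "frame_field d k z p = 0\<^sub>m (k * d) d" using zero_tangent[OF p] by simp
qed

text \<open>Tangent vectors of the quotient correspond to families with first member zero.
  Subtracting the first member, which leaves the form unchanged, brings any family into this shape,
  and it becomes zero only if the family was constant.\<close>

lemma hess_positive_iff:
  "(\<forall>Z\<in>T p. Z \<noteq> 0\<^sub>m (k * d) d \<longrightarrow> 0 < mmetric R p (riem_hess R F p Z) Z) \<longleftrightarrow> sf.form_positive"
proof
  assume H: "\<forall>Z\<in>T p. Z \<noteq> 0\<^sub>m (k * d) d \<longrightarrow> 0 < mmetric R p (riem_hess R F p Z) Z"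
  show sf.form_positive unfolding sf.form_positive_def
  proof (intro allI impI, elim conjE exE)
    fix \<Omega> i j assume sk: "\<forall>i<Suc k. \<Omega> i \<in> skew_mats d" and ij: "i < Suc k" "j < Suc k" "\<Omega> i \<noteq> \<Omega> j"
    have Oc: "\<Omega> i \<in> carrier_mat d d" if "i < Suc k" for i using sk that skew_matsD(1) by auto
    define z where "z = (\<lambda>j a b. \<Omega> (Suc j) $$ (a,b) - \<Omega> 0 $$ (a,b))"
    have z: "skew_family d k z" unfolding skew_family_def
    proof (intro allI impI)
      fix j a b assume j: "j < k" "a < d" "b < d"
      have "\<Omega> (Suc j) $$ (a,b) = - \<Omega> (Suc j) $$ (b,a)" "\<Omega> 0 $$ (a,b) = - \<Omega> 0 $$ (b,a)"
        using sk j by (intro skew_matsD(3); simp)+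
      thus "z j a b = - z j b a" unfolding z_def by linarith
    qed
    have fl: "family_lift d z i = \<Omega> i - \<Omega> 0" if "i < Suc k" for i
      using Oc[OF that] Oc[of 0] by (intro eq_matI) (auto simp: family_lift_def z_def split: nat.splits)
    have "frame_field d k z p \<noteq> 0\<^sub>m (k * d) d"
    proof
      assume "frame_field d k z p = 0\<^sub>m (k * d) d"
      hence z0: "z i a b = 0" if "i < k" "a < d" "b < d" for i a b using that frame_field_eq_0_iff by blast
      have "\<Omega> i = \<Omega> 0" if "i < Suc k" for i
      proof (cases i)
        case (Suc j)
        show ?thesis
        proof (rule eq_matI)
          fix a b assume "a < dim_row (\<Omega> 0)" "b < dim_col (\<Omega> 0)"
          hence "a < d" "b < d" using Oc[of 0] by auto
          thus "\<Omega> i $$ (a,b) = \<Omega> 0 $$ (a,b)" using z0[of j a b] Suc that by (simp add: z_def)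
        qed (use Oc[OF that] Oc[of 0] in auto)
      qed simp
      from this[OF ij(1)] this[OF ij(2)] show False using ij(3) by simp
    qed
    hence "0 < mmetric R p (riem_hess R F p (frame_field d k z p)) (frame_field d k z p)"
      using H frame_field_tangent[OF z] by blast
    hence "0 < sf.Lf (family_lift d z) (family_lift d z)" unfolding hess_metric_self[OF z] by simp
    also have "\<dots> = sf.Lf (\<lambda>i. \<Omega> i - \<Omega> 0) (\<lambda>i. \<Omega> i - \<Omega> 0)" by (rule L_form_cong) (fact fl)+
    also have "\<dots> = sf.Lf \<Omega> \<Omega>" by (rule sf.form_shift) (use Oc in auto)
    finally show "0 < sf.Lf \<Omega> \<Omega>" .
  qed
next
  assume pos: sf.form_positive
  show "\<forall>Z\<in>T p. Z \<noteq> 0\<^sub>m (k * d) d \<longrightarrow> 0 < mmetric R p (riem_hess R F p Z) Z"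
  proof (intro ballI impI)
    fix Z assume Z: "Z \<in> T p" "Z \<noteq> 0\<^sub>m (k * d) d"
    define z where "z = frame_coord d p Z"
    note z = orth_tangentD(1,2)[OF p Z(1), folded z_def]
    obtain i a b where i: "i < k" "a < d" "b < d" "z i a b \<noteq> 0"
      using frame_field_eq_0_iff[of z] Z(2) z(2) by auto
    have "family_lift d z (Suc i) $$ (a,b) \<noteq> family_lift d z 0 $$ (a,b)" using i by (simp add: family_lift_def)
    hence "family_lift d z (Suc i) \<noteq> family_lift d z 0" by auto
    hence "0 < sf.Lf (family_lift d z) (family_lift d z)"
      using i family_lift_skew[OF z(1)] by (intro sf.form_positiveD[OF pos, where i="Suc i" and j=0]) simp_all
    thus "0 < mmetric R p (riem_hess R F p Z) Z" using hess_metric_self[OF z(1)] z(2) by simp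
  qed
qed

text \<open>Along a curve of velocity \<open>z\<close> the relative rotation minus the identity,
  divided by \<open>t\<close>, tends to the family of \<open>z\<close>. The expansion of the
  objective is exact and quadratic, so its increment over \<open>t\<^sup>2\<close> tends to the form
  at \<open>z\<close>, and at a local minimum all these quotients are eventually
  non-negative.\<close>

lemma local_minimizer_form_nonneg:
  assumes lm: "local_minimizer R F p" and z: "skew_family d k z"
  shows "0 \<le> sf.Lf (family_lift d z) (family_lift d z)"
proof -
  obtain e where e: "0 < e" "\<And>q. q \<in> M \<Longrightarrow> frob_norm (q - p) < e \<Longrightarrow> F p \<le> F q"
    using lm by (auto simp: local_minimizer_def)
  obtain c where c: "curve_through M p (frame_field d k z p) c"
    using orth_power_curve[OF p frame_field_tangent[OF z]] by blast
  have ct: "c t \<in> M" for t using c by (simp add: curve_through_def)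
  have c0: "c 0 = p" using c by (simp add: curve_through_def)
  note pc = orth_powerD(1)[OF p] and cc = orth_powerD(1)[OF ct]
  have dc: "((\<lambda>t. c t $$ (r,b)) has_real_derivative frame_field d k z p $$ (r,b)) (at 0)" if "r < k * d" "b < d" for r b
    using c that by (simp add: curve_through_def)
  have lim: "((\<lambda>t. rel (c t) i $$ (a,b) / t) \<longlongrightarrow> family_lift d z i $$ (a,b)) (at 0)"
    if i: "i < Suc k" and ab: "a < d" "b < d" for i a b
  proof (cases i)
    case 0
    thus ?thesis using ab by (simp add: relative_family_0 family_lift_def)
  next
    case (Suc j)
    hence j: "j < k" using i by simp
    have "((\<lambda>t. rel (c t) (Suc j) $$ (a,b)) has_real_derivative (\<Sum>g<d. p $$ (j * d + g, a) * (frame_field d k z p $$ (j * d + g, b) - 0))) (at 0)"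
      unfolding relative_family_index[OF p ct j ab]
      by (intro DERIV_sum DERIV_cmult DERIV_diff dc DERIV_const) (use j ab in \<open>auto intro: block_index_less\<close>)
    also have "(\<Sum>g<d. p $$ (j * d + g, a) * (frame_field d k z p $$ (j * d + g, b) - 0)) = family_lift d z (Suc j) $$ (a,b)"
      using frame_coord_frame_field[OF p j ab, of z] ab by (simp add: frame_coord_def family_lift_def)
    finally have "((\<lambda>t. (rel (c (0 + t)) (Suc j) $$ (a,b) - rel (c 0) (Suc j) $$ (a,b)) / t) \<longlongrightarrow> family_lift d z (Suc j) $$ (a,b)) (at 0)"
      unfolding DERIV_def .
    moreover have "rel (c 0) (Suc j) $$ (a,b) = 0" unfolding c0 relative_family_index[OF p p j ab] by simp
    ultimately show ?thesis unfolding Suc by simp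
  qed
  have "((\<lambda>t. sf.Lf (rel (c t)) (rel (c t)) / t^2) \<longlongrightarrow> sf.Lf (family_lift d z) (family_lift d z)) (at 0)"
  proof -
    have "sf.Lf (rel (c t)) (rel (c t)) / t^2 = (\<Sum>s<d. \<Sum>r<d. \<Sum>i<Suc k. \<Sum>r'<d. \<Sum>i'<Suc k.
        (rel (c t) i $$ (r,s) / t) * (L_at d (Suc k) C (sl p) $$ (i * d + r, i' * d + r') * (rel (c t) i' $$ (r',s) / t)))" for t
      unfolding sf.form_expand[of "rel (c t)" "rel (c t)", OF rel_carrier rel_carrier] sum_divide_distrib
      by (intro sum.cong refl) (simp add: power2_eq_square)
    moreover have "((\<lambda>t. \<Sum>s<d. \<Sum>r<d. \<Sum>i<Suc k. \<Sum>r'<d. \<Sum>i'<Suc k.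
        (rel (c t) i $$ (r,s) / t) * (L_at d (Suc k) C (sl p) $$ (i * d + r, i' * d + r') * (rel (c t) i' $$ (r',s) / t)))
      \<longlongrightarrow> sf.Lf (family_lift d z) (family_lift d z)) (at 0)"
      unfolding sf.form_expand[of "family_lift d z" "family_lift d z", OF family_lift_carrier family_lift_carrier]
      by (intro tendsto_sum tendsto_mult tendsto_const lim) auto
    ultimately show ?thesis by (simp only:)
  qed
  moreover have "eventually (\<lambda>t. 0 \<le> sf.Lf (rel (c t)) (rel (c t)) / t^2) (at 0)"
  proof -
    have "((\<lambda>t. sqrt (\<Sum>ij\<in>{..<k * d} \<times> {..<d}. ((c t - p) $$ ij)^2)) \<longlongrightarrow> sqrt (\<Sum>ij\<in>{..<k * d} \<times> {..<d}. 0^2)) (at 0)"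
    proof (intro tendsto_real_sqrt tendsto_sum tendsto_power)
      fix ij assume "ij \<in> {..<k * d} \<times> {..<d}"
      then obtain r b where rb: "ij = (r,b)" "r < k * d" "b < d" by auto
      have "((\<lambda>t. c t $$ (r,b)) \<longlongrightarrow> c 0 $$ (r,b)) (at 0)"
        using DERIV_isCont[OF dc[OF rb(2,3)]] by (simp add: isCont_def)
      hence "((\<lambda>t. c t $$ (r,b) - p $$ (r,b)) \<longlongrightarrow> c 0 $$ (r,b) - p $$ (r,b)) (at 0)" by (intro tendsto_diff tendsto_const)
      thus "((\<lambda>t. (c t - p) $$ ij) \<longlongrightarrow> 0) (at 0)" using rb pc cc c0 by simp
    qed
    hence "((\<lambda>t. frob_norm (c t - p)) \<longlongrightarrow> 0) (at 0)"
      unfolding frob_norm_eq[OF minus_carrier_mat[OF pc]] L2_set_def by simp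
    hence "eventually (\<lambda>t. frob_norm (c t - p) < e) (at 0)" using e(1) by (rule order_tendstoD)
    thus ?thesis
    proof (rule eventually_mono)
      fix t assume "frob_norm (c t - p) < e"
      hence "0 \<le> F (c t) - F p" using e(2)[OF ct] by simp
      thus "0 \<le> sf.Lf (rel (c t)) (rel (c t)) / t^2" unfolding objective_difference'[OF ct] by simp
    qed
  qed
  ultimately show ?thesis by (rule tendsto_lowerbound) simp
qed

text \<open>If the form vanished at \<open>z\<close>, its non-negativity at \<open>s w + z\<close>
  for all real \<open>s\<close> would force the mixed value with every \<open>w\<close> to be zero.
  The Hessian of \<open>Z\<close> would then be orthogonal to the whole tangent space, hence zero,
  against non-degeneracy.\<close>

lemma nondegenerate_local_min_hess_positive:
  assumes nd: "nondegenerate_local_min R F p" and Z: "Z \<in> T p" "Z \<noteq> 0\<^sub>m (k * d) d"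
  shows "0 < mmetric R p (riem_hess R F p Z) Z"
proof -
  have lm: "local_minimizer R F p" using nd by (simp add: nondegenerate_local_min_def)
  note nn = local_minimizer_form_nonneg[OF lm]
  define z where "z = frame_coord d p Z"
  note z = orth_tangentD(1,2)[OF p Z(1), folded z_def]
  let ?z = "family_lift d z"
  have "sf.Lf ?z ?z \<noteq> 0"
  proof
    assume 0: "sf.Lf ?z ?z = 0"
    have "mmetric R p (riem_hess R F p Z) W = 0" if W: "W \<in> T p" for W
    proof -
      define w where "w = frame_coord d p W"
      note w = orth_tangentD(1,2)[OF p W, folded w_def]
      let ?w = "family_lift d w"
      have "0 \<le> 2 * s * sf.Lf ?w ?z + s^2 * sf.Lf ?w ?w" for s
      proof -
        have "skew_family d k (\<lambda>i a b. s * w i a b + 1 * z i a b)" unfolding skew_family_def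
        proof (intro allI impI)
          fix i a b assume i: "i < k" "a < d" "b < d"
          show "s * w i a b + 1 * z i a b = - (s * w i b a + 1 * z i b a)"
            unfolding skew_familyD[OF w(1) i] skew_familyD[OF z(1) i] by simp
        qed
        from nn[OF this] have "0 \<le> sf.Lf (\<lambda>i. s \<cdot>\<^sub>m ?w i + 1 \<cdot>\<^sub>m ?z i) (\<lambda>i. s \<cdot>\<^sub>m ?w i + 1 \<cdot>\<^sub>m ?z i)"
          unfolding family_lift_linear[abs_def] .
        also have "\<dots> = s^2 * sf.Lf ?w ?w + 2 * s * 1 * sf.Lf ?w ?z + 1^2 * sf.Lf ?z ?z"
          by (rule sf.form_quadratic) (rule family_lift_carrier)+
        finally show ?thesis using 0 by simp
      qed
      hence "sf.Lf ?w ?z = 0" by (rule real_quadratic_nonneg)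
      thus ?thesis using hess_metric[OF p crit z(1) w(1)] z(2) w(2) by simp
    qed
    hence "riem_hess R F p Z = 0\<^sub>m (k * d) d"
      by (intro metric_nondegenerate[OF p riem_hess_critical(1)[OF objective_smooth p crit Z(1) z(1)]])
    hence "Z = 0\<^sub>m (k * d) d" using nd Z(1) by (simp add: nondegenerate_local_min_def)
    thus False using Z(2) by simp
  qed
  hence "0 < sf.Lf ?z ?z" using nn[OF z(1)] by simp
  thus ?thesis using hess_metric_self[OF z(1)] z(2) by simp
qed

lemma form_positive_local_minimizer:
  assumes pos: sf.form_positive
  shows "local_minimizer R F p"
proof -
  obtain \<delta> where \<delta>: "0 < \<delta>"
    "\<And>Q. (\<And>i. i < Suc k \<Longrightarrow> Q i \<in> orth_mats d) \<Longrightarrow> Q 0 = 1\<^sub>m d \<Longrightarrow> sf.fn (\<lambda>i. Q i - 1\<^sub>m d) < \<delta>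
      \<Longrightarrow> 0 \<le> sf.Lf (\<lambda>i. Q i - 1\<^sub>m d) (\<lambda>i. Q i - 1\<^sub>m d)"
    using sf.form_positive_near_identity[OF pos] by blast
  \<comment> \<open>Entries of the relative rotation minus the identity are at most \<open>d\<close>
    times the distance from \<open>p\<close>, as entries of orthogonal matrices are bounded by
    \<open>1\<close>; the other factors count the entries of the stack. Dividing \<delta> by
    \<open>B + 1\<close> keeps the denominator positive.\<close>
  define B where "B = real (Suc k * d) * real d * real d"
  have B: "0 \<le> B" by (simp add: B_def)
  have "F p \<le> F q" if q: "q \<in> M" and small: "frob_norm (q - p) < \<delta> / (B + 1)" for q
  proof -
    note pc = orth_powerD(1)[OF p] and qc = orth_powerD(1)[OF q]
    let ?r = "frob_norm (q - p)"
    have "\<bar>rel q i $$ (a,b)\<bar> \<le> real d * ?r" if i: "i < Suc k" and ab: "a < d" "b < d" for i a b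
    proof (cases i)
      case 0
      thus ?thesis using ab by (simp add: relative_family_0)
    next
      case (Suc j)
      hence j: "j < k" using i by simp
      have "\<bar>rel q (Suc j) $$ (a,b)\<bar> \<le> (\<Sum>c<d. 1 * ?r)"
        unfolding relative_family_index[OF p q j ab]
      proof (intro order_trans[OF sum_abs] sum_mono)
        fix c assume "c \<in> {..<d}"
        hence c: "c < d" by simp
        note l = block_index_less[OF j c]
        have "\<bar>p $$ (j * d + c, a)\<bar> \<le> 1"
          using orth_mats_abs_le_1[OF orth_powerD(2)[OF p j] c ab(1)] pc c ab by simp
        moreover have "\<bar>q $$ (j * d + c, b) - p $$ (j * d + c, b)\<bar> \<le> ?r"
          using abs_index_le_frob_norm[OF minus_carrier_mat[OF pc] l ab(2), of q] pc qc l ab by simp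
        ultimately show "\<bar>p $$ (j * d + c, a) * (q $$ (j * d + c, b) - p $$ (j * d + c, b))\<bar> \<le> 1 * ?r"
          unfolding abs_mult by (intro mult_mono) auto
      qed
      thus ?thesis unfolding Suc by simp
    qed
    from vstack_frob_norm_le[of "Suc k" d "rel q", OF this] have "sf.fn (rel q) \<le> B * ?r" by (simp add: B_def mult_ac)
    also have "\<dots> \<le> (B + 1) * ?r" by (intro mult_right_mono) auto
    also have "\<dots> < \<delta>" using small B by (simp add: field_simps)
    finally have "0 \<le> sf.Lf (rel q) (rel q)"
      by (intro \<delta>(2) relative_family_orth[OF p q] relative_family_0)
    thus ?thesis using objective_difference'[OF q] by simp
  qed
  moreover have "0 < \<delta> / (B + 1)" using \<delta>(1) B by simp
  ultimately show ?thesis unfolding local_minimizer_def R_simps using p by blast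
qed

theorem nondegenerate_local_min_iff: "nondegenerate_local_min R F p \<longleftrightarrow> sf.form_positive"
proof
  assume "nondegenerate_local_min R F p"
  thus sf.form_positive unfolding hess_positive_iff[symmetric] using nondegenerate_local_min_hess_positive by blast
next
  assume pos: sf.form_positive
  have "Z = 0\<^sub>m (k * d) d" if Z: "Z \<in> T p" "riem_hess R F p Z = 0\<^sub>m (k * d) d" for Z
  proof (rule ccontr)
    assume "Z \<noteq> 0\<^sub>m (k * d) d"
    hence "0 < mmetric R p (riem_hess R F p Z) Z" using pos Z(1) unfolding hess_positive_iff[symmetric] by blast
    moreover have "mmetric R p (0\<^sub>m (k * d) d) Z = 0"
      using riem_grad_zero(1)[OF objective_smooth p crit Z(1)] unfolding crit .
    ultimately show False unfolding Z(2) by simp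
  qed
  thus "nondegenerate_local_min R F p"
    unfolding nondegenerate_local_min_def using form_positive_local_minimizer[OF pos] by simp
qed

end

end

section \<open>From the section to an arbitrary point of the fibre\<close>

lemma all_equivalentI: "list_all (\<lambda>P. P \<longleftrightarrow> Q) Ps \<Longrightarrow> all_equivalent Ps"
  unfolding all_equivalent_def list_all_iff by blast

context stress_form
begin

lemma stress_form_right_mult:
  assumes Q: "Q \<in> orth_mats d"
  shows "stress_form d m C (S * Q)"
proof
  note q = orth_matsD[OF Q]
  show "S * Q \<in> carrier_mat (m * d) d" using S q(1) by (rule mult_carrier_mat)
  fix i assume i: "i < m"
  note K = C_hat_carrier[OF d C Csym S, of i]
  have "(Q\<^sup>T * C_hat_block d C S i * Q)\<^sup>T = Q\<^sup>T * (Q\<^sup>T * C_hat_block d C S i)\<^sup>T"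
    by (rule transpose_mult[of _ d d _ d]) (use K q in auto)
  also have "(Q\<^sup>T * C_hat_block d C S i)\<^sup>T = (C_hat_block d C S i)\<^sup>T * (Q\<^sup>T)\<^sup>T"
    by (rule transpose_mult[of _ d d _ d]) (use K q in auto)
  also have "\<dots> = C_hat_block d C S i * Q" using C_hat_sym[OF i] by simp
  also have "Q\<^sup>T * (C_hat_block d C S i * Q) = Q\<^sup>T * C_hat_block d C S i * Q"
    by (rule assoc_mult_mat[symmetric, of _ d d _ d _ d]) (use K q in auto)
  finally show "(C_hat_block d C (S * Q) i)\<^sup>T = C_hat_block d C (S * Q) i"
    unfolding C_hat_block_right_mult[OF d C Csym S q(1) i] .
qed (rule d m C Csym)+

text \<open>Conjugation by an orthogonal matrix preserves skewness, and being invertible it keeps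
  different members of a family different, so the hypothesis applies to the conjugated
  family.\<close>

lemma form_positive_right_mult:
  assumes Q: "Q \<in> orth_mats d" and pos: form_positive
  shows "stress_form.form_positive d m C (S * Q)"
proof -
  interpret r: stress_form d m C "S * Q" by (rule stress_form_right_mult[OF Q])
  note q = orth_matsD[OF Q]
  show ?thesis unfolding r.form_positive_def
  proof (intro allI impI, elim conjE exE)
    fix \<Omega> i j assume sk: "\<forall>i<m. \<Omega> i \<in> skew_mats d" and ij: "i < m" "j < m" "\<Omega> i \<noteq> \<Omega> j"
    have Oc: "\<Omega> i \<in> carrier_mat d d" if "i < m" for i using sk that skew_matsD(1) by auto
    note ac = assoc_mult_mat[of _ d d _ d _ d] mult_carrier_mat[of _ d d _ d]
    have unconj: "Q\<^sup>T * (Q * \<Omega> i * Q\<^sup>T) * Q = \<Omega> i" if "i < m" for i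
    proof -
      have "Q\<^sup>T * (Q * \<Omega> i * Q\<^sup>T) * Q = (Q\<^sup>T * Q) * \<Omega> i * (Q\<^sup>T * Q)"
        using q(1) Oc[OF that] by (simp add: ac)
      thus ?thesis unfolding q(2) using Oc[OF that] by simp
    qed
    have "Q * \<Omega> i * Q\<^sup>T \<noteq> Q * \<Omega> j * Q\<^sup>T"
      using unconj[OF ij(1)] unconj[OF ij(2)] ij(3) by auto
    moreover have "Q * \<Omega> i * Q\<^sup>T \<in> skew_mats d" if "i < m" for i
      using skew_mats_conj[of "Q\<^sup>T" d "\<Omega> i"] q(1) sk that by simp
    ultimately have "0 < Lf (\<lambda>i. Q * \<Omega> i * Q\<^sup>T) (\<lambda>i. Q * \<Omega> i * Q\<^sup>T)"
      using ij by (intro form_positiveD[OF pos, where i=i and j=j])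
    also have "\<dots> = r.Lf \<Omega> \<Omega>"
      by (rule L_form_conj[OF d C Csym S Q, symmetric]) (fact Oc)+
    finally show "0 < r.Lf \<Omega> \<Omega>" .
  qed
qed

lemma form_positive_right_mult_iff:
  assumes Q: "Q \<in> orth_mats d"
  shows "stress_form.form_positive d m C (S * Q) \<longleftrightarrow> form_positive"
proof
  note q = orth_matsD[OF Q]
  interpret r: stress_form d m C "S * Q" by (rule stress_form_right_mult[OF Q])
  assume "r.form_positive"
  hence "stress_form.form_positive d m C (S * Q * Q\<^sup>T)" by (rule r.form_positive_right_mult[OF orth_mats_transpose[OF Q]])
  moreover have "S * Q * Q\<^sup>T = S" using assoc_mult_mat[OF S q(1), of "Q\<^sup>T" d] q S by simp
  ultimately show form_positive by simp
qed (rule form_positive_right_mult[OF Q])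

end

text \<open>Each block is \<open>(S\<^sub>i S\<^sub>0\<^sup>T) S\<^sub>0\<close>, so any point of
  the fibre is the section times its own first block.\<close>

lemma section_lift_quot_proj:
  assumes S: "S \<in> orth_power d (Suc k)"
  shows "S = section_lift d k (quot_proj d (Suc k) S) * row_block d S 0"
proof (rule row_block_eqI)
  note Sc = orth_powerD(1)[OF S]
  let ?S0 = "row_block d S 0"
  have S0: "?S0 \<in> orth_mats d" using orth_powerD(2)[OF S] by simp
  note s0 = orth_matsD[OF S0]
  have qc: "quot_proj d (Suc k) S \<in> carrier_mat (k * d) d" by (simp add: quot_proj_def)
  show "S \<in> carrier_mat (Suc k * d) d" by (rule Sc)
  show "section_lift d k (quot_proj d (Suc k) S) * ?S0 \<in> carrier_mat (Suc k * d) d"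
    using section_lift_carrier s0(1) by (rule mult_carrier_mat)
  fix i assume i: "i < Suc k"
  have "row_block d (section_lift d k (quot_proj d (Suc k) S) * ?S0) i
      = (case i of 0 \<Rightarrow> 1\<^sub>m d | Suc j \<Rightarrow> row_block d (quot_proj d (Suc k) S) j) * ?S0"
    unfolding row_block_mult[OF section_lift_carrier s0(1) i] section_lift_block[OF qc i] ..
  also have "\<dots> = row_block d S i"
  proof (cases i)
    case 0
    thus ?thesis using s0(1) by simp
  next
    case (Suc j)
    hence j: "j < k" using i by simp
    have r: "row_block d S (Suc j) \<in> carrier_mat d d" by (rule row_block_carrier[OF Sc])
    have "row_block d (quot_proj d (Suc k) S) j = row_block d S (Suc j) * ?S0\<^sup>T"
      unfolding quot_proj_def using row_block_vstack[of j k "\<lambda>i. row_block d S (Suc i) * ?S0\<^sup>T" d] j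
        mult_carrier_mat[OF row_block_carrier[OF Sc], of "?S0\<^sup>T" d] s0(1) by simp
    thus ?thesis using assoc_mult_mat[OF r, of "?S0\<^sup>T" d ?S0 d] s0 r by (simp add: Suc)
  qed
  finally show "row_block d S i = row_block d (section_lift d k (quot_proj d (Suc k) S) * ?S0) i" ..
qed

theorem theorem3p1:
  fixes d n m :: nat
    and E :: "(nat \<times> nat) set"
    and x :: "nat \<Rightarrow> nat \<Rightarrow> real vec"
    and C S St :: "real mat"
    and R :: riem_manifold
    and Ft :: "real mat \<Rightarrow> real"
  assumes "0 < d" and "0 < m"
    and "patch_framework d n m E x"
    and "patch_connected n m E"
    and C: "C = patch_stress d n m E x"
    and R: "R = orth_quotient d m"
    and Ft: "Ft = quot_objective d C"
    and "critical_point R Ft St"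
    and "S \<in> orth_power d m" and "quot_proj d m S = St"
  shows "all_equivalent
    [nondegenerate_local_min R Ft St,
     \<forall>Zt\<in>mtangent R St. Zt \<noteq> 0\<^sub>m ((m - 1) * d) d \<longrightarrow>
       0 < mmetric R St (riem_hess R Ft St Zt) Zt,
     \<forall>\<Omega>. (\<forall>i<m. \<Omega> i \<in> skew_mats d) \<and> mat_sum d d \<Omega> {..<m} = 0\<^sub>m d d \<and> (\<exists>i<m. \<Omega> i \<noteq> 0\<^sub>m d d) \<longrightarrow>
       0 < mat_tr ((vstack d m \<Omega>)\<^sup>T * L_at d m C S * vstack d m \<Omega>),
     \<forall>\<Omega>. (\<forall>i<m. \<Omega> i \<in> skew_mats d) \<and> (\<exists>i<m. \<exists>j<m. \<Omega> i \<noteq> \<Omega> j) \<longrightarrow>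
       0 < mat_tr ((vstack d m \<Omega>)\<^sup>T * L_at d m C S * vstack d m \<Omega>),
     \<forall>w. (\<forall>r s. r < s \<and> s < d \<longrightarrow> w (r, s) \<in> carrier_vec m) \<and>
         (\<exists>r s. r < s \<and> s < d \<and> \<not> constant_vec (w (r, s))) \<longrightarrow>
       0 < quad_form (LL_at d m C S) (stack_pairs d m w),
     pos_semidef (LL_at d m C S) \<and> mat_rank (LL_at d m C S) = (m - 1) * (d * (d - 1) div 2),
     0 < eigval_asc (d * (d - 1) div 2 + 1) (LL_at d m C S)]"
proof -
  obtain k where m: "m = Suc k" using \<open>0 < m\<close> by (cases m) auto
  interpret orth_quot d k by unfold_locales
  interpret orth_objective d k C
    using \<open>0 < d\<close> patch_stress_symmetric[OF \<open>patch_framework d n m E x\<close>] by unfold_locales (auto simp: C m)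
  have St: "St \<in> orth_power d k" and crit: "riem_grad (orth_quotient d (Suc k)) F St = 0\<^sub>m (k * d) d"
    using \<open>critical_point R Ft St\<close> unfolding critical_point_def R Ft m by simp_all
  have S: "S \<in> orth_power d (Suc k)" using \<open>S \<in> orth_power d m\<close> by (simp add: m)
  have S0: "row_block d S 0 \<in> orth_mats d" using orth_powerD(2)[OF S] by simp
  have S_eq: "sl St * row_block d S 0 = S"
    using section_lift_quot_proj[OF S] \<open>quot_proj d m S = St\<close> by (simp add: m)
  interpret sec: stress_form d "Suc k" C "sl St"
    by unfold_locales (use \<open>0 < d\<close> C Csym C_hat_symmetric[OF St crit] in auto)
  interpret sf: stress_form d "Suc k" C S
    using sec.stress_form_right_mult[OF S0] unfolding S_eq .
  \<comment> \<open>The first two conditions are evaluated at the section over \<open>St\<close>,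
    the other five at \<open>S\<close>; positivity of the form at the two points is the
    same.\<close>
  have base: "sec.form_positive \<longleftrightarrow> sf.form_positive"
    using sec.form_positive_right_mult_iff[OF S0] unfolding S_eq ..
  show ?thesis
    unfolding R Ft m
    by (rule all_equivalentI[where Q=sf.form_positive], unfold list.pred_inject diff_Suc_1, intro conjI list.pred_inject(1)
        nondegenerate_local_min_iff[OF St crit, unfolded base] hess_positive_iff[OF St crit, unfolded base, folded R_simps(4)]
        sf.form_positive_iff_centered sf.form_positive_iff_trace sf.form_positive_iff_quad_form
        sf.form_positive_iff_rank[unfolded diff_Suc_1])
qed

end
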